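(* Assume GCH and let $\mu>\omega$ be a regular cardinal. Let $P=\prod^*_{\mu}\mathrm{Fn}(\omega,2)$. Then forcing with $P$ preserves cardinals and cofinalities, $(2^\omega)^{V^P}=\mu$, and in $V^P$ the principle $\Phi(\kappa)$ holds for each cardinal $\kappa$ with $\omega_1\le\kappa\le 2^\omega$.
   Context: $\mathrm{Fn}(\omega,2)$ is the poset of finite partial functions from $\omega$ to $2$ ordered by reverse inclusion, with largest element $1=\emptyset$. For a set $X$ and posets $P_i$ ($i\in X$), and $p\in\prod_{i\in X}P_i$, let $\mathrm{supp}(p)=\{i\in X: p(i)\ne 1_{P_i}\}$. The poset $\prod^*_{i\in X}P_i$ consists of all $p\in\prod_{i\in X}P_i$ with countable support, ordered by: $p\le q$ iff $p(i)\le_i q(i)$ for all $i\in X$ and the set $\{i\in X: p(i)<_i q(i)<_i 1_{P_i}\}$ is finite. $\prod^*_{\mu}\mathrm{Fn}(\omega,2)$ denotes this product with $X=\mu$ and every $P_i=\mathrm{Fn}(\omega,2)$. For a cardinal $\kappa$, the principle $\Phi(\kappa)$ states: there are a set $T\subset\mathbb R$ with $|T|=\kappa$ and a family $\mathcal A$ of countably infinite subsets of $T$ with $|\mathcal A|=\kappa$ such that (a) $|\overline{A}\cap T|=\kappa$ for each $A\in\mathcal A$ (closure in $\mathbb R$); and (b) for each $X\subset T$ with $|X|=\omega_1$ there is $A\in\mathcal A$ with $A\subset X$. *)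

theory Defs
  imports Main
begin

section \<open>The first-order language of set theory\<close>

datatype fm = Mem nat nat | Equ nat nat | Neg fm | Conj fm fm | Forall nat fm

primrec sat :: "('v \<Rightarrow> 'v \<Rightarrow> bool) \<Rightarrow> (nat \<Rightarrow> 'v) \<Rightarrow> fm \<Rightarrow> bool" where
  "sat E env (Mem i j) \<longleftrightarrow> E (env i) (env j)"
| "sat E env (Equ i j) \<longleftrightarrow> env i = env j"
| "sat E env (Neg \<phi>) \<longleftrightarrow> \<not> sat E env \<phi>"
| "sat E env (Conj \<phi> \<psi>) \<longleftrightarrow> sat E env \<phi> \<and> sat E env \<psi>"
| "sat E env (Forall n \<phi>) \<longleftrightarrow> (\<forall>x. sat E (env(n := x)) \<phi>)"

text \<open>
  A structure consists of all elements of the type \<open>'v\<close> with membership relation \<open>E\<close>; it need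
  neither be well-founded nor countable.  Separation and Replacement range over all formulas;
  variable 0 (and 1) are the distinguished ones and the other values of \<open>env\<close> are parameters.
\<close>

definition ZFC_model :: "('v \<Rightarrow> 'v \<Rightarrow> bool) \<Rightarrow> bool" where
  "ZFC_model E \<longleftrightarrow>
     \<comment> \<open>Extensionality\<close>
     (\<forall>x y. (\<forall>z. E z x \<longleftrightarrow> E z y) \<longrightarrow> x = y) \<and>
     \<comment> \<open>Foundation\<close>
     (\<forall>x. (\<exists>y. E y x) \<longrightarrow> (\<exists>y. E y x \<and> \<not> (\<exists>z. E z x \<and> E z y))) \<and>
     \<comment> \<open>Pairing\<close>
     (\<forall>x y. \<exists>z. E x z \<and> E y z) \<and>
     \<comment> \<open>Union\<close>
     (\<forall>a. \<exists>u. \<forall>y x. E x y \<and> E y a \<longrightarrow> E x u) \<and>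
     \<comment> \<open>Power set\<close>
     (\<forall>a. \<exists>b. \<forall>x. (\<forall>z. E z x \<longrightarrow> E z a) \<longrightarrow> E x b) \<and>
     \<comment> \<open>Infinity\<close>
     (\<exists>a. (\<exists>e. E e a \<and> (\<forall>z. \<not> E z e)) \<and>
          (\<forall>y. E y a \<longrightarrow> (\<exists>s. E s a \<and> (\<forall>z. E z s \<longleftrightarrow> E z y \<or> z = y)))) \<and>
     \<comment> \<open>Choice\<close>
     (\<forall>a. (\<forall>x. E x a \<longrightarrow> (\<exists>z. E z x)) \<and>
          (\<forall>x y z. E x a \<and> E y a \<and> E z x \<and> E z y \<longrightarrow> x = y) \<longrightarrow>
          (\<exists>c. \<forall>x. E x a \<longrightarrow> (\<exists>!z. E z x \<and> E z c))) \<and>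
     \<comment> \<open>Separation\<close>
     (\<forall>\<phi> env a. \<exists>b. \<forall>x. E x b \<longleftrightarrow> E x a \<and> sat E (env(0 := x)) \<phi>) \<and>
     \<comment> \<open>Replacement\<close>
     (\<forall>\<phi> env a. (\<forall>x. E x a \<longrightarrow> (\<exists>!y. sat E (env(0 := x, 1 := y)) \<phi>)) \<longrightarrow>
          (\<exists>b. \<forall>x. E x a \<longrightarrow> (\<exists>y. E y b \<and> sat E (env(0 := x, 1 := y)) \<phi>)))"

text \<open>
  Formulas are written in higher-order abstract syntax.  A formula under construction is a
  function of the first unused variable: a quantifier binds that variable and passes on its
  successor, so everything built from the operators below is free of variable capture.
\<close>

type_synonym pf = "nat \<Rightarrow> fm"

definition pmem :: "nat \<Rightarrow> nat \<Rightarrow> pf" (infix \<open>\<^bold>\<in>\<close> 50) where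
  "x \<^bold>\<in> y = (\<lambda>_. Mem x y)"

definition peq :: "nat \<Rightarrow> nat \<Rightarrow> pf" (infix \<open>\<^bold>=\<close> 50) where
  "x \<^bold>= y = (\<lambda>_. Equ x y)"

definition pneg :: "pf \<Rightarrow> pf" (\<open>\<^bold>\<not> _\<close> [40] 40) where
  "(\<^bold>\<not> A) = (\<lambda>n. Neg (A n))"

definition pconj :: "pf \<Rightarrow> pf \<Rightarrow> pf" (infixr \<open>\<^bold>\<and>\<close> 35) where
  "(A \<^bold>\<and> B) = (\<lambda>n. Conj (A n) (B n))"

definition pdisj :: "pf \<Rightarrow> pf \<Rightarrow> pf" (infixr \<open>\<^bold>\<or>\<close> 30) where
  "(A \<^bold>\<or> B) = (\<^bold>\<not> (\<^bold>\<not> A \<^bold>\<and> \<^bold>\<not> B))"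

definition pimp :: "pf \<Rightarrow> pf \<Rightarrow> pf" (infixr \<open>\<^bold>\<longrightarrow>\<close> 25) where
  "(A \<^bold>\<longrightarrow> B) = (\<^bold>\<not> (A \<^bold>\<and> \<^bold>\<not> B))"

definition piff :: "pf \<Rightarrow> pf \<Rightarrow> pf" (infixr \<open>\<^bold>\<longleftrightarrow>\<close> 25) where
  "(A \<^bold>\<longleftrightarrow> B) = ((A \<^bold>\<longrightarrow> B) \<^bold>\<and> (B \<^bold>\<longrightarrow> A))"

definition pall :: "(nat \<Rightarrow> pf) \<Rightarrow> pf" (binder \<open>\<^bold>\<forall>\<close> 10) where
  "pall A = (\<lambda>n. Forall n (A n (Suc n)))"

definition pex :: "(nat \<Rightarrow> pf) \<Rightarrow> pf" (binder \<open>\<^bold>\<exists>\<close> 10) where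
  "pex A = (\<^bold>\<not> (\<^bold>\<forall>x. \<^bold>\<not> A x))"

text \<open>The formula with free variables \<open>0, \<dots>, k - 1\<close>; use it with an environment \<open>(!) [a\<^sub>0, \<dots>]\<close>.\<close>

definition fm0 :: "pf \<Rightarrow> fm" where "fm0 A = A 0"
definition fm1 :: "(nat \<Rightarrow> pf) \<Rightarrow> fm" where "fm1 A = A 0 1"
definition fm2 :: "(nat \<Rightarrow> nat \<Rightarrow> pf) \<Rightarrow> fm" where "fm2 A = A 0 1 2"
definition fm3 :: "(nat \<Rightarrow> nat \<Rightarrow> nat \<Rightarrow> pf) \<Rightarrow> fm" where "fm3 A = A 0 1 2 3"
definition fm4 :: "(nat \<Rightarrow> nat \<Rightarrow> nat \<Rightarrow> nat \<Rightarrow> pf) \<Rightarrow> fm" where "fm4 A = A 0 1 2 3 4"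
definition fm5 :: "(nat \<Rightarrow> nat \<Rightarrow> nat \<Rightarrow> nat \<Rightarrow> nat \<Rightarrow> pf) \<Rightarrow> fm" where "fm5 A = A 0 1 2 3 4 5"


section \<open>Basic set-theoretic notions as formulas\<close>

definition is_subset :: "nat \<Rightarrow> nat \<Rightarrow> pf" (infix \<open>\<^bold>\<subseteq>\<close> 50) where
  "x \<^bold>\<subseteq> y = (\<^bold>\<forall>z. z \<^bold>\<in> x \<^bold>\<longrightarrow> z \<^bold>\<in> y)"

definition is_empty :: "nat \<Rightarrow> pf" where
  "is_empty x = (\<^bold>\<forall>z. \<^bold>\<not> z \<^bold>\<in> x)"

definition is_upair :: "nat \<Rightarrow> nat \<Rightarrow> nat \<Rightarrow> pf" where
  "is_upair a b z = (\<^bold>\<forall>w. w \<^bold>\<in> z \<^bold>\<longleftrightarrow> w \<^bold>= a \<^bold>\<or> w \<^bold>= b)"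

definition is_pair :: "nat \<Rightarrow> nat \<Rightarrow> nat \<Rightarrow> pf" where
  "is_pair a b z = (\<^bold>\<forall>w. w \<^bold>\<in> z \<^bold>\<longleftrightarrow> is_upair a a w \<^bold>\<or> is_upair a b w)"

definition pair_in :: "nat \<Rightarrow> nat \<Rightarrow> nat \<Rightarrow> pf" where
  "pair_in a b r = (\<^bold>\<exists>z. z \<^bold>\<in> r \<^bold>\<and> is_pair a b z)"

definition is_triple :: "nat \<Rightarrow> nat \<Rightarrow> nat \<Rightarrow> nat \<Rightarrow> pf" where
  "is_triple a b c z = (\<^bold>\<exists>y. is_pair b c y \<^bold>\<and> is_pair a y z)"

definition triple_in :: "nat \<Rightarrow> nat \<Rightarrow> nat \<Rightarrow> nat \<Rightarrow> pf" where
  "triple_in a b c r = (\<^bold>\<exists>z. z \<^bold>\<in> r \<^bold>\<and> is_triple a b c z)"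

definition is_succ :: "nat \<Rightarrow> nat \<Rightarrow> pf" where
  "is_succ x y = (\<^bold>\<forall>z. z \<^bold>\<in> y \<^bold>\<longleftrightarrow> z \<^bold>\<in> x \<^bold>\<or> z \<^bold>= x)"

definition is_two :: "nat \<Rightarrow> pf" where
  "is_two t = (\<^bold>\<exists>z. \<^bold>\<exists>u. is_empty z \<^bold>\<and> is_succ z u \<^bold>\<and> is_succ u t)"

definition is_func :: "nat \<Rightarrow> nat \<Rightarrow> nat \<Rightarrow> pf" where
  "is_func f a b =
     ((\<^bold>\<forall>z. z \<^bold>\<in> f \<^bold>\<longrightarrow> (\<^bold>\<exists>x. \<^bold>\<exists>y. x \<^bold>\<in> a \<^bold>\<and> y \<^bold>\<in> b \<^bold>\<and> is_pair x y z)) \<^bold>\<and>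
      (\<^bold>\<forall>x. x \<^bold>\<in> a \<^bold>\<longrightarrow>
         (\<^bold>\<exists>y. pair_in x y f \<^bold>\<and> (\<^bold>\<forall>y'. pair_in x y' f \<^bold>\<longrightarrow> y' \<^bold>= y))))"

definition is_inj :: "nat \<Rightarrow> nat \<Rightarrow> nat \<Rightarrow> pf" where
  "is_inj f a b =
     (is_func f a b \<^bold>\<and>
      (\<^bold>\<forall>x. \<^bold>\<forall>x'. \<^bold>\<forall>y. pair_in x y f \<^bold>\<and> pair_in x' y f \<^bold>\<longrightarrow> x \<^bold>= x'))"

definition is_bij :: "nat \<Rightarrow> nat \<Rightarrow> nat \<Rightarrow> pf" where
  "is_bij f a b = (is_inj f a b \<^bold>\<and> (\<^bold>\<forall>y. y \<^bold>\<in> b \<^bold>\<longrightarrow> (\<^bold>\<exists>x. pair_in x y f)))"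

definition is_func_space :: "nat \<Rightarrow> nat \<Rightarrow> nat \<Rightarrow> pf" where
  "is_func_space a b s = (\<^bold>\<forall>f. f \<^bold>\<in> s \<^bold>\<longleftrightarrow> is_func f a b)"

definition equipotent :: "nat \<Rightarrow> nat \<Rightarrow> pf" where
  "equipotent a b = (\<^bold>\<exists>f. is_bij f a b)"


section \<open>Ordinals, cardinals and cofinality\<close>

definition is_transitive :: "nat \<Rightarrow> pf" where
  "is_transitive x = (\<^bold>\<forall>y. y \<^bold>\<in> x \<^bold>\<longrightarrow> y \<^bold>\<subseteq> x)"

definition is_Ord :: "nat \<Rightarrow> pf" where
  "is_Ord x = (is_transitive x \<^bold>\<and> (\<^bold>\<forall>y. y \<^bold>\<in> x \<^bold>\<longrightarrow> is_transitive y))"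

definition is_Limit :: "nat \<Rightarrow> pf" where
  "is_Limit x =
     (is_Ord x \<^bold>\<and> \<^bold>\<not> is_empty x \<^bold>\<and> (\<^bold>\<forall>y. y \<^bold>\<in> x \<^bold>\<longrightarrow> (\<^bold>\<exists>z. z \<^bold>\<in> x \<^bold>\<and> y \<^bold>\<in> z)))"

definition is_omega :: "nat \<Rightarrow> pf" where
  "is_omega w = (is_Limit w \<^bold>\<and> (\<^bold>\<forall>y. y \<^bold>\<in> w \<^bold>\<longrightarrow> \<^bold>\<not> is_Limit y))"

definition is_Finite :: "nat \<Rightarrow> pf" where
  "is_Finite x = (\<^bold>\<exists>w. is_omega w \<^bold>\<and> (\<^bold>\<exists>n. n \<^bold>\<in> w \<^bold>\<and> equipotent x n))"

definition is_Countable :: "nat \<Rightarrow> pf" where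
  "is_Countable x = (\<^bold>\<exists>w. is_omega w \<^bold>\<and> (\<^bold>\<exists>f. is_inj f x w))"

definition is_countably_infinite :: "nat \<Rightarrow> pf" where
  "is_countably_infinite x = (\<^bold>\<exists>w. is_omega w \<^bold>\<and> equipotent x w)"

definition is_Card :: "nat \<Rightarrow> pf" where
  "is_Card k = (is_Ord k \<^bold>\<and> (\<^bold>\<forall>a. a \<^bold>\<in> k \<^bold>\<longrightarrow> \<^bold>\<not> equipotent a k))"

definition is_InfCard :: "nat \<Rightarrow> pf" where
  "is_InfCard k = (is_Card k \<^bold>\<and> (\<^bold>\<exists>w. is_omega w \<^bold>\<and> w \<^bold>\<subseteq> k))"

definition has_card :: "nat \<Rightarrow> nat \<Rightarrow> pf" where
  "has_card x k = (is_Card k \<^bold>\<and> equipotent x k)"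

definition is_succ_card :: "nat \<Rightarrow> nat \<Rightarrow> pf" where
  "is_succ_card k l =
     (is_Card l \<^bold>\<and> k \<^bold>\<in> l \<^bold>\<and> (\<^bold>\<forall>c. c \<^bold>\<in> l \<^bold>\<and> is_Card c \<^bold>\<longrightarrow> c \<^bold>\<subseteq> k))"

definition is_omega1 :: "nat \<Rightarrow> pf" where
  "is_omega1 k = (\<^bold>\<exists>w. is_omega w \<^bold>\<and> is_succ_card w k)"

definition is_two_power :: "nat \<Rightarrow> nat \<Rightarrow> pf" where
  "is_two_power k l = (\<^bold>\<exists>t. \<^bold>\<exists>s. is_two t \<^bold>\<and> is_func_space k t s \<^bold>\<and> has_card s l)"

definition is_continuum :: "nat \<Rightarrow> pf" where
  "is_continuum c = (\<^bold>\<exists>w. is_omega w \<^bold>\<and> is_two_power w c)"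

definition GCH :: pf where
  "GCH = (\<^bold>\<forall>k. is_InfCard k \<^bold>\<longrightarrow> (\<^bold>\<exists>l. is_succ_card k l \<^bold>\<and> is_two_power k l))"

definition is_cofinal_map :: "nat \<Rightarrow> nat \<Rightarrow> nat \<Rightarrow> pf" where
  "is_cofinal_map f d g =
     (is_func f d g \<^bold>\<and>
      (\<^bold>\<forall>a. a \<^bold>\<in> g \<^bold>\<longrightarrow> (\<^bold>\<exists>x. \<^bold>\<exists>y. pair_in x y f \<^bold>\<and> (a \<^bold>\<in> y \<^bold>\<or> a \<^bold>= y))))"

definition is_cf :: "nat \<Rightarrow> nat \<Rightarrow> pf" where
  "is_cf g d =
     (is_Ord d \<^bold>\<and> (\<^bold>\<exists>f. is_cofinal_map f d g) \<^bold>\<and>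
      (\<^bold>\<forall>c. c \<^bold>\<in> d \<^bold>\<longrightarrow> \<^bold>\<not> (\<^bold>\<exists>f. is_cofinal_map f c g)))"

definition is_regular :: "nat \<Rightarrow> pf" where
  "is_regular k = (is_InfCard k \<^bold>\<and> is_cf k k)"

definition is_uncountable_regular :: "nat \<Rightarrow> pf" where
  "is_uncountable_regular k = (is_regular k \<^bold>\<and> (\<^bold>\<exists>w. is_omega w \<^bold>\<and> w \<^bold>\<in> k))"


section \<open>The real line\<close>

text \<open>
  Sum and product of natural numbers as cardinals of disjoint unions and Cartesian products.
\<close>

definition is_sum :: "nat \<Rightarrow> nat \<Rightarrow> nat \<Rightarrow> pf" where
  "is_sum m n k =
     (\<^bold>\<exists>x. \<^bold>\<exists>y. equipotent x m \<^bold>\<and> equipotent y n \<^bold>\<and>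
        \<^bold>\<not> (\<^bold>\<exists>z. z \<^bold>\<in> x \<^bold>\<and> z \<^bold>\<in> y) \<^bold>\<and> (\<^bold>\<forall>z. z \<^bold>\<in> k \<^bold>\<longleftrightarrow> z \<^bold>\<in> x \<^bold>\<or> z \<^bold>\<in> y))"

definition is_prod :: "nat \<Rightarrow> nat \<Rightarrow> nat \<Rightarrow> pf" where
  "is_prod m n k =
     (\<^bold>\<exists>c. equipotent c k \<^bold>\<and>
        (\<^bold>\<forall>z. z \<^bold>\<in> c \<^bold>\<longleftrightarrow> (\<^bold>\<exists>x. \<^bold>\<exists>y. x \<^bold>\<in> m \<^bold>\<and> y \<^bold>\<in> n \<^bold>\<and> is_pair x y z)))"

text \<open>
  A triple \<open>(a, b, c)\<close> of natural numbers with \<open>c \<noteq> 0\<close> codes the rational number \<open>(a - b) / c\<close>.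
  Codes are not unique, but a Dedekind cut as defined below contains with one code of a rational
  all its codes, because it has no greatest element.
\<close>

definition is_rat :: "nat \<Rightarrow> pf" where
  "is_rat q =
     (\<^bold>\<exists>w. is_omega w \<^bold>\<and>
        (\<^bold>\<exists>a. \<^bold>\<exists>b. \<^bold>\<exists>c. a \<^bold>\<in> w \<^bold>\<and> b \<^bold>\<in> w \<^bold>\<and> c \<^bold>\<in> w \<^bold>\<and> \<^bold>\<not> is_empty c \<^bold>\<and> is_triple a b c q))"

text \<open>\<open>(a - b) / c < (a' - b') / c'\<close> iff \<open>a c' + b' c < a' c + b c'\<close>.\<close>

definition rat_less :: "nat \<Rightarrow> nat \<Rightarrow> pf" where
  "rat_less q q' =
     (\<^bold>\<exists>w. is_omega w \<^bold>\<and>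
       (\<^bold>\<exists>a. \<^bold>\<exists>b. \<^bold>\<exists>c. \<^bold>\<exists>a'. \<^bold>\<exists>b'. \<^bold>\<exists>c'. is_triple a b c q \<^bold>\<and> is_triple a' b' c' q' \<^bold>\<and>
         (\<^bold>\<exists>k. \<^bold>\<exists>l. \<^bold>\<exists>m. \<^bold>\<exists>n. \<^bold>\<exists>s. \<^bold>\<exists>t.
            k \<^bold>\<in> w \<^bold>\<and> l \<^bold>\<in> w \<^bold>\<and> m \<^bold>\<in> w \<^bold>\<and> n \<^bold>\<in> w \<^bold>\<and> s \<^bold>\<in> w \<^bold>\<and> t \<^bold>\<in> w \<^bold>\<and>
            is_prod a c' k \<^bold>\<and> is_prod b' c l \<^bold>\<and> is_sum k l s \<^bold>\<and>
            is_prod a' c m \<^bold>\<and> is_prod b c' n \<^bold>\<and> is_sum m n t \<^bold>\<and> s \<^bold>\<in> t)))"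

definition is_real :: "nat \<Rightarrow> pf" where
  "is_real x =
     ((\<^bold>\<forall>q. q \<^bold>\<in> x \<^bold>\<longrightarrow> is_rat q) \<^bold>\<and>
      (\<^bold>\<exists>q. q \<^bold>\<in> x) \<^bold>\<and>
      (\<^bold>\<exists>q. is_rat q \<^bold>\<and> \<^bold>\<not> q \<^bold>\<in> x) \<^bold>\<and>
      (\<^bold>\<forall>q. \<^bold>\<forall>r. q \<^bold>\<in> x \<^bold>\<and> is_rat r \<^bold>\<and> rat_less r q \<^bold>\<longrightarrow> r \<^bold>\<in> x) \<^bold>\<and>
      (\<^bold>\<forall>q. q \<^bold>\<in> x \<^bold>\<longrightarrow> (\<^bold>\<exists>r. r \<^bold>\<in> x \<^bold>\<and> rat_less q r)))"

definition real_less :: "nat \<Rightarrow> nat \<Rightarrow> pf" where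
  "real_less x y = (x \<^bold>\<subseteq> y \<^bold>\<and> \<^bold>\<not> x \<^bold>= y)"

definition in_closure :: "nat \<Rightarrow> nat \<Rightarrow> pf" where
  "in_closure x A =
     (is_real x \<^bold>\<and>
      (\<^bold>\<forall>u. \<^bold>\<forall>v. is_real u \<^bold>\<and> is_real v \<^bold>\<and> real_less u x \<^bold>\<and> real_less x v \<^bold>\<longrightarrow>
         (\<^bold>\<exists>a. a \<^bold>\<in> A \<^bold>\<and> real_less u a \<^bold>\<and> real_less a v)))"


section \<open>The principle \<open>\<Phi>(\<kappa>)\<close>\<close>

definition Phi :: "nat \<Rightarrow> pf" where
  "Phi k =
     (\<^bold>\<exists>T. \<^bold>\<exists>F.
        (\<^bold>\<forall>x. x \<^bold>\<in> T \<^bold>\<longrightarrow> is_real x) \<^bold>\<and> has_card T k \<^bold>\<and> has_card F k \<^bold>\<and>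
        (\<^bold>\<forall>A. A \<^bold>\<in> F \<^bold>\<longrightarrow> A \<^bold>\<subseteq> T \<^bold>\<and> is_countably_infinite A) \<^bold>\<and>
        (\<^bold>\<forall>A. A \<^bold>\<in> F \<^bold>\<longrightarrow>
           (\<^bold>\<exists>C. (\<^bold>\<forall>x. x \<^bold>\<in> C \<^bold>\<longleftrightarrow> in_closure x A \<^bold>\<and> x \<^bold>\<in> T) \<^bold>\<and> has_card C k)) \<^bold>\<and>
        (\<^bold>\<forall>X. X \<^bold>\<subseteq> T \<^bold>\<and> (\<^bold>\<exists>o1. is_omega1 o1 \<^bold>\<and> has_card X o1) \<^bold>\<longrightarrow>
           (\<^bold>\<exists>A. A \<^bold>\<in> F \<^bold>\<and> A \<^bold>\<subseteq> X)))"

definition Phi_up_to_continuum :: pf where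
  "Phi_up_to_continuum =
     (\<^bold>\<forall>k. is_Card k \<^bold>\<and> (\<^bold>\<exists>o1. is_omega1 o1 \<^bold>\<and> o1 \<^bold>\<subseteq> k) \<^bold>\<and> (\<^bold>\<exists>c. is_continuum c \<^bold>\<and> k \<^bold>\<subseteq> c)
        \<^bold>\<longrightarrow> Phi k)"


section \<open>The forcing notion\<close>

text \<open>Posets are given by carrier, order (as a set of pairs) and largest element.\<close>

definition is_Fn_omega_2 :: "nat \<Rightarrow> nat \<Rightarrow> nat \<Rightarrow> pf" where
  "is_Fn_omega_2 Q r u =
     (\<^bold>\<exists>w. \<^bold>\<exists>t. is_omega w \<^bold>\<and> is_two t \<^bold>\<and>
        (\<^bold>\<forall>p. p \<^bold>\<in> Q \<^bold>\<longleftrightarrow> is_Finite p \<^bold>\<and> (\<^bold>\<exists>d. d \<^bold>\<subseteq> w \<^bold>\<and> is_func p d t)) \<^bold>\<and>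
        (\<^bold>\<forall>z. z \<^bold>\<in> r \<^bold>\<longleftrightarrow> (\<^bold>\<exists>p. \<^bold>\<exists>q. p \<^bold>\<in> Q \<^bold>\<and> q \<^bold>\<in> Q \<^bold>\<and> q \<^bold>\<subseteq> p \<^bold>\<and> is_pair p q z)) \<^bold>\<and>
        is_empty u)"

definition strictly_below :: "nat \<Rightarrow> nat \<Rightarrow> nat \<Rightarrow> pf" where
  "strictly_below r a b = (pair_in a b r \<^bold>\<and> \<^bold>\<not> a \<^bold>= b)"

definition is_supp :: "nat \<Rightarrow> nat \<Rightarrow> nat \<Rightarrow> nat \<Rightarrow> pf" where
  "is_supp X u p s = (\<^bold>\<forall>i. i \<^bold>\<in> s \<^bold>\<longleftrightarrow> i \<^bold>\<in> X \<^bold>\<and> (\<^bold>\<exists>a. pair_in i a p \<^bold>\<and> \<^bold>\<not> a \<^bold>= u))"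

text \<open>\<open>(P, l, e)\<close> is the \<open>*\<close>-product of \<open>X\<close> copies of the poset \<open>(Q, r, u)\<close>.\<close>

definition is_star_power ::
    "nat \<Rightarrow> nat \<Rightarrow> nat \<Rightarrow> nat \<Rightarrow> nat \<Rightarrow> nat \<Rightarrow> nat \<Rightarrow> pf" where
  "is_star_power X Q r u P l e =
     ((\<^bold>\<forall>p. p \<^bold>\<in> P \<^bold>\<longleftrightarrow> is_func p X Q \<^bold>\<and> (\<^bold>\<exists>s. is_supp X u p s \<^bold>\<and> is_Countable s)) \<^bold>\<and>
      (\<^bold>\<forall>z. z \<^bold>\<in> l \<^bold>\<longleftrightarrow>
         (\<^bold>\<exists>p. \<^bold>\<exists>q. p \<^bold>\<in> P \<^bold>\<and> q \<^bold>\<in> P \<^bold>\<and> is_pair p q z \<^bold>\<and>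
            (\<^bold>\<forall>i. i \<^bold>\<in> X \<^bold>\<longrightarrow>
               (\<^bold>\<exists>a. \<^bold>\<exists>b. pair_in i a p \<^bold>\<and> pair_in i b q \<^bold>\<and> pair_in a b r)) \<^bold>\<and>
            (\<^bold>\<exists>s. is_Finite s \<^bold>\<and>
               (\<^bold>\<forall>i. i \<^bold>\<in> s \<^bold>\<longleftrightarrow> i \<^bold>\<in> X \<^bold>\<and>
                  (\<^bold>\<exists>a. \<^bold>\<exists>b. pair_in i a p \<^bold>\<and> pair_in i b q \<^bold>\<and>
                     strictly_below r a b \<^bold>\<and> strictly_below r b u))))) \<^bold>\<and>
      e \<^bold>\<in> P \<^bold>\<and> (\<^bold>\<forall>i. i \<^bold>\<in> X \<^bold>\<longrightarrow> pair_in i u e))"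

definition is_star_power_Fn :: "nat \<Rightarrow> nat \<Rightarrow> nat \<Rightarrow> nat \<Rightarrow> pf" where
  "is_star_power_Fn \<mu> P l e =
     (\<^bold>\<exists>Q. \<^bold>\<exists>r. \<^bold>\<exists>u. is_Fn_omega_2 Q r u \<^bold>\<and> is_star_power \<mu> Q r u P l e)"


section \<open>Names and the forcing relation\<close>

text \<open>
  A name is a set of pairs \<open>(\<sigma>, p)\<close> with \<open>\<sigma>\<close> a name and \<open>p \<in> P\<close>.  Since the model need not be
  well-founded, the recursive definitions of names, check-names and the forcing relation for
  equality are evaluated inside the model: by Foundation and Replacement there, an object
  satisfies such a recursion iff some set-sized partial solution witnesses it.
\<close>

definition is_name_set :: "nat \<Rightarrow> nat \<Rightarrow> pf" where
  "is_name_set P N =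
     (\<^bold>\<forall>x. \<^bold>\<forall>z. x \<^bold>\<in> N \<^bold>\<and> z \<^bold>\<in> x \<^bold>\<longrightarrow>
        (\<^bold>\<exists>s. \<^bold>\<exists>p. s \<^bold>\<in> N \<^bold>\<and> p \<^bold>\<in> P \<^bold>\<and> is_pair s p z))"

definition is_name :: "nat \<Rightarrow> nat \<Rightarrow> pf" where
  "is_name P x = (\<^bold>\<exists>N. x \<^bold>\<in> N \<^bold>\<and> is_name_set P N)"

text \<open>The check-name of \<open>x\<close> is the set of all \<open>(check y, e)\<close> with \<open>y \<in> x\<close>.\<close>

definition is_check :: "nat \<Rightarrow> nat \<Rightarrow> nat \<Rightarrow> pf" where
  "is_check e x c =
     (\<^bold>\<exists>N. \<^bold>\<exists>M. \<^bold>\<exists>f. is_transitive N \<^bold>\<and> x \<^bold>\<in> N \<^bold>\<and> is_func f N M \<^bold>\<and>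
        (\<^bold>\<forall>y. \<^bold>\<forall>d. pair_in y d f \<^bold>\<longrightarrow>
           (\<^bold>\<forall>z. z \<^bold>\<in> d \<^bold>\<longleftrightarrow>
              (\<^bold>\<exists>v. \<^bold>\<exists>b. v \<^bold>\<in> y \<^bold>\<and> pair_in v b f \<^bold>\<and> is_pair b e z))) \<^bold>\<and>
        pair_in x c f)"

text \<open>
  \<open>p \<tturnstile> x = y\<close> iff for all \<open>(s, u) \<in> x\<close> the set of \<open>r \<le> p\<close> such that
  \<open>r \<le> u\<close> implies that \<open>r \<le> v\<close> and \<open>r \<tturnstile> s = t\<close> for some \<open>(t, v) \<in> y\<close> is dense below \<open>p\<close>,
  and symmetrically in \<open>x\<close> and \<open>y\<close>.  Here \<open>R\<close> is the set of triples \<open>(p, x, y)\<close> with \<open>p \<tturnstile> x = y\<close>.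
\<close>

definition eq_step :: "nat \<Rightarrow> nat \<Rightarrow> nat \<Rightarrow> nat \<Rightarrow> nat \<Rightarrow> pf" where
  "eq_step l R p x y =
     ((\<^bold>\<forall>s. \<^bold>\<forall>u. pair_in s u x \<^bold>\<longrightarrow>
         (\<^bold>\<forall>q. pair_in q p l \<^bold>\<longrightarrow>
            (\<^bold>\<exists>r. pair_in r q l \<^bold>\<and>
               (pair_in r u l \<^bold>\<longrightarrow>
                  (\<^bold>\<exists>t. \<^bold>\<exists>v. pair_in t v y \<^bold>\<and> pair_in r v l \<^bold>\<and> triple_in r s t R))))) \<^bold>\<and>
      (\<^bold>\<forall>t. \<^bold>\<forall>v. pair_in t v y \<^bold>\<longrightarrow>
         (\<^bold>\<forall>q. pair_in q p l \<^bold>\<longrightarrow>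
            (\<^bold>\<exists>r. pair_in r q l \<^bold>\<and>
               (pair_in r v l \<^bold>\<longrightarrow>
                  (\<^bold>\<exists>s. \<^bold>\<exists>u. pair_in s u x \<^bold>\<and> pair_in r u l \<^bold>\<and> triple_in r s t R))))))"

definition forces_eq :: "nat \<Rightarrow> nat \<Rightarrow> nat \<Rightarrow> nat \<Rightarrow> nat \<Rightarrow> pf" where
  "forces_eq P l p x y =
     (\<^bold>\<exists>N. \<^bold>\<exists>R. is_name_set P N \<^bold>\<and> x \<^bold>\<in> N \<^bold>\<and> y \<^bold>\<in> N \<^bold>\<and>
        (\<^bold>\<forall>q. \<^bold>\<forall>a. \<^bold>\<forall>b. q \<^bold>\<in> P \<^bold>\<and> a \<^bold>\<in> N \<^bold>\<and> b \<^bold>\<in> N \<^bold>\<longrightarrow>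
           (triple_in q a b R \<^bold>\<longleftrightarrow> eq_step l R q a b)) \<^bold>\<and>
        triple_in p x y R)"

definition forces_mem :: "nat \<Rightarrow> nat \<Rightarrow> nat \<Rightarrow> nat \<Rightarrow> nat \<Rightarrow> pf" where
  "forces_mem P l p x y =
     (\<^bold>\<forall>q. pair_in q p l \<^bold>\<longrightarrow>
        (\<^bold>\<exists>r. pair_in r q l \<^bold>\<and>
           (\<^bold>\<exists>t. \<^bold>\<exists>v. pair_in t v y \<^bold>\<and> pair_in r v l \<^bold>\<and> forces_eq P l r t x)))"

text \<open>\<open>env\<close> assigns names to variables.\<close>

primrec forces :: "('v \<Rightarrow> 'v \<Rightarrow> bool) \<Rightarrow> 'v \<Rightarrow> 'v \<Rightarrow> 'v \<Rightarrow> (nat \<Rightarrow> 'v) \<Rightarrow> fm \<Rightarrow> bool" where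
  "forces E P l p env (Mem i j) \<longleftrightarrow> sat E ((!) [P, l, p, env i, env j]) (fm5 forces_mem)"
| "forces E P l p env (Equ i j) \<longleftrightarrow> sat E ((!) [P, l, p, env i, env j]) (fm5 forces_eq)"
| "forces E P l p env (Neg \<phi>) \<longleftrightarrow>
     (\<forall>q. sat E ((!) [q, p, l]) (fm3 pair_in) \<longrightarrow> \<not> forces E P l q env \<phi>)"
| "forces E P l p env (Conj \<phi> \<psi>) \<longleftrightarrow> forces E P l p env \<phi> \<and> forces E P l p env \<psi>"
| "forces E P l p env (Forall n \<phi>) \<longleftrightarrow>
     (\<forall>x. sat E ((!) [P, x]) (fm2 is_name) \<longrightarrow> forces E P l p (env(n := x)) \<phi>)"

definition check :: "('v \<Rightarrow> 'v \<Rightarrow> bool) \<Rightarrow> 'v \<Rightarrow> 'v \<Rightarrow> 'v" where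
  "check E e x = (THE c. sat E ((!) [e, x, c]) (fm3 is_check))"

text \<open>
  In every generic extension exactly the cardinals of the ground model are cardinals: no
  condition forces a non-cardinal of the ground model to be a cardinal.
\<close>

definition preserves_cardinals :: "('v \<Rightarrow> 'v \<Rightarrow> bool) \<Rightarrow> 'v \<Rightarrow> 'v \<Rightarrow> 'v \<Rightarrow> bool" where
  "preserves_cardinals E P l e \<longleftrightarrow>
     (\<forall>\<beta>. sat E ((!) [\<beta>]) (fm1 is_Ord) \<longrightarrow>
        (\<forall>p. E p P \<longrightarrow>
           (forces E P l p ((!) [check E e \<beta>]) (fm1 is_Card) \<longleftrightarrow> sat E ((!) [\<beta>]) (fm1 is_Card))))"

definition preserves_cofinalities :: "('v \<Rightarrow> 'v \<Rightarrow> bool) \<Rightarrow> 'v \<Rightarrow> 'v \<Rightarrow> 'v \<Rightarrow> bool" where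
  "preserves_cofinalities E P l e \<longleftrightarrow>
     (\<forall>\<gamma> \<delta>. sat E ((!) [\<gamma>]) (fm1 is_Limit) \<and> sat E ((!) [\<gamma>, \<delta>]) (fm2 is_cf) \<longrightarrow>
        forces E P l e ((!) [check E e \<gamma>, check E e \<delta>]) (fm2 is_cf))"

end

theory Submission
  imports Defs "HOL-Library.Countable_Set"
begin

text \<open>
  By the Loewenheim-Skolem theorem a counterexample would already occur in a countable model, and over a countable
  model generic filters exist; the extension consists of the names modulo equality forced by the filter.

  The order of the product allows a condition to be changed at only finitely many coordinates where it is already
  nonempty. Hence a sequence of \<open>\<omega>\<^sub>1\<close> conditions, each of which is below the common base of its
  predecessors, departs from the final base in finite sets; by a \<open>\<Delta>\<close>-system argument infinitely many of them
  have a lower bound. So every countable family of ordinals of the extension is decided up to countably many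
  values, and together with a chain condition obtained from GCH this preserves cardinals and cofinalities. Reals of
  the extension have countable names, and there are \<open>\<mu>\<close> many of these.

  For \<open>\<Phi>(\<kappa>)\<close> the set \<open>T\<close> consists of \<open>\<kappa>\<close> Cohen reals, and the family consists of the
  countable bounded sets of indices of the ground model whose closure is large. The same fusion finds inside any
  uncountable set of indices an infinite set of the ground model on which a condition of the filter is constantly some
  nonempty \<open>s\<close>. By genericity the corresponding Cohen reals accumulate at each Cohen real extending \<open>s\<close>, and
  there are \<open>\<kappa>\<close> many of those.
\<close>

section \<open>Definability with parameters\<close>

text \<open>The model \<open>E\<close> may be ill-founded and uncountable, so its sets can be
  reached only through its own Separation and Replacement: a predicate or function of the
  metalanguage yields a set only if some formula defines it. This is why definability
  (\<open>dp\<close>, \<open>dt\<close>) accompanies every construction and is left to the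
  simplifier. The countable model is placed on the type \<open>nat\<close>, and the extension is
  numbered by \<open>nat\<close> again, so that the set theory of the locale \<open>zfc\<close> is
  available in both. The order is not countably closed, since one coordinate may grow forever, and
  not ccc, since infinitely many coordinates may be filled at once. The delicate case of
  \<Phi>(\<kappa>) is \<kappa> of countable cofinality. Then \<kappa> has more than \<kappa>
  countable subsets, but under GCH only \<kappa> bounded ones; hence the restriction to bounded
  sets, and hence an uncountable set of indices must first be thinned out until its countable
  subsets are bounded.\<close>

primrec fv :: "fm => nat set" where
  "fv (Mem i j) = {i, j}"
| "fv (Equ i j) = {i, j}"
| "fv (Neg \<phi>) = fv \<phi>"
| "fv (Conj \<phi> \<psi>) = fv \<phi> \<union> fv \<psi>"
| "fv (Forall n \<phi>) = fv \<phi> - {n}"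

lemma finite_fv: "finite (fv \<phi>)"
  by (induction \<phi>) auto

lemma sat_cong: "(!!n. n : fv \<phi> ==> e n = e' n) ==> sat E e \<phi> = sat E e' \<phi>"
proof (induction \<phi> arbitrary: e e')
  case (Forall n \<phi>)
  have "sat E (e(n := x)) \<phi> = sat E (e'(n := x)) \<phi>" for x
    using Forall.prems by (intro Forall.IH) auto
  then show ?case by simp
next
  case (Conj \<phi> \<psi>)
  from Conj.IH[of e e'] Conj.prems show ?case by auto
next
  case (Neg \<phi>)
  from Neg.IH[of e e'] Neg.prems show ?case by auto
qed auto

definition fresh :: "nat set => nat" where
  "fresh A = Suc (Max (insert 0 A))"

lemma fresh: "finite A ==> k : A ==> k < fresh A"
  by (simp add: fresh_def le_imp_less_Suc)

text \<open>Capture is avoided by moving each bound variable above all images of the variables free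
  in its scope. Hence \<open>sat_ren\<close> holds for arbitrary \<rho>, injective or not.\<close>

primrec ren :: "fm => (nat => nat) => fm" where
  "ren (Mem i j) \<rho> = Mem (\<rho> i) (\<rho> j)"
| "ren (Equ i j) \<rho> = Equ (\<rho> i) (\<rho> j)"
| "ren (Neg \<phi>) \<rho> = Neg (ren \<phi> \<rho>)"
| "ren (Conj \<phi> \<psi>) \<rho> = Conj (ren \<phi> \<rho>) (ren \<psi> \<rho>)"
| "ren (Forall n \<phi>) \<rho> = Forall (fresh (\<rho> ` fv \<phi>)) (ren \<phi> (\<rho>(n := fresh (\<rho> ` fv \<phi>))))"

lemma sat_ren: "sat E e (ren \<phi> \<rho>) = sat E (%n. e (\<rho> n)) \<phi>"
proof (induction \<phi> arbitrary: e \<rho>)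
  case (Forall n \<phi>)
  let ?m = "fresh (\<rho> ` fv \<phi>)"
  have "sat E (e(?m := x)) (ren \<phi> (\<rho>(n := ?m))) = sat E ((%n. e (\<rho> n))(n := x)) \<phi>" for x
  proof -
    have "\<rho> k ~= ?m" if "k : fv \<phi>" for k
      using fresh[of "\<rho> ` fv \<phi>" "\<rho> k"] that finite_fv[of \<phi>] by auto
    then show ?thesis
      unfolding Forall.IH by (intro sat_cong) auto
  qed
  then show ?case by simp
qed auto

definition mrg :: "(nat => 'v) => (nat => 'v) => nat => 'v" where
  "mrg e s n = (if even n then e (n div 2) else s (n div 2))"

locale estr =
  fixes E :: "'v => 'v => bool" (infix \<open><:\<close> 50)
begin

text \<open>A relation or operation on environments is definable if some formula defines it with parameters; the parameters
  \<open>s\<close> occupy the odd variables, the arguments \<open>e\<close> the even ones.\<close>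

definition dp :: "((nat => 'v) => bool) => bool" where
  "dp R \<longleftrightarrow> (EX \<phi> s. ALL e. R e = sat E (mrg e s) \<phi>)"

definition dt :: "((nat => 'v) => 'v) => bool" where
  "dt t \<longleftrightarrow> dp (%e. e 0 = t (%n. e (Suc n)))"

lemma dpE: assumes "dp R" obtains \<phi> s where "!!e. R e = sat E (mrg e s) \<phi>"
  using assms unfolding dp_def by blast

lemma dpI: "(!!e. R e = sat E (mrg e s) \<phi>) ==> dp R"
  unfolding dp_def by blast

lemma dp_ren: assumes "dp R" shows "dp (%e. R (%n. e (\<rho> n)))"
proof -
  obtain \<phi> s where *: "!!e. R e = sat E (mrg e s) \<phi>" using assms by (rule dpE) blast
  show ?thesis
    by (rule dpI[where s=s and \<phi>="ren \<phi> (%k. if even k then 2 * \<rho> (k div 2) else k)"])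
      (auto simp: * sat_ren mrg_def intro!: arg_cong[where f="%x. sat E x \<phi>"])
qed

lemma dp_neg [simp]: assumes "dp R" shows "dp (%e. ~ R e)"
proof -
  obtain \<phi> s where *: "!!e. R e = sat E (mrg e s) \<phi>" using assms by (rule dpE) blast
  show ?thesis by (rule dpI[where s=s and \<phi>="Neg \<phi>"]) (simp add: *)
qed

lemma dp_conj [simp]: assumes "dp R" "dp Q" shows "dp (%e. R e & Q e)"
proof -
  obtain \<phi> s where 1: "!!e. R e = sat E (mrg e s) \<phi>" using assms(1) by (rule dpE) blast
  obtain \<psi> t where 2: "!!e. Q e = sat E (mrg e t) \<psi>" using assms(2) by (rule dpE) blast
  show ?thesis
  \<comment> \<open>The two parameter sequences share the odd variables: parameter number m of
    \<phi> becomes number 2m of \<open>mrg s t\<close>, and parameter number m of \<psi> becomes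
    number 2m+1.\<close>
  proof (rule dpI[where s="mrg s t" and \<phi>="Conj (ren \<phi> (%k. if even k then k else 2 * (2 * (k div 2)) + 1))
        (ren \<psi> (%k. if even k then k else 2 * (2 * (k div 2) + 1) + 1))"])
    fix e
    have "(%n. mrg e (mrg s t) (if even n then n else 2 * (2 * (n div 2)) + 1)) = mrg e s"
      by (auto simp: mrg_def fun_eq_iff) (metis even_Suc odd_Suc_minus_one odd_Suc_div_two Suc_pred odd_pos even_Suc_div_two diff_Suc_1)
    moreover have "(%n. mrg e (mrg s t) (if even n then n else 2 * (2 * (n div 2) + 1) + 1)) = mrg e t"
      by (auto simp: mrg_def fun_eq_iff)
    ultimately show "(R e & Q e) = sat E (mrg e (mrg s t)) (Conj (ren \<phi> (%k. if even k then k else 2 * (2 * (k div 2)) + 1))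
        (ren \<psi> (%k. if even k then k else 2 * (2 * (k div 2) + 1) + 1)))"
      by (simp add: 1 2 sat_ren)
  qed
qed

text \<open>As with de Bruijn indices, the quantified object becomes argument 0 and the old
  arguments move up by one, so quantifiers can be stripped by conditional rewriting. In the formula
  the quantifier binds a variable \<open>m\<close> that differs from all variables left after
  shifting back.\<close>

lemma dp_all [simp]: assumes "dp (%e. R (%n. e (Suc n)) (e 0))" shows "dp (%e. ALL x. R e x)"
proof -
  obtain \<phi> s where "!!e. R (%n. e (Suc n)) (e 0) = sat E (mrg e s) \<phi>"
    using assms by (rule dpE) blast
  from this[of "case_nat x e" for x e]
  have *: "R e x = sat E (mrg (case_nat x e) s) \<phi>" for e x by simp
  define \<rho> where "\<rho> m k = (if k = 0 then m else if even k then k - 2 else k)" for m k :: nat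
  define m where "m = fresh (\<rho> 0 ` fv \<phi>)"
  have m: "\<rho> m k ~= m" if "k : fv \<phi>" "k ~= 0" for k
  proof -
    have "\<rho> m k = \<rho> 0 k" using that by (simp add: \<rho>_def)
    then have "\<rho> m k : \<rho> 0 ` fv \<phi>" using that(1) by simp
    from fresh[OF finite_imageI[OF finite_fv] this] show ?thesis by (simp add: m_def)
  qed
  have "sat E (mrg (case_nat x e) s) \<phi> = sat E ((mrg e s)(m := x)) (ren \<phi> (\<rho> m))" for e x
    unfolding sat_ren
  proof (rule sat_cong)
    fix k assume k: "k : fv \<phi>"
    show "mrg (case_nat x e) s k = ((mrg e s)(m := x)) (\<rho> m k)"
    proof (cases "k = 0")
      case True then show ?thesis by (simp add: mrg_def \<rho>_def)
    next
      case False
      then have "mrg (case_nat x e) s k = mrg e s (\<rho> m k)"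
        by (auto simp: mrg_def \<rho>_def elim!: evenE split: nat.splits)
      with m[OF k False] show ?thesis by simp
    qed
  qed
  then show ?thesis
    by (intro dpI[where s=s and \<phi>="Forall m (ren \<phi> (\<rho> m))"]) (simp add: *)
qed

lemma dp_mem_var: "dp (%e. e i <: e j)"
  by (rule dpI[where \<phi>="Mem (2*i) (2*j)"]) (simp add: mrg_def)
lemma dp_eq_var: "dp (%e. e i = e j)"
  by (rule dpI[where \<phi>="Equ (2*i) (2*j)"]) (simp add: mrg_def)
lemma dp_const [simp]: "dp (%e. C)"
  using dp_eq_var[of 0 0] dp_neg[OF dp_eq_var[of 0 0]] by (cases C) auto
lemma dt_const [simp]: "dt (%e. c)"
  unfolding dt_def by (rule dpI[where \<phi>="Equ 0 1" and s="%_. c"]) (simp add: mrg_def)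
lemma dt_var [simp]: "dt (%e. e i)"
  unfolding dt_def by (rule dp_eq_var)

lemma dp_disj [simp]: assumes "dp R" "dp Q" shows "dp (%e. R e | Q e)"
  using dp_neg[OF dp_conj[OF dp_neg[OF assms(1)] dp_neg[OF assms(2)]]] by simp
lemma dp_imp [simp]: assumes "dp R" "dp Q" shows "dp (%e. R e --> Q e)"
  using dp_disj[OF dp_neg[OF assms(1)] assms(2)] unfolding imp_conv_disj .
lemma dp_iff [simp]: assumes "dp R" "dp Q" shows "dp (%e. R e \<longleftrightarrow> Q e)"
  unfolding iff_conv_conj_imp by (rule dp_conj[OF dp_imp[OF assms(1,2)] dp_imp[OF assms(2,1)]])
lemma dp_ex [simp]: assumes "dp (%e. R (%n. e (Suc n)) (e 0))" shows "dp (%e. EX x. R e x)"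
  using dp_neg[OF dp_all[OF dp_neg[OF assms]]] by simp
lemma dp_if [simp]: "dp P ==> dp R ==> dp Q ==> dp (%e. if P e then R e else Q e)"
  unfolding if_bool_eq_conj by (intro dp_conj dp_imp dp_neg)

lemma dt_ren: "dt t ==> dt (%e. t (%n. e (\<rho> n)))"
  unfolding dt_def using dp_ren[of "%e. e 0 = t (%n. e (Suc n))" "case_nat 0 (%n. Suc (\<rho> n))"] by simp

lemma dp_subst: assumes "dp (%e. R (e 0) (%n. e (Suc n)))" "dt t" shows "dp (%e. R (t e) e)"
proof -
  have "dp (%e. EX x. x = t e & R x e)"
    using assms by (intro dp_ex dp_conj) (simp_all add: dt_def)
  then show ?thesis by simp
qed

text \<open>Closure under substitution of definable terms: it suffices to check a predicate on
  distinct variables. This is how each notion introduced below is registered with the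
  simplifier.\<close>

lemma dp1: "dp (%e. P (e 0)) ==> dt t ==> dp (%e. P (t e))"
  using dp_subst[where R="%x e. P x"] by simp

lemma dp2: assumes "dp (%e. P (e 0) (e (Suc 0)))" "dt t" "dt s" shows "dp (%e. P (t e) (s e))"
proof -
  have "dp (%e. P (t (%n. e (Suc n))) (e 0))"
    using dp_subst[where R="%x e. P x (e 0)", OF _ dt_ren[OF assms(2)]] assms(1) by simp
  from dp_subst[where R="%x e. P (t e) x", OF this assms(3)] show ?thesis .
qed

lemma dp3: assumes "dp (%e. P (e 0) (e (Suc 0)) (e (Suc (Suc 0))))" "dt t" "dt s" "dt u"
  shows "dp (%e. P (t e) (s e) (u e))"
proof -
  have "dp (%e. P (t (%n. e (Suc n))) (s (%n. e (Suc n))) (e 0))"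
  proof -
    have "dp (%e. P (t (%n. e (Suc (Suc n)))) (e 0) (e (Suc 0)))"
      using dp_subst[where R="%x e. P x (e 0) (e (Suc 0))", OF _ dt_ren[OF assms(2)]] assms(1) by simp
    from dp_subst[where R="%x e. P (t (%n. e (Suc n))) x (e 0)", OF this dt_ren[OF assms(3)]] show ?thesis .
  qed
  from dp_subst[where R="%x e. P (t e) (s e) x", OF this assms(4)] show ?thesis .
qed

lemma dp4: assumes "dp (%e. P (e 0) (e (Suc 0)) (e (Suc (Suc 0))) (e (Suc (Suc (Suc 0)))))"
  "dt t" "dt s" "dt u" "dt v"
  shows "dp (%e. P (t e) (s e) (u e) (v e))"
proof -
  have "dp (%e. P (t (%n. e (Suc n))) (e 0) (e (Suc 0)) (e (Suc (Suc 0))))"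
    using dp_subst[where R="%x e. P x (e 0) (e (Suc 0)) (e (Suc (Suc 0)))", OF _ dt_ren[OF assms(2)]] assms(1)
    by simp
  note a = dp_ren[OF this]
  have "dp (%e. P (t (%n. e (Suc (Suc (Suc n))))) (e 0) (e (Suc 0)) (e (Suc (Suc 0))))"
    using dp_subst[where R="%x e. P x (e 0) (e (Suc 0)) (e (Suc (Suc 0)))", OF _ dt_ren[OF assms(2)]] assms(1)
    by simp
  from dp_subst[where R="%x e. P (t (%n. e (Suc (Suc n)))) x (e 0) (e (Suc 0))", OF this dt_ren[OF assms(3)]]
  have "dp (%e. P (t (%n. e (Suc (Suc n)))) (s (%n. e (Suc (Suc n)))) (e 0) (e (Suc 0)))" .
  from dp_subst[where R="%x e. P (t (%n. e (Suc n))) (s (%n. e (Suc n))) x (e 0)", OF this dt_ren[OF assms(4)]]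
  have "dp (%e. P (t (%n. e (Suc n))) (s (%n. e (Suc n))) (u (%n. e (Suc n))) (e 0))" .
  from dp_subst[where R="%x e. P (t e) (s e) (u e) x", OF this assms(5)] show ?thesis .
qed

lemma dp_mem [simp]: "dt t ==> dt s ==> dp (%e. t e <: s e)"
  by (rule dp2) (rule dp_mem_var)
lemma dp_eq [simp]: "dt t ==> dt s ==> dp (%e. t e = s e)"
  by (rule dp2) (rule dp_eq_var)

lemma dt1: "dt (%e. F (e 0)) ==> dt t ==> dt (%e. F (t e))"
  by (subst dt_def, rule dp2[where P="%a b. a = F b"]) (simp_all add: dt_ren dt_def[of "%e. F (e 0)"])
lemma dt2: "dt (%e. F (e 0) (e (Suc 0))) ==> dt t ==> dt s ==> dt (%e. F (t e) (s e))"
  by (subst dt_def, rule dp3[where P="%a b c. a = F b c"])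
    (simp_all add: dt_ren dt_def[of "%e. F (e 0) (e (Suc 0))"])
lemma dt3: "dt (%e. F (e 0) (e (Suc 0)) (e (Suc (Suc 0)))) ==> dt t ==> dt s ==> dt u ==> dt (%e. F (t e) (s e) (u e))"
  by (subst dt_def, rule dp4[where P="%a b c d. a = F b c d"])
    (simp_all add: dt_ren dt_def[of "%e. F (e 0) (e (Suc 0)) (e (Suc (Suc 0)))"])

lemma dt_if [simp]: "dp P ==> dt t ==> dt s ==> dt (%e. if P e then t e else s e)"
  unfolding dt_def if_distrib[where f="%x. _ = x"] by (rule dp_if) (simp_all add: dp_ren)

lemma dp_ex1 [simp]: "dp (%e. R (%n. e (Suc n)) (e 0)) ==> dp (%e. EX! x. R e x)"
  unfolding Ex1_def
  using dp_ren[of "%e. R (%n. e (Suc n)) (e 0)" "case_nat 0 (%n. Suc (Suc n))"] by simp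

end

section \<open>Elementary submodels\<close>

text \<open>Skolem terms. A \<open>Wit\<close> term names a counterexample to a universal formula,
  the only kind of witness needed since \<open>Forall\<close> is the only quantifier. That the terms
  form a countable datatype is the cardinality estimate in the downward Loewenheim-Skolem
  theorem.\<close>

datatype skt = Base nat | Wit fm nat "skt list"

instance fm :: countable by countable_datatype
instance skt :: countable by countable_datatype

definition lenv :: "'v => 'v list => nat => 'v" where
  "lenv c xs i = (if i < length xs then xs ! i else c)"

primrec ev :: "('v => 'v => bool) => (nat => 'v) => skt => 'v" where
  "ev E b (Base n) = b n"
| "ev E b (Wit \<phi> n ts) = (SOME x. ~ sat E ((lenv (b 0) (map (ev E b) ts))(n := x)) \<phi>)"

lemma elementary_submodel:
  fixes E :: "'v => 'v => bool" and b :: "nat => 'v"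
  assumes "infinite (UNIV :: 'v set)"
  obtains h :: "nat => 'v" where "inj h" "range b \<subseteq> range h"
    "!!env \<phi>. sat (%i j. E (h i) (h j)) env \<phi> = sat E (%n. h (env n)) \<phi>"
proof -
  obtain g :: "nat => 'v" where g: "inj g" using assms infinite_countable_subset by blast
  \<comment> \<open>Mixing in the injection \<open>g\<close> makes the hull infinite, so that
    \<open>from_nat_into\<close> numbers it bijectively by \<open>nat\<close>.\<close>
  define b' where "b' = mrg b g"
  define S where "S = range (ev E b')"
  have bS: "b' n : S" for n unfolding S_def by (rule range_eqI[of _ _ "Base n"]) simp
  have "g n = b' (2*n+1)" "b n = b' (2*n)" for n by (auto simp: b'_def mrg_def)
  then have gS: "range g \<subseteq> S" and bS': "range b \<subseteq> S" using bS by auto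
  have "infinite S" using gS g by (meson finite_subset range_inj_infinite)
  moreover have "countable S" unfolding S_def by simp
  ultimately have bij: "bij_betw (from_nat_into S) UNIV S" by (intro bij_betw_from_nat_into)
  define h where "h = from_nat_into S"
  have h: "inj h" "range h = S" using bij by (auto simp: h_def bij_betw_def)
  have "sat (%i j. E (h i) (h j)) env \<phi> = sat E (%n. h (env n)) \<phi>" for env \<phi>
  proof (induction \<phi> arbitrary: env)
    case (Equ i j) then show ?case using h(1) by (auto dest: injD)
  next
    case (Forall n \<phi>)
    have upd: "(%k. h ((env(n := x)) k)) = (%k. h (env k))(n := h x)" for x by auto
    have "EX x. ~ sat E ((%k. h (env k))(n := h x)) \<phi>" if x: "~ sat E ((%k. h (env k))(n := x)) \<phi>" for x
    proof -
      have "ALL k. EX t. h (env k) = ev E b' t" using h(2) unfolding S_def by auto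
      then obtain t where t: "!!k. h (env k) = ev E b' (t k)" by metis
      \<comment> \<open>Only the finitely many free variables of \<phi> matter, so a finite list of
        terms suffices as parameters of the witness.\<close>
      define w where "w = Wit \<phi> n (map t [0..<fresh (fv \<phi>)])"
      define le where "le = lenv (b' 0) (map (ev E b') (map t [0..<fresh (fv \<phi>)]))"
      have le: "sat E (le(n := y)) \<phi> = sat E ((%k. h (env k))(n := y)) \<phi>" for y
        by (rule sat_cong) (auto simp: le_def lenv_def t fresh finite_fv)
      have "~ sat E (le(n := x)) \<phi>" using x le by blast
      then have "~ sat E (le(n := ev E b' w)) \<phi>"
        unfolding w_def ev.simps le_def[symmetric] by (rule someI)
      moreover have "ev E b' w : range h" unfolding h(2) S_def by simp
      ultimately show ?thesis using le by auto
    qed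
    then show ?case unfolding sat.simps Forall.IH upd by blast
  qed auto
  with h bS' that show ?thesis by blast
qed

section \<open>Basic set theory in a model\<close>

locale zfc = estr E for E :: "'v => 'v => bool" (infix \<open><:\<close> 50) +
  assumes ZFC: "ZFC_model E"
begin

abbreviation (input) dP :: "('v => bool) => bool" where "dP Q == dp (%e. Q (e 0))"
abbreviation (input) dP2 :: "('v => 'v => bool) => bool" where "dP2 Q == dp (%e. Q (e 0) (e (Suc 0)))"
abbreviation (input) dF :: "('v => 'v) => bool" where "dF F == dt (%e. F (e 0))"
abbreviation (input) dF2 :: "('v => 'v => 'v) => bool" where "dF2 F == dt (%e. F (e 0) (e (Suc 0)))"

section \<open>Extensionality, Separation and definable comprehension\<close>

lemma set_ext: "(!!z. z <: x \<longleftrightarrow> z <: y) ==> x = y"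
  using ZFC unfolding ZFC_model_def by (elim conjE) blast

lemma foundation_ax: "y <: x ==> EX y. y <: x & ~ (EX z. z <: x & z <: y)"
  using ZFC unfolding ZFC_model_def by (elim conjE) blast

lemma separation_ax: assumes "dP Q" shows "EX b. ALL x. x <: b \<longleftrightarrow> x <: a & Q x"
proof -
  obtain \<phi> s where *: "!!e. Q (e 0) = sat E (mrg e s) \<phi>" using assms by (rule dpE) blast
  define e0 where "e0 = (%_::nat. a)"
  have m: "mrg (e0(0 := x)) s = (mrg e0 s)(0 := x)" for x
    by (auto simp: mrg_def fun_eq_iff elim: evenE)
  have "ALL \<phi> env a. EX b. ALL x. E x b \<longleftrightarrow> E x a & sat E (env(0 := x)) \<phi>"
    using ZFC unfolding ZFC_model_def by (elim conjE)
  then obtain b where "ALL x. x <: b \<longleftrightarrow> x <: a & sat E ((mrg e0 s)(0 := x)) \<phi>" by blast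
  moreover have "sat E ((mrg e0 s)(0 := x)) \<phi> = Q x" for x
    using *[of "e0(0 := x)"] by (simp add: m)
  ultimately show ?thesis by auto
qed

definition isset :: "('v => bool) => bool" where
  "isset Q \<longleftrightarrow> (EX y. ALL z. z <: y \<longleftrightarrow> Q z)"

lemma isset_sub: assumes "dP Q" "!!z. Q z ==> z <: a" shows "isset Q"
  using separation_ax[OF assms(1), of a] assms(2) unfolding isset_def by blast

definition emp :: 'v where "emp = (THE y. ALL z. ~ z <: y)"

lemma not_mem_emp [simp]: "~ z <: emp"
proof -
  obtain y where "ALL z. ~ z <: y" using separation_ax[of "%_. False" undefined] by auto
  then have "EX! y. ALL z. ~ z <: y" using set_ext by (intro ex1I[of _ y]) auto
  from theI'[OF this] show ?thesis by (simp add: emp_def)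
qed

text \<open>A description operator with default \<open>emp\<close>, in contrast to
  \<open>THE\<close>: its graph is then first-order (\<open>eq_the1\<close>), so it preserves
  definability.\<close>

definition the1 :: "('v => bool) => 'v" where
  "the1 Q = (if EX! y. Q y then (THE y. Q y) else emp)"

lemma the1_eq: "Q y ==> (!!z. Q z ==> z = y) ==> the1 Q = y"
proof -
  assume *: "Q y" "!!z. Q z ==> z = y"
  have "the1 Q = (THE y. Q y)" unfolding the1_def by (rule if_P) (rule ex1I[of Q, OF *])
  then show ?thesis using the_equality[of Q, OF *] by simp
qed

lemma the1I: "EX! y. Q y ==> Q (the1 Q)"
  unfolding the1_def by (simp only: if_True theI')

lemma eq_the1: "x = the1 Q \<longleftrightarrow> (Q x & (ALL y. Q y --> y = x)) | (~ (EX! y. Q y) & x = emp)"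
proof (cases "EX! y. Q y")
  case True
  from the1I[OF this] True show ?thesis by blast
next
  case False
  then have "the1 Q = emp" unfolding the1_def by (rule if_not_P)
  then show ?thesis using False by (simp only: simp_thms) blast
qed

lemma dt_the1 [simp]:
  assumes "dp (%e. Q (%n. e (Suc n)) (e 0))"
  shows "dt (%e. the1 (Q e))"
proof -
  have *: "dp (%e. Q (%n. e (\<rho> n)) (e i))" for \<rho> i
    using dp_ren[OF assms, of "case_nat i \<rho>"] unfolding nat.case .
  show ?thesis unfolding dt_def eq_the1 by (intro dp_disj dp_conj dp_all dp_imp dp_neg dp_ex1 * dp_eq dt_var dt_const)
qed

definition Col :: "('v => bool) => 'v" where
  "Col Q = the1 (%y. ALL z. z <: y \<longleftrightarrow> Q z)"

lemma mem_Col: "isset Q ==> z <: Col Q \<longleftrightarrow> Q z"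
proof -
  assume "isset Q"
  then have "EX! y. ALL z. z <: y \<longleftrightarrow> Q z" unfolding isset_def by (auto intro: set_ext)
  from the1I[OF this] show ?thesis unfolding Col_def by blast
qed

lemma dt_Col [simp]: assumes "dp (%e. Q (%n. e (Suc n)) (e 0))" shows "dt (%e. Col (Q e))"
proof -
  have "dp (%e. Q (%n. e (Suc (Suc n))) (e 0))"
    using dp_ren[OF assms, of "case_nat 0 (%n. Suc (Suc n))"] unfolding nat.case .
  then show ?thesis unfolding Col_def by simp
qed

definition Sep :: "'v => ('v => bool) => 'v" where "Sep a Q = Col (%z. z <: a & Q z)"

lemma mem_Sep [simp]: "dP Q ==> z <: Sep a Q \<longleftrightarrow> z <: a & Q z"
  unfolding Sep_def by (rule mem_Col) (rule isset_sub[where a=a], simp_all)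

lemma dt_Sep [simp]: "dt a ==> dp (%e. Q (%n. e (Suc n)) (e 0)) ==> dt (%e. Sep (a e) (Q e))"
  unfolding Sep_def by (simp add: dt_ren[of a])

section \<open>Pairs, unions, power sets and Replacement\<close>

lemma isset_pair: "isset (%z. z = a | z = b)"
proof -
  have "EX z. E a z & E b z" using ZFC unfolding ZFC_model_def by (elim conjE) blast
  then obtain c where "a <: c" "b <: c" by blast
  then show ?thesis by (intro isset_sub[where a=c]) auto
qed

definition upr :: "'v => 'v => 'v" where "upr a b = Col (%z. z = a | z = b)"
lemma mem_upr [simp]: "z <: upr a b \<longleftrightarrow> z = a | z = b"
  unfolding upr_def by (rule mem_Col[OF isset_pair])
lemma dt_upr [simp]: "dt a ==> dt b ==> dt (%e. upr (a e) (b e))"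
  by (rule dt2[where F=upr], unfold upr_def) simp_all

definition pr :: "'v => 'v => 'v" where "pr a b = upr (upr a a) (upr a b)"
lemma dt_pr [simp]: "dt a ==> dt b ==> dt (%e. pr (a e) (b e))"
  unfolding pr_def by simp

lemma upr_eq: "upr a b = upr c d \<longleftrightarrow> a = c & b = d | a = d & b = c"
proof
  assume "upr a b = upr c d"
  then have "ALL z. z = a | z = b \<longleftrightarrow> z = c | z = d" by (metis mem_upr)
  then show "a = c & b = d | a = d & b = c" by metis
next
  show "a = c & b = d | a = d & b = c ==> upr a b = upr c d" by (auto intro!: set_ext)
qed

lemma pr_eq [simp]: "pr a b = pr c d \<longleftrightarrow> a = c & b = d"
  unfolding pr_def upr_eq by auto

definition fs :: "'v => 'v" where "fs z = the1 (%a. EX b. z = pr a b)"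
definition sn :: "'v => 'v" where "sn z = the1 (%b. EX a. z = pr a b)"
lemma fs_pr [simp]: "fs (pr a b) = a" unfolding fs_def by (rule the1_eq) auto
lemma sn_pr [simp]: "sn (pr a b) = b" unfolding sn_def by (rule the1_eq) auto
lemma dt_fs [simp]: "dt t ==> dt (%e. fs (t e))" by (rule dt1[where F=fs], unfold fs_def) simp_all
lemma dt_sn [simp]: "dt t ==> dt (%e. sn (t e))" by (rule dt1[where F=sn], unfold sn_def) simp_all

definition Uni :: "'v => 'v" where "Uni a = Col (%z. EX y. y <: a & z <: y)"
lemma mem_Uni [simp]: "z <: Uni a \<longleftrightarrow> (EX y. y <: a & z <: y)"
proof -
  have "EX u. ALL y x. E x y & E y a --> E x u" using ZFC unfolding ZFC_model_def by (elim conjE) blast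
  then obtain u where "ALL y x. x <: y & y <: a --> x <: u" by blast
  then show ?thesis unfolding Uni_def by (intro mem_Col isset_sub[where a=u]) auto
qed
lemma dt_Uni [simp]: "dt t ==> dt (%e. Uni (t e))" by (rule dt1[where F=Uni], unfold Uni_def) simp_all

definition sub :: "'v => 'v => bool" where "sub a b \<longleftrightarrow> (ALL z. z <: a --> z <: b)"
lemma dp_sub [simp]: "dt a ==> dt b ==> dp (%e. sub (a e) (b e))" by (rule dp2[where P=sub], unfold sub_def) simp_all
lemma subI: "(!!z. z <: a ==> z <: b) ==> sub a b" unfolding sub_def by blast
lemma subD: "sub a b ==> z <: a ==> z <: b" unfolding sub_def by blast
lemma sub_refl [simp]: "sub a a" unfolding sub_def by blast
lemma sub_trans: "sub a b ==> sub b c ==> sub a c" unfolding sub_def by blast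
lemma sub_antisym: "sub a b ==> sub b a ==> a = b" unfolding sub_def by (rule set_ext) blast

definition Pw :: "'v => 'v" where "Pw a = Col (%z. sub z a)"
lemma mem_Pw [simp]: "z <: Pw a \<longleftrightarrow> sub z a"
proof -
  have "EX b. ALL x. (ALL z. E z x --> E z a) --> E x b" using ZFC unfolding ZFC_model_def by (elim conjE) blast
  then obtain b where "ALL x. sub x a --> x <: b" unfolding sub_def by blast
  then show ?thesis unfolding Pw_def by (intro mem_Col isset_sub[where a=b]) auto
qed
lemma dt_Pw [simp]: "dt t ==> dt (%e. Pw (t e))" by (rule dt1[where F=Pw], unfold Pw_def) simp_all

lemma isset_Rep: assumes "dF F" shows "isset (%z. EX x. x <: A & z = F x)"
proof -
  note [simp] = dt1[where F=F, OF assms]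
  have "dp (%e. e (Suc 0) = F (e 0))" by simp
  then obtain \<phi> s where *: "!!e. (e (Suc 0) = F (e 0)) = sat E (mrg e s) \<phi>" by (rule dpE) blast
  define e0 where "e0 = (%_::nat. A)"
  \<comment> \<open>The axiom speaks of variables 0 and 1, whereas the second argument of a
    definable relation sits at variable 2; so 1 and 2 are exchanged.\<close>
  define \<rho> where "\<rho> = (%k::nat. if k = 2 then 1 else if k = 1 then 2 else k)"
  define env where "env = (%k. mrg e0 s (\<rho> k))"
  have "(%k. (env(0 := x, 1 := y)) (\<rho> k)) = mrg (e0(0 := x, Suc 0 := y)) s" for x y
    by (auto simp: env_def \<rho>_def mrg_def fun_eq_iff elim!: evenE)
  then have **: "sat E (env(0 := x, 1 := y)) (ren \<phi> \<rho>) \<longleftrightarrow> y = F x" for x y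
    unfolding sat_ren using *[of "e0(0 := x, Suc 0 := y)"] by simp
  have "ALL \<phi> env a. (ALL x. E x a --> (EX! y. sat E (env(0 := x, 1 := y)) \<phi>)) -->
          (EX b. ALL x. E x a --> (EX y. E y b & sat E (env(0 := x, 1 := y)) \<phi>))"
    using ZFC unfolding ZFC_model_def by (elim conjE)
  from this[rule_format, of A env "ren \<phi> \<rho>"]
  obtain b where "ALL x. x <: A --> (EX y. y <: b & y = F x)" unfolding ** by blast
  then show ?thesis by (intro isset_sub[where a=b]) auto
qed

definition Rep :: "'v => ('v => 'v) => 'v" where "Rep A F = Col (%z. EX x. x <: A & z = F x)"
lemma mem_Rep [simp]: "dF F ==> z <: Rep A F \<longleftrightarrow> (EX x. x <: A & z = F x)"
  unfolding Rep_def by (rule mem_Col[OF isset_Rep])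
lemma RepI: "dF F ==> x <: A ==> F x <: Rep A F" by auto
lemma dt_Rep [simp]: assumes "dt A" "dt (%e. F (%n. e (Suc n)) (e 0))" shows "dt (%e. Rep (A e) (F e))"
proof -
  have "dt (%e. F (%n. e (Suc (Suc n))) (e 0))"
    using dt_ren[OF assms(2), of "case_nat 0 (%n. Suc (Suc n))"] unfolding nat.case .
  then show ?thesis unfolding Rep_def by (simp add: dt_ren[of A] assms)
qed

definition cup :: "'v => 'v => 'v" where "cup a b = Uni (upr a b)"
lemma mem_cup [simp]: "z <: cup a b \<longleftrightarrow> z <: a | z <: b" unfolding cup_def by auto
lemma dt_cup [simp]: "dt a ==> dt b ==> dt (%e. cup (a e) (b e))" unfolding cup_def by simp

definition sg :: "'v => 'v" where "sg a = upr a a"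
lemma mem_sg [simp]: "z <: sg a \<longleftrightarrow> z = a" unfolding sg_def by simp
lemma dt_sg [simp]: "dt a ==> dt (%e. sg (a e))" unfolding sg_def by simp

definition suc :: "'v => 'v" where "suc a = cup a (sg a)"
lemma mem_suc [simp]: "z <: suc a \<longleftrightarrow> z <: a | z = a" unfolding suc_def by simp
lemma dt_suc [simp]: "dt a ==> dt (%e. suc (a e))" unfolding suc_def by simp

definition prd :: "'v => 'v => 'v" where "prd a b = Col (%z. EX x y. x <: a & y <: b & z = pr x y)"
lemma mem_prd: "z <: prd a b \<longleftrightarrow> (EX x y. x <: a & y <: b & z = pr x y)"
  unfolding prd_def
  by (intro mem_Col isset_sub[where a="Pw (Pw (cup a b))"]) (auto simp: sub_def pr_def)
lemma pr_mem_prd [simp]: "pr x y <: prd a b \<longleftrightarrow> x <: a & y <: b" by (auto simp: mem_prd)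
lemma dt_prd [simp]: "dt a ==> dt b ==> dt (%e. prd (a e) (b e))" by (rule dt2[where F=prd], unfold prd_def) simp_all

definition diff :: "'v => 'v => 'v" where "diff a b = Sep a (%z. ~ z <: b)"
lemma mem_diff [simp]: "z <: diff a b \<longleftrightarrow> z <: a & ~ z <: b" unfolding diff_def by simp
lemma dt_diff [simp]: "dt a ==> dt b ==> dt (%e. diff (a e) (b e))" by (rule dt2[where F=diff], unfold diff_def) simp_all

section \<open>Functions as sets of pairs\<close>

definition domn :: "'v => 'v" where "domn f = Col (%x. EX y. pr x y <: f)"
lemma mem_domn [simp]: "x <: domn f \<longleftrightarrow> (EX y. pr x y <: f)"
proof -
  have "isset (%x. EX y. pr x y <: f)"
    by (rule isset_sub[where a="Uni (Uni f)"]) (auto simp: pr_def intro!: exI[of _ "upr _ _"])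
  then show ?thesis unfolding domn_def by (rule mem_Col)
qed
lemma dt_domn [simp]: "dt a ==> dt (%e. domn (a e))" by (rule dt1[where F=domn], unfold domn_def) simp_all

definition app :: "'v => 'v => 'v" where "app f x = the1 (%y. pr x y <: f)"
lemma dt_app [simp]: "dt a ==> dt b ==> dt (%e. app (a e) (b e))" by (rule dt2[where F=app], unfold app_def) simp_all

definition Func :: "'v => 'v => 'v => bool" where
  "Func f a b \<longleftrightarrow> (ALL z. z <: f --> (EX x y. x <: a & y <: b & z = pr x y)) & (ALL x. x <: a --> (EX! y. pr x y <: f))"
lemma dp_Func [simp]: "dt f ==> dt a ==> dt b ==> dp (%e. Func (f e) (a e) (b e))"
  by (rule dp3[where P=Func], unfold Func_def) simp_all

lemma Func_memD: "Func f a b ==> z <: f ==> EX x y. x <: a & y <: b & z = pr x y"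
  and Func_ex1: "Func f a b ==> x <: a ==> EX! y. pr x y <: f"
  unfolding Func_def by blast+

lemma Func_pr: assumes "Func f a b" shows "pr x y <: f \<longleftrightarrow> x <: a & y = app f x"
proof -
  have *: "pr x (app f x) <: f" if "x <: a"
    unfolding app_def by (rule the1I[OF Func_ex1[OF assms that]])
  have "x <: a" if "pr x y <: f" using Func_memD[OF assms that] by auto
  then show ?thesis using * Func_ex1[OF assms] by blast
qed
lemma Func_app: assumes "Func f a b" "x <: a" shows "app f x <: b"
  using Func_memD[OF assms(1), of "pr x (app f x)"] Func_pr[OF assms(1)] assms(2) by auto
lemma Func_mem: assumes "Func f a b" shows "z <: f \<longleftrightarrow> (EX x. x <: a & z = pr x (app f x))"
proof
  assume z: "z <: f"
  then obtain x y where "z = pr x y" using Func_memD[OF assms] by blast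
  with z show "EX x. x <: a & z = pr x (app f x)" by (auto simp: Func_pr[OF assms])
qed (auto simp: Func_pr[OF assms])
lemma Func_eqI: "Func f a b ==> Func g a c ==> (!!x. x <: a ==> app f x = app g x) ==> f = g"
  by (rule set_ext) (auto simp: Func_mem)
definition lam :: "'v => ('v => 'v) => 'v" where "lam A F = Rep A (%x. pr x (F x))"
lemma dt_lam [simp]: assumes "dt A" "dt (%e. F (%n. e (Suc n)) (e 0))" shows "dt (%e. lam (A e) (F e))"
  unfolding lam_def using assms by simp
lemma mem_lam: "dF F ==> z <: lam A F \<longleftrightarrow> (EX x. x <: A & z = pr x (F x))"
  unfolding lam_def by simp
lemma app_lam [simp]: "dF F ==> x <: A ==> app (lam A F) x = F x"
  unfolding app_def by (rule the1_eq) (auto simp: mem_lam)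
lemma Func_lam: "dF F ==> (!!x. x <: A ==> F x <: B) ==> Func (lam A F) A B"
  unfolding Func_def by (auto simp: mem_lam)
definition funsp :: "'v => 'v => 'v" where "funsp a b = Sep (Pw (prd a b)) (%f. Func f a b)"
lemma mem_funsp [simp]: "f <: funsp a b \<longleftrightarrow> Func f a b"
  unfolding funsp_def by (auto simp: sub_def Func_def mem_prd)
lemma dt_funsp [simp]: "dt a ==> dt b ==> dt (%e. funsp (a e) (b e))" by (rule dt2[where F=funsp], unfold funsp_def) simp_all

subsection \<open>Natural numbers, transitive closure, recursion\<close>

lemma not_mem_self [simp]: "~ x <: x"
  using foundation_ax[of x "sg x"] by auto
lemma not_mem_cycle: "x <: y ==> ~ y <: x"
  using foundation_ax[of x "upr x y"] by auto
lemma suc_inj [simp]: "suc x = suc y \<longleftrightarrow> x = y"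
  by (metis mem_suc not_mem_cycle)
lemma suc_not_emp [simp]: "suc x ~= emp" "emp ~= suc x"
  by (metis mem_suc not_mem_emp)+

definition indu :: "'v => bool" where "indu a \<longleftrightarrow> emp <: a & (ALL y. y <: a --> suc y <: a)"
lemma dp_indu [simp]: "dt a ==> dp (%e. indu (a e))" by (rule dp1[where P=indu], unfold indu_def) simp_all

definition om :: 'v where "om = Col (%n. ALL a. indu a --> n <: a)"

lemma mem_om: "n <: om \<longleftrightarrow> (ALL a. indu a --> n <: a)"
proof -
  have "EX a. (EX e. E e a & (ALL z. ~ E z e)) & (ALL y. E y a --> (EX s. E s a & (ALL z. E z s \<longleftrightarrow> E z y | z = y)))"
    using ZFC unfolding ZFC_model_def by (elim conjE)
  then obtain a e where a: "e <: a" "ALL z. ~ z <: e" "ALL y. y <: a --> (EX s. s <: a & (ALL z. z <: s \<longleftrightarrow> z <: y | z = y))"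
    by blast
  have "e = emp" using a by (intro set_ext) auto
  moreover have "s = suc y" if "ALL z. z <: s \<longleftrightarrow> z <: y | z = y" for s y using that by (intro set_ext) auto
  ultimately have "indu a" using a unfolding indu_def by metis
  then have "isset (%n. ALL a. indu a --> n <: a)" by (intro isset_sub[where a=a]) auto
  then show ?thesis unfolding om_def by (rule mem_Col)
qed

lemma emp_om [simp]: "emp <: om" and suc_om [simp]: "n <: om ==> suc n <: om"
  unfolding mem_om indu_def by auto

text \<open>Seen from outside, \<open>om\<close> may be nonstandard, so induction is sound only for
  definable \<open>Q\<close>: these cut out an inductive set of the model.\<close>

lemma om_induct [consumes 1, case_names dp emp suc]:
  assumes "n <: om" "dP Q" "Q emp" "!!n. n <: om ==> Q n ==> Q (suc n)"
  shows "Q n"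
proof -
  have "indu (Sep om Q)" unfolding indu_def using assms by auto
  then have "n <: Sep om Q" using assms(1) unfolding mem_om by blast
  then show ?thesis using assms(2) by simp
qed

definition tran :: "'v => bool" where "tran x \<longleftrightarrow> (ALL y z. y <: x --> z <: y --> z <: x)"
lemma dp_tran [simp]: "dt a ==> dp (%e. tran (a e))" by (rule dp1[where P=tran], unfold tran_def) simp_all

lemma ex_tran: "EX t. tran t & x <: t"
proof -
  \<comment> \<open>The recursion theorem rests on transitive closures, so here the iterates of
    \<open>Uni\<close> are built by hand: \<open>f\<close> is a set of pairs, each justified by an
    earlier one, and \<open>R n y\<close> says that \<open>y\<close> is the n-th iterate from
    \<open>sg x\<close>.\<close>
  define R where "R n y \<longleftrightarrow> (EX f. (ALL k y. pr k y <: f --> k = emp & y = sg x |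
     (EX k' y'. k = suc k' & y = Uni y' & pr k' y' <: f)) & pr n y <: f)" for n y
  have [simp]: "dt t ==> dt s ==> dp (%e. R (t e) (s e))" for t s by (rule dp2[where P=R], unfold R_def) simp_all
  have R0: "R emp y \<longleftrightarrow> y = sg x" for y
  proof
    assume "R emp y" then show "y = sg x" unfolding R_def by (metis suc_not_emp(2))
  qed (auto simp: R_def intro!: exI[of _ "sg (pr emp (sg x))"])
  have RS: "R (suc n) y \<longleftrightarrow> (EX y'. R n y' & y = Uni y')" for n y
  proof
    assume "R (suc n) y"
    then obtain f where f: "ALL k y. pr k y <: f --> k = emp & y = sg x |
     (EX k' y'. k = suc k' & y = Uni y' & pr k' y' <: f)" "pr (suc n) y <: f" unfolding R_def by blast
    then obtain y' where "y = Uni y'" "pr n y' <: f" by (metis suc_not_emp(1) suc_inj)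
    then show "EX y'. R n y' & y = Uni y'" using f(1) unfolding R_def by blast
  next
    assume "EX y'. R n y' & y = Uni y'"
    then obtain y' f where f: "ALL k y. pr k y <: f --> k = emp & y = sg x |
     (EX k' y'. k = suc k' & y = Uni y' & pr k' y' <: f)" "pr n y' <: f" "y = Uni y'" unfolding R_def by blast
    show "R (suc n) y" unfolding R_def
      by (rule exI[of _ "cup f (sg (pr (suc n) y))"]) (use f in auto)
  qed
  have ex1: "EX! y. R n y" if "n <: om" for n
    using that by (induction rule: om_induct) (auto simp: R0 RS)
  define g where "g n = the1 (R n)" for n
  have [simp]: "dt t ==> dt (%e. g (t e))" for t by (rule dt1[where F=g], unfold g_def) simp_all
  have g0: "g emp = sg x" unfolding g_def by (rule the1_eq) (auto simp: R0)
  have gS: "g (suc n) = Uni (g n)" if "n <: om" for n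
  proof -
    have "R (suc n) (g (suc n))" "R n (g n)" unfolding g_def
      by (rule the1I[OF ex1[OF suc_om[OF that]]], rule the1I[OF ex1[OF that]])
    then show ?thesis unfolding RS using ex1[OF that] by blast
  qed
  let ?t = "Uni (Rep om g)"
  have "tran ?t" unfolding tran_def
  proof (intro allI impI)
    fix y z assume "y <: ?t" "z <: y"
    then obtain n where n: "n <: om" "y <: g n" by auto
    then have "z <: g (suc n)" using \<open>z <: y\<close> by (auto simp: gS)
    moreover have "suc n <: om" using n by simp
    ultimately show "z <: ?t" by auto
  qed
  have "x <: g emp" using g0 by simp
  moreover have "g emp <: Rep om g" by (rule RepI) simp_all
  ultimately have "x <: ?t" unfolding mem_Uni by blast
  with \<open>tran ?t\<close> show ?thesis by blast
qed

definition tcl :: "'v => 'v" where "tcl x = Col (%y. ALL t. tran t & x <: t --> y <: t)"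

lemma mem_tcl: "y <: tcl x \<longleftrightarrow> (ALL t. tran t & x <: t --> y <: t)"
proof -
  obtain t where "tran t" "x <: t" using ex_tran by blast
  then have "isset (%y. ALL t. tran t & x <: t --> y <: t)" by (intro isset_sub[where a=t]) auto
  then show ?thesis unfolding tcl_def by (rule mem_Col)
qed
lemma tcl_self [simp]: "x <: tcl x" by (simp add: mem_tcl)
lemma tran_tcl: "tran (tcl x)" unfolding tran_def mem_tcl by blast
lemma tclD: "y <: tcl x ==> z <: y ==> z <: tcl x" using tran_tcl unfolding tran_def by blast

text \<open>Foundation concerns sets, and the counterexamples to \<open>Q\<close> may form a proper
  class; so a minimal one is taken inside the transitive closure \<open>tcl x\<close>.\<close>

lemma mem_induct [case_names dp step]:
  assumes "dP Q" "!!x. (!!y. y <: x ==> Q y) ==> Q x"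
  shows "Q x"
proof (rule ccontr)
  note [simp] = dp1[where P=Q, OF assms(1)]
  assume "~ Q x"
  then have "x <: Sep (tcl x) (%y. ~ Q y)" by simp
  from foundation_ax[OF this] obtain y where y: "y <: tcl x" "~ Q y" "ALL z. z <: tcl x & z <: y --> Q z"
    by auto
  then show False using assms(2)[of y] tclD by blast
qed

section \<open>Recursion along membership\<close>

definition restr :: "'v => 'v => 'v" where "restr f a = Sep f (%z. EX u w. u <: a & z = pr u w)"
lemma dt_restr [simp]: "dt a ==> dt b ==> dt (%e. restr (a e) (b e))" by (rule dt2[where F=restr], unfold restr_def) simp_all
lemma mem_restr: "z <: restr f a \<longleftrightarrow> z <: f & (EX u w. u <: a & z = pr u w)" unfolding restr_def by simp

text \<open>The attempts in the proof of the recursion theorem: their domain is closed under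
  elements, and they are single-valued because the value at \<open>y\<close> is \<open>G\<close>
  applied to \<open>y\<close> and the restriction of \<open>f\<close> to \<open>y\<close>.\<close>

definition approx :: "('v => 'v => 'v) => 'v => bool" where
  "approx G f \<longleftrightarrow> (ALL y v. pr y v <: f --> v = G y (restr f y) & (ALL u. u <: y --> (EX w. pr u w <: f)))"

definition wrec :: "('v => 'v => 'v) => 'v => 'v" where
  "wrec G x = the1 (%v. EX f. approx G f & pr x v <: f)"

text \<open>Covers step functions that have parameters of their own: \<open>G\<close> also reads the
  ambient environment, shifted past its two arguments.\<close>

lemma dt_ctx2:
  assumes "dt (%e. G (%n. e (Suc (Suc n))) (e 0) (e (Suc 0)))" "dt t" "dt s"
  shows "dt (%e. G (%n. e (\<rho> n)) (t e) (s e))"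
proof -
  have b: "dp (%e. e 0 = G (%n. e (Suc (Suc (Suc n)))) (e (Suc 0)) (e (Suc (Suc 0))))"
    using assms(1) unfolding dt_def .
  have "dp (%e. e (Suc (Suc 0)) = G (%n. e (Suc (Suc (Suc (\<rho> n))))) (e (Suc 0)) (e 0))"
    using dp_ren[OF b, of "case_nat (Suc (Suc 0)) (case_nat (Suc 0) (case_nat 0 (%n. Suc (Suc (Suc (\<rho> n))))))"]
    unfolding nat.case .
  moreover have "dp (%e. e (Suc 0) = t (%n. e (Suc (Suc (Suc n)))))" "dp (%e. e 0 = s (%n. e (Suc (Suc (Suc n)))))"
    by (intro dp_eq dt_var dt_ren[OF assms(2)] dt_ren[OF assms(3)])+
  ultimately have "dp (%e. EX a b. a = t (%n. e (Suc n)) & b = s (%n. e (Suc n)) & e 0 = G (%n. e (Suc (\<rho> n))) a b)"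
    by (intro dp_ex dp_conj)
  then show ?thesis unfolding dt_def by (rule back_subst[where P=dp]) (auto simp: fun_eq_iff)
qed

lemma dt_wrec [simp]:
  assumes "dt (%e. G (%n. e (Suc (Suc n))) (e 0) (e (Suc 0)))" "dt t"
  shows "dt (%e. wrec (G e) (t e))"
  unfolding wrec_def approx_def using assms by (simp add: dt_ctx2[where G=G, OF assms(1)] dt_ren[of t])

context
  fixes G assumes G: "dF2 G"
begin

lemma approx_unique:
  "ALL f f' v v'. approx G f --> approx G f' --> pr y v <: f --> pr y v' <: f' --> v = v'"
proof (induction y rule: mem_induct)
  case dp
  show ?case unfolding approx_def by (simp add: dt2[where F=G, OF G])
next
  case (step y)
  show ?case
  proof (intro allI impI)
    fix f f' v v' assume *: "approx G f" "approx G f'" "pr y v <: f" "pr y v' <: f'"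
    have "restr f y = restr f' y"
    proof (rule set_ext)
      fix z
      have t: "EX w. pr u w <: f" "EX w. pr u w <: f'" if "u <: y" for u
        using * that unfolding approx_def by blast+
      have u: "w = w'" if "u <: y" "pr u w <: f" "pr u w' <: f'" for u w w'
        using step[OF that(1)] that *(1,2) by blast
      have "pr u w <: f \<longleftrightarrow> pr u w <: f'" if "u <: y" for u w
        using t[OF that] u[OF that] by blast
      then show "z <: restr f y \<longleftrightarrow> z <: restr f' y" unfolding mem_restr by blast
    qed
    then show "v = v'" using * unfolding approx_def by metis
  qed
qed

lemma wrec_eqI: assumes "approx G g" "pr u w <: g" shows "wrec G u = w"
  unfolding wrec_def
proof (rule the1_eq)
  show "EX f. approx G f & pr u w <: f" using assms by blast
  show "z = w" if "EX f. approx G f & pr u z <: f" for z using that assms approx_unique by blast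
qed

lemma approx_exists: "EX f v. approx G f & pr x v <: f"
proof (induction x rule: mem_induct)
  case dp
  show ?case unfolding approx_def by (simp add: dt2[where F=G, OF G])
next
  case (step x)
  note [simp] = dt2[where F=G, OF G]
  have dpa[simp]: "dt t ==> dp (%e. approx G (t e))" for t by (rule dp1[where P="approx G"], unfold approx_def) simp_all
  \<comment> \<open>Any two attempts agree where both are defined, so their union is again an
    attempt. Restricting it to the transitive closure, with the values of \<open>wrec G\<close> as a
    bound, makes it a set.\<close>
  define f where "f = Sep (prd (tcl x) (Rep (tcl x) (wrec G))) (%z. EX f. approx G f & z <: f)"
  note W = wrec_eqI
  have f: "pr u w <: f \<longleftrightarrow> u <: tcl x & (EX f. approx G f & pr u w <: f)" for u w
    unfolding f_def using W by auto
  have af: "approx G f" unfolding approx_def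
  proof (intro allI impI)
    fix y v assume yv: "pr y v <: f"
    then obtain g where g: "approx G g" "pr y v <: g" "y <: tcl x" using f by blast
    have g2: "EX w. pr u w <: g" if "u <: y" for u
      using g(1,2) that unfolding approx_def by blast
    have v: "v = G y (restr g y)" using g(1,2) unfolding approx_def by blast
    have fg: "pr u w <: f \<longleftrightarrow> pr u w <: g" if u: "u <: y" for u w
    proof -
      have "u <: tcl x" using g(3) u by (rule tclD)
      then show ?thesis using f[of u w] g(1) g2[OF u] approx_unique[of u] by blast
    qed
    have "restr f y = restr g y"
      by (rule set_ext) (use fg in \<open>unfold mem_restr, blast\<close>)
    moreover have "ALL u. u <: y --> (EX w. pr u w <: f)" using fg g2 by blast
    ultimately show "v = G y (restr f y) & (ALL u. u <: y --> (EX w. pr u w <: f))"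
      using v by simp
  qed
  show ?case
  proof (cases "EX v. pr x v <: f")
    case True then show ?thesis using af by blast
  next
    case False
    define f1 where "f1 = cup f (sg (pr x (G x (restr f x))))"
    have r: "restr f1 y = restr f y" if "~ x <: y" for y
      using that by (intro set_ext) (auto simp: mem_restr f1_def)
    have nx: "~ x <: y" if "pr y v <: f" for y v using that False af unfolding approx_def by blast
    have "approx G f1" unfolding approx_def
    proof (intro allI impI)
      fix y v assume "pr y v <: f1"
      then consider "pr y v <: f" | "y = x" "v = G x (restr f x)" by (auto simp: f1_def)
      then show "v = G y (restr f1 y) & (ALL u. u <: y --> (EX w. pr u w <: f1))"
      proof cases
        case 1
        then have "v = G y (restr f y)" "ALL u. u <: y --> (EX w. pr u w <: f)" using af unfolding approx_def by blast+
        then show ?thesis using r[OF nx[OF 1]] by (auto simp: f1_def)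
      next
        case 2
        have "EX w. pr u w <: f" if "u <: x" for u using step[OF that] f tclD[OF tcl_self that] by blast
        then show ?thesis using 2 r[of x] by (auto simp: f1_def)
      qed
    qed
    moreover have "pr x (G x (restr f x)) <: f1" unfolding f1_def by simp
    ultimately show ?thesis by blast
  qed
qed

lemma wrec_unfold: "wrec G x = G x (lam x (wrec G))"
proof -
  note [simp] = dt2[where F=G, OF G]
  obtain f v where f: "approx G f" "pr x v <: f" using approx_exists by blast
  note W = wrec_eqI
  have "restr f x = lam x (wrec G)"
  proof (rule set_ext)
    fix z
    have "EX w. pr u w <: f" if "u <: x" for u using f that unfolding approx_def by blast
    then have "pr u w <: f \<longleftrightarrow> w = wrec G u" if "u <: x" for u w using W f(1) that by blast
    then show "z <: restr f x \<longleftrightarrow> z <: lam x (wrec G)" by (auto simp: mem_restr mem_lam)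
  qed
  moreover have "v = G x (restr f x)" using f unfolding approx_def by blast
  ultimately show ?thesis using W[OF f] by simp
qed

end

end

context zfc
begin

subsection \<open>Ordinals\<close>

definition Ord :: "'v => bool" where "Ord x \<longleftrightarrow> tran x & (ALL y. y <: x --> tran y)"
lemma dp_Ord [simp]: "dt a ==> dp (%e. Ord (a e))" by (rule dp1[where P=Ord], unfold Ord_def) simp_all

lemma Ord_mem: "Ord a ==> b <: a ==> Ord b" unfolding Ord_def tran_def by blast
lemma Ord_trans: "Ord a ==> b <: a ==> c <: b ==> c <: a" unfolding Ord_def tran_def by blast

lemma Ord_linear_aux: "Ord a --> (ALL b. Ord b --> a <: b | a = b | b <: a)"
proof (induction a rule: mem_induct)
  case (step a)
  have "Ord a --> Ord b --> a <: b | a = b | b <: a" for b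
  proof (induction b rule: mem_induct)
    case (step b)
    note inner = this
    show ?case
    proof (intro impI, rule ccontr)
      assume o: "Ord a" "Ord b" and n: "~ (a <: b | a = b | b <: a)"
      have "z <: b" if "z <: a" for z
        using that \<open>z <: a ==> Ord z --> (ALL b. Ord b --> z <: b | z = b | b <: z)\<close> o n Ord_mem Ord_trans by blast
      moreover have "z <: a" if "z <: b" for z
        using that inner[OF that] o n Ord_mem Ord_trans by blast
      ultimately have "a = b" by (intro set_ext) blast
      then show False using n by blast
    qed
  qed simp
  then show ?case by blast
qed simp

lemma Ord_linear: "Ord a ==> Ord b ==> a <: b | a = b | b <: a"
  using Ord_linear_aux by blast

lemma Ord_sub: assumes "Ord a" "Ord b" shows "sub a b \<longleftrightarrow> a <: b | a = b"
proof
  assume "sub a b"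
  then have "~ b <: a" using not_mem_self[of b] subD by blast
  then show "a <: b | a = b" using Ord_linear[OF assms] by blast
next
  assume "a <: b | a = b"
  then show "sub a b" unfolding sub_def using Ord_trans[OF assms(2)] by blast
qed

lemma Ord_not_mem: assumes "Ord a" "Ord b" shows "~ a <: b \<longleftrightarrow> sub b a"
proof -
  have "~ (a <: b & (b <: a | b = a))" using not_mem_cycle[of a b] not_mem_self[of a] by blast
  then show ?thesis unfolding Ord_sub[OF assms(2,1)] using Ord_linear[OF assms] by blast
qed

lemma Ord_emp [simp]: "Ord emp" unfolding Ord_def tran_def by simp
lemma Ord_suc [simp]: "Ord a ==> Ord (suc a)" unfolding Ord_def tran_def mem_suc by blast
lemma Ord_Uni: "(!!x. x <: A ==> Ord x) ==> Ord (Uni A)" unfolding Ord_def tran_def mem_Uni by blast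
lemma Ord_cup: "Ord a ==> Ord b ==> Ord (cup a b)" unfolding cup_def by (rule Ord_Uni) auto
lemma Ord_suc_sub: "Ord a ==> b <: a ==> sub (suc b) a" unfolding sub_def using Ord_trans by auto

lemma Ord_least: assumes "dP Q" "Ord a" "Q a" shows "EX b. Ord b & Q b & (ALL c. c <: b --> ~ Q c)"
proof (rule ccontr)
  note [simp] = dp1[where P=Q, OF assms(1)]
  assume n: "~ ?thesis"
  have "Ord x --> ~ Q x" for x
    by (induction x rule: mem_induct) (use n Ord_mem in \<open>simp, blast\<close>)
  then show False using assms by blast
qed

definition lst :: "('v => bool) => 'v" where
  "lst Q = the1 (%b. Ord b & Q b & (ALL c. c <: b --> ~ Q c))"

lemma dt_lst [simp]: assumes "dp (%e. Q (%n. e (Suc n)) (e 0))" shows "dt (%e. lst (Q e))"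
proof -
  have "dp (%e. Q (%n. e (Suc (Suc n))) (e 0))"
    using dp_ren[OF assms, of "case_nat 0 (%n. Suc (Suc n))"] unfolding nat.case .
  then show ?thesis using assms unfolding lst_def by simp
qed

lemma lst: assumes "dP Q" "Ord a" "Q a"
  shows "Ord (lst Q)" "Q (lst Q)" "!!c. c <: lst Q ==> ~ Q c"
proof -
  let ?R = "%b. Ord b & Q b & (ALL c. c <: b --> ~ Q c)"
  have "EX! b. ?R b" using Ord_least[OF assms] Ord_linear by blast
  from the1I[OF this] have "?R (lst Q)" unfolding lst_def .
  then show "Ord (lst Q)" "Q (lst Q)" "!!c. c <: lst Q ==> ~ Q c" by blast+
qed

lemma lst_sub: assumes "dP Q" "Ord a" "Q a" shows "sub (lst Q) a"
  using lst[OF assms] assms Ord_not_mem by blast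

lemma Ord_om_mem: "n <: om ==> Ord n"
  by (induction rule: om_induct) simp_all
lemma om_memD: assumes "n <: om" "m <: n" shows "m <: om"
proof -
  have "ALL m. m <: n --> m <: om" using assms(1) by (induction rule: om_induct) auto
  then show ?thesis using assms by blast
qed
lemma Ord_om [simp]: "Ord om" unfolding Ord_def tran_def using om_memD Ord_om_mem Ord_trans by blast
lemma om_cases: "n <: om ==> n = emp | (EX m. m <: om & n = suc m)"
  by (induction rule: om_induct) auto

definition Lim :: "'v => bool" where
  "Lim x \<longleftrightarrow> Ord x & x ~= emp & (ALL y. y <: x --> (EX z. z <: x & y <: z))"
lemma Lim_om: "Lim om" unfolding Lim_def
proof (intro conjI allI impI)
  show "om ~= emp"
  proof
    assume "om = emp"
    with emp_om show False by simp
  qed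
  show "EX z. z <: om & y <: z" if "y <: om" for y using that by (intro exI[of _ "suc y"]) simp
qed simp
lemma not_Lim_om: "n <: om ==> ~ Lim n"
  using om_cases[of n] not_mem_cycle unfolding Lim_def by auto
lemma omega_iff: "Lim w & (ALL y. y <: w --> ~ Lim y) \<longleftrightarrow> w = om"
proof
  assume w: "Lim w & (ALL y. y <: w --> ~ Lim y)"
  then have "Ord w" unfolding Lim_def by blast
  from Ord_linear[OF this Ord_om] show "w = om" using w Lim_om not_Lim_om by blast
qed (use Lim_om not_Lim_om in blast)

lemma not_all_Ord: "EX a. Ord a & ~ a <: A"
proof (rule ccontr)
  assume "~ ?thesis"
  then have *: "a <: Sep A Ord \<longleftrightarrow> Ord a" for a by auto
  then have "Ord (Sep A Ord)" unfolding Ord_def[of "Sep A Ord"] tran_def using Ord_mem Ord_trans by blast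
  then have "Sep A Ord <: Sep A Ord" unfolding * .
  then show False by simp
qed

section \<open>Rank, the cumulative hierarchy and Collection\<close>

definition rk :: "'v => 'v" where "rk = wrec (%x f. Uni (Rep x (%y. suc (app f y))))"
lemma dt_rk [simp]: "dt a ==> dt (%e. rk (a e))" by (rule dt1[where F=rk], unfold rk_def) simp_all
lemma rk_unfold: "rk x = Uni (Rep x (%y. suc (rk y)))"
proof -
  have "rk x = Uni (Rep x (%y. suc (app (lam x rk) y)))"
    unfolding rk_def by (subst wrec_unfold) simp_all
  also have "... = Uni (Rep x (%y. suc (rk y)))"
    by (rule set_ext) (auto cong: conj_cong)
  finally show ?thesis .
qed
lemma mem_rk: "z <: rk x \<longleftrightarrow> (EX y. y <: x & (z <: rk y | z = rk y))"
  by (subst rk_unfold) auto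
lemma Ord_rk [simp]: "Ord (rk x)"
proof (induction x rule: mem_induct)
  case (step x) then show ?case by (subst rk_unfold) (auto intro!: Ord_Uni)
qed simp
lemma rk_mem: "y <: x ==> rk y <: rk x" by (subst mem_rk) auto

definition Vs :: "'v => 'v" where "Vs = wrec (%x f. Uni (Rep x (%y. Pw (app f y))))"
lemma dt_Vs [simp]: "dt a ==> dt (%e. Vs (a e))" by (rule dt1[where F=Vs], unfold Vs_def) simp_all
lemma mem_Vs: "z <: Vs x \<longleftrightarrow> (EX y. y <: x & sub z (Vs y))"
proof -
  have "Vs x = Uni (Rep x (%y. Pw (app (lam x Vs) y)))"
    unfolding Vs_def by (subst wrec_unfold) simp_all
  then show ?thesis by (auto cong: conj_cong)
qed
lemma sub_Vs_rk: "sub x (Vs (rk x))"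
proof (induction x rule: mem_induct)
  case (step x) then show ?case unfolding sub_def[of x] mem_Vs using rk_mem by blast
qed simp
lemma mem_Vs_suc_rk: "x <: Vs (suc (rk x))"
  unfolding mem_Vs using sub_Vs_rk by auto

text \<open>Scott's trick: each \<open>x\<close> is assigned the whole level of the cumulative
  hierarchy at the least ordinal where a witness shows up, and Replacement collects these
  levels.\<close>

lemma collection:
  assumes "dP2 R"
  shows "EX B. ALL x. x <: A --> (EX y. R x y) --> (EX y. y <: B & R x y)"
proof -
  note [simp] = dp2[where P=R, OF assms]
  define F where "F x = lst (%a. EX y. y <: Vs a & R x y)" for x
  have [simp]: "dt t ==> dt (%e. F (t e))" for t by (rule dt1[where F=F], unfold F_def) simp_all
  have "EX y. y <: Uni (Rep A (%x. Vs (F x))) & R x y" if x: "x <: A" and y: "R x y" for x y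
  proof -
    have "EX y. y <: Vs (F x) & R x y"
      unfolding F_def by (rule lst(2)[where a="suc (rk y)"]) (use y mem_Vs_suc_rk in auto)
    then show ?thesis using x by auto
  qed
  then show ?thesis by blast
qed

subsection \<open>Choice and equipotence\<close>

definition ext :: "'v => 'v set" where "ext a = {x. x <: a}"
lemma mem_ext [simp]: "x : ext a \<longleftrightarrow> x <: a" unfolding ext_def by simp

lemma bij_ext: "bij_betw F (ext a) (ext b) \<longleftrightarrow> inj_on F (ext a) & (ALL x. x <: a --> F x <: b) &
    (ALL y. y <: b --> (EX x. x <: a & F x = y))"
proof -
  have "F ` ext a = ext b \<longleftrightarrow> (ALL y. (EX x. x <: a & y = F x) \<longleftrightarrow> y <: b)"
    unfolding set_eq_iff image_iff Bex_def mem_ext by (rule refl)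
  also have "... \<longleftrightarrow> (ALL x. x <: a --> F x <: b) & (ALL y. y <: b --> (EX x. x <: a & F x = y))" by metis
  finally show ?thesis unfolding bij_betw_def by simp
qed
lemma inj_ext: "inj_on F (ext a) \<longleftrightarrow> (ALL x y. x <: a --> y <: a --> F x = F y --> x = y)"
  unfolding inj_on_def Ball_def mem_ext by blast

lemma AC: "EX C. dF C & (ALL y. y <: a & (EX z. z <: y) --> C y <: y)"
proof -
  define a' where "a' = Sep a (%y. EX z. z <: y)"
  have a': "y <: a' \<longleftrightarrow> y <: a & (EX z. z <: y)" for y unfolding a'_def by simp
  \<comment> \<open>The axiom picks from disjoint families only, so every nonempty y is replaced by
    its copy {y} \<times> y.\<close>
  define b where "b = Rep a' (%x. prd (sg x) x)"
  have b: "z <: b \<longleftrightarrow> (EX x. x <: a' & z = prd (sg x) x)" for z unfolding b_def by simp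
  have ne: "x <: b ==> EX z. z <: x" for x unfolding b by (auto simp: a' mem_prd)
  have dj: "x <: b & y <: b & z <: x & z <: y ==> x = y" for x y z unfolding b by (auto simp: mem_prd)
  have "ALL a. (ALL x. E x a --> (EX z. E z x)) & (ALL x y z. E x a & E y a & E z x & E z y --> x = y) -->
          (EX c. ALL x. E x a --> (EX! z. E z x & E z c))"
    using ZFC unfolding ZFC_model_def by (elim conjE)
  then have "(ALL x. E x b --> (EX z. E z x)) & (ALL x y z. E x b & E y b & E z x & E z y --> x = y) -->
          (EX c. ALL x. E x b --> (EX! z. E z x & E z c))" by (rule spec)
  then have "EX c. ALL x. x <: b --> (EX! z. z <: x & z <: c)" by (rule mp) (use ne dj in blast)
  then obtain c where c: "ALL x. x <: b --> (EX! z. z <: x & z <: c)" by (elim exE)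
  define C where "C y = the1 (%z. z <: y & pr y z <: c)" for y
  have "dF C" unfolding C_def by simp
  moreover have "C y <: y" if "y <: a" "z <: y" for y z
  proof -
    have "prd (sg y) y <: b" using that unfolding b a' by blast
    then have "EX! z. z <: prd (sg y) y & z <: c" using c by blast
    then obtain p where p: "p <: prd (sg y) y" "p <: c" "!!q. q <: prd (sg y) y ==> q <: c ==> q = p" by blast
    from p(1) obtain z where z: "p = pr y z" "z <: y" by (auto simp: mem_prd)
    have "EX! z. z <: y & pr y z <: c"
    proof (rule ex1I[of _ z])
      show "z <: y & pr y z <: c" using z p(2) by simp
      fix u assume "u <: y & pr y u <: c"
      then have "pr y u = p" using p(3)[of "pr y u"] by simp
      then show "u = z" using z by simp
    qed
    from the1I[OF this] show ?thesis unfolding C_def by blast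
  qed
  ultimately show ?thesis by blast
qed

text \<open>Zermelo's well-ordering theorem. The equation for \<open>F\<close> is kept because the
  order of enumeration matters in \<open>prd_lep_aux\<close>, where \<open>C\<close> prefers pairs
  with small maximum.\<close>

lemma enumeration:
  assumes C: "dF C" "!!y. sub y A ==> y ~= emp ==> C y <: y"
  obtains F \<alpha> where "Ord \<alpha>" "dF F" "bij_betw F (ext \<alpha>) (ext A)"
    "!!\<beta>. \<beta> <: \<alpha> ==> F \<beta> = C (diff A (Rep \<beta> F))"
proof -
  note [simp] = dt1[where F=C, OF C(1)]
  \<comment> \<open>The value \<open>A\<close>, never an element of \<open>A\<close>, marks
    exhaustion. If it never occurred, Replacement would give a set containing all ordinals.\<close>
  define G where "G \<alpha> f = (if diff A (Rep \<alpha> (app f)) ~= emp then C (diff A (Rep \<alpha> (app f))) else A)" for \<alpha> f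
  have dG: "dF2 G" unfolding G_def by simp
  define H where "H = wrec G"
  have [simp]: "dt t ==> dt (%e. H (t e))" for t
    unfolding H_def by (rule dt_wrec) (use dG in simp_all)
  have H: "H \<alpha> = (if diff A (Rep \<alpha> H) ~= emp then C (diff A (Rep \<alpha> H)) else A)" for \<alpha>
  proof -
    have "Rep \<alpha> (app (lam \<alpha> H)) = Rep \<alpha> H" by (rule set_ext) (auto cong: conj_cong)
    then show ?thesis unfolding H_def by (subst wrec_unfold[OF dG]) (simp add: G_def H_def[symmetric])
  qed
  have HA: "diff A (Rep \<alpha> H) ~= emp & H \<alpha> = C (diff A (Rep \<alpha> H)) & H \<alpha> <: diff A (Rep \<alpha> H)" if "H \<alpha> <: A" for \<alpha>
  proof -
    have n: "diff A (Rep \<alpha> H) ~= emp" using that H[of \<alpha>] by (auto split: if_splits)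
    then show ?thesis using H[of \<alpha>] C(2)[of "diff A (Rep \<alpha> H)"] by (auto simp: sub_def)
  qed
  have inj: "H \<alpha> ~= H \<beta>" if "H \<alpha> <: A" "\<beta> <: \<alpha>" for \<alpha> \<beta>
    using HA[OF that(1)] that(2) by auto
  have "EX \<alpha>. Ord \<alpha> & ~ H \<alpha> <: A"
  proof (rule ccontr)
    assume n: "~ ?thesis"
    define G where "G z = the1 (%\<alpha>. Ord \<alpha> & H \<alpha> = z)" for z
    have [simp]: "dt t ==> dt (%e. G (t e))" for t by (rule dt1[where F=G], unfold G_def) simp_all
    have "G (H \<alpha>) = \<alpha>" if "Ord \<alpha>" for \<alpha>
      unfolding G_def
    proof (rule the1_eq)
      fix \<beta> assume "Ord \<beta> & H \<beta> = H \<alpha>"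
      then show "\<beta> = \<alpha>" using that n inj[of \<alpha> \<beta>] inj[of \<beta> \<alpha>] Ord_linear[of \<alpha> \<beta>] by auto
    qed (simp add: that)
    then have "\<alpha> <: Rep A G" if "Ord \<alpha>" for \<alpha> using that n RepI[of G "H \<alpha>" A] by auto
    then show False using not_all_Ord by blast
  qed
  then obtain \<alpha>0 where "Ord \<alpha>0" "~ H \<alpha>0 <: A" by blast
  note l = lst[of "%\<alpha>. ~ H \<alpha> <: A", OF _ this, simplified]
  define \<alpha> where "\<alpha> = lst (%\<alpha>. ~ H \<alpha> <: A)"
  have "bij_betw H (ext \<alpha>) (ext A)" unfolding bij_ext
  proof (intro conjI)
    show "inj_on H (ext \<alpha>)"
    proof (rule inj_onI)
      fix x y assume xy: "x : ext \<alpha>" "y : ext \<alpha>" "H x = H y"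
      then have "H x <: A" "H y <: A" "Ord x" "Ord y" using l(3) Ord_mem[OF l(1)] unfolding \<alpha>_def by auto
      then show "x = y" using xy inj[of x y] inj[of y x] Ord_linear[of x y] by auto
    qed
    have "diff A (Rep \<alpha> H) = emp"
    proof (rule ccontr)
      assume "diff A (Rep \<alpha> H) ~= emp"
      then have "H \<alpha> <: A" using H[of \<alpha>] C(2)[of "diff A (Rep \<alpha> H)"] by (auto simp: sub_def)
      then show False using l(2) unfolding \<alpha>_def by blast
    qed
    then have "ALL z. z <: A --> z <: Rep \<alpha> H" using mem_diff[of _ A "Rep \<alpha> H"] by auto
    then show "ALL y. y <: A --> (EX x. x <: \<alpha> & H x = y)" by auto
    show "ALL x. x <: \<alpha> --> H x <: A" using l(3) unfolding \<alpha>_def[symmetric] by blast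
  qed
  moreover have "H \<beta> = C (diff A (Rep \<beta> H))" if "\<beta> <: \<alpha>" for \<beta> using HA l(3) that unfolding \<alpha>_def by blast
  ultimately show ?thesis using that[of \<alpha> H] l(1) unfolding \<alpha>_def by simp
qed

section \<open>Comparison of sizes\<close>

definition lep :: "'v => 'v => bool" where
  "lep a b \<longleftrightarrow> (EX f. Func f a b & (ALL x y. x <: a --> y <: a --> app f x = app f y --> x = y))"
definition eqp :: "'v => 'v => bool" where
  "eqp a b \<longleftrightarrow> (EX f. Func f a b & (ALL x y. x <: a --> y <: a --> app f x = app f y --> x = y) &
     (ALL y. y <: b --> (EX x. x <: a & app f x = y)))"
lemma dp_lep [simp]: "dt a ==> dt b ==> dp (%e. lep (a e) (b e))" by (rule dp2[where P=lep], unfold lep_def) simp_all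
lemma dp_eqp [simp]: "dt a ==> dt b ==> dp (%e. eqp (a e) (b e))" by (rule dp2[where P=eqp], unfold eqp_def) simp_all

lemma lepI: assumes "dF F" "inj_on F (ext a)" "!!x. x <: a ==> F x <: b" shows "lep a b"
  unfolding lep_def using assms
  by (intro exI[of _ "lam a F"]) (auto intro!: Func_lam simp: inj_on_def)
lemma lepE: assumes "lep a b" obtains F where "dF F" "inj_on F (ext a)" "!!x. x <: a ==> F x <: b"
proof -
  obtain f where "Func f a b" "ALL x y. x <: a --> y <: a --> app f x = app f y --> x = y"
    using assms unfolding lep_def by blast
  then show ?thesis using that[of "app f"] Func_app by (auto simp: inj_on_def)
qed
lemma eqpI: assumes "dF F" "bij_betw F (ext a) (ext b)" shows "eqp a b"
proof -
  have "Func (lam a F) a b" using assms by (intro Func_lam) (auto simp: bij_ext)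
  moreover have "app (lam a F) x = F x" if "x <: a" for x using assms(1) that by simp
  ultimately show ?thesis unfolding eqp_def using assms(2) unfolding bij_ext inj_ext
    by (intro exI[of _ "lam a F"] conjI) (simp_all cong: conj_cong)
qed
lemma eqpE: assumes "eqp a b" obtains F where "dF F" "bij_betw F (ext a) (ext b)"
proof -
  obtain f where f: "Func f a b" "ALL x y. x <: a --> y <: a --> app f x = app f y --> x = y"
     "ALL y. y <: b --> (EX x. x <: a & app f x = y)"
    using assms unfolding eqp_def by blast
  have "bij_betw (app f) (ext a) (ext b)"
    using f Func_app[OF f(1)] unfolding bij_ext inj_ext by blast
  then show ?thesis using that[of "app f"] by simp
qed

lemma lep_refl [simp]: "lep a a" by (rule lepI[of "%x. x"]) auto
lemma sub_lep: "sub a b ==> lep a b" by (rule lepI[of "%x. x"]) (auto dest: subD)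
lemma lep_trans: assumes "lep a b" "lep b c" shows "lep a c"
proof -
  obtain F where F: "dF F" "inj_on F (ext a)" "!!x. x <: a ==> F x <: b" using assms(1) by (rule lepE) blast
  obtain G where G: "dF G" "inj_on G (ext b)" "!!x. x <: b ==> G x <: c" using assms(2) by (rule lepE) blast
  show ?thesis
    by (rule lepI[of "%x. G (F x)"]) (use F G dt1[OF G(1) F(1)] in \<open>auto simp: inj_on_def\<close>)
qed
lemma eqp_refl [simp]: "eqp a a" by (rule eqpI[of "%x. x"]) (auto simp: bij_betw_def)
lemma eqp_lep: "eqp a b ==> lep a b" unfolding eqp_def lep_def by blast
lemma eqp_sym: assumes "eqp a b" shows "eqp b a"
proof -
  obtain F where F: "dF F" "bij_betw F (ext a) (ext b)" using assms by (rule eqpE) blast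
  note [simp] = dt1[where F=F, OF F(1)]
  let ?G = "%y. the1 (%x. x <: a & F x = y)"
  have G: "?G (F x) = x" if "x <: a" for x
    using that F(2) by (intro the1_eq) (auto simp: bij_ext inj_ext)
  have "bij_betw ?G (ext b) (ext a)"
    unfolding bij_ext inj_ext
  proof (intro conjI allI impI)
    fix x y assume "x <: b" "y <: b" "?G x = ?G y"
    then show "x = y" using F(2) G unfolding bij_ext by metis
  next
    fix x assume "x <: b" then show "?G x <: a" using F(2) G unfolding bij_ext by metis
  next
    fix y assume "y <: a" then show "EX x. x <: b & ?G x = y" using F(2) G unfolding bij_ext by blast
  qed
  then show ?thesis by (intro eqpI[of ?G]) simp_all
qed
lemma eqp_trans: assumes "eqp a b" "eqp b c" shows "eqp a c"
proof -
  obtain F where F: "dF F" "bij_betw F (ext a) (ext b)" using assms(1) by (rule eqpE) blast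
  obtain G where G: "dF G" "bij_betw G (ext b) (ext c)" using assms(2) by (rule eqpE) blast
  show ?thesis
    by (rule eqpI[of "%x. G (F x)"]) (use F G dt1[OF G(1) F(1)] bij_betw_trans[OF F(2) G(2)] in \<open>auto simp: o_def\<close>)
qed

lemma surj_lep: assumes "dF F" "!!y. y <: b ==> EX x. x <: a & F x = y" shows "lep b a"
proof -
  note [simp] = dt1[where F=F, OF assms(1)]
  obtain C where C: "dF C" "ALL y. y <: Pw a & (EX z. z <: y) --> C y <: y" using AC by blast
  note [simp] = dt1[where F=C, OF C(1)]
  have C': "C (Sep a (%x. F x = y)) <: a & F (C (Sep a (%x. F x = y))) = y" if "y <: b" for y
    using C(2)[rule_format, of "Sep a (%x. F x = y)"] assms(2)[OF that] by (auto simp: sub_def)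
  show ?thesis
    by (rule lepI[of "%y. C (Sep a (%x. F x = y))"]) (use C' in \<open>auto intro: inj_on_inverseI[where g=F]\<close>)
qed

lemma lep_antisym: assumes "lep a b" "lep b a" shows "eqp a b"
proof -
  obtain F where F: "dF F" "inj_on F (ext a)" "!!x. x <: a ==> F x <: b" using assms(1) by (rule lepE) blast
  obtain G where G: "dF G" "inj_on G (ext b)" "!!x. x <: b ==> G x <: a" using assms(2) by (rule lepE) blast
  note [simp] = dt1[where F=F, OF F(1)] dt1[where F=G, OF G(1)]
  \<comment> \<open>Cantor-Bernstein by a fixed point: \<open>X\<close> is the greatest S with S = a
    - G[b - F[S]]. The bijection is \<open>F\<close> on \<open>X\<close> and the inverse of
    \<open>G\<close> outside it.\<close>
  define St where "St S = diff a (Rep (diff b (Rep S F)) G)" for S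
  have [simp]: "dt t ==> dt (%e. St (t e))" for t by (rule dt1[where F=St], unfold St_def) simp_all
  have St: "z <: St S \<longleftrightarrow> z <: a & ~ (EX y. y <: b & ~ (EX x. x <: S & y = F x) & z = G y)" for z S
    unfolding St_def by auto
  define X where "X = Uni (Sep (Pw a) (%S. sub S (St S)))"
  have X: "z <: X \<longleftrightarrow> (EX S. sub S a & sub S (St S) & z <: S)" for z unfolding X_def by auto
  have Xa: "sub X a" unfolding X sub_def[of X] using subD by blast
  have 1: "sub X (St X)"
  proof (rule subI)
    fix z assume "z <: X"
    then obtain S where S: "sub S a" "sub S (St S)" "z <: S" unfolding X by blast
    then have "z <: St S" "ALL x. x <: S --> x <: X" using subD unfolding X by blast+
    then show "z <: St X" unfolding St by blast
  qed
  have 2: "sub (St X) X"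
  proof (rule subI)
    fix z assume z: "z <: St X"
    have "sub (St X) (St (St X))" using 1 unfolding sub_def St by blast
    moreover have "sub (St X) a" unfolding sub_def St by blast
    ultimately show "z <: X" unfolding X using z by blast
  qed
  have fx: "z <: X \<longleftrightarrow> z <: a & ~ (EX y. y <: b & ~ (EX x. x <: X & y = F x) & z = G y)" for z
    using 1 2 St[of z X] subD by blast
  let ?H = "%z. if z <: X then F z else the1 (%y. y <: b & z = G y)"
  have Gi: "the1 (%y. y <: b & G u = G y) = u" if "u <: b" for u
    using that G(2) by (intro the1_eq) (auto simp: inj_on_def)
  have n: "EX y. y <: b & ~ (EX x. x <: X & y = F x) & z = G y & ?H z = y" if "z <: a" "~ z <: X" for z
    using fx[of z] that Gi by auto
  have "bij_betw ?H (ext a) (ext b)" unfolding bij_ext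
  proof (intro conjI allI impI)
    show "inj_on ?H (ext a)"
    proof (rule inj_onI)
      fix x y assume xy: "x : ext a" "y : ext a" "?H x = ?H y"
      show "x = y"
      proof (cases "x <: X"; cases "y <: X")
        assume "x <: X" "y <: X" then show ?thesis using xy F(2) by (simp add: inj_on_def)
      next
        assume "x <: X" "~ y <: X" then show ?thesis using xy n[of y] by auto
      next
        assume "~ x <: X" "y <: X" then show ?thesis using xy n[of x] by auto
      next
        assume "~ x <: X" "~ y <: X" then show ?thesis using xy n[of x] n[of y] by auto
      qed
    qed
    show "?H x <: b" if "x <: a" for x using n[OF that] F(3)[OF that] by (cases "x <: X") auto
    show "EX x. x <: a & ?H x = y" if "y <: b" for y
    proof (cases "EX x. x <: X & y = F x")
      case True then show ?thesis using Xa subD by auto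
    next
      case False
      then have "~ G y <: X" using fx[of "G y"] that by blast
      then show ?thesis using Gi[OF that] G(3)[OF that] by (intro exI[of _ "G y"]) auto
    qed
  qed
  then show ?thesis by (intro eqpI[of ?H]) simp_all
qed

lemma cantor: "~ lep (Pw a) a"
proof
  assume "lep (Pw a) a"
  then obtain F where F: "dF F" "inj_on F (ext (Pw a))" "!!x. x <: Pw a ==> F x <: a" by (rule lepE) blast
  note [simp] = dt1[where F=F, OF F(1)]
  define D where "D = Sep a (%z. EX y. sub y a & z = F y & ~ z <: y)"
  have D: "z <: D \<longleftrightarrow> z <: a & (EX y. sub y a & z = F y & ~ z <: y)" for z unfolding D_def by simp
  have "sub D a" unfolding sub_def D by blast
  then have 1: "F D <: a" and 2: "!!y. sub y a ==> F D = F y ==> y = D"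
    using F(2,3) unfolding inj_ext by auto
  show False
  proof (cases "F D <: D")
    case True
    then obtain y where h: "sub y a" "F D = F y" "~ F D <: y" using D[of "F D"] by auto
    have "y = D" by (rule 2[OF h(1,2)])
    then show False using h(3) True by blast
  next
    case False
    with 1 \<open>sub D a\<close> show False using D[of "F D"] by auto
  qed
qed

subsection \<open>Cardinals\<close>

definition Card :: "'v => bool" where "Card k \<longleftrightarrow> Ord k & (ALL a. a <: k --> ~ eqp a k)"
lemma dp_Card [simp]: "dt a ==> dp (%e. Card (a e))" by (rule dp1[where P=Card], unfold Card_def) simp_all
definition card :: "'v => 'v" where "card a = lst (%\<alpha>. eqp \<alpha> a)"
lemma dt_card [simp]: "dt a ==> dt (%e. card (a e))" by (rule dt1[where F=card], unfold card_def) simp_all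

lemma ex_Ord_eqp: "EX \<alpha>. Ord \<alpha> & eqp \<alpha> A"
proof -
  obtain C where C: "dF C" "ALL y. y <: Pw A & (EX z. z <: y) --> C y <: y" using AC by blast
  have "C y <: y" if "sub y A" "y ~= emp" for y
  proof -
    have "EX z. z <: y" using that(2) set_ext[of y emp] by auto
    then show ?thesis using that(1) C(2) by simp
  qed
  from enumeration[OF C(1) this] obtain F \<alpha> where "Ord \<alpha>" "dF F" "bij_betw F (ext \<alpha>) (ext A)" .
  then show ?thesis using eqpI by blast
qed

lemma card_eqp: "eqp (card a) a" and Card_card [simp]: "Card (card a)"
proof -
  obtain \<alpha> where \<alpha>: "Ord \<alpha>" "eqp \<alpha> a" using ex_Ord_eqp by blast
  note l = lst[of "%\<alpha>. eqp \<alpha> a", OF _ \<alpha>, simplified, folded card_def]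
  show "eqp (card a) a" by (rule l)
  show "Card (card a)" unfolding Card_def using l eqp_trans by blast
qed

lemma Card_Ord: "Card k ==> Ord k" unfolding Card_def by blast
lemma Ord_card [simp]: "Ord (card a)" using Card_card Card_Ord by blast

lemma Card_lep_sub: assumes "Card k" "Ord l" "lep k l" shows "sub k l"
proof (rule ccontr)
  assume "~ sub k l"
  then have "l <: k" using Ord_linear[of k l] Ord_sub[of k l] assms Card_Ord by blast
  then have "sub l k" using Ord_trans[OF Card_Ord[OF assms(1)]] unfolding sub_def by blast
  then have "eqp l k" by (rule lep_antisym[OF sub_lep assms(3)])
  then show False using assms(1) \<open>l <: k\<close> unfolding Card_def by blast
qed

lemma Card_eqI: "Card k ==> Card l ==> eqp k l ==> k = l"
  by (rule sub_antisym) (blast intro: Card_lep_sub Card_Ord eqp_lep eqp_sym)+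
lemma card_unique: assumes "Card k" "eqp a k" shows "k = card a"
  by (rule Card_eqI[OF assms(1) Card_card eqp_trans[OF eqp_sym[OF assms(2)] eqp_sym[OF card_eqp]]])
lemma card_lep: "lep a b \<longleftrightarrow> sub (card a) (card b)"
proof
  assume "lep a b"
  then have "lep (card a) (card b)"
    by (rule lep_trans[OF eqp_lep[OF card_eqp] lep_trans[OF _ eqp_lep[OF eqp_sym[OF card_eqp]]]])
  then show "sub (card a) (card b)" by (rule Card_lep_sub[rotated 2]) simp_all
next
  assume "sub (card a) (card b)"
  then have "lep (card a) (card b)" by (rule sub_lep)
  then show "lep a b"
    by (rule lep_trans[OF eqp_lep[OF eqp_sym[OF card_eqp]] lep_trans[OF _ eqp_lep[OF card_eqp]]])
qed
lemma lep_total: "lep a b | lep b a"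
  using Ord_linear[of "card a" "card b"] unfolding card_lep by (auto simp: Ord_sub)
lemma card_mem: "Ord a ==> sub (card a) a"
  using Card_lep_sub[of "card a" a] card_eqp eqp_lep by simp
lemma Card_card_eq: "Card k ==> card k = k" using card_unique[of k k] by simp
lemma lep_Card: "Card k ==> lep a k \<longleftrightarrow> sub (card a) k" using card_lep[of a k] Card_card_eq by simp
lemma less_Card: assumes "Card k" "a <: k" shows "card a <: k"
proof -
  have "Ord a" "Ord k" using assms Card_Ord Ord_mem by blast+
  then have "sub (card a) a" by (rule_tac card_mem)
  then show ?thesis using assms \<open>Ord a\<close> \<open>Ord k\<close> Ord_sub[of "card a" a] Ord_trans[of k a "card a"] by auto
qed
lemma not_lep_less: "Card k ==> a <: k ==> ~ lep k a"
  using Card_lep_sub[of k a] Card_Ord[of k] Ord_mem[of k a] subD[of k a a] by auto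

end

context zfc
begin

subsection \<open>Finite sets\<close>

lemma not_lep_suc: "n <: om ==> ~ lep (suc n) n"
proof (induction rule: om_induct)
  case emp
  show ?case by (auto simp: lep_def Func_def)
next
  case (suc n)
  show ?case
  proof
    assume "lep (suc (suc n)) (suc n)"
    then obtain F where F: "dF F" "inj_on F (ext (suc (suc n)))" "!!x. x <: suc (suc n) ==> F x <: suc n" by (rule lepE) blast
    note [simp] = dt1[where F=F, OF F(1)]
    have i: "F x = F y ==> x = y" if "x <: suc (suc n)" "y <: suc (suc n)" for x y
      using F(2) that unfolding inj_ext by blast
    have ne: "x ~= suc n" if "x <: suc n" for x using that not_mem_self[of "suc n"] by blast
    \<comment> \<open>Remove the last point \<open>suc n\<close> from the domain and
      \<open>n\<close> from the range; the point sent to \<open>n\<close> inherits the image of the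
      removed one.\<close>
    let ?G = "%x. if F x = n then F (suc n) else F x"
    have "lep (suc n) n"
    proof (rule lepI[of ?G])
      show "inj_on ?G (ext (suc n))" unfolding inj_ext
      proof (intro allI impI)
        fix x y assume xy: "x <: suc n" "y <: suc n" "?G x = ?G y"
        then have m: "x <: suc (suc n)" "y <: suc (suc n)" "suc n <: suc (suc n)" by auto
        show "x = y"
          using xy(3) i[OF m(1,2)] i[OF m(1,3)] i[OF m(2,3)] ne[OF xy(1)] ne[OF xy(2)] by (auto split: if_splits)
      qed
      fix x assume x: "x <: suc n"
      then have m: "x <: suc (suc n)" "suc n <: suc (suc n)" by auto
      have "F x <: suc n" "F (suc n) <: suc n" using F(3) m by blast+
      then show "?G x <: n" using i[OF m] ne[OF x] by auto
    qed simp
    then show False using suc by blast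
  qed
qed simp

lemma Card_om_le: assumes "Ord k" "sub k om" shows "Card k"
  unfolding Card_def
proof (intro conjI allI impI notI)
  fix a assume a: "a <: k" "eqp a k"
  then have "a <: om" using assms(2) subD by blast
  have "lep (suc a) k" by (rule sub_lep[OF Ord_suc_sub[OF assms(1) a(1)]])
  then have "lep (suc a) a" by (rule lep_trans[OF _ eqp_lep[OF eqp_sym[OF a(2)]]])
  then show False using not_lep_suc[OF \<open>a <: om\<close>] by blast
qed (rule assms)

lemma Card_om [simp]: "Card om" by (rule Card_om_le) simp_all
lemma Card_nat: assumes "n <: om" shows "Card n"
  by (rule Card_om_le[OF Ord_om_mem[OF assms]]) (rule subI, rule om_memD[OF assms])

definition Fin :: "'v => bool" where "Fin a \<longleftrightarrow> (EX n. n <: om & eqp a n)"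
lemma dp_Fin [simp]: "dt a ==> dp (%e. Fin (a e))" by (rule dp1[where P=Fin], unfold Fin_def) simp_all

lemma Fin_card: "Fin a \<longleftrightarrow> card a <: om"
proof
  assume "Fin a"
  then obtain n where "n <: om" "eqp a n" unfolding Fin_def by blast
  then show "card a <: om" using card_unique[OF Card_nat] by blast
next
  assume "card a <: om"
  then show "Fin a" unfolding Fin_def using card_eqp eqp_sym by blast
qed
lemma Fin_lep: assumes "Fin b" "lep a b" shows "Fin a"
proof -
  have "sub (card a) (card b)" "card b <: om" using assms unfolding card_lep Fin_card by blast+
  then show ?thesis unfolding Fin_card using Ord_sub[of "card a" "card b"] om_memD by auto
qed
lemma Fin_sub: "Fin b ==> sub a b ==> Fin a" using Fin_lep sub_lep by blast
lemma Fin_nat: "n <: om ==> Fin n" unfolding Fin_def using eqp_refl by blast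
lemma Fin_emp [simp]: "Fin emp" by (rule Fin_nat) simp
lemma not_Fin: "~ Fin a \<longleftrightarrow> lep om a"
proof -
  have "~ card a <: om \<longleftrightarrow> sub om (card a)" by (rule Ord_not_mem) simp_all
  then show ?thesis unfolding Fin_card card_lep using Card_card_eq[OF Card_om] by simp
qed
lemma Fin_ctb: "Fin a ==> lep a om"
  using not_Fin lep_total by blast
lemma not_Fin_om: "~ Fin om" unfolding not_Fin by simp

lemma Fin_ins: assumes "Fin a" shows "Fin (cup a (sg x))"
proof -
  obtain n where n: "n <: om" "eqp a n" using assms unfolding Fin_def by blast
  obtain F where F: "dF F" "bij_betw F (ext a) (ext n)" using n(2) by (rule eqpE)
  note [simp] = dt1[where F=F, OF F(1)]
  have "lep (cup a (sg x)) (suc n)"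
    by (rule lepI[of "%z. if z <: a then F z else n"])
      (use F(2) in \<open>auto simp: bij_ext inj_ext\<close>)
  then show ?thesis using Fin_lep[OF Fin_nat[OF suc_om[OF n(1)]]] by blast
qed

lemma Fin_induct [consumes 1, case_names dp emp ins]:
  assumes "Fin a" and Q: "dP Q" "Q emp" "!!a x. Fin a ==> ~ x <: a ==> Q a ==> Q (cup a (sg x))"
  shows "Q a"
proof -
  note [simp] = dp1[where P=Q, OF Q(1)]
  have "ALL a. eqp a n --> Q a" if "n <: om" for n
    using that
  proof (induction rule: om_induct)
    case emp
    have "a = emp" if ae: "eqp a emp" for a
    proof (rule set_ext)
      obtain F where "dF F" "bij_betw F (ext a) (ext emp)" using ae by (rule eqpE)
      then show "z <: a \<longleftrightarrow> z <: emp" for z unfolding bij_ext by auto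
    qed
    then show ?case using Q(2) by blast
  next
    case (suc n)
    show ?case
    proof (intro allI impI)
      fix a assume "eqp a (suc n)"
      then obtain F where F: "dF F" "bij_betw F (ext a) (ext (suc n))" by (rule eqpE)
      then obtain x where x: "x <: a" "F x = n" unfolding bij_ext by auto
      have "bij_betw F (ext (diff a (sg x))) (ext n)"
        unfolding bij_ext inj_ext
      proof (intro conjI allI impI)
        show "y = z" if "y <: diff a (sg x)" "z <: diff a (sg x)" "F y = F z" for y z
          using that F(2) unfolding bij_ext inj_ext by simp
        show "F y <: n" if "y <: diff a (sg x)" for y
          using that F(2) x unfolding bij_ext inj_ext by auto
        show "EX y. y <: diff a (sg x) & F y = m" if m: "m <: n" for m
        proof -
          obtain y where "y <: a" "F y = m" using F(2) m unfolding bij_ext by auto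
          moreover have "y ~= x" using calculation x m by auto
          ultimately show ?thesis by auto
        qed
      qed
      then have e: "eqp (diff a (sg x)) n" by (rule eqpI[OF F(1)])
      then have "Q (diff a (sg x))" "Fin (diff a (sg x))" using suc unfolding Fin_def by blast+
      then have "Q (cup (diff a (sg x)) (sg x))" by (intro Q(3)) auto
      moreover have "cup (diff a (sg x)) (sg x) = a" by (rule set_ext) (use x in auto)
      ultimately show "Q a" by simp
    qed
  qed simp
  then show ?thesis using assms(1) unfolding Fin_def by blast
qed

lemma mem_ne: "x <: a ==> a ~= emp" by auto
lemma cup_emp [simp]: "cup emp a = a" "cup a emp = a" by (rule set_ext, simp)+
lemma cup_Ord: assumes "Ord a" "Ord b" shows "cup a b = a | cup a b = b"
proof -
  have "sub a b | sub b a" using Ord_linear[OF assms] Ord_sub[OF assms] Ord_sub[OF assms(2,1)] by blast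
  moreover have "cup a b = b" if "sub a b" by (rule set_ext) (use subD[OF that] in auto)
  moreover have "cup a b = a" if "sub b a" by (rule set_ext) (use subD[OF that] in auto)
  ultimately show ?thesis by blast
qed

lemma Fin_cup: assumes "Fin a" "Fin b" shows "Fin (cup a b)"
  using assms(1)
proof (induction rule: Fin_induct)
  case (ins a x)
  have "cup (cup a (sg x)) b = cup (cup a b) (sg x)" by (rule set_ext) auto
  then show ?case using Fin_ins[OF ins(3)] by simp
qed (simp_all add: assms)
lemma Fin_sg [simp]: "Fin (sg x)" using Fin_ins[OF Fin_emp] by simp
lemma Fin_upr [simp]: "Fin (upr x y)"
proof -
  have "upr x y = cup (sg x) (sg y)" by (rule set_ext) auto
  then show ?thesis using Fin_cup[OF Fin_sg Fin_sg] by simp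
qed
lemma Rep_lep: assumes "dF F" shows "lep (Rep a F) a"
  by (rule surj_lep[OF assms]) (use assms in auto)
lemma Fin_Rep: "Fin a ==> dF F ==> Fin (Rep a F)" using Fin_lep Rep_lep by blast
lemma Fin_Uni: assumes "Fin A" "!!x. x <: A ==> Fin x" shows "Fin (Uni A)"
proof -
  have "(ALL x. x <: A --> Fin x) --> Fin (Uni A)" using assms(1)
  proof (induction rule: Fin_induct)
    case emp
    have "Uni emp = emp" by (rule set_ext) simp
    then show ?case by simp
  next
    case (ins a x)
    have "Uni (cup a (sg x)) = cup (Uni a) x" by (rule set_ext) auto
    then show ?case using ins Fin_cup by simp
  qed simp
  then show ?thesis using assms(2) by blast
qed
lemma Fin_prd: assumes "Fin a" "Fin b" shows "Fin (prd a b)"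
proof -
  have "prd a b = Uni (Rep a (%x. Rep b (pr x)))" by (rule set_ext) (auto simp: mem_prd)
  then show ?thesis using assms by (auto intro!: Fin_Uni Fin_Rep)
qed
lemma Fin_bounded: assumes "Fin a" "sub a g" "Lim g" shows "EX b. b <: g & (ALL x. x <: a --> x <: b)"
proof -
  have "sub a g --> (EX b. b <: g & (ALL x. x <: a --> x <: b))" using assms(1)
  proof (induction rule: Fin_induct)
    case emp
    have "EX b. b <: g" using assms(3) set_ext[of g emp] unfolding Lim_def by auto
    then show ?case by auto
  next
    case (ins a x)
    show ?case
    proof
      assume s: "sub (cup a (sg x)) g"
      then have "sub a g" "x <: g" unfolding sub_def by auto
      then obtain b where b: "b <: g" "ALL x. x <: a --> x <: b" using ins by blast
      obtain c where c: "c <: g" "x <: c" using \<open>x <: g\<close> assms(3) unfolding Lim_def by blast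
      have g: "Ord g" using assms(3) unfolding Lim_def by blast
      have o: "Ord b" "Ord c" using Ord_mem[OF g] b c by blast+
      from Ord_linear[OF this] show "EX b. b <: g & (ALL y. y <: cup a (sg x) --> y <: b)"
      proof (elim disjE)
        assume "b <: c" then show ?thesis using b c Ord_trans[OF o(2)] by (intro exI[of _ c]) auto
      next
        assume "b = c" then show ?thesis using b c by (intro exI[of _ c]) auto
      next
        assume "c <: b" then show ?thesis using b c Ord_trans[OF o(1)] by (intro exI[of _ b]) auto
      qed
    qed
  qed simp
  then show ?thesis using assms by blast
qed

subsection \<open>Cardinal arithmetic\<close>

lemma lep_prd: assumes "lep a c" "lep b d" shows "lep (prd a b) (prd c d)"
proof -
  obtain F where F: "dF F" "inj_on F (ext a)" "!!x. x <: a ==> F x <: c" using assms(1) by (rule lepE) blast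
  obtain G where G: "dF G" "inj_on G (ext b)" "!!x. x <: b ==> G x <: d" using assms(2) by (rule lepE) blast
  note [simp] = dt1[where F=F, OF F(1)] dt1[where F=G, OF G(1)]
  show ?thesis
    by (rule lepI[of "%z. pr (F (fs z)) (G (sn z))"])
      (use F G in \<open>auto simp: inj_ext mem_prd\<close>)
qed

text \<open>Hessenberg's theorem. Enumerate k \<times> k, always choosing a remaining pair with
  least maximum. If the enumeration went beyond k, the pairs listed before stage k would all lie in
  m \<times> m for some m of smaller cardinality, against the induction hypothesis or, for finite m,
  against the infinity of k.\<close>

lemma prd_lep_aux: "Card k --> sub om k --> lep (prd k k) k"
proof (induction k rule: mem_induct)
  case (step k)
  show ?case
  proof (intro impI)
    assume k: "Card k" "sub om k"
    then have ok: "Ord k" by (rule_tac Card_Ord)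
    define M where "M y = lst (%m. EX a b. pr a b <: y & m = cup a b)" for y
    have [simp]: "dt t ==> dt (%e. M (t e))" for t by (rule dt1[where F=M], unfold M_def) simp_all
    obtain C0 where C0: "dF C0" "ALL y. y <: Pw (prd k k) & (EX z. z <: y) --> C0 y <: y" using AC by blast
    note [simp] = dt1[where F=C0, OF C0(1)]
    define C where "C y = C0 (Sep y (%z. EX a b. z = pr a b & cup a b = M y))" for y
    have dC: "dF C" unfolding C_def by simp
    have M: "Ord (M y) & (EX a b. pr a b <: y & M y = cup a b) & (ALL a b. pr a b <: y --> sub (M y) (cup a b))"
      if yk: "sub y (prd k k)" "y ~= emp" for y
    proof -
      have oc: "Ord (cup a b)" if "pr a b <: y" for a b
        using subD[OF \<open>sub y (prd k k)\<close> that] Ord_mem[OF ok] by (intro Ord_cup) auto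
      obtain z where "z <: y" using yk(2) set_ext[of y emp] by auto
      with yk(1) obtain a b where ab: "pr a b <: y" using subD[of y "prd k k" z] by (auto simp: mem_prd)
      have "EX a' b'. pr a' b' <: y & cup a b = cup a' b'" using ab by blast
      note l = lst[of "%m. EX a b. pr a b <: y & m = cup a b", OF _ oc[OF ab] this, folded M_def]
      have 1: "Ord (M y)" "EX a b. pr a b <: y & M y = cup a b" by (rule l(1), simp) (rule l(2), simp)
      have "sub (M y) (cup a b)" if "pr a b <: y" for a b
        unfolding M_def using that oc[OF that] by (intro lst_sub) auto
      then show ?thesis using 1 by blast
    qed
    have C: "EX a b. C y = pr a b & pr a b <: y & cup a b = M y" if "sub y (prd k k)" "y ~= emp" for y
    proof -
      let ?S = "Sep y (%z. EX a b. z = pr a b & cup a b = M y)"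
      have "EX z. z <: ?S" using M[OF that] by auto
      moreover have "?S <: Pw (prd k k)" using that(1) by (auto simp: sub_def)
      ultimately have "C y <: ?S" unfolding C_def using C0(2) by blast
      then show ?thesis by auto
    qed
    have C': "C y <: y" if "sub y (prd k k)" "y ~= emp" for y using C[OF that] by auto
    obtain F \<alpha> where F: "Ord \<alpha>" "dF F" "bij_betw F (ext \<alpha>) (ext (prd k k))"
      "!!\<beta>. \<beta> <: \<alpha> ==> F \<beta> = C (diff (prd k k) (Rep \<beta> F))"
      by (rule enumeration[where A="prd k k", OF dC], rule C', assumption, assumption, rule that)
    have "sub \<alpha> k"
    proof (rule ccontr)
      assume "~ sub \<alpha> k"
      then have "k <: \<alpha>" using Ord_not_mem[OF ok F(1)] by blast
      then have "F k <: prd k k" using F(3) unfolding bij_ext by blast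
      then obtain a b where ab: "F k = pr a b" "a <: k" "b <: k" by (auto simp: mem_prd)
      have o: "Ord a" "Ord b" using ab Ord_mem[OF ok] by blast+
      define m where "m = suc (cup a b)"
      have Fb: "F \<beta> <: prd m m" if "\<beta> <: k" for \<beta>
      proof -
        have ba: "\<beta> <: \<alpha>" using Ord_trans[OF F(1) \<open>k <: \<alpha>\<close> that] .
        let ?D = "diff (prd k k) (Rep \<beta> F)"
        have "F k ~= F \<gamma>" if "\<gamma> <: \<beta>" for \<gamma>
        proof -
          have "\<gamma> <: k" using Ord_trans[OF ok \<open>\<beta> <: k\<close> that] .
          then have "\<gamma> <: \<alpha>" "\<gamma> ~= k" using Ord_trans[OF F(1) \<open>k <: \<alpha>\<close>] not_mem_self by blast+
          then show ?thesis using F(3) \<open>k <: \<alpha>\<close> unfolding bij_ext inj_ext by metis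
        qed
        then have D: "F k <: ?D" using \<open>F k <: prd k k\<close> F(2) by auto
        have D2: "sub ?D (prd k k)" "?D ~= emp"
          by (simp add: sub_def) (rule mem_ne[OF D])
        obtain c d where cd: "F \<beta> = pr c d" "pr c d <: ?D" "cup c d = M ?D" using C[OF D2] F(4)[OF ba] by auto
        have "sub (cup c d) (cup a b)" using M[OF D2] D ab cd by auto
        moreover have "Ord c" "Ord d" using cd Ord_mem[OF ok] by auto
        ultimately have "sub c (cup a b)" "sub d (cup a b)" by (auto simp: sub_def)
        then show ?thesis using cd \<open>Ord c\<close> \<open>Ord d\<close> Ord_cup[OF o] Ord_sub[of _ "cup a b"] unfolding m_def by auto
      qed
      have "lep k (prd m m)"
        by (rule lepI[OF F(2)]) (use F(3) Fb Ord_trans[OF F(1) \<open>k <: \<alpha>\<close>] in \<open>auto simp: bij_ext inj_ext\<close>)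
      have "cup a b <: k" using cup_Ord[OF o] ab by auto
      have Om: "Ord m" unfolding m_def using o by (simp add: Ord_cup)
      show False
      proof (cases "Fin m")
        case True
        then have "Fin (prd m m)" by (intro Fin_prd)
        then have "Fin k" using Fin_lep \<open>lep k (prd m m)\<close> by blast
        then show False using Fin_sub k(2) not_Fin_om by blast
      next
        case False
        \<comment> \<open>Hilbert's hotel: one more point does not enlarge an infinite ordinal, so
          the cardinality of \<open>m\<close> stays below \<open>k\<close>.\<close>
        have "lep (suc (cup a b)) (cup a b)"
        proof -
          have "lep om (cup a b)"
            using False Fin_ins[of "cup a b" "cup a b"] unfolding m_def suc_def not_Fin[symmetric] by blast
          then have oc: "sub om (cup a b)" using Card_lep_sub[OF Card_om Ord_cup[OF o]] by blast
          let ?G = "%z. if z = cup a b then emp else if z <: om then suc z else z"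
          show ?thesis
            by (rule lepI[of ?G]) (use oc in \<open>auto simp: inj_ext sub_def\<close>)
        qed
        then have mk: "lep m (cup a b)" unfolding m_def .
        let ?c = "card m"
        have "?c <: k"
        proof -
          have "sub ?c (card (cup a b))" using mk unfolding card_lep .
          moreover have "card (cup a b) <: k" using less_Card[OF k(1) \<open>cup a b <: k\<close>] .
          ultimately show ?thesis using Ord_sub[of ?c "card (cup a b)"] Ord_trans[OF ok] by auto
        qed
        moreover have "sub om ?c" using False Card_card_eq[OF Card_om] unfolding not_Fin card_lep by simp
        ultimately have "lep (prd ?c ?c) ?c" using step[of ?c] by simp
        moreover have "lep (prd m m) (prd ?c ?c)" using card_eqp eqp_sym eqp_lep lep_prd by blast
        ultimately have "lep k ?c" using \<open>lep k (prd m m)\<close> lep_trans by blast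
        then show False using not_lep_less[OF k(1) \<open>?c <: k\<close>] by blast
      qed
    qed
    then have "lep \<alpha> k" by (rule sub_lep)
    moreover have "lep (prd k k) \<alpha>" using eqp_lep eqp_sym eqpI[OF F(2,3)] by blast
    ultimately show "lep (prd k k) k" using lep_trans by blast
  qed
qed simp

definition Inf :: "'v => bool" where "Inf k \<longleftrightarrow> Card k & sub om k"
lemma Inf_om [simp]: "Inf om" unfolding Inf_def by simp
lemma InfD: "Inf k ==> Card k" "Inf k ==> Ord k" "Inf k ==> sub om k" unfolding Inf_def by (auto simp: Card_Ord)
lemma prd_lep: "Inf k ==> lep a k ==> lep b k ==> lep (prd a b) k"
  using prd_lep_aux[of k] lep_prd[of a k b k] lep_trans[of "prd a b" "prd k k" k] unfolding Inf_def by blast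

text \<open>A member of the union is coded by the index of one chosen set containing it and by its
  place there. The injections into \<open>k\<close> that give these places have to be chosen
  simultaneously, out of the sets \<open>J x\<close>.\<close>

lemma Uni_lep:
  assumes k: "Inf k" "lep A k" and "dF F" "!!x. x <: A ==> lep (F x) k"
  shows "lep (Uni (Rep A F)) k"
proof -
  note [simp] = dt1[where F=F, OF assms(3)]
  obtain I where I: "dF I" "inj_on I (ext A)" "!!x. x <: A ==> I x <: k" using k(2) by (rule lepE) blast
  note [simp] = dt1[where F=I, OF I(1)]
  define J where "J x = Sep (funsp (F x) k) (%f. ALL u v. u <: F x --> v <: F x --> app f u = app f v --> u = v)" for x
  have [simp]: "dt t ==> dt (%e. J (t e))" for t by (rule dt1[where F=J], unfold J_def) simp_all
  have J: "f <: J x \<longleftrightarrow> Func f (F x) k & (ALL u v. u <: F x --> v <: F x --> app f u = app f v --> u = v)" for f x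
    unfolding J_def by simp
  obtain C where C: "dF C" "ALL y. y <: Rep A J & (EX z. z <: y) --> C y <: y" using AC by blast
  obtain D where D: "dF D" "ALL y. y <: Pw A & (EX z. z <: y) --> D y <: y" using AC by blast
  note [simp] = dt1[where F=C, OF C(1)] dt1[where F=D, OF D(1)]
  have CJ: "C (J x) <: J x" if "x <: A" for x
  proof -
    have "EX f. f <: J x" using assms(4)[OF that] unfolding lep_def J .
    then show ?thesis using C(2) RepI[of J x A] that by auto
  qed
  define X where "X z = D (Sep A (%x. z <: F x))" for z
  have [simp]: "dt t ==> dt (%e. X (t e))" for t by (rule dt1[where F=X], unfold X_def) simp_all
  have X: "X z <: A & z <: F (X z)" if "z <: Uni (Rep A F)" for z
    using that D(2)[rule_format, of "Sep A (%x. z <: F x)"] unfolding X_def by (auto simp: sub_def)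
  have "lep (Uni (Rep A F)) (prd k k)"
  proof (rule lepI[of "%z. pr (I (X z)) (app (C (J (X z))) z)"])
    show "inj_on (%z. pr (I (X z)) (app (C (J (X z))) z)) (ext (Uni (Rep A F)))" unfolding inj_ext
    proof (intro allI impI)
      fix y z assume yz: "y <: Uni (Rep A F)" "z <: Uni (Rep A F)"
        "pr (I (X y)) (app (C (J (X y))) y) = pr (I (X z)) (app (C (J (X z))) z)"
      note Xy = X[OF yz(1)] and Xz = X[OF yz(2)]
      have "X y = X z" using yz(3) Xy Xz I(2) unfolding inj_ext by auto
      then show "y = z" using yz(3) CJ[of "X z"] Xy Xz unfolding J by auto
    qed
    fix z assume "z <: Uni (Rep A F)"
    note Xz = X[OF this]
    then show "pr (I (X z)) (app (C (J (X z))) z) <: prd k k"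
      using I(3) CJ[of "X z"] Func_app unfolding J by auto
  qed simp
  then show ?thesis using prd_lep[OF k(1) lep_refl lep_refl] lep_trans by blast
qed

lemma Inf_Fin: "Inf k ==> Fin a ==> lep a k"
  using Fin_ctb[of a] sub_lep[OF InfD(3), of k] lep_trans by blast

lemma cup_lep: assumes "Inf k" "lep a k" "lep b k" shows "lep (cup a b) k"
proof -
  have "cup a b = Uni (Rep (upr a b) (%x. x))" by (rule set_ext) auto
  then show ?thesis using Uni_lep[of k "upr a b" "%x. x"] assms Inf_Fin[OF assms(1) Fin_upr] by auto
qed

section \<open>Successor cardinals and countable subsets\<close>

definition csuc :: "'v => 'v" where "csuc k = lst (%a. ~ lep a k)"
lemma csuc: "Ord (csuc k)" "~ lep (csuc k) k" "a <: csuc k ==> lep a k"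
proof -
  have "~ lep (card (Pw k)) k" using cantor[of k] card_eqp[of "Pw k"] eqp_lep eqp_sym lep_trans by blast
  note l = lst[of "%a. ~ lep a k", OF _ Ord_card this, folded csuc_def, simplified]
  show "Ord (csuc k)" "~ lep (csuc k) k" "a <: csuc k ==> lep a k" using l by blast+
qed
lemma Card_csuc [simp]: "Card (csuc k)"
  unfolding Card_def using csuc(1,2) csuc(3)[of _ k] eqp_lep eqp_sym lep_trans by blast
lemma csuc_mem: assumes "Ord k" shows "k <: csuc k"
proof (rule ccontr)
  assume "~ k <: csuc k"
  then have "sub (csuc k) k" using Ord_not_mem[OF assms csuc(1)] by blast
  then show False using sub_lep csuc(2) by blast
qed
lemma csuc_le: assumes "Card k" "c <: k" shows "sub (csuc c) k"
proof (rule ccontr)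
  assume "~ sub (csuc c) k"
  then have "k <: csuc c" using Ord_not_mem[OF Card_Ord[OF assms(1)] csuc(1)] by blast
  then have "lep k c" by (rule csuc(3))
  then show False using not_lep_less assms by blast
qed
lemma Inf_csuc: assumes "Inf k" shows "Inf (csuc k)"
proof -
  have "sub k (csuc k)" using csuc_mem[OF InfD(2)[OF assms]] Ord_sub[OF InfD(2)[OF assms] csuc(1)] by blast
  then show ?thesis using InfD(3)[OF assms] sub_trans unfolding Inf_def by simp
qed
lemma succ_card_iff: assumes "Card k"
  shows "Card l & k <: l & (ALL c. c <: l & Card c --> sub c k) \<longleftrightarrow> l = csuc k"
proof
  assume l: "Card l & k <: l & (ALL c. c <: l & Card c --> sub c k)"
  have "~ csuc k <: l"
  proof
    assume "csuc k <: l"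
    then have "sub (csuc k) k" using l by simp
    then show False using sub_lep csuc(2) by blast
  qed
  moreover have "sub (csuc k) l" using csuc_le l by blast
  ultimately show "l = csuc k" using Ord_sub[OF csuc(1) Card_Ord] l by blast
next
  assume "l = csuc k"
  moreover have "sub c k" if "c <: csuc k" "Card c" for c
    using csuc(3)[OF that(1)] Card_lep_sub[OF that(2) Card_Ord[OF assms]] by blast
  ultimately show "Card l & k <: l & (ALL c. c <: l & Card c --> sub c k)"
    using csuc_mem[OF Card_Ord[OF assms]] by auto
qed

definition w1 :: 'v where "w1 = csuc om"
lemma Inf_w1 [simp]: "Inf w1" unfolding w1_def by (rule Inf_csuc) simp
lemma w1_props: "Card w1" "Ord w1" "om <: w1" "a <: w1 ==> lep a om" "~ lep w1 om"
  unfolding w1_def using csuc(1,2)[of om] csuc(3)[of a om] csuc_mem[OF Ord_om] by simp_all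

text \<open>Uncountable cofinality, in the form in which it is used for \<mu> and for
  \<open>w1\<close>: countable subsets are bounded.\<close>

definition ctbbd :: "'v => bool" where
  "ctbbd k \<longleftrightarrow> Inf k & (ALL a. sub a k --> lep a om --> (EX b. b <: k & sub a b))"

lemma ctbbd_w1: "ctbbd w1"
proof -
  have "EX b. b <: w1 & sub a b" if a: "sub a w1" "lep a om" for a
  proof -
    have "lep (Uni (Rep a suc)) om"
    proof (rule Uni_lep[OF Inf_om a(2)])
      fix x assume "x <: a"
      then have "lep x om" using a(1) subD w1_props(4) by blast
      then show "lep (suc x) om" unfolding suc_def by (rule cup_lep[OF Inf_om _ Fin_ctb[OF Fin_sg]])
    qed simp
    moreover have o: "Ord (Uni (Rep a suc))"
    proof (rule Ord_Uni)
      fix x assume "x <: Rep a suc"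
      then obtain y where "y <: a" "x = suc y" by auto
      then show "Ord x" using a(1) subD Ord_mem[OF w1_props(2)] by auto
    qed
    moreover have "Uni (Rep a suc) <: w1"
      using Ord_not_mem[OF o w1_props(2)] calculation(1) w1_props(5) sub_lep lep_trans by blast
    moreover have "sub a (Uni (Rep a suc))" by (auto simp: sub_def)
    ultimately show ?thesis by blast
  qed
  then show ?thesis unfolding ctbbd_def by simp
qed

definition ctb :: "'v => 'v" where "ctb A = Sep (Pw A) (%x. lep x om)"
lemma mem_ctb [simp]: "x <: ctb A \<longleftrightarrow> sub x A & lep x om" unfolding ctb_def by simp
text \<open>As countable subsets of \<open>k\<close> are bounded, they are all contained in the
  union of the power sets of the ordinals below \<open>k\<close>; so it is enough to count bounded
  subsets.\<close>

lemma ctb_lep_aux: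
  assumes "ctbbd k" "lep A k" "lep (Uni (Rep k Pw)) k"
  shows "lep (ctb A) k"
proof -
  obtain F where F: "dF F" "inj_on F (ext A)" "!!x. x <: A ==> F x <: k" using assms(2) by (rule lepE) blast
  note [simp] = dt1[where F=F, OF F(1)]
  have "lep (ctb A) (Uni (Rep k Pw))"
  proof (rule lepI[of "%x. Rep x F"])
    show "inj_on (%x. Rep x F) (ext (ctb A))" unfolding inj_ext
    proof (intro allI impI set_ext)
      fix x y z assume xy: "x <: ctb A" "y <: ctb A" "Rep x F = Rep y F"
      have *: "z <: x \<longleftrightarrow> F z <: Rep x F" if "sub x A" "z <: A" for x z
        using that F(2) unfolding inj_ext by (auto simp: sub_def)
      have "~ z <: x & ~ z <: y" if "~ z <: A" using that xy by (auto simp: sub_def)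
      then show "z <: x \<longleftrightarrow> z <: y" using *[of x z] *[of y z] xy by auto
    qed
    fix x assume x: "x <: ctb A"
    have "sub (Rep x F) k" using x F(3) by (auto simp: sub_def)
    moreover have "lep (Rep x F) om" using x Rep_lep[OF F(1)] lep_trans by auto
    ultimately obtain b where "b <: k" "sub (Rep x F) b" using assms(1) unfolding ctbbd_def by blast
    then show "Rep x F <: Uni (Rep k Pw)" by auto
  qed simp
  then show ?thesis using assms(3) lep_trans by blast
qed

definition two :: 'v where "two = suc (suc emp)"
lemma mem_two [simp]: "x <: two \<longleftrightarrow> x = emp | x = suc emp" unfolding two_def by auto

lemma Pw_lep_funsp: "lep (Pw k) (funsp k two)"
proof (rule lepI[of "%x. lam k (%i. if i <: x then suc emp else emp)"])
  show "inj_on (%x. lam k (%i. if i <: x then suc emp else emp)) (ext (Pw k))"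
    unfolding inj_ext
  proof (intro allI impI set_ext)
    fix x y z assume xy: "x <: Pw k" "y <: Pw k"
      "lam k (%i. if i <: x then suc emp else emp) = lam k (%i. if i <: y then suc emp else emp)"
    then have "app (lam k (%i. if i <: x then suc emp else emp)) z = app (lam k (%i. if i <: y then suc emp else emp)) z"
      by simp
    then have "z <: k ==> z <: x \<longleftrightarrow> z <: y" by (simp split: if_splits)
    then show "z <: x \<longleftrightarrow> z <: y" using xy by (auto simp: sub_def)
  qed
qed (auto intro!: Func_lam)

lemma Pw_lep: assumes "lep a b" shows "lep (Pw a) (Pw b)"
proof -
  obtain F where F: "dF F" "inj_on F (ext a)" "!!x. x <: a ==> F x <: b" using assms by (rule lepE) blast
  note [simp] = dt1[where F=F, OF F(1)]
  show ?thesis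
  proof (rule lepI[of "%x. Rep x F"])
    show "inj_on (%x. Rep x F) (ext (Pw a))" unfolding inj_ext
    proof (intro allI impI set_ext)
      fix x y z assume xy: "x <: Pw a" "y <: Pw a" "Rep x F = Rep y F"
      have *: "z <: x \<longleftrightarrow> F z <: Rep x F" if "sub x a" "z <: a" for x z
        using that F(2) unfolding inj_ext by (auto simp: sub_def)
      have "~ z <: x & ~ z <: y" if "~ z <: a" using that xy by (auto simp: sub_def)
      then show "z <: x \<longleftrightarrow> z <: y" using *[of x z] *[of y z] xy by auto
    qed
  qed (use F(3) in \<open>auto simp: sub_def\<close>)
qed

text \<open>For \<alpha> below \<open>k\<close>, GCH bounds the power set of \<alpha> by the
  successor of an infinite cardinal below \<open>k\<close>, hence by \<open>k\<close>. The argument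
  covers singular \<open>k\<close>, and this is what keeps the family for \<Phi> small at every
  \<kappa>.\<close>

lemma bounded_subsets_lep:
  assumes gch: "!!k. Inf k ==> lep (Pw k) (csuc k)" and k: "Card k" "om <: k"
  shows "lep (Uni (Rep k Pw)) k"
proof -
  have ok: "Ord k" by (rule Card_Ord[OF k(1)])
  have ik: "Inf k" unfolding Inf_def using k Ord_sub[OF Ord_om ok] by blast
  show ?thesis
  proof (rule Uni_lep[OF ik lep_refl])
    fix \<alpha> assume a: "\<alpha> <: k"
    then have oa: "Ord \<alpha>" using Ord_mem[OF ok] by blast
    \<comment> \<open>GCH speaks of infinite cardinals, so a finite \<alpha> is enlarged to
      \<open>om\<close> first.\<close>
    define \<beta> where "\<beta> = cup \<alpha> om"
    have "\<beta> = \<alpha> | \<beta> = om" unfolding \<beta>_def by (rule cup_Ord[OF oa Ord_om])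
    then have b: "\<beta> <: k" using a k(2) by blast
    have "lep om \<beta>" unfolding \<beta>_def by (rule sub_lep) (auto simp: sub_def)
    then have ic: "Inf (card \<beta>)" unfolding Inf_def using card_lep[of om \<beta>] Card_card_eq[OF Card_om] by simp
    have "lep (Pw \<alpha>) (Pw \<beta>)" by (rule Pw_lep, rule sub_lep) (auto simp: sub_def \<beta>_def)
    moreover have "lep (Pw \<beta>) (Pw (card \<beta>))" by (rule Pw_lep[OF eqp_lep[OF eqp_sym[OF card_eqp]]])
    moreover have "lep (csuc (card \<beta>)) k" by (rule sub_lep[OF csuc_le[OF k(1) less_Card[OF k(1) b]]])
    ultimately show "lep (Pw \<alpha>) k" using gch[OF ic] lep_trans by blast
  qed simp
qed

end

section \<open>Evaluating formulas in a model\<close>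

lemma sat_pmem [simp]: "sat E e ((x \<^bold>\<in> y) n) \<longleftrightarrow> E (e x) (e y)" by (simp add: pmem_def)
lemma sat_peq [simp]: "sat E e ((x \<^bold>= y) n) \<longleftrightarrow> e x = e y" by (simp add: peq_def)
lemma sat_pneg [simp]: "sat E e ((\<^bold>\<not> A) n) \<longleftrightarrow> ~ sat E e (A n)" by (simp add: pneg_def)
lemma sat_pconj [simp]: "sat E e ((A \<^bold>\<and> B) n) \<longleftrightarrow> sat E e (A n) & sat E e (B n)" by (simp add: pconj_def)
lemma sat_pdisj [simp]: "sat E e ((A \<^bold>\<or> B) n) \<longleftrightarrow> sat E e (A n) | sat E e (B n)" by (simp add: pdisj_def)
lemma sat_pimp [simp]: "sat E e ((A \<^bold>\<longrightarrow> B) n) \<longleftrightarrow> (sat E e (A n) --> sat E e (B n))" by (simp add: pimp_def)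
lemma sat_piff [simp]: "sat E e ((A \<^bold>\<longleftrightarrow> B) n) \<longleftrightarrow> (sat E e (A n) \<longleftrightarrow> sat E e (B n))" by (simp add: piff_def) blast
lemma sat_pall [simp]: "sat E e (pall A n) \<longleftrightarrow> (ALL x. sat E (e(n := x)) (A n (Suc n)))" by (simp add: pall_def)
lemma sat_pex [simp]: "sat E e (pex A n) \<longleftrightarrow> (EX x. sat E (e(n := x)) (A n (Suc n)))" by (simp add: pex_def)

context zfc
begin

lemma sat_subset [simp]: "x < n ==> y < n ==> sat E e ((x \<^bold>\<subseteq> y) n) \<longleftrightarrow> sub (e x) (e y)"
  by (simp add: is_subset_def sub_def)
lemma eq_emp: "x = emp \<longleftrightarrow> (ALL z. ~ z <: x)" using set_ext[of x emp] by auto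
lemma sat_empty [simp]: "x < n ==> sat E e (is_empty x n) \<longleftrightarrow> e x = emp"
  by (simp add: is_empty_def eq_emp)
lemma eq_upr: "z = upr a b \<longleftrightarrow> (ALL w. w <: z \<longleftrightarrow> w = a | w = b)" using set_ext[of z "upr a b"] by auto
lemma sat_upair [simp]: "a < n ==> b < n ==> z < n ==> sat E e (is_upair a b z n) \<longleftrightarrow> e z = upr (e a) (e b)"
  by (simp add: is_upair_def eq_upr)
lemma sat_pair [simp]: "a < n ==> b < n ==> z < n ==> sat E e (is_pair a b z n) \<longleftrightarrow> e z = pr (e a) (e b)"
  by (simp add: is_pair_def pr_def eq_upr[of "e z"])
lemma sat_pair_in [simp]: "a < n ==> b < n ==> r < n ==> sat E e (pair_in a b r n) \<longleftrightarrow> pr (e a) (e b) <: e r"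
  by (simp add: pair_in_def)
lemma sat_triple [simp]: "a < n ==> b < n ==> c < n ==> z < n ==>
    sat E e (is_triple a b c z n) \<longleftrightarrow> e z = pr (e a) (pr (e b) (e c))"
  by (simp add: is_triple_def)
lemma sat_triple_in [simp]: "a < n ==> b < n ==> c < n ==> r < n ==>
    sat E e (triple_in a b c r n) \<longleftrightarrow> pr (e a) (pr (e b) (e c)) <: e r"
  by (simp add: triple_in_def)
lemma eq_suc: "y = suc x \<longleftrightarrow> (ALL z. z <: y \<longleftrightarrow> z <: x | z = x)" using set_ext[of y "suc x"] by auto
lemma sat_succ [simp]: "x < n ==> y < n ==> sat E e (is_succ x y n) \<longleftrightarrow> e y = suc (e x)"
  by (simp add: is_succ_def eq_suc)
lemma sat_two [simp]: "x < n ==> sat E e (is_two x n) \<longleftrightarrow> e x = two"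
  by (simp add: is_two_def two_def)
lemma sat_func [simp]: "f < n ==> a < n ==> b < n ==> sat E e (is_func f a b n) \<longleftrightarrow> Func (e f) (e a) (e b)"
  by (simp add: is_func_def Func_def Ex1_def)
lemma sat_inj [simp]: assumes "f < n" "a < n" "b < n"
  shows "sat E e (is_inj f a b n) \<longleftrightarrow> Func (e f) (e a) (e b) &
     (ALL x y. x <: e a --> y <: e a --> app (e f) x = app (e f) y --> x = y)"
proof -
  have "sat E e (is_inj f a b n) \<longleftrightarrow> Func (e f) (e a) (e b) & (ALL x x' y. pr x y <: e f & pr x' y <: e f --> x = x')"
    using assms by (simp add: is_inj_def)
  also have "... \<longleftrightarrow> Func (e f) (e a) (e b) & (ALL x y. x <: e a --> y <: e a --> app (e f) x = app (e f) y --> x = y)"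
    by (rule conj_cong[OF refl]) (auto simp: Func_pr)
  finally show ?thesis .
qed
lemma sat_bij [simp]: assumes "f < n" "a < n" "b < n"
  shows "sat E e (is_bij f a b n) \<longleftrightarrow> Func (e f) (e a) (e b) &
     (ALL x y. x <: e a --> y <: e a --> app (e f) x = app (e f) y --> x = y) & (ALL y. y <: e b --> (EX x. x <: e a & app (e f) x = y))"
proof -
  have "sat E e (is_bij f a b n) \<longleftrightarrow> (Func (e f) (e a) (e b) &
     (ALL x y. x <: e a --> y <: e a --> app (e f) x = app (e f) y --> x = y)) & (ALL y. y <: e b --> (EX x. pr x y <: e f))"
    using assms by (simp add: is_bij_def)
  also have "... \<longleftrightarrow> Func (e f) (e a) (e b) & (ALL x y. x <: e a --> y <: e a --> app (e f) x = app (e f) y --> x = y) &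
     (ALL y. y <: e b --> (EX x. x <: e a & app (e f) x = y))"
    unfolding conj_assoc by (rule conj_cong[OF refl]) (auto simp: Func_pr)
  finally show ?thesis .
qed
lemma sat_func_space [simp]: "a < n ==> b < n ==> s < n ==> sat E e (is_func_space a b s n) \<longleftrightarrow> e s = funsp (e a) (e b)"
proof -
  have "s = funsp a b \<longleftrightarrow> (ALL f. f <: s \<longleftrightarrow> Func f a b)" for s a b using set_ext[of s "funsp a b"] by auto
  then show "a < n ==> b < n ==> s < n ==> ?thesis" by (simp add: is_func_space_def)
qed
lemma sat_equipotent [simp]: "a < n ==> b < n ==> sat E e (equipotent a b n) \<longleftrightarrow> eqp (e a) (e b)"
  by (simp add: equipotent_def eqp_def)
lemma sat_transitive [simp]: "x < n ==> sat E e (is_transitive x n) \<longleftrightarrow> tran (e x)"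
  by (simp add: is_transitive_def tran_def sub_def)
lemma sat_Ord [simp]: "x < n ==> sat E e (is_Ord x n) \<longleftrightarrow> Ord (e x)"
  by (simp add: is_Ord_def Ord_def)
lemma sat_Limit [simp]: "x < n ==> sat E e (is_Limit x n) \<longleftrightarrow> Lim (e x)"
  by (simp add: is_Limit_def Lim_def)
lemma sat_omega [simp]: "x < n ==> sat E e (is_omega x n) \<longleftrightarrow> e x = om"
  by (simp add: is_omega_def omega_iff[symmetric])
lemma sat_Finite [simp]: "x < n ==> sat E e (is_Finite x n) \<longleftrightarrow> Fin (e x)"
  by (simp add: is_Finite_def Fin_def)
lemma sat_Countable [simp]: "x < n ==> sat E e (is_Countable x n) \<longleftrightarrow> lep (e x) om"
  by (simp add: is_Countable_def lep_def)
lemma sat_countably_infinite [simp]: "x < n ==> sat E e (is_countably_infinite x n) \<longleftrightarrow> eqp (e x) om"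
  by (simp add: is_countably_infinite_def)
lemma sat_Card [simp]: "x < n ==> sat E e (is_Card x n) \<longleftrightarrow> Card (e x)"
  by (simp add: is_Card_def Card_def)
lemma sat_InfCard [simp]: "x < n ==> sat E e (is_InfCard x n) \<longleftrightarrow> Inf (e x)"
  by (simp add: is_InfCard_def Inf_def)
lemma sat_has_card [simp]: "x < n ==> k < n ==> sat E e (has_card x k n) \<longleftrightarrow> Card (e k) & eqp (e x) (e k)"
  by (simp add: has_card_def)
lemma sat_succ_card [simp]: "k < n ==> l < n ==> sat E e (is_succ_card k l n) \<longleftrightarrow>
    Card (e l) & e k <: e l & (ALL c. c <: e l & Card c --> sub c (e k))"
  by (simp add: is_succ_card_def)
lemma sat_omega1 [simp]: "x < n ==> sat E e (is_omega1 x n) \<longleftrightarrow> e x = w1"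
  using succ_card_iff[OF Card_om, of "e x"] by (simp add: is_omega1_def w1_def)
lemma sat_two_power [simp]: "k < n ==> l < n ==> sat E e (is_two_power k l n) \<longleftrightarrow> Card (e l) & eqp (funsp (e k) two) (e l)"
  by (simp add: is_two_power_def)
lemma sat_continuum [simp]: "c < n ==> sat E e (is_continuum c n) \<longleftrightarrow> Card (e c) & eqp (funsp om two) (e c)"
  by (simp add: is_continuum_def)

lemma sat_GCH: assumes "sat E e (GCH n)" "Inf k" shows "lep (Pw k) (csuc k)"
proof -
  obtain l where l: "Card l & k <: l & (ALL c. c <: l & Card c --> sub c k)" "eqp (funsp k two) l"
    using assms by (auto simp: GCH_def)
  have "l = csuc k" using succ_card_iff[OF InfD(1)[OF assms(2)]] l(1) by blast
  then show ?thesis using lep_trans[OF Pw_lep_funsp eqp_lep[OF l(2)]] by simp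
qed

section \<open>Cofinal maps and regularity\<close>

definition cofm :: "'v => 'v => 'v => bool" where
  "cofm f d g \<longleftrightarrow> Func f d g & (ALL a. a <: g --> (EX x. x <: d & (a <: app f x | a = app f x)))"
lemma sat_cofinal_map [simp]: assumes "f < n" "d < n" "g < n"
  shows "sat E e (is_cofinal_map f d g n) \<longleftrightarrow> cofm (e f) (e d) (e g)"
proof -
  have "sat E e (is_cofinal_map f d g n) \<longleftrightarrow> Func (e f) (e d) (e g) &
     (ALL a. a <: e g --> (EX x y. pr x y <: e f & (a <: y | a = y)))"
    using assms by (simp add: is_cofinal_map_def)
  also have "... \<longleftrightarrow> cofm (e f) (e d) (e g)" unfolding cofm_def
    by (rule conj_cong[OF refl]) (auto simp: Func_pr)
  finally show ?thesis .
qed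
lemma sat_cf [simp]: "g < n ==> d < n ==> sat E e (is_cf g d n) \<longleftrightarrow>
    Ord (e d) & (EX f. cofm f (e d) (e g)) & (ALL c. c <: e d --> ~ (EX f. cofm f c (e g)))"
  by (simp add: is_cf_def)
lemma sat_uncountable_regular [simp]: "k < n ==> sat E e (is_uncountable_regular k n) \<longleftrightarrow>
    Inf (e k) & (EX f. cofm f (e k) (e k)) & (ALL c. c <: e k --> ~ (EX f. cofm f c (e k))) & om <: e k"
  by (auto simp: is_uncountable_regular_def is_regular_def InfD)

lemma regular_ctbbd:
  assumes "Inf k" "om <: k" "!!c. c <: k ==> ~ (EX f. cofm f c k)"
  shows "ctbbd k"
proof -
  have "EX b. b <: k & sub a b" if a: "sub a k" "lep a om" for a
  proof -
    let ?c = "card a"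
    have "sub ?c om" using a(2) unfolding lep_Card[OF Card_om] .
    then have ck: "?c <: k" using assms(2) Ord_sub[of ?c om] Ord_trans[OF InfD(2)[OF assms(1)] assms(2), of ?c] by auto
    obtain F where F: "dF F" "bij_betw F (ext ?c) (ext a)" using card_eqp by (rule eqpE)
    have "F x <: k" if "x <: ?c" for x using F(2) a(1) that unfolding bij_ext by (auto simp: sub_def)
    then have "Func (lam ?c F) ?c k" using Func_lam[OF F(1)] by blast
    with assms(3)[OF ck] obtain b where b: "b <: k" "ALL x. x <: ?c --> ~ (b <: F x | b = F x)"
      using F(1) unfolding cofm_def by fastforce
    have "x <: b" if xa: "x <: a" for x
    proof -
      obtain y where "y <: ?c" "F y = x" using F(2) xa unfolding bij_ext by blast
      then have "~ (b <: x | b = x)" using b(2) by blast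
      then show ?thesis using Ord_linear[of b x] b(1) subD[OF a(1) xa] Ord_mem[OF InfD(2)[OF assms(1)]] by blast
    qed
    then show ?thesis using b(1) by (auto simp: sub_def)
  qed
  then show ?thesis unfolding ctbbd_def using assms(1) by blast
qed

end

section \<open>The forcing relation\<close>

text \<open>A list used as an environment through \<open>(!)\<close> has unspecified values beyond
  its length. Formulas with \<open>bd n\<close> read only the first n variables and so do not see
  them.\<close>

definition bd :: "nat => fm => bool" where "bd n \<phi> \<longleftrightarrow> fv \<phi> \<subseteq> {..<n}"

lemma bd_pmem [simp]: "bd n ((x \<^bold>\<in> y) m) \<longleftrightarrow> x < n & y < n" by (simp add: bd_def pmem_def)
lemma bd_peq [simp]: "bd n ((x \<^bold>= y) m) \<longleftrightarrow> x < n & y < n" by (simp add: bd_def peq_def)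
lemma bd_pneg [simp]: "bd n ((\<^bold>\<not> A) m) \<longleftrightarrow> bd n (A m)" by (simp add: bd_def pneg_def)
lemma bd_pconj [simp]: "bd n ((A \<^bold>\<and> B) m) \<longleftrightarrow> bd n (A m) & bd n (B m)" by (simp add: bd_def pconj_def)
lemma bd_pdisj [simp]: "bd n ((A \<^bold>\<or> B) m) \<longleftrightarrow> bd n (A m) & bd n (B m)" by (simp add: pdisj_def)
lemma bd_pimp [simp]: "bd n ((A \<^bold>\<longrightarrow> B) m) \<longleftrightarrow> bd n (A m) & bd n (B m)" by (simp add: pimp_def)
lemma bd_piff [simp]: "bd n ((A \<^bold>\<longleftrightarrow> B) m) \<longleftrightarrow> bd n (A m) & bd n (B m)" by (auto simp: piff_def)
lemma bd_pall [simp]: "bd (Suc n) (A n (Suc n)) ==> bd n (pall A n)"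
  by (fastforce simp: bd_def pall_def less_Suc_eq)
lemma bd_pex [simp]: "bd (Suc n) (A n (Suc n)) ==> bd n (pex A n)" by (simp add: pex_def)

lemma bd_subset [simp]: "x < n ==> y < n ==> bd n ((x \<^bold>\<subseteq> y) n)" by (simp add: is_subset_def)
lemma bd_empty [simp]: "x < n ==> bd n (is_empty x n)" by (simp add: is_empty_def)
lemma bd_upair [simp]: "a < n ==> b < n ==> z < n ==> bd n (is_upair a b z n)" by (simp add: is_upair_def)
lemma bd_pair [simp]: "a < n ==> b < n ==> z < n ==> bd n (is_pair a b z n)" by (simp add: is_pair_def)
lemma bd_pair_in [simp]: "a < n ==> b < n ==> z < n ==> bd n (pair_in a b z n)" by (simp add: pair_in_def)
lemma bd_triple [simp]: "a < n ==> b < n ==> c < n ==> z < n ==> bd n (is_triple a b c z n)" by (simp add: is_triple_def)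
lemma bd_triple_in [simp]: "a < n ==> b < n ==> c < n ==> z < n ==> bd n (triple_in a b c z n)" by (simp add: triple_in_def)
lemma bd_succ [simp]: "x < n ==> y < n ==> bd n (is_succ x y n)" by (simp add: is_succ_def)
lemma bd_two [simp]: "x < n ==> bd n (is_two x n)" by (simp add: is_two_def)
lemma bd_func [simp]: "f < n ==> a < n ==> b < n ==> bd n (is_func f a b n)" by (simp add: is_func_def)
lemma bd_inj [simp]: "f < n ==> a < n ==> b < n ==> bd n (is_inj f a b n)" by (simp add: is_inj_def)
lemma bd_bij [simp]: "f < n ==> a < n ==> b < n ==> bd n (is_bij f a b n)" by (simp add: is_bij_def)
lemma bd_func_space [simp]: "f < n ==> a < n ==> b < n ==> bd n (is_func_space f a b n)" by (simp add: is_func_space_def)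
lemma bd_equipotent [simp]: "a < n ==> b < n ==> bd n (equipotent a b n)" by (simp add: equipotent_def)
lemma bd_transitive [simp]: "a < n ==> bd n (is_transitive a n)" by (simp add: is_transitive_def)
lemma bd_Ord [simp]: "a < n ==> bd n (is_Ord a n)" by (simp add: is_Ord_def)
lemma bd_Limit [simp]: "a < n ==> bd n (is_Limit a n)" by (simp add: is_Limit_def)
lemma bd_omega [simp]: "a < n ==> bd n (is_omega a n)" by (simp add: is_omega_def)
lemma bd_countably_infinite [simp]: "a < n ==> bd n (is_countably_infinite a n)" by (simp add: is_countably_infinite_def)
lemma bd_Card [simp]: "a < n ==> bd n (is_Card a n)" by (simp add: is_Card_def)
lemma bd_has_card [simp]: "a < n ==> b < n ==> bd n (has_card a b n)" by (simp add: has_card_def)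
lemma bd_succ_card [simp]: "a < n ==> b < n ==> bd n (is_succ_card a b n)" by (simp add: is_succ_card_def)
lemma bd_omega1 [simp]: "a < n ==> bd n (is_omega1 a n)" by (simp add: is_omega1_def)
lemma bd_two_power [simp]: "a < n ==> b < n ==> bd n (is_two_power a b n)" by (simp add: is_two_power_def)
lemma bd_continuum [simp]: "a < n ==> bd n (is_continuum a n)" by (simp add: is_continuum_def)
lemma bd_cofinal_map [simp]: "f < n ==> a < n ==> b < n ==> bd n (is_cofinal_map f a b n)" by (simp add: is_cofinal_map_def)
lemma bd_cf [simp]: "a < n ==> b < n ==> bd n (is_cf a b n)" by (simp add: is_cf_def)
lemma bd_sum [simp]: "f < n ==> a < n ==> b < n ==> bd n (is_sum f a b n)" by (simp add: is_sum_def)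
lemma bd_prod [simp]: "f < n ==> a < n ==> b < n ==> bd n (is_prod f a b n)" by (simp add: is_prod_def)
lemma bd_rat [simp]: "a < n ==> bd n (is_rat a n)" by (simp add: is_rat_def)
lemma bd_rat_less [simp]: "a < n ==> b < n ==> bd n (rat_less a b n)" by (simp add: rat_less_def)
lemma bd_real [simp]: "a < n ==> bd n (is_real a n)" by (simp add: is_real_def)
lemma bd_real_less [simp]: "a < n ==> b < n ==> bd n (real_less a b n)" by (simp add: real_less_def)
lemma bd_in_closure [simp]: "a < n ==> b < n ==> bd n (in_closure a b n)" by (simp add: in_closure_def)
lemma bd_Phi [simp]: "a < n ==> bd n (Phi a n)" by (simp add: Phi_def)
lemma bd_Phi_up_to_continuum: "bd n (Phi_up_to_continuum n)" by (simp add: Phi_up_to_continuum_def)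
lemma bd_name_set [simp]: "a < n ==> b < n ==> bd n (is_name_set a b n)" by (simp add: is_name_set_def)
lemma bd_name [simp]: "a < n ==> b < n ==> bd n (is_name a b n)" by (simp add: is_name_def)
lemma bd_eq_step [simp]: "l < n ==> R < n ==> p < n ==> x < n ==> y < n ==> bd n (eq_step l R p x y n)" by (simp add: eq_step_def)
lemma bd_forces_eq [simp]: "P < n ==> l < n ==> p < n ==> x < n ==> y < n ==> bd n (forces_eq P l p x y n)" by (simp add: forces_eq_def)
lemma bd_forces_mem [simp]: "P < n ==> l < n ==> p < n ==> x < n ==> y < n ==> bd n (forces_mem P l p x y n)" by (simp add: forces_mem_def)

lemma sat_bd: "bd n \<phi> ==> (!!k. k < n ==> e k = e' k) ==> sat E e \<phi> = sat E e' \<phi>"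
  by (rule sat_cong) (auto simp: bd_def)

lemma forces_cong: "(!!n. n : fv \<phi> ==> e n = e' n) ==> forces E P l p e \<phi> = forces E P l p e' \<phi>"
proof (induction \<phi> arbitrary: e e' p)
  case (Neg \<phi>)
  have "forces E P l q e \<phi> = forces E P l q e' \<phi>" for q
    by (rule Neg.IH) (use Neg.prems in simp)
  then show ?case by simp
next
  case (Conj \<phi> \<psi>)
  from Conj.IH[of e e'] Conj.prems show ?case by simp
next
  case (Forall n \<phi>)
  have "forces E P l p (e(n := x)) \<phi> = forces E P l p (e'(n := x)) \<phi>" for x
    using Forall.prems by (intro Forall.IH) auto
  then show ?case by simp
qed auto

text \<open>Forcing a fixed formula is itself expressible by a formula: variables 0, 1, 2 hold the
  poset, its order and the condition, and every variable of the formula moves up by 3. This gives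
  the definable dense classes of the truth lemma and carries \<open>forces\<close> over to
  elementary submodels.\<close>

primrec ftr :: "fm => fm" where
  "ftr (Mem i j) = ren (fm5 forces_mem) (%k. if k < 3 then k else if k = 3 then i + 3 else j + 3)"
| "ftr (Equ i j) = ren (fm5 forces_eq) (%k. if k < 3 then k else if k = 3 then i + 3 else j + 3)"
| "ftr (Neg \<phi>) = (let m = 3 + fresh (fv (ftr \<phi>)) in
     Forall m (Neg (Conj (pair_in m 2 1 (Suc m)) (ren (ftr \<phi>) (%k. if k = 2 then m else k)))))"
| "ftr (Conj \<phi> \<psi>) = Conj (ftr \<phi>) (ftr \<psi>)"
| "ftr (Forall n \<phi>) = (let m = 3 + fresh (fv (ftr \<phi>)) in
     Forall m (Neg (Conj (is_name 0 m (Suc m)) (Neg (ren (ftr \<phi>) (%k. if k = n + 3 then m else k))))))"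

lemma sat_ftr: "sat E e (ftr \<phi>) \<longleftrightarrow> forces E (e 0) (e 1) (e 2) (%n. e (n + 3)) \<phi>"
proof (induction \<phi> arbitrary: e)
  case (Mem i j)
  show ?case unfolding ftr.simps sat_ren forces.simps
    by (rule sat_bd[of 5]) (auto simp: fm5_def less_Suc_eq numeral_eq_Suc)
next
  case (Equ i j)
  show ?case unfolding ftr.simps sat_ren forces.simps
    by (rule sat_bd[of 5]) (auto simp: fm5_def less_Suc_eq numeral_eq_Suc)
next
  case (Neg \<phi>)
  define m where "m = 3 + fresh (fv (ftr \<phi>))"
  have m: "k ~= m" if "k : fv (ftr \<phi>)" for k using fresh[OF finite_fv that] by (simp add: m_def)
  have "sat E (%k. (e(m := q)) (if k = 2 then m else k)) (ftr \<phi>) = sat E (e(2 := q)) (ftr \<phi>)" for q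
    by (rule sat_cong) (auto dest: m)
  also have "... q \<longleftrightarrow> forces E (e 0) (e 1) q (%n. e (n + 3)) \<phi>" for q
    unfolding Neg.IH by simp
  finally have 1: "sat E (%k. (e(m := q)) (if k = 2 then m else k)) (ftr \<phi>) \<longleftrightarrow> forces E (e 0) (e 1) q (%n. e (n + 3)) \<phi>" for q .
  have 2: "sat E (e(m := q)) (pair_in m 2 1 (Suc m)) \<longleftrightarrow> sat E ((!) [q, e 2, e 1]) (fm3 pair_in)" for q
  proof -
    have "sat E (e(m := q)) (pair_in m 2 1 (Suc m)) \<longleftrightarrow> sat E (%k. (e(m := q)) (if k = 0 then m else if k = 1 then 2 else 1)) (pair_in 0 1 2 3)"
      by (simp add: pair_in_def is_pair_def is_upair_def m_def)
    also have "... \<longleftrightarrow> sat E ((!) [q, e 2, e 1]) (pair_in 0 1 2 3)"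
      by (rule sat_bd[of 3]) (auto simp: m_def less_Suc_eq numeral_eq_Suc)
    finally show ?thesis by (simp add: fm3_def)
  qed
  show ?case using 1 2 by (simp add: Let_def m_def[symmetric] sat_ren)
next
  case (Forall n \<phi>)
  define m where "m = 3 + fresh (fv (ftr \<phi>))"
  have m: "k ~= m" if "k : fv (ftr \<phi>)" for k using fresh[OF finite_fv that] by (simp add: m_def)
  have "sat E (%k. (e(m := x)) (if k = n + 3 then m else k)) (ftr \<phi>) = sat E (e(n + 3 := x)) (ftr \<phi>)" for x
    by (rule sat_cong) (auto dest: m)
  also have "... x \<longleftrightarrow> forces E (e 0) (e 1) (e 2) ((%n. e (n + 3))(n := x)) \<phi>" for x
    unfolding Forall.IH by (auto intro!: arg_cong[where f="%e'. forces E _ _ _ e' \<phi>"])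
  finally have 1: "sat E (%k. (e(m := x)) (if k = n + 3 then m else k)) (ftr \<phi>) \<longleftrightarrow> forces E (e 0) (e 1) (e 2) ((%n. e (n + 3))(n := x)) \<phi>" for x .
  have 2: "sat E (e(m := x)) (is_name 0 m (Suc m)) \<longleftrightarrow> sat E ((!) [e 0, x]) (fm2 is_name)" for x
  proof -
    have "sat E (e(m := x)) (is_name 0 m (Suc m)) \<longleftrightarrow> sat E (%k. (e(m := x)) (if k = 0 then 0 else m)) (is_name 0 1 2)"
      by (simp add: is_name_def is_name_set_def is_pair_def is_upair_def m_def)
    also have "... \<longleftrightarrow> sat E ((!) [e 0, x]) (is_name 0 1 2)"
      by (rule sat_bd[of 2]) (auto simp: m_def less_Suc_eq numeral_eq_Suc)
    finally show ?thesis by (simp add: fm2_def)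
  qed
  show ?case using 1 2 by (simp add: Let_def m_def[symmetric] sat_ren)
qed (simp_all)

locale forcing = zfc E for E :: "'v => 'v => bool" (infix \<open><:\<close> 50) +
  fixes P l e :: 'v
  assumes le_P: "pr p q <: l ==> p <: P & q <: P"
    and le_refl: "p <: P ==> pr p p <: l"
    and le_trans: "pr p q <: l ==> pr q r <: l ==> pr p r <: l"
    and e_P [simp]: "e <: P"
    and le_e: "p <: P ==> pr p e <: l"
begin

abbreviation le :: "'v => 'v => bool" where "le p q == pr p q <: l"

definition nset :: "'v => bool" where
  "nset N \<longleftrightarrow> (ALL x z. x <: N & z <: x --> (EX s p. s <: N & p <: P & z = pr s p))"
lemma dp_nset [simp]: "dt a ==> dp (%e. nset (a e))" by (rule dp1[where P=nset], unfold nset_def) simp_all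
definition Name :: "'v => bool" where "Name x \<longleftrightarrow> (EX N. x <: N & nset N)"
lemma dp_Name [simp]: "dt a ==> dp (%e. Name (a e))" by (rule dp1[where P=Name], unfold Name_def) simp_all

text \<open>The recursion step \<open>eq_step\<close> with the relation of the earlier stages
  abstracted to \<open>T\<close>, so that it applies to a set-sized solution, to \<open>FE\<close>
  and to the converse of \<open>FE\<close>.\<close>

definition stp :: "('v => 'v => 'v => bool) => 'v => 'v => 'v => bool" where
  "stp T p x y \<longleftrightarrow>
    (ALL s u. pr s u <: x --> (ALL q. le q p --> (EX r. le r q & (le r u --> (EX t v. pr t v <: y & le r v & T r s t))))) &
    (ALL t v. pr t v <: y --> (ALL q. le q p --> (EX r. le r q & (le r v --> (EX s u. pr s u <: x & le r u & T r s t)))))"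

definition sol :: "'v => 'v => bool" where
  "sol N R \<longleftrightarrow> nset N & (ALL q a b. q <: P & a <: N & b <: N --> (pr q (pr a b) <: R \<longleftrightarrow> stp (%r s t. pr r (pr s t) <: R) q a b))"

definition FE :: "'v => 'v => 'v => bool" where
  "FE p x y \<longleftrightarrow> (EX N R. sol N R & x <: N & y <: N & pr p (pr x y) <: R)"
lemma dp_FE [simp]: "dt a ==> dt b ==> dt c ==> dp (%e. FE (a e) (b e) (c e))"
  by (rule dp3[where P=FE], unfold FE_def sol_def stp_def) simp_all
definition FM :: "'v => 'v => 'v => bool" where
  "FM p x y \<longleftrightarrow> (ALL q. le q p --> (EX r. le r q & (EX t v. pr t v <: y & le r v & FE r t x)))"
lemma dp_FM [simp]: "dt a ==> dt b ==> dt c ==> dp (%e. FM (a e) (b e) (c e))"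
  by (rule dp3[where P=FM], unfold FM_def) simp_all

lemma sat_name_set: "a < n ==> b < n ==> env a = P ==> sat E env (is_name_set a b n) \<longleftrightarrow> nset (env b)"
  by (simp add: is_name_set_def nset_def)
lemma sat_name: "env a = P ==> a < n ==> b < n ==> sat E env (is_name a b n) \<longleftrightarrow> Name (env b)"
  by (simp add: is_name_def Name_def sat_name_set)
lemma sat_eq_step: "env a = l ==> a < n ==> R < n ==> p < n ==> x < n ==> y < n ==>
   sat E env (eq_step a R p x y n) \<longleftrightarrow> stp (%r s t. pr r (pr s t) <: env R) (env p) (env x) (env y)"
  by (simp add: eq_step_def stp_def)
lemma sat_forces_eq: "env a = P ==> env b = l ==> a < n ==> b < n ==> p < n ==> x < n ==> y < n ==>
   sat E env (forces_eq a b p x y n) \<longleftrightarrow> FE (env p) (env x) (env y)"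
  by (simp add: forces_eq_def FE_def sol_def sat_name_set sat_eq_step) blast
lemma sat_forces_mem: "env a = P ==> env b = l ==> a < n ==> b < n ==> p < n ==> x < n ==> y < n ==>
   sat E env (forces_mem a b p x y n) \<longleftrightarrow> FM (env p) (env x) (env y)"
  by (simp add: forces_mem_def FM_def sat_forces_eq)

lemma forces_Mem [simp]: "forces E P l p env (Mem i j) \<longleftrightarrow> FM p (env i) (env j)"
  by (simp add: fm5_def sat_forces_mem)
lemma forces_Equ [simp]: "forces E P l p env (Equ i j) \<longleftrightarrow> FE p (env i) (env j)"
  by (simp add: fm5_def sat_forces_eq)
lemma forces_Neg [simp]: "forces E P l p env (Neg \<phi>) \<longleftrightarrow> (ALL q. le q p --> ~ forces E P l q env \<phi>)"
  by (simp add: fm3_def)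
lemma forces_Forall [simp]: "forces E P l p env (Forall n \<phi>) \<longleftrightarrow> (ALL x. Name x --> forces E P l p (env(n := x)) \<phi>)"
  by (simp add: fm2_def sat_name)
declare forces.simps(1,2,3,5) [simp del]

section \<open>The recursion for forced equality\<close>

lemma rk_pr: assumes "pr s u <: x" shows "rk s <: rk x"
proof -
  have "s <: upr s s" "upr s s <: pr s u" by (auto simp: pr_def)
  then have "rk s <: rk (upr s s)" "rk (upr s s) <: rk (pr s u)" "rk (pr s u) <: rk x" using rk_mem assms by blast+
  then show ?thesis using Ord_trans[OF Ord_rk] by blast
qed

text \<open>The elements of a name are pairs, so recursion on names runs along first components.
  These need not be elements of the name, but they have smaller rank.\<close>

lemma rk_induct:
  assumes "dP Q" "!!x. (!!s u. pr s u <: x ==> Q s) ==> Q x"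
  shows "Q x"
proof -
  note [simp] = dp1[where P=Q, OF assms(1)]
  have "ALL x. rk x = a --> Q x" for a
  proof (induction a rule: mem_induct)
    case (step a)
    show ?case
    proof (intro allI impI)
      fix x assume "rk x = a"
      then have "Q s" if "pr s u <: x" for s u using step[of "rk s"] rk_pr[OF that] by simp
      then show "Q x" by (rule assms(2))
    qed
  qed simp
  then show ?thesis by blast
qed

lemma nsetD: assumes "nset N" "x <: N" "pr s u <: x" shows "s <: N & u <: P"
proof -
  obtain s' p where "s' <: N" "p <: P" "pr s u = pr s' p" using assms unfolding nset_def by blast
  then show ?thesis by simp
qed
lemma NameD: "Name x ==> pr s u <: x ==> Name s & u <: P"
  unfolding Name_def using nsetD by blast
lemma Name_pair: "Name x ==> z <: x ==> EX s u. z = pr s u"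
  unfolding Name_def nset_def by blast
lemma nset_cup: "nset M ==> nset N ==> nset (cup M N)"
  unfolding nset_def mem_cup by blast

lemma stp_mono:
  assumes "stp T p x y" and T: "!!r s t u v. pr s u <: x ==> pr t v <: y ==> r <: P ==> T r s t ==> T' r s t"
  shows "stp T' p x y"
  unfolding stp_def
proof (intro conjI allI impI)
  fix s u q assume su: "pr s u <: x" "le q p"
  obtain r where r: "le r q" "le r u --> (EX t v. pr t v <: y & le r v & T r s t)"
    using assms(1) su unfolding stp_def by blast
  have "r <: P" using r(1) le_P by blast
  then show "EX r. le r q & (le r u --> (EX t v. pr t v <: y & le r v & T' r s t))"
    using r T[OF su(1)] by blast
next
  fix t v q assume tv: "pr t v <: y" "le q p"
  obtain r where r: "le r q" "le r v --> (EX s u. pr s u <: x & le r u & T r s t)"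
    using assms(1) tv unfolding stp_def by blast
  have "r <: P" using r(1) le_P by blast
  then show "EX r. le r q & (le r v --> (EX s u. pr s u <: x & le r u & T' r s t))"
    using r T[OF _ tv(1)] by blast
qed

lemma sol_unique:
  assumes "sol N R" "sol N' R'"
  shows "ALL b q. a <: N & a <: N' & b <: N & b <: N' & q <: P --> (pr q (pr a b) <: R \<longleftrightarrow> pr q (pr a b) <: R')"
proof (induction a rule: rk_induct)
  case (2 a)
  show ?case
  proof (intro allI impI)
    fix b q assume b: "a <: N & a <: N' & b <: N & b <: N' & q <: P"
    have "pr r (pr s t) <: R \<longleftrightarrow> pr r (pr s t) <: R'" if "pr s u <: a" "pr t v <: b" "r <: P" for r s t u v
    proof -
      have "s <: N & s <: N' & t <: N & t <: N'" using that b assms nsetD unfolding sol_def by blast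
      then show ?thesis using 2[OF that(1)] that(3) by blast
    qed
    then have "stp (%r s t. pr r (pr s t) <: R) q a b \<longleftrightarrow> stp (%r s t. pr r (pr s t) <: R') q a b"
      by (auto elim!: stp_mono)
    then show "pr q (pr a b) <: R \<longleftrightarrow> pr q (pr a b) <: R'" using b assms unfolding sol_def by blast
  qed
qed simp

lemma sol_exists: assumes "nset N" shows "EX R. sol N R"
proof -
  define W where "W = prd P (prd N N)"
  \<comment> \<open>The greatest fixed point of the step, as the union of all sets of triples that
    justify themselves; \<open>stp_mono\<close> makes the union justify itself. This replaces a
    recursion on pairs of names.\<close>
  define R where "R = Uni (Sep (Pw W) (%S. ALL q a b. pr q (pr a b) <: S --> stp (%r s t. pr r (pr s t) <: S) q a b))"
  have [simp]: "dp (%e. ALL q a b. pr q (pr a b) <: e 0 --> stp (%r s t. pr r (pr s t) <: e 0) q a b)"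
    unfolding stp_def by simp
  have R: "z <: R \<longleftrightarrow> (EX S. sub S W & (ALL q a b. pr q (pr a b) <: S --> stp (%r s t. pr r (pr s t) <: S) q a b) & z <: S)" for z
    unfolding R_def by auto
  have RS: "stp (%r s t. pr r (pr s t) <: R) q a b" if qab: "pr q (pr a b) <: R" for q a b
  proof -
    obtain S where S: "sub S W" "ALL q a b. pr q (pr a b) <: S --> stp (%r s t. pr r (pr s t) <: S) q a b" "pr q (pr a b) <: S"
      using qab unfolding R by blast
    then have "stp (%r s t. pr r (pr s t) <: S) q a b" by blast
    then show ?thesis
    proof (rule stp_mono)
      fix r s t assume "pr r (pr s t) <: S"
      then show "pr r (pr s t) <: R" unfolding R using S by blast
    qed
  qed
  have "pr q (pr a b) <: R" if qab: "q <: P" "a <: N" "b <: N" "stp (%r s t. pr r (pr s t) <: R) q a b" for q a b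
  proof -
    define S where "S = cup R (sg (pr q (pr a b)))"
    have RSub: "pr r (pr s t) <: R ==> pr r (pr s t) <: S" for r s t unfolding S_def by simp
    have "sub S W"
    proof (rule subI)
      fix z assume "z <: S"
      then show "z <: W" using qab(1-3) subD unfolding S_def mem_cup mem_sg R W_def by auto
    qed
    moreover have "stp (%r s t. pr r (pr s t) <: S) q' a' b'" if S': "pr q' (pr a' b') <: S" for q' a' b'
    proof -
      have "stp (%r s t. pr r (pr s t) <: R) q' a' b'" using S' RS qab(4) unfolding S_def by auto
      then show ?thesis by (rule stp_mono) (rule RSub)
    qed
    moreover have "pr q (pr a b) <: S" unfolding S_def by simp
    ultimately show ?thesis unfolding R by blast
  qed
  then have "sol N R" unfolding sol_def using assms RS by blast
  then show ?thesis by blast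
qed

lemma FE_sol: assumes "sol N R" "x <: N" "y <: N" "p <: P" shows "FE p x y \<longleftrightarrow> pr p (pr x y) <: R"
  unfolding FE_def using sol_unique[OF assms(1)] assms by blast

lemma FE_step: assumes "Name x" "Name y" "p <: P" shows "FE p x y \<longleftrightarrow> stp FE p x y"
proof -
  obtain M N where "nset M" "x <: M" "nset N" "y <: N" using assms unfolding Name_def by blast
  then have "nset (cup M N)" "x <: cup M N" "y <: cup M N" using nset_cup by auto
  moreover then obtain R where R: "sol (cup M N) R" using sol_exists by blast
  ultimately have "FE r s t \<longleftrightarrow> pr r (pr s t) <: R" if "pr s u <: x" "pr t v <: y" "r <: P" for r s t u v
    using that nsetD by (intro FE_sol[OF R]) blast+
  then have "stp FE p x y \<longleftrightarrow> stp (%r s t. pr r (pr s t) <: R) p x y" by (auto elim!: stp_mono)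
  then show ?thesis using FE_sol[OF R] R assms(3) \<open>x <: cup M N\<close> \<open>y <: cup M N\<close> unfolding sol_def by blast
qed

lemma FE_P: "FE p x y ==> p <: P ==> Name x & Name y" unfolding FE_def sol_def Name_def by blast

lemma FE_mono: "Name x ==> Name y ==> FE p x y ==> le q p ==> FE q x y"
  using FE_step[of x y p] FE_step[of x y q] le_P[of q p] le_trans[of _ q p] unfolding stp_def by blast

lemma FE_sym: "ALL y p. Name x --> Name y --> p <: P --> FE p x y --> FE p y x"
proof (induction x rule: rk_induct)
  case (2 x)
  show ?case
  proof (intro allI impI)
    fix y p assume a: "Name x" "Name y" "p <: P" "FE p x y"
    have s: "stp FE p x y" using a FE_step by blast
    have "FE r t s" if "pr s u <: x" "pr t v <: y" "r <: P" "FE r s t" for r s t u v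
      using 2[OF that(1)] that NameD a by blast
    then have "stp (%r s t. FE r t s) p x y" by (rule stp_mono[OF s])
    then have "stp FE p y x" unfolding stp_def by blast
    then show "FE p y x" using a FE_step by blast
  qed
qed simp
lemma FE_symI: "p <: P ==> FE p x y ==> FE p y x" using FE_sym FE_P by blast

lemma FE_refl: "Name x --> (ALL p. p <: P --> FE p x x)"
proof (induction x rule: rk_induct)
  case (2 x)
  show ?case
  proof (intro allI impI)
    fix p assume a: "Name x" "p <: P"
    have "FE q s s" if "pr s u <: x" "q <: P" for q s u using 2[OF that(1)] NameD that a by blast
    then have "stp FE p x x" unfolding stp_def using le_refl le_P by blast
    then show "FE p x x" using a FE_step by blast
  qed
qed simp

lemma FE_dense: assumes "Name x" "Name y" "p <: P" "!!q. le q p ==> EX r. le r q & FE r x y" shows "FE p x y"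
proof -
  have *: "EX r. le r q & stp FE r x y" if "le q p" for q
    using assms(4)[OF that] FE_step[OF assms(1,2)] le_P by blast
  have "stp FE p x y" unfolding stp_def
  proof (intro conjI allI impI)
    fix s u q assume "pr s u <: x" "le q p"
    from *[OF this(2)] obtain r where r: "le r q" "stp FE r x y" by blast
    then obtain r' where "le r' r" "le r' u --> (EX t v. pr t v <: y & le r' v & FE r' s t)"
      using \<open>pr s u <: x\<close> le_refl le_P unfolding stp_def by blast
    then show "EX r. le r q & (le r u --> (EX t v. pr t v <: y & le r v & FE r s t))" using r le_trans by blast
  next
    fix s u q assume "pr s u <: y" "le q p"
    from *[OF this(2)] obtain r where r: "le r q" "stp FE r x y" by blast
    then obtain r' where "le r' r" "le r' u --> (EX t v. pr t v <: x & le r' v & FE r' t s)"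
      using \<open>pr s u <: y\<close> le_refl le_P unfolding stp_def by blast
    then show "EX r. le r q & (le r u --> (EX t v. pr t v <: x & le r v & FE r t s))" using r le_trans by blast
  qed
  then show ?thesis using FE_step[OF assms(1-3)] by blast
qed

lemma FE_trans_aux: "ALL y z p. Name x --> Name y --> Name z --> p <: P --> FE p x y --> FE p y z --> FE p x z"
proof (induction x rule: rk_induct)
  case (2 x)
  show ?case
  proof (intro allI impI)
    fix y z p assume a: "Name x" "Name y" "Name z" "p <: P" "FE p x y" "FE p y z"
    have xy: "stp FE p x y" and yz: "stp FE p y z" using a FE_step by blast+
    have IH: "FE r s w" if "pr s u <: x" "pr t v <: y" "pr w k <: z" "r <: P" "FE r s t" "FE r t w" for r s t w u v k
      using 2[OF that(1)] that NameD a by blast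
    have "stp FE p x z" unfolding stp_def
    proof (intro conjI allI impI)
      fix s u q assume su: "pr s u <: x" "le q p"
      obtain r where r: "le r q" "le r u --> (EX t v. pr t v <: y & le r v & FE r s t)" using xy su unfolding stp_def by blast
      show "EX r. le r q & (le r u --> (EX t v. pr t v <: z & le r v & FE r s t))"
      proof (cases "le r u")
        case True
        then obtain t v where t: "pr t v <: y" "le r v" "FE r s t" using r by blast
        have "le r p" using r su le_trans by blast
        then obtain r' where r': "le r' r" "le r' v --> (EX w k. pr w k <: z & le r' k & FE r' t w)" using yz t unfolding stp_def by blast
        then have "le r' v" using t le_trans by blast
        then obtain w k where w: "pr w k <: z" "le r' k" "FE r' t w" using r' by blast
        have "FE r' s t" using FE_mono[OF _ _ t(3) r'(1)] NameD a su t by blast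
        then have "FE r' s w" using IH[OF su(1) t(1) w(1)] w le_P by blast
        then show ?thesis using r' r w le_trans by blast
      next
        case False then show ?thesis using r by blast
      qed
    next
      fix w k q assume wk: "pr w k <: z" "le q p"
      obtain r where r: "le r q" "le r k --> (EX t v. pr t v <: y & le r v & FE r t w)" using yz wk unfolding stp_def by blast
      show "EX r. le r q & (le r k --> (EX s u. pr s u <: x & le r u & FE r s w))"
      proof (cases "le r k")
        case True
        then obtain t v where t: "pr t v <: y" "le r v" "FE r t w" using r by blast
        have "le r p" using r wk le_trans by blast
        then obtain r' where r': "le r' r" "le r' v --> (EX s u. pr s u <: x & le r' u & FE r' s t)" using xy t unfolding stp_def by blast
        then have "le r' v" using t le_trans by blast
        then obtain s u where s: "pr s u <: x" "le r' u" "FE r' s t" using r' by blast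
        have "FE r' t w" using FE_mono[OF _ _ t(3) r'(1)] NameD a wk t by blast
        then have "FE r' s w" using IH[OF s(1) t(1) wk(1)] s le_P by blast
        then show ?thesis using r' r s le_trans by blast
      next
        case False then show ?thesis using r by blast
      qed
    qed
    then show "FE p x z" using a FE_step by blast
  qed
qed simp
lemma FE_trans: "p <: P ==> FE p x y ==> FE p y z ==> FE p x z" using FE_trans_aux FE_P by blast

lemma forces_mono: "forces E P l p env \<phi> ==> (!!i. Name (env i)) ==> le q p ==> forces E P l q env \<phi>"
proof (induction \<phi> arbitrary: env p q)
  case (Mem i j) then show ?case unfolding forces_Mem FM_def using le_trans by blast
next
  case (Equ i j) then show ?case using FE_mono by simp
next
  case (Neg \<phi>)
  show ?case unfolding forces_Neg
  proof (intro allI impI)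
    fix r assume "le r q"
    then have "le r p" using Neg.prems(3) le_trans by blast
    then show "~ forces E P l r env \<phi>" using Neg.prems(1) unfolding forces_Neg by blast
  qed
next
  case (Forall n \<phi>)
  have "forces E P l q (env(n := x)) \<phi>" if "Name x" for x
  proof (rule Forall.IH)
    show "forces E P l p (env(n := x)) \<phi>" using Forall.prems(1) that by simp
    show "Name ((env(n := x)) i)" for i using Forall.prems(2)[of i] that by simp
  qed (rule Forall.prems(3))
  then show ?case by simp
qed auto

lemma forces_dense: "p <: P ==> (!!q. le q p ==> EX r. le r q & forces E P l r env \<phi>) ==> (!!i. Name (env i)) ==> forces E P l p env \<phi>"
proof (induction \<phi> arbitrary: env)
  case (Mem i j) then show ?case unfolding forces_Mem FM_def using le_trans le_refl le_P by meson
next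
  case (Equ i j) then show ?case using FE_dense by simp
next
  case (Neg \<phi>)
  show ?case unfolding forces_Neg
  proof (intro allI impI notI)
    fix q assume q: "le q p" "forces E P l q env \<phi>"
    then obtain r where r: "le r q" "forces E P l r env (Neg \<phi>)" using Neg.prems(2) by blast
    then have "forces E P l r env \<phi>" using forces_mono q Neg.prems(3) by blast
    then show False using r le_refl le_P unfolding forces_Neg by blast
  qed
next
  case (Conj \<phi> \<psi>)
  have "EX r. le r q & forces E P l r env \<phi>" "EX r. le r q & forces E P l r env \<psi>" if "le q p" for q
    using Conj.prems(2)[OF that] by auto
  then show ?case using Conj by simp
next
  case (Forall n \<phi>)
  have "forces E P l p (env(n := x)) \<phi>" if "Name x" for x
  proof (rule Forall.IH)
    show "EX r. le r q & forces E P l r (env(n := x)) \<phi>" if "le q p" for q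
      using Forall.prems(2)[OF that] \<open>Name x\<close> by auto
  qed (use Forall.prems that in auto)
  then show ?case by simp
qed

subsection \<open>Check names\<close>

definition chk :: "'v => 'v" where "chk = wrec (%x f. Rep x (%v. pr (app f v) e))"
lemma dt_chk [simp]: "dt a ==> dt (%e. chk (a e))" by (rule dt1[where F=chk], unfold chk_def) simp_all
lemma mem_chk: "z <: chk x \<longleftrightarrow> (EX v. v <: x & z = pr (chk v) e)"
proof -
  have "chk x = Rep x (%v. pr (app (lam x chk) v) e)"
    unfolding chk_def by (subst wrec_unfold) simp_all
  then show ?thesis by (auto cong: conj_cong)
qed

lemma Name_chk [simp]: "Name (chk x)"
proof -
  have "nset (Rep (tcl x) chk)" unfolding nset_def
  proof (intro allI impI, elim conjE)
    fix y z assume "y <: Rep (tcl x) chk" "z <: y"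
    then obtain u v where "u <: tcl x" "v <: u" "z = pr (chk v) e" by (auto simp: mem_chk)
    moreover then have "chk v <: Rep (tcl x) chk" using tclD by (intro RepI) auto
    ultimately show "EX s p. s <: Rep (tcl x) chk & p <: P & z = pr s p" by auto
  qed
  moreover have "chk x <: Rep (tcl x) chk" by (rule RepI) auto
  ultimately show ?thesis unfolding Name_def by blast
qed

lemma sat_check: "sat E ((!) [e, x, c]) (fm3 is_check) \<longleftrightarrow> c = chk x"
proof -
  let ?F = "%N f. ALL y d. pr y d <: f --> (ALL z. z <: d \<longleftrightarrow> (EX v b. v <: y & pr v b <: f & z = pr b e))"
  have "sat E ((!) [e, x, c]) (fm3 is_check) \<longleftrightarrow> (EX N M f. tran N & x <: N & Func f N M & ?F N f & pr x c <: f)" for c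
    by (simp add: fm3_def is_check_def)
  moreover have "(EX N M f. tran N & x <: N & Func f N M & ?F N f & pr x c <: f) \<longleftrightarrow> c = chk x" for c
  proof
    assume "EX N M f. tran N & x <: N & Func f N M & ?F N f & pr x c <: f"
    then obtain N M f where f: "tran N" "x <: N" "Func f N M" "?F N f" "pr x c <: f" by blast
    have A: "y <: N --> app f y = chk y" for y
    proof (induction y rule: mem_induct)
      case (step y)
      show ?case
      proof
        assume y: "y <: N"
        then have "pr y (app f y) <: f" using Func_pr[OF f(3)] by blast
        then have *: "z <: app f y \<longleftrightarrow> (EX v b. v <: y & pr v b <: f & z = pr b e)" for z using f(4) by blast
        have "pr v b <: f \<longleftrightarrow> b = chk v" if "v <: y" for v b
        proof -
          have "v <: N" using f(1) y that unfolding tran_def by blast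
          then show ?thesis using Func_pr[OF f(3), of v b] step[OF that] by simp
        qed
        then have "(EX v b. v <: y & pr v b <: f & z = pr b e) \<longleftrightarrow> (EX v. v <: y & z = pr (chk v) e)" for z
          by (simp cong: conj_cong)
        then show "app f y = chk y" unfolding * mem_chk by (intro set_ext) (simp only: * mem_chk)
      qed
    qed simp
    have "c = app f x" using Func_pr[OF f(3), of x c] f(5) by simp
    then show "c = chk x" using A[of x] f(2) by simp
  next
    assume c: "c = chk x"
    let ?N = "tcl x"
    have f: "Func (lam ?N chk) ?N (Rep ?N chk)" by (rule Func_lam) (auto intro!: RepI)
    have pf: "pr y d <: lam ?N chk \<longleftrightarrow> y <: ?N & d = chk y" for y d by (auto simp: mem_lam)
    have "?F ?N (lam ?N chk)" unfolding pf using tclD by (auto simp: mem_chk)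
    then show "EX N M f. tran N & x <: N & Func f N M & ?F N f & pr x c <: f"
      using f tran_tcl c pf tcl_self by blast
  qed
  ultimately show ?thesis by simp
qed
lemma check_chk: "check E e x = chk x" unfolding check_def sat_check by simp

lemma FE_chk: "ALL y p. p <: P --> FE p (chk x) (chk y) --> x = y"
proof (induction x rule: mem_induct)
  case (step x)
  show ?case
  proof (intro allI impI)
    fix y p assume p: "p <: P" "FE p (chk x) (chk y)"
    then have s: "stp FE p (chk x) (chk y)" using FE_step by simp
    have 1: "v <: y" if "v <: x" for v
    proof -
      have "pr (chk v) e <: chk x" "le p p" using that p le_refl by (auto simp: mem_chk)
      then obtain r where r: "le r p" "le r e --> (EX t v'. pr t v' <: chk y & le r v' & FE r (chk v) t)"
        using s unfolding stp_def by blast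
      have "r <: P" using r le_P by blast
      then obtain w where "w <: y" "FE r (chk v) (chk w)" using r le_e by (auto simp: mem_chk)
      then show ?thesis using step[OF that] \<open>r <: P\<close> by blast
    qed
    have 2: "w <: x" if "w <: y" for w
    proof -
      have "pr (chk w) e <: chk y" "le p p" using that p le_refl by (auto simp: mem_chk)
      then obtain r where r: "le r p" "le r e --> (EX t v'. pr t v' <: chk x & le r v' & FE r t (chk w))"
        using s unfolding stp_def by blast
      have "r <: P" using r le_P by blast
      then obtain v where "v <: x" "FE r (chk v) (chk w)" using r le_e by (auto simp: mem_chk)
      then show ?thesis using step[of v] \<open>r <: P\<close> by blast
    qed
    show "x = y" using 1 2 by (intro set_ext) blast
  qed
qed simp

end

section \<open>Generic extensions of countable models\<close>

lemma (in zfc) mem_UniRep: assumes "dF F" shows "z <: Uni (Rep A F) \<longleftrightarrow> (EX x. x <: A & z <: F x)"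
  unfolding mem_Uni mem_Rep[OF assms] by blast

text \<open>Genericity is asked for dense classes that are definable with parameters; a countable
  model has only countably many of these.\<close>

locale gext = forcing E P l e for E :: "nat => nat => bool" (infix \<open><:\<close> 50) and P l e +
  fixes G :: "nat set"
  assumes G_P: "p : G ==> p <: P"
    and e_G: "e : G"
    and G_up: "p : G ==> pr p q <: l ==> q : G"
    and G_dir: "p : G ==> q : G ==> EX r:G. pr r p <: l & pr r q <: l"
    and G_generic: "dp (%e. D (e 0)) ==> (!!p. p <: P ==> EX q. pr q p <: l & D q) ==> EX p:G. D p"

lemma generic_exists:
  fixes E :: "nat => nat => bool" (infix \<open><:\<close> 50)
  assumes "forcing E P l e" "p <: P"
  shows "EX G. gext E P l e G & p : G"
proof -
  interpret forcing E P l e by fact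
  \<comment> \<open>\<open>d\<close> lists all definable classes of conditions, since a formula
    together with a finite list of parameters is coded by a natural number.\<close>
  define d where "d n = (%x. sat E (mrg (%_. x) (lenv 0 (snd (from_nat n :: fm \<times> nat list)))) (fst (from_nat n :: fm \<times> nat list)))" for n
  have d: "EX n. d n = D" if D: "dP D" for D
  proof -
    obtain \<phi> s where *: "!!e. D (e 0) = sat E (mrg e s) \<phi>" using D by (rule dpE) blast
    define xs where "xs = map s [0..<fresh (fv \<phi>)]"
    have "D x = sat E (mrg (%_. x) (lenv 0 xs)) \<phi>" for x
      unfolding *[of "%_. x", simplified]
      by (rule sat_cong) (auto simp: mrg_def lenv_def xs_def dest!: fresh[OF finite_fv])
    then have "d (to_nat (\<phi>, xs)) = D" by (auto simp: d_def)
    then show ?thesis by blast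
  qed
  \<comment> \<open>Enter the n-th class if it can be met below \<open>q\<close>; otherwise any
    extension of \<open>q\<close> will do.\<close>
  define nx where "nx n q = (SOME r. le r q & ((EX r. le r q & d n r) --> d n r))" for n q
  have nx: "le (nx n q) q & ((EX r. le r q & d n r) --> d n (nx n q))" if "q <: P" for n q
  proof -
    have "EX r. le r q & ((EX r. le r q & d n r) --> d n r)" using le_refl[OF that] by blast
    from someI_ex[OF this] show ?thesis unfolding nx_def .
  qed
  define sq where "sq = rec_nat p nx"
  have sq0: "sq 0 = p" and sqS: "sq (Suc n) = nx n (sq n)" for n by (auto simp: sq_def)
  have sqP: "sq n <: P" for n
  proof (induction n)
    case (Suc n) then show ?case using nx[OF Suc] le_P by (auto simp: sqS)
  qed (simp add: sq0 assms)
  have sqle: "le (sq m) (sq n)" if "n \<le> m" for n m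
    using that
  proof (induction m rule: dec_induct)
    case base then show ?case using le_refl sqP by blast
  next
    case (step m) then show ?case using nx[OF sqP, of m m] le_trans unfolding sqS by blast
  qed
  define G where "G = {q. q <: P & (EX n. le (sq n) q)}"
  have "gext E P l e G"
  proof unfold_locales
    show "p : G ==> p <: P" for p by (simp add: G_def)
    show "e : G" using le_e[OF sqP] by (auto simp: G_def)
    show "p : G ==> le p q ==> q : G" for p q using le_trans le_P by (auto simp: G_def)
    show "EX r:G. le r p & le r q" if pq: "p : G" "q : G" for p q
    proof -
      obtain m n where mn: "le (sq m) p" "le (sq n) q" using pq by (auto simp: G_def)
      have "le (sq (max m n)) p" "le (sq (max m n)) q"
        using le_trans[OF sqle mn(1)] le_trans[OF sqle mn(2)] by auto
      moreover have "sq (max m n) : G" using sqP le_refl by (auto simp: G_def)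
      ultimately show ?thesis by blast
    qed
    show "EX p:G. D p" if D: "dP D" "!!p. p <: P ==> EX q. le q p & D q" for D
    proof -
      obtain n where n: "d n = D" using d D(1) by blast
      have "D (sq (Suc n))" unfolding sqS n[symmetric] using nx[OF sqP, of n n] D(2)[OF sqP, of n] n by blast
      moreover have "sq (Suc n) : G" using sqP le_refl by (auto simp: G_def)
      ultimately show ?thesis by blast
    qed
  qed
  moreover have "p : G" unfolding G_def using le_refl[OF assms(2)] assms(2) sq0 by auto
  ultimately show ?thesis by blast
qed

context gext
begin

text \<open>A class dense below \<open>p0\<close> becomes dense everywhere once the conditions
  incompatible with \<open>p0\<close> are added, and none of these is in \<open>G\<close>.\<close>

lemma gen_below:
  assumes "p0 : G" "dP D" "!!p. le p p0 ==> EX q. le q p & D q"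
  shows "EX q:G. le q p0 & D q"
proof -
  note [simp] = dp1[where P=D, OF assms(2)]
  let ?D = "%q. (le q p0 & D q) | ~ (EX r. le r q & le r p0)"
  have "EX q:G. ?D q"
  proof (rule G_generic)
    fix p assume "p <: P"
    show "EX q. le q p & ?D q"
    proof (cases "EX r. le r p & le r p0")
      case True
      then obtain r where r: "le r p" "le r p0" by blast
      then obtain q where "le q r" "D q" using assms(3) by blast
      then show ?thesis using r le_trans by blast
    next
      case False then show ?thesis using le_refl[OF \<open>p <: P\<close>] by blast
    qed
  qed simp
  then show ?thesis using G_dir assms(1) by blast
qed

section \<open>Names modulo equality forced by the filter\<close>

definition geq :: "nat => nat => bool" where "geq x y \<longleftrightarrow> (EX p:G. FE p x y)"
definition gmem :: "nat => nat => bool" where "gmem x y \<longleftrightarrow> (EX p:G. FM p x y)"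

lemma FM_mono: "FM p x y ==> le q p ==> FM q x y" unfolding FM_def using le_trans by blast

lemma FM_cong: assumes "FM p s a" "p <: P" "FE p s s'" shows "FM p s' a"
  unfolding FM_def
proof (intro allI impI)
  fix q assume q: "le q p"
  then obtain r t v where r: "le r q" "pr t v <: a" "le r v" "FE r t s" using assms(1) unfolding FM_def by blast
  have "FE r s s'" using FE_mono[OF _ _ assms(3) le_trans[OF r(1) q]] FE_P[OF assms(3,2)] by blast
  then have "FE r t s'" using FE_trans[OF _ r(4)] le_P[OF r(1)] by blast
  then show "EX r. le r q & (EX t v. pr t v <: a & le r v & FE r t s')" using r by blast
qed

lemma geq_refl: "Name x ==> geq x x" unfolding geq_def using FE_refl e_G e_P by blast
lemma geq_sym: "geq x y ==> geq y x" unfolding geq_def using FE_symI G_P by blast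
lemma geq_trans: assumes "geq x y" "geq y z" shows "geq x z"
proof -
  obtain p q where pq: "p : G" "q : G" "FE p x y" "FE q y z" using assms unfolding geq_def by blast
  then obtain r where r: "r : G" "le r p" "le r q" using G_dir by blast
  have "FE r x y" "FE r y z" using FE_mono[OF _ _ pq(3) r(2)] FE_mono[OF _ _ pq(4) r(3)] FE_P pq G_P by blast+
  then show ?thesis unfolding geq_def using FE_trans r G_P by blast
qed

lemma gmem_iff: "gmem x y \<longleftrightarrow> (EX t v. pr t v <: y & v : G & geq t x)"
proof
  assume "gmem x y"
  then obtain p where p: "p : G" "FM p x y" unfolding gmem_def by blast
  have "EX q:G. le q p & (EX t v. pr t v <: y & le q v & FE q t x)"
    by (rule gen_below[OF p(1)]) (use p(2) in \<open>simp_all add: FM_def\<close>)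
  then show "EX t v. pr t v <: y & v : G & geq t x" unfolding geq_def using G_up by blast
next
  assume "EX t v. pr t v <: y & v : G & geq t x"
  then obtain t v q where t: "pr t v <: y" "v : G" "q : G" "FE q t x" unfolding geq_def by blast
  then obtain r where r: "r : G" "le r v" "le r q" using G_dir by blast
  have "FM r x y" unfolding FM_def
  proof (intro allI impI)
    fix q' assume q': "le q' r"
    have "FE q' t x" using FE_mono[OF _ _ t(4) le_trans[OF q' r(3)]] FE_P[OF t(4)] G_P t by blast
    moreover have "le q' v" "le q' q'" using le_trans[OF q' r(2)] le_refl le_P[OF q'] by blast+
    ultimately show "EX r. le r q' & (EX t v. pr t v <: y & le r v & FE r t x)" using t by blast
  qed
  then show "gmem x y" unfolding gmem_def using r by blast
qed

lemma gmem_self: "Name t ==> pr t v <: y ==> v : G ==> gmem t y" unfolding gmem_iff using geq_refl by blast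

lemma geq_half:
  assumes "Name x" "Name y" "p : G" "FE p x y" "pr s u <: x" "u : G"
  shows "EX t v. pr t v <: y & v : G & geq s t"
proof -
  have s: "stp FE p x y" using assms FE_step G_P by blast
  obtain r0 where r0: "r0 : G" "le r0 p" "le r0 u" using G_dir assms by blast
  have "EX q:G. le q r0 & (EX t v. pr t v <: y & le q v & FE q s t)"
  proof (rule gen_below[OF r0(1)])
    fix q assume q: "le q r0"
    then obtain r where r: "le r q" "le r u --> (EX t v. pr t v <: y & le r v & FE r s t)"
      using s assms(5) le_trans[OF q r0(2)] unfolding stp_def by blast
    then show "EX r. le r q & (EX t v. pr t v <: y & le r v & FE r s t)" using le_trans[OF r(1) le_trans[OF q r0(3)]] by blast
  qed simp
  then show ?thesis unfolding geq_def using G_up by blast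
qed

lemma geq_iff:
  assumes "Name x" "Name y"
  shows "geq x y \<longleftrightarrow> (ALL t. Name t --> gmem t x \<longleftrightarrow> gmem t y)"
proof
  assume "geq x y"
  then have *: "geq x y" "geq y x" using geq_sym by blast+
  have "gmem t y" if xy: "Name x" "Name y" "geq x y" "gmem t x" for x y t
  proof -
    obtain s u where s: "pr s u <: x" "u : G" "geq s t" using xy(4) unfolding gmem_iff by blast
    obtain p where "p : G" "FE p x y" using xy(3) unfolding geq_def by blast
    from geq_half[OF xy(1,2) this s(1,2)]
    obtain t' v where "pr t' v <: y" "v : G" "geq s t'" by blast
    then show ?thesis unfolding gmem_iff[of t y] using geq_trans[OF geq_sym] s(3) by blast
  qed
  then show "ALL t. Name t --> gmem t x \<longleftrightarrow> gmem t y" using assms * by blast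
next
  assume *: "ALL t. Name t --> gmem t x \<longleftrightarrow> gmem t y"
  \<comment> \<open>Where the recursion step for forced equality fails, some extension puts a member
    \<open>s\<close> into one of the names and excludes it from the other for good. Such a condition
    in \<open>G\<close> would contradict the equality of members.\<close>
  let ?bad = "%x y q T. EX s u. pr s u <: x & le q u & ~ (EX r t v. le r q & pr t v <: y & le r v & T r s t)"
  have "EX q:G. FE q x y | ?bad x y q FE | ?bad y x q (%r s t. FE r t s)"
  proof (rule G_generic)
    fix p assume p: "p <: P"
    show "EX q. le q p & (FE q x y | ?bad x y q FE | ?bad y x q (%r s t. FE r t s))"
    proof (cases "FE p x y")
      case True then show ?thesis using le_refl[OF p] by blast
    next
      case False
      then have "~ stp FE p x y" using FE_step[OF assms p] by blast
      then consider s u q where "pr s u <: x" "le q p" "ALL r. le r q --> le r u & ~ (EX t v. pr t v <: y & le r v & FE r s t)"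
        | s u q where "pr s u <: y" "le q p" "ALL r. le r q --> le r u & ~ (EX t v. pr t v <: x & le r v & FE r t s)"
        unfolding stp_def by blast
      then show ?thesis
      proof cases
        case 1 then show ?thesis using le_refl le_P by blast
      next
        case 2 then show ?thesis using le_refl le_P by blast
      qed
    qed
  qed simp
  then obtain q where q: "q : G" "FE q x y | ?bad x y q FE | ?bad y x q (%r s t. FE r t s)" by blast
  have nb: "~ ?bad x y q FE" if "Name x" "Name y" "ALL t. Name t --> gmem t x \<longleftrightarrow> gmem t y" for x y
  proof
    assume "?bad x y q FE"
    then obtain s u where s: "pr s u <: x" "le q u" "~ (EX r t v. le r q & pr t v <: y & le r v & FE r s t)" by blast
    then have "u : G" "Name s" using q G_up NameD that by blast+
    then have "gmem s y" using that gmem_self s by blast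
    then obtain t v where t: "pr t v <: y" "v : G" "geq t s" using gmem_iff by blast
    then obtain q' where q': "q' : G" "FE q' s t" using geq_sym unfolding geq_def by blast
    obtain r where r: "r : G" "le r q" "le r v" using G_dir q(1) t(2) by blast
    obtain r' where r': "r' : G" "le r' r" "le r' q'" using G_dir r(1) q'(1) by blast
    have "FE r' s t" using FE_mono[OF _ _ q'(2) r'(3)] FE_P[OF q'(2)] G_P q' by blast
    then show False using s(3) t(1) le_trans[OF r'(2) r(2)] le_trans[OF r'(2) r(3)] by blast
  qed
  have "?bad y x q (%r s t. FE r t s) --> ?bad y x q FE" using FE_symI le_P by blast
  then have "FE q x y" using q nb[OF assms *] nb[OF assms(2,1)] * by blast
  then show "geq x y" unfolding geq_def using q by blast
qed

lemma gmem_cong: assumes "geq x x'" "geq y y'" "Name x" "Name x'" "Name y" "Name y'"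
  shows "gmem x y \<longleftrightarrow> gmem x' y'"
proof -
  have "gmem x y \<longleftrightarrow> gmem x' y" unfolding gmem_iff using assms(1) geq_sym geq_trans by blast
  then show ?thesis using geq_iff[OF assms(5,6)] assms by blast
qed

lemma geq_chk: "geq (chk x) (chk y) \<longleftrightarrow> x = y"
  using FE_chk G_P geq_refl[OF Name_chk] unfolding geq_def by blast

definition cls :: "nat => nat set" where "cls x = {y. Name y & geq x y}"
text \<open>The classes of names are numbered, so that the extension is again a relation on
  \<open>nat\<close> to which the locale \<open>zfc\<close> applies. Check names give infinitely
  many classes, so every number is used (\<open>pi_surj\<close>).\<close>

definition pi :: "nat => nat" where "pi x = to_nat_on (cls ` {x. Name x}) (cls x)"
definition EN :: "nat => nat => bool" where
  "EN a b \<longleftrightarrow> (EX x y. Name x & Name y & pi x = a & pi y = b & gmem x y)"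

lemma cls_eq: assumes "Name x" "Name y" shows "cls x = cls y \<longleftrightarrow> geq x y"
proof
  assume "cls x = cls y"
  moreover have "y : cls y" using assms geq_refl by (simp add: cls_def)
  ultimately have "y : cls x" by simp
  then show "geq x y" by (simp add: cls_def)
next
  assume "geq x y"
  then show "cls x = cls y" unfolding cls_def using geq_sym geq_trans by blast
qed

lemma pi_eq: "Name x ==> Name y ==> pi x = pi y \<longleftrightarrow> geq x y"
  unfolding pi_def cls_eq[symmetric] by (subst to_nat_on_inj) auto

lemma pi_surj: "EX x. Name x & pi x = a"
proof -
  have "inj (%x. cls (chk x))" by (rule injI) (simp add: cls_eq geq_chk)
  then have "infinite (range (%x. cls (chk x)))" using finite_imageD infinite_UNIV_nat by blast
  moreover have "range (%x. cls (chk x)) \<subseteq> cls ` {x. Name x}" by auto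
  ultimately have "infinite (cls ` {x. Name x})" using finite_subset by blast
  then obtain c where "c : cls ` {x. Name x}" "to_nat_on (cls ` {x. Name x}) c = a"
    using to_nat_on_surj[of "cls ` {x. Name x}" a] by auto
  then show ?thesis unfolding pi_def by auto
qed

definition nm :: "nat => nat" where "nm a = (SOME x. Name x & pi x = a)"
lemma Name_nm [simp]: "Name (nm a)" and pi_nm [simp]: "pi (nm a) = a"
  using someI_ex[OF pi_surj[of a]] unfolding nm_def by blast+

lemma EN_pi: "Name x ==> Name y ==> EN (pi x) (pi y) \<longleftrightarrow> gmem x y"
  unfolding EN_def using pi_eq gmem_cong by blast

lemma EN_iff: assumes "Name y" shows "EN a (pi y) \<longleftrightarrow> (EX t v. pr t v <: y & v : G & pi t = a)"
proof -
  have "EN a (pi y) \<longleftrightarrow> gmem (nm a) y" using EN_pi[OF Name_nm assms, of a] by simp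
  also have "... \<longleftrightarrow> (EX t v. pr t v <: y & v : G & pi t = a)"
    unfolding gmem_iff using pi_eq[OF _ Name_nm, of _ a] NameD[OF assms] by simp blast
  finally show ?thesis .
qed

lemma truth: "(!!i. Name (env i)) ==> sat EN (%i. pi (env i)) \<phi> \<longleftrightarrow> (EX p:G. forces E P l p env \<phi>)"
proof (induction \<phi> arbitrary: env)
  case (Mem i j) then show ?case by (simp add: EN_pi gmem_def)
next
  case (Equ i j) then show ?case by (simp add: pi_eq geq_def)
next
  case (Neg \<phi>)
  \<comment> \<open>Genericity needs a definable class; \<open>ftr\<close> provides the formula,
    with the poset, its order and the names as parameters.\<close>
  have d: "dP (%p. forces E P l p env \<phi>)"
    by (rule dpI[where s="%n. if n = 0 then P else if n = 1 then l else env (n - 2)" and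
        \<phi>="ren (ftr \<phi>) (%k. if k = 0 then 1 else if k = 1 then 3 else if k = 2 then 0 else 2 * (k - 1) + 1)"])
      (simp add: sat_ren sat_ftr mrg_def)
  note [simp] = dp1[where P="%p. forces E P l p env \<phi>", OF d]
  have "EX p:G. forces E P l p env \<phi> | forces E P l p env (Neg \<phi>)"
    by (rule G_generic) (use le_refl in \<open>auto simp: forces_Neg\<close>)
  moreover have "~ ((EX p:G. forces E P l p env \<phi>) & (EX p:G. forces E P l p env (Neg \<phi>)))"
  proof
    assume "(EX p:G. forces E P l p env \<phi>) & (EX p:G. forces E P l p env (Neg \<phi>))"
    then obtain p q where pq: "p : G" "q : G" "forces E P l p env \<phi>" "forces E P l q env (Neg \<phi>)" by blast
    then obtain r where "le r p" "le r q" using G_dir by blast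
    then show False using forces_mono[OF pq(3) Neg.prems] pq(4) unfolding forces_Neg by blast
  qed
  ultimately show ?case using Neg by auto
next
  case (Conj \<phi> \<psi>)
  have "(EX p:G. forces E P l p env \<phi>) & (EX p:G. forces E P l p env \<psi>) --> (EX p:G. forces E P l p env (Conj \<phi> \<psi>))"
  proof (intro impI, elim conjE bexE)
    fix p q assume pq: "p : G" "q : G" "forces E P l p env \<phi>" "forces E P l q env \<psi>"
    then obtain r where "r : G" "le r p" "le r q" using G_dir by blast
    then show "EX p:G. forces E P l p env (Conj \<phi> \<psi>)"
      using forces_mono[OF pq(3) Conj.prems] forces_mono[OF pq(4) Conj.prems] by auto
  qed
  then show ?case using Conj by auto
next
  case (Forall n \<phi>)
  have nenv: "Name ((env(n := x)) i)" if "Name x" for x i using that Forall.prems by simp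
  have upd: "(%i. pi ((env(n := x)) i)) = (%i. pi (env i))(n := pi x)" for x by auto
  have IH: "sat EN ((%i. pi (env i))(n := pi x)) \<phi> \<longleftrightarrow> (EX p:G. forces E P l p (env(n := x)) \<phi>)" if "Name x" for x
    using Forall.IH[of "env(n := x)", OF nenv[OF that]] unfolding upd .
  have d: "dP2 (%p x. forces E P l p (env(n := x)) \<phi>)"
    by (rule dpI[where s="%n. if n = 0 then P else if n = 1 then l else env (n - 2)" and
        \<phi>="ren (ftr \<phi>) (%k. if k = 0 then 1 else if k = 1 then 3 else if k = 2 then 0 else if k = n + 3 then 2 else 2 * (k - 1) + 1)"])
      (auto simp: sat_ren sat_ftr mrg_def intro!: arg_cong[where f="%e. forces E P l _ e \<phi>"])
  note [simp] = dp2[where P="%p x. forces E P l p (env(n := x)) \<phi>", OF d]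
  have "EX p:G. forces E P l p env (Forall n \<phi>) | (EX x. Name x & forces E P l p (env(n := x)) (Neg \<phi>))"
  proof (rule G_generic)
    fix p assume p: "p <: P"
    show "EX q. le q p & (forces E P l q env (Forall n \<phi>) | (EX x. Name x & forces E P l q (env(n := x)) (Neg \<phi>)))"
    proof (cases "forces E P l p env (Forall n \<phi>)")
      case True then show ?thesis using le_refl[OF p] by blast
    next
      case False
      then obtain x where x: "Name x" "~ forces E P l p (env(n := x)) \<phi>" by auto
      then obtain q where "le q p" "~ (EX r. le r q & forces E P l r (env(n := x)) \<phi>)"
        using forces_dense[OF p, of "env(n := x)" \<phi>] nenv[OF x(1)] by blast
      then show ?thesis using x unfolding forces_Neg by blast
    qed
  qed (simp add: forces_Neg forces_Forall)
  moreover have False if "Name x" "p : G" "q : G" "forces E P l p (env(n := x)) (Neg \<phi>)" "forces E P l q (env(n := x)) \<phi>" for x p q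
    using G_dir[OF that(2,3)] forces_mono[OF that(5) nenv[OF that(1)]] that(4) unfolding forces_Neg by blast
  ultimately have "(ALL x. Name x --> (EX p:G. forces E P l p (env(n := x)) \<phi>)) \<longleftrightarrow> (EX p:G. forces E P l p env (Forall n \<phi>))"
    unfolding forces_Forall by blast
  moreover have "sat EN (%i. pi (env i)) (Forall n \<phi>) \<longleftrightarrow> (ALL x. Name x --> sat EN ((%i. pi (env i))(n := pi x)) \<phi>)"
    using pi_surj by (simp, metis)
  ultimately show ?case using IH by blast
qed

section \<open>The embedding of the ground model, and the axioms in the extension\<close>

definition j :: "nat => nat" where "j x = pi (chk x)"

lemma j_eq [simp]: "j x = j y \<longleftrightarrow> x = y" unfolding j_def by (simp add: pi_eq geq_chk)
lemma EN_j: "EN a (j x) \<longleftrightarrow> (EX v. v <: x & a = j v)"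
  unfolding j_def EN_iff[OF Name_chk] mem_chk pr_eq using e_G by blast
lemma EN_j_j [simp]: "EN (j x) (j y) \<longleftrightarrow> x <: y" by (auto simp: EN_j)

subsection \<open>The extension is a model of ZFC\<close>

lemma NameI: assumes "!!z. z <: B ==> EX s p. Name s & p <: P & z = pr s p" shows "Name B"
proof -
  let ?N = "cup (Sep (tcl B) Name) (sg B)"
  have "nset ?N" unfolding nset_def
  proof (intro allI impI, elim conjE)
    fix x z assume x: "x <: ?N" "z <: x"
    have xt: "x <: tcl B" using x by auto
    have "EX s p. Name s & p <: P & z = pr s p"
      using x assms NameD[of x] Name_pair[of x z] by auto
    then obtain s p where s: "Name s" "p <: P" "z = pr s p" by blast
    have "s <: upr s s" "upr s s <: z" using s by (auto simp: pr_def)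
    then have "s <: tcl B" using tclD[OF tclD[OF tclD[OF xt x(2)]]] by blast
    then show "EX s p. s <: ?N & p <: P & z = pr s p" using s by auto
  qed
  moreover have "B <: ?N" by simp
  ultimately show ?thesis unfolding Name_def[of B] by blast
qed

lemma Name_prd: "(!!s. s <: A ==> Name s) ==> Name (prd A (sg e))"
  by (rule NameI) (auto simp: mem_prd)
lemma EN_prd: "(!!s. s <: A ==> Name s) ==> EN a (pi (prd A (sg e))) \<longleftrightarrow> (EX s. s <: A & pi s = a)"
  by (subst EN_iff[OF Name_prd]) (auto simp: e_G)

lemma EN_ext: "(!!z. EN z x \<longleftrightarrow> EN z y) ==> x = y"
proof -
  assume *: "!!z. EN z x \<longleftrightarrow> EN z y"
  have "gmem t (nm x) \<longleftrightarrow> gmem t (nm y)" if "Name t" for t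
    using *[of "pi t"] EN_pi[OF that Name_nm, of x] EN_pi[OF that Name_nm, of y] by simp
  then have "geq (nm x) (nm y)" using geq_iff by simp
  then show ?thesis using pi_eq[of "nm x" "nm y"] by simp
qed

text \<open>A name of least rank cannot be chosen from outside: the model may be ill-founded, and
  \<open>G\<close> need not be a class of it. Instead it is dense to decide a minimal element of
  \<open>A\<close>: if a name t forced into \<open>A\<close> is not minimal, a stronger condition
  forces some member of t, a name of smaller rank, into \<open>A\<close>, and induction
  applies.\<close>

lemma EN_foundation: assumes "EN y x" shows "EX y. EN y x & ~ (EX z. EN z x & EN z y)"
proof -
  define A where "A = nm x"
  have A: "Name A" "pi A = x" by (auto simp: A_def)
  let ?D = "%q. EX t. Name t & FM q t A & ~ (EX s r. Name s & le r q & FM r s A & FM r s t)"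
  have D: "Name t --> (ALL q. q <: P --> FM q t A --> (EX r. le r q & ?D r))" for t
  proof (induction t rule: rk_induct)
    case (2 t)
    show ?case
    proof (intro impI allI)
      fix q assume t: "Name t" "q <: P" "FM q t A"
      show "EX r. le r q & ?D r"
      proof (cases "EX s r. Name s & le r q & FM r s A & FM r s t")
        case True
        then obtain s r where s: "Name s" "le r q" "FM r s A" "FM r s t" by blast
        have rP: "r <: P" using s le_P by blast
        then obtain r' s' v where r': "le r' r" "pr s' v <: t" "FE r' s' s"
          using s(4) le_refl unfolding FM_def by blast
        have r'P: "r' <: P" using r' le_P by blast
        have "FM r' s' A" by (rule FM_cong[OF FM_mono[OF s(3) r'(1)] r'P FE_symI[OF r'P r'(3)]])
        then obtain r'' where "le r'' r'" "?D r''" using 2[OF r'(2)] NameD[OF t(1) r'(2)] r'P by blast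
        then show ?thesis using le_trans r'(1) s(2) by blast
      next
        case False then show ?thesis using t le_refl by blast
      qed
    qed
  qed simp
  have "gmem (nm y) A" using assms EN_pi[of "nm y" A] A by simp
  then obtain p where p: "p : G" "FM p (nm y) A" unfolding gmem_def by blast
  have "EX q:G. le q p & ?D q"
  proof (rule gen_below[OF p(1)])
    fix q assume "le q p"
    then show "EX r. le r q & ?D r" using D[of "nm y"] FM_mono[OF p(2)] le_P by simp
  qed simp
  then obtain q t where q: "q : G" "Name t" "FM q t A" "~ (EX s r. Name s & le r q & FM r s A & FM r s t)" by blast
  have "~ (EN z x & EN z (pi t))" for z
  proof
    assume "EN z x & EN z (pi t)"
    then have "gmem (nm z) A" "gmem (nm z) t" using EN_pi[of "nm z" A] EN_pi[of "nm z" t] A q by simp_all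
    then obtain r1 r2 where r: "r1 : G" "r2 : G" "FM r1 (nm z) A" "FM r2 (nm z) t" unfolding gmem_def by blast
    then obtain r3 r where "r3 : G" "le r3 r1" "le r3 r2" "le r r3" "le r q" using G_dir q by meson
    then have "le r q" "FM r (nm z) A" "FM r (nm z) t" using r FM_mono le_trans by blast+
    then show False using q(4) Name_nm by blast
  qed
  moreover have "EN (pi t) x" using EN_pi[OF q(2) A(1)] A(2) q unfolding gmem_def by blast
  ultimately show ?thesis by blast
qed

lemma dp_forces_env:
  assumes "dt t" "dt x" "dt y" shows "dp (%e. forces E P l (t e) (env(m := x e, n := y e)) \<phi>)"
proof (rule dp3[where P="%p x y. forces E P l p (env(m := x, n := y)) \<phi>", OF _ assms])
  define \<sigma> where "\<sigma> = (%n. if n = 0 then P else if n = 1 then l else env (n - 2))"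
  define \<rho> where "\<rho> = (%k::nat. if k = 0 then 1 else if k = 1 then 3 else if k = 2 then 0 else if k = n + 3 then 4
          else if k = m + 3 then 2 else 2 * (k - 1) + 1)"
  show "dp (%e. forces E P l (e 0) (env(m := e (Suc 0), n := e (Suc (Suc 0)))) \<phi>)"
  proof (rule dpI[where s=\<sigma> and \<phi>="ren (ftr \<phi>) \<rho>"])
    fix e
    have "mrg e \<sigma> (\<rho> (k + 3)) = (env(m := e (Suc 0), n := e (Suc (Suc 0)))) k" for k
    proof -
      have "\<sigma> (2 + k) = env k" by (simp add: \<sigma>_def)
      moreover have "mrg e \<sigma> (2 * (2 + k) + 1) = \<sigma> (2 + k)" by (simp add: mrg_def)
      moreover have "mrg e \<sigma> 4 = e (Suc (Suc 0))" "mrg e \<sigma> 2 = e (Suc 0)"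
        by (auto simp: mrg_def numeral_2_eq_2[symmetric])
      ultimately show ?thesis by (auto simp: \<rho>_def)
    qed
    then have "(%k. mrg e \<sigma> (\<rho> (k + 3))) = env(m := e (Suc 0), n := e (Suc (Suc 0)))" by (rule HOL.ext)
    then show "forces E P l (e 0) (env(m := e (Suc 0), n := e (Suc (Suc 0)))) \<phi> = sat E (mrg e \<sigma>) (ren (ftr \<phi>) \<rho>)"
      unfolding sat_ren sat_ftr by (simp add: \<rho>_def \<sigma>_def mrg_def)
  qed
qed

lemma dp_forces_env1: "dt t ==> dt x ==> dp (%e. forces E P l (t e) (env(n := x e)) \<phi>)"
  using dp_forces_env[of t x x env n n \<phi>] by simp

lemma truth_env: assumes "Name x" "Name y"
  shows "sat EN (env(m := pi x, n := pi y)) \<phi> \<longleftrightarrow> (EX p:G. forces E P l p ((%i. nm (env i))(m := x, n := y)) \<phi>)"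
proof -
  have "(%i. pi (((%i. nm (env i))(m := x, n := y)) i)) = env(m := pi x, n := pi y)" by auto
  then show ?thesis using truth[of "(%i. nm (env i))(m := x, n := y)" \<phi>] assms by auto
qed

lemma EN_separation: "EX b. ALL x. EN x b \<longleftrightarrow> EN x a & sat EN (env(0 := x)) \<phi>"
proof -
  define A where "A = nm a"
  have A: "Name A" "pi A = a" by (auto simp: A_def)
  let ?F = "%p s. forces E P l p ((%i. nm (env i))(0 := s)) \<phi>"
  note [simp] = dp_forces_env1[where env="%i. nm (env i)"]
  have tr: "sat EN (env(0 := pi s)) \<phi> \<longleftrightarrow> (EX p:G. ?F p s)" if "Name s" for s
    using truth_env[OF that that, of env 0 0 \<phi>] by simp
  define B where "B = Sep (prd (domn A) P) (%z. EX s p v. z = pr s p & pr s v <: A & le p v & ?F p s)"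
  have B: "z <: B \<longleftrightarrow> (EX s p v. z = pr s p & pr s v <: A & le p v & ?F p s)" for z
    unfolding B_def using le_P by (auto simp: mem_prd)
  have NB: "Name B" by (rule NameI) (use B NameD[OF A(1)] le_P in blast)
  have "EN x (pi B) \<longleftrightarrow> EN x a & sat EN (env(0 := x)) \<phi>" for x
  proof
    assume "EN x (pi B)"
    then obtain s p v where s: "pi s = x" "p : G" "pr s v <: A" "le p v" "?F p s"
      unfolding EN_iff[OF NB] B by auto
    have "Name s" "v : G" using NameD[OF A(1) s(3)] G_up s by blast+
    then show "EN x a & sat EN (env(0 := x)) \<phi>"
      using s tr[of s] EN_iff[OF A(1), of x] A(2) by blast
  next
    assume x: "EN x a & sat EN (env(0 := x)) \<phi>"
    then obtain s v where s: "pr s v <: A" "v : G" "pi s = x" using EN_iff[OF A(1), of x] A(2) by blast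
    have Ns: "Name s" using NameD[OF A(1) s(1)] by blast
    then obtain q where q: "q : G" "?F q s" using x tr[of s] s(3) by blast
    obtain p where p: "p : G" "le p q" "le p v" using G_dir q s by blast
    have "?F p s" by (rule forces_mono[OF q(2) _ p(2)]) (simp add: Ns)
    then have "pr s p <: B" unfolding B using s p by blast
    then show "EN x (pi B)" unfolding EN_iff[OF NB] using p s by blast
  qed
  then show ?thesis by blast
qed

text \<open>Collection in the ground model, applied to pairs of a potential member and a condition,
  bounds the names that are needed as values.\<close>

lemma EN_replacement:
  assumes "!!x. EN x a ==> EX! y. sat EN (env(0 := x, 1 := y)) \<phi>"
  shows "EX b. ALL x. EN x a --> (EX y. EN y b & sat EN (env(0 := x, 1 := y)) \<phi>)"
proof -
  define A where "A = nm a"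
  have A: "Name A" "pi A = a" by (auto simp: A_def)
  let ?F = "%p s y. forces E P l p ((%i. nm (env i))(0 := s, 1 := y)) \<phi>"
  note [simp] = dp_forces_env[where env="%i. nm (env i)" and m=0 and n="Suc 0"]
  note tr = truth_env[of _ _ env 0 1 \<phi>]
  have "dP2 (%z y. Name y & (EX s p. z = pr s p & ?F p s y))" by simp
  from collection[OF this, of "prd (domn A) P"]
  obtain B where B: "ALL z. z <: prd (domn A) P --> (EX y. Name y & (EX s p. z = pr s p & ?F p s y)) -->
     (EX y. y <: B & Name y & (EX s p. z = pr s p & ?F p s y))" by blast
  let ?B = "Sep B Name"
  have "EX y. EN y (pi (prd ?B (sg e))) & sat EN (env(0 := x, 1 := y)) \<phi>" if x: "EN x a" for x
  proof -
    obtain s v where s: "pr s v <: A" "v : G" "pi s = x" using x EN_iff[OF A(1), of x] A(2) by blast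
    have Ns: "Name s" using NameD[OF A(1) s(1)] by blast
    obtain y where "sat EN (env(0 := x, 1 := y)) \<phi>" using assms[OF x] by blast
    then obtain p where p: "p : G" "?F p s (nm y)" using tr[OF Ns Name_nm, of y] s(3) by auto
    have "pr s p <: prd (domn A) P" using s p G_P by auto
    moreover have "EX y. Name y & (EX s' p'. pr s p = pr s' p' & ?F p' s' y)" using p(2) Name_nm[of y] by blast
    ultimately have "EX y. y <: B & Name y & (EX s' p'. pr s p = pr s' p' & ?F p' s' y)" using B by blast
    then obtain Y where Y: "Y <: B" "Name Y" "?F p s Y" unfolding pr_eq by blast
    then have "sat EN (env(0 := x, 1 := pi Y)) \<phi>" using tr[OF Ns Y(2)] p s(3) by blast
    moreover have "EN (pi Y) (pi (prd ?B (sg e)))" using Y by (subst EN_prd) auto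
    ultimately show ?thesis by blast
  qed
  then show ?thesis by blast
qed

text \<open>Each subset of \<open>a\<close> has a name contained in \<open>prd (domn A) P\<close>,
  so these names together bound the power set.\<close>

lemma EN_power: "EX b. ALL x. (ALL z. EN z x --> EN z a) --> EN x b"
proof -
  define A where "A = nm a"
  have A: "Name A" "pi A = a" by (auto simp: A_def)
  let ?B = "Pw (prd (domn A) P)"
  have NB: "Name z" if "z <: ?B" for z
  proof (rule NameI)
    fix y assume "y <: z"
    then have "y <: prd (domn A) P" using that subD by simp
    then show "EX s p. Name s & p <: P & y = pr s p" using NameD[OF A(1)] unfolding mem_prd mem_domn by blast
  qed
  have "EN x (pi (prd ?B (sg e)))" if x: "ALL z. EN z x --> EN z a" for x
  proof -
    define X where "X = nm x"
    have X: "Name X" "pi X = x" by (auto simp: X_def)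
    define Z where "Z = Sep (prd (domn A) P) (%z. EX s p. z = pr s p & FM p s X)"
    have Z: "pr s p <: Z \<longleftrightarrow> s <: domn A & p <: P & FM p s X" for s p unfolding Z_def by auto
    have ZB: "Z <: ?B" unfolding Z_def by (auto simp: sub_def)
    have "EN y (pi Z) \<longleftrightarrow> EN y x" for y
    proof
      assume "EN y (pi Z)"
      then obtain s p where s: "s <: domn A" "FM p s X" "p : G" "pi s = y" unfolding EN_iff[OF NB[OF ZB]] Z by blast
      then have "Name s" using NameD[OF A(1)] by auto
      then show "EN y x" using EN_pi[of s X] X s unfolding gmem_def by blast
    next
      assume y: "EN y x"
      then have "EN y (pi A)" using x A by simp
      then obtain s v where s: "pr s v <: A" "v : G" "pi s = y" unfolding EN_iff[OF A(1)] by blast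
      have "Name s" using NameD[OF A(1) s(1)] by blast
      then obtain p where "p : G" "FM p s X" using EN_pi[of s X] X s y unfolding gmem_def by blast
      then have "pr s p <: Z" unfolding Z using s(1) G_P by auto
      then show "EN y (pi Z)" unfolding EN_iff[OF NB[OF ZB]] using \<open>p : G\<close> s by blast
    qed
    then have "pi Z = x" by (rule EN_ext)
    then show ?thesis using ZB by (subst EN_prd[OF NB]) auto
  qed
  then show ?thesis by blast
qed

text \<open>All potential members of members of \<open>A\<close> are enumerated along an ordinal
  \<theta>. The choice set takes from each member of \<open>A\<close> the element of least index: a
  condition contributes \<open>F \<xi>\<close> only if none of its extensions admits an earlier
  candidate.\<close>

lemma EN_choice:
  assumes ne: "!!x. EN x a ==> EX z. EN z x" and dj: "!!x y z. EN x a ==> EN y a ==> EN z x ==> EN z y ==> x = y"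
  shows "EX c. ALL x. EN x a --> (EX! z. EN z x & EN z c)"
proof -
  define A where "A = nm a"
  have A: "Name A" "pi A = a" by (auto simp: A_def)
  define D2 where "D2 = Uni (Rep (domn A) domn)"
  have D2: "s <: D2 \<longleftrightarrow> (EX t v u. pr t v <: A & pr s u <: t)" for s
      unfolding D2_def by (subst mem_UniRep) (simp, unfold mem_domn, blast)
  have ND: "Name s" if "s <: D2" for s using that NameD A(1) unfolding D2 by blast
  obtain \<theta> where \<theta>: "Ord \<theta>" "eqp \<theta> D2" using ex_Ord_eqp by blast
  obtain F where F: "dF F" "bij_betw F (ext \<theta>) (ext D2)" using \<theta>(2) by (rule eqpE)
  note [simp] = dt1[where F=F, OF F(1)]
  have FD: "\<xi> <: \<theta> ==> F \<xi> <: D2" for \<xi> using F(2) unfolding bij_ext by blast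
  define C where "C = Sep (prd D2 P) (%z. EX \<xi> p x v. \<xi> <: \<theta> & z = pr (F \<xi>) p & pr x v <: A & le p v &
     FM p (F \<xi>) x & (ALL \<eta> q. \<eta> <: \<xi> --> le q p --> ~ FM q (F \<eta>) x))"
  have C: "z <: C \<longleftrightarrow> (EX \<xi> p x v. \<xi> <: \<theta> & z = pr (F \<xi>) p & pr x v <: A & le p v &
     FM p (F \<xi>) x & (ALL \<eta> q. \<eta> <: \<xi> --> le q p --> ~ FM q (F \<eta>) x))" for z
    unfolding C_def using FD le_P by auto
  have NC: "Name C" by (rule NameI) (use C ND[OF FD] le_P in blast)
  have gm: "gmem (F \<xi>) x \<longleftrightarrow> EN (pi (F \<xi>)) (pi x)" if "\<xi> <: \<theta>" "Name x" for \<xi> x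
    using EN_pi[OF ND[OF FD[OF that(1)]] that(2)] by simp
  have mem_c: "EX \<xi> x. \<xi> <: \<theta> & z = pi (F \<xi>) & EN (pi x) a & EN z (pi x) & (ALL \<eta>. \<eta> <: \<xi> --> ~ EN (pi (F \<eta>)) (pi x))"
    if z: "EN z (pi C)" for z
  proof -
    obtain \<xi> p x v where s: "\<xi> <: \<theta>" "p : G" "z = pi (F \<xi>)" "pr x v <: A" "le p v" "FM p (F \<xi>) x"
      "ALL \<eta> q. \<eta> <: \<xi> --> le q p --> ~ FM q (F \<eta>) x"
      using z unfolding EN_iff[OF NC] C by auto
    have Nx: "Name x" and vG: "v : G" using NameD[OF A(1) s(4)] G_up s by blast+
    have "EN (pi x) a" using EN_iff[OF A(1)] A(2) s vG by blast
    moreover have "EN z (pi x)" using gm[OF s(1) Nx] s unfolding gmem_def by blast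
    moreover have "~ EN (pi (F \<eta>)) (pi x)" if h: "\<eta> <: \<xi>" for \<eta>
    proof
      assume "EN (pi (F \<eta>)) (pi x)"
      then have "gmem (F \<eta>) x" using gm[OF Ord_trans[OF \<theta>(1) s(1) h] Nx] by blast
      then obtain q where "q : G" "FM q (F \<eta>) x" unfolding gmem_def by blast
      then obtain r where "le r p" "FM r (F \<eta>) x" using G_dir[OF s(2)] FM_mono by blast
      then show False using s(7) h by blast
    qed
    ultimately show ?thesis using s by blast
  qed
  have "EX! z. EN z X & EN z (pi C)" if X: "EN X a" for X
  proof -
    obtain x v where x: "pr x v <: A" "v : G" "pi x = X" using X EN_iff[OF A(1), of X] A(2) by blast
    have Nx: "Name x" using NameD[OF A(1) x(1)] by blast
    obtain z where "EN z X" using ne[OF X] by blast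
    then obtain s u where s: "pr s u <: x" "u : G" unfolding x(3)[symmetric] EN_iff[OF Nx] by blast
    then have "s <: D2" unfolding D2 using x by blast
    then obtain \<xi>0 where xi0: "\<xi>0 <: \<theta>" "F \<xi>0 = s" using F(2) unfolding bij_ext by blast
    obtain q0 where q0: "q0 : G" "FM q0 (F \<xi>0) x" using gmem_self[OF _ s] NameD[OF Nx s(1)] xi0 unfolding gmem_def by blast
    obtain r0 where r0: "r0 : G" "le r0 q0" "le r0 v" using G_dir q0 x by blast
    have "EX q:G. le q r0 & (EX \<xi>. \<xi> <: \<theta> & FM q (F \<xi>) x & (ALL \<eta> r. \<eta> <: \<xi> --> le r q --> ~ FM r (F \<eta>) x))"
    proof (rule gen_below[OF r0(1)])
      fix p assume p: "le p r0"
      let ?Q = "%\<xi>. \<xi> <: \<theta> & (EX q. le q p & FM q (F \<xi>) x)"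
      have Q0: "?Q \<xi>0" using xi0 FM_mono[OF q0(2) le_trans[OF p r0(2)]] le_refl le_P[OF p] by blast
      have dQ: "dP ?Q" by simp
      note 1 = lst(2)[OF dQ Ord_mem[OF \<theta>(1) xi0(1)] Q0] and 2 = lst(3)[OF dQ Ord_mem[OF \<theta>(1) xi0(1)] Q0]
      obtain q where q: "le q p" "FM q (F (lst ?Q)) x" using 1 by blast
      have "~ FM r (F \<eta>) x" if "\<eta> <: lst ?Q" "le r q" for \<eta> r
        using 2[OF that(1)] Ord_trans[OF \<theta>(1) conjunct1[OF 1] that(1)] le_trans[OF that(2) q(1)] by blast
      then show "EX q. le q p & (EX \<xi>. \<xi> <: \<theta> & FM q (F \<xi>) x & (ALL \<eta> r. \<eta> <: \<xi> --> le r q --> ~ FM r (F \<eta>) x))"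
        using q 1 by blast
    qed simp
    then obtain q \<xi> where q: "q : G" "le q r0" "\<xi> <: \<theta>" "FM q (F \<xi>) x" "ALL \<eta> r. \<eta> <: \<xi> --> le r q --> ~ FM r (F \<eta>) x" by blast
    have "pr (F \<xi>) q <: C" unfolding C using q x le_trans[OF q(2) r0(3)] by blast
    then have 1: "EN (pi (F \<xi>)) (pi C)" unfolding EN_iff[OF NC] using q by blast
    have 2: "EN (pi (F \<xi>)) X" using gm[OF q(3) Nx] q x unfolding gmem_def by blast
    show ?thesis
    proof (rule ex1I[of _ "pi (F \<xi>)"])
      show "EN (pi (F \<xi>)) X & EN (pi (F \<xi>)) (pi C)" using 1 2 by blast
      fix z assume z: "EN z X & EN z (pi C)"
      obtain \<xi>1 x1 where 3: "\<xi>1 <: \<theta>" "z = pi (F \<xi>1)" "EN (pi x1) a" "EN z (pi x1)" "ALL \<eta>. \<eta> <: \<xi>1 --> ~ EN (pi (F \<eta>)) (pi x1)"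
        using mem_c z by blast
      obtain \<xi>2 x2 where 4: "\<xi>2 <: \<theta>" "pi (F \<xi>) = pi (F \<xi>2)" "EN (pi x2) a" "EN (pi (F \<xi>)) (pi x2)" "ALL \<eta>. \<eta> <: \<xi>2 --> ~ EN (pi (F \<eta>)) (pi x2)"
        using mem_c 1 by blast
      have x12: "pi x1 = X" "pi x2 = X" using dj 3 4 z 2 X by blast+
      have "Ord \<xi>1" "Ord \<xi>2" using 3 4 Ord_mem[OF \<theta>(1)] by blast+
      then have "\<xi>1 = \<xi>2" using Ord_linear[of \<xi>1 \<xi>2] 3 4 z 2 unfolding x12 by auto
      then show "z = pi (F \<xi>)" using 3 4 by simp
    qed
  qed
  then show ?thesis by blast
qed

lemma ZFC_EN: "ZFC_model EN"
  unfolding ZFC_model_def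
proof (intro conjI)
  show "ALL x y. (ALL z. EN z x \<longleftrightarrow> EN z y) --> x = y" using EN_ext by blast
  show "ALL x. (EX y. EN y x) --> (EX y. EN y x & ~ (EX z. EN z x & EN z y))" using EN_foundation by blast
  show "ALL x y. EX z. EN x z & EN y z"
  proof (intro allI)
    fix x y
    have "EN a (pi (prd (upr (nm x) (nm y)) (sg e))) \<longleftrightarrow> (EX s. s <: upr (nm x) (nm y) & pi s = a)" for a
      by (rule EN_prd) auto
    then show "EX z. EN x z & EN y z" by (intro exI[of _ "pi (prd (upr (nm x) (nm y)) (sg e))"]) auto
  qed
  show "ALL a. EX u. ALL y x. EN x y & EN y a --> EN x u"
  proof (rule allI)
    fix a
    define A where "A = nm a"
    have A: "Name A" "pi A = a" by (auto simp: A_def)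
    define D2 where "D2 = Uni (Rep (domn A) domn)"
    have D2: "s <: D2 \<longleftrightarrow> (EX t v u. pr t v <: A & pr s u <: t)" for s
      unfolding D2_def by (subst mem_UniRep) (simp, unfold mem_domn, blast)
    have ND: "Name s" if "s <: D2" for s using that NameD A(1) unfolding D2 by blast
    have "EN x (pi (prd D2 (sg e)))" if xy: "EN x y" "EN y a" for x y
    proof -
      obtain t v where t: "pr t v <: A" "pi t = y" using xy(2) EN_iff[OF A(1), of y] A(2) by blast
      have "Name t" using NameD[OF A(1) t(1)] by blast
      then obtain s u where "pr s u <: t" "pi s = x" using xy(1) EN_iff[of t x] t(2) by blast
      then show ?thesis using t(1) by (subst EN_prd[OF ND]) (auto simp: D2)
    qed
    then show "EX u. ALL y x. EN x y & EN y a --> EN x u" by blast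
  qed
  show "ALL a. EX b. ALL x. (ALL z. EN z x --> EN z a) --> EN x b" using EN_power by blast
  show "EX a. (EX e. EN e a & (ALL z. ~ EN z e)) & (ALL y. EN y a --> (EX s. EN s a & (ALL z. EN z s \<longleftrightarrow> EN z y | z = y)))"
  proof (rule exI[of _ "j om"], intro conjI allI impI)
    show "EX e. EN e (j om) & (ALL z. ~ EN z e)" by (intro exI[of _ "j emp"]) (simp add: EN_j)
    fix y assume "EN y (j om)"
    then obtain n where "n <: om" "y = j n" unfolding EN_j by blast
    then show "EX s. EN s (j om) & (ALL z. EN z s \<longleftrightarrow> EN z y | z = y)"
      by (intro exI[of _ "j (suc n)"]) (auto simp: EN_j)
  qed
  show "ALL a. (ALL x. EN x a --> (EX z. EN z x)) & (ALL x y z. EN x a & EN y a & EN z x & EN z y --> x = y) -->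
      (EX c. ALL x. EN x a --> (EX! z. EN z x & EN z c))"
    by (intro allI impI, rule EN_choice) blast+
  show "ALL \<phi> env a. EX b. ALL x. EN x b \<longleftrightarrow> EN x a & sat EN (env(0 := x)) \<phi>" using EN_separation by blast
  show "ALL \<phi> env a. (ALL x. EN x a --> (EX! y. sat EN (env(0 := x, 1 := y)) \<phi>)) -->
      (EX b. ALL x. EN x a --> (EX y. EN y b & sat EN (env(0 := x, 1 := y)) \<phi>))"
    by (intro allI impI, rule EN_replacement) blast
qed

text \<open>From here on all set theory proved above is available inside the extension, under the
  prefix \<open>N\<close>.\<close>

sublocale N: zfc EN
  by unfold_locales (rule ZFC_EN)

end

section \<open>Combinatorics of the star product\<close>

context zfc
begin

lemma pr_ne_emp [simp]: "pr a b ~= emp" "emp ~= pr a b"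
  using mem_ne[of "upr a a" "pr a b"] by (auto simp: pr_def)

lemma eqp_ins: assumes "eqp a n" "~ z <: a" shows "eqp (cup a (sg z)) (suc n)"
proof -
  obtain F where F: "dF F" "bij_betw F (ext a) (ext n)" using assms(1) by (rule eqpE)
  note [simp] = dt1[where F=F, OF F(1)]
  let ?G = "%y. if y = z then n else F y"
  have Fn: "F y <: n" "F y ~= n" if "y <: a" for y
  proof -
    show "F y <: n" using F(2) that unfolding bij_ext by blast
    then show "F y ~= n" by auto
  qed
  have "bij_betw ?G (ext (cup a (sg z))) (ext (suc n))" unfolding bij_ext inj_ext
  proof (intro conjI allI impI)
    fix x y assume "x <: cup a (sg z)" "y <: cup a (sg z)" "?G x = ?G y"
    then show "x = y" using F(2) Fn unfolding bij_ext inj_ext by (auto split: if_splits)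
  next
    fix x assume "x <: cup a (sg z)" then show "?G x <: suc n" using Fn by auto
  next
    fix y assume y: "y <: suc n"
    show "EX x. x <: cup a (sg z) & ?G x = y"
    proof (cases "y = n")
      case True then show ?thesis by (intro exI[of _ z]) simp
    next
      case False
      then obtain x where "x <: a" "F x = y" using y F(2) unfolding bij_ext by auto
      then show ?thesis using assms(2) by (intro exI[of _ x]) auto
    qed
  qed
  then show ?thesis by (rule eqpI[rotated]) simp
qed

lemma eqp_del: assumes "eqp a (suc n)" "n <: om" "z <: a" shows "eqp (diff a (sg z)) n"
proof -
  let ?b = "diff a (sg z)"
  have "Fin a" using assms unfolding Fin_def by (intro exI[of _ "suc n"]) simp
  then have "Fin ?b" by (rule Fin_sub) (auto simp: sub_def)
  then obtain m where m: "m <: om" "eqp ?b m" unfolding Fin_def by blast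
  have "cup ?b (sg z) = a" by (rule set_ext) (use assms(3) in auto)
  then have "eqp a (suc m)" using eqp_ins[OF m(2), of z] by simp
  then have "eqp (suc m) (suc n)" using assms(1) eqp_trans eqp_sym by blast
  then have "suc m = suc n" using m(1) assms(2) by (intro Card_eqI Card_nat suc_om)
  then show ?thesis using m by simp
qed

lemma Fin_Pw: assumes "Fin a" shows "Fin (Pw a)"
  using assms
proof (induction rule: Fin_induct)
  case emp
  have "Pw emp = sg emp" by (rule set_ext) (auto simp: sub_def eq_emp)
  then show ?case by simp
next
  case (ins a x)
  have "sub (Pw (cup a (sg x))) (cup (Pw a) (Rep (Pw a) (%y. cup y (sg x))))"
  proof (rule subI)
    fix y assume y: "y <: Pw (cup a (sg x))"
    show "y <: cup (Pw a) (Rep (Pw a) (%y. cup y (sg x)))"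
    proof (cases "x <: y")
      case True
      then have "y = cup (diff y (sg x)) (sg x)" by (intro set_ext) auto
      moreover have "diff y (sg x) <: Pw a" using y by (auto simp: sub_def)
      ultimately have "y <: Rep (Pw a) (%y. cup y (sg x))" by (subst mem_Rep) auto
      then show ?thesis by (subst mem_cup) blast
    next
      case False then show ?thesis using y by (auto simp: sub_def)
    qed
  qed
  then show ?case by (rule Fin_sub[rotated]) (intro Fin_cup ins Fin_Rep, simp)
qed simp

definition fsub :: "'v => 'v" where "fsub a = Sep (Pw a) Fin"
lemma mem_fsub [simp]: "x <: fsub a \<longleftrightarrow> sub x a & Fin x" unfolding fsub_def by simp
lemma fsub_ctb: assumes "lep a om" shows "lep (fsub a) om"
proof -
  obtain F where F: "dF F" "inj_on F (ext a)" "!!x. x <: a ==> F x <: om" using assms by (rule lepE) blast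
  note [simp] = dt1[where F=F, OF F(1)]
  have "lep (fsub a) (Uni (Rep om Pw))"
  proof (rule lepI[of "%x. Rep x F"])
    show "inj_on (%x. Rep x F) (ext (fsub a))" unfolding inj_ext
    proof (intro allI impI set_ext)
      fix x y z assume xy: "x <: fsub a" "y <: fsub a" "Rep x F = Rep y F"
      have *: "z <: x \<longleftrightarrow> F z <: Rep x F" if "sub x a" "z <: a" for x z
        using that F(2) unfolding inj_ext by (auto simp: sub_def)
      have "~ z <: x & ~ z <: y" if "~ z <: a" using that xy by (auto simp: sub_def)
      then show "z <: x \<longleftrightarrow> z <: y" using *[of x z] *[of y z] xy by auto
    qed
    fix x assume x: "x <: fsub a"
    have "Fin (Rep x F)" using x by (auto intro!: Fin_Rep)
    moreover have "sub (Rep x F) om" using x F(3) by (auto simp: sub_def)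
    ultimately obtain b where "b <: om" "ALL z. z <: Rep x F --> z <: b" using Fin_bounded Lim_om by blast
    then show "Rep x F <: Uni (Rep om Pw)" by (subst mem_UniRep) (auto simp: sub_def)
  qed simp
  moreover have "lep (Uni (Rep om Pw)) om"
    by (rule Uni_lep[OF Inf_om lep_refl]) (simp, intro Fin_ctb Fin_Pw Fin_nat)
  ultimately show ?thesis using lep_trans by blast
qed

lemma Uni_sub_lep:
  assumes "Inf k" "lep A k" "dF F" "!!x. x <: A ==> lep (F x) k" "!!z. z <: B ==> EX x. x <: A & z <: F x"
  shows "lep B k"
proof -
  have "sub B (Uni (Rep A F))" unfolding sub_def mem_UniRep[OF assms(3)] using assms(5) by blast
  then show ?thesis using Uni_lep[OF assms(1-4)] sub_lep lep_trans by blast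
qed

lemma pigeonhole:
  assumes W: "~ lep W om" and F: "dF F" "!!x. x <: W ==> F x <: C" "lep C om"
  shows "EX c. c <: C & ~ lep (Sep W (%x. F x = c)) om"
proof (rule ccontr)
  note [simp] = dt1[where F=F, OF F(1)]
  assume n: "~ ?thesis"
  have "lep W om"
    by (rule Uni_sub_lep[OF Inf_om F(3), of "%c. Sep W (%x. F x = c)"]) (use n F(2) in auto)
  then show False using W by blast
qed

section \<open>The Cohen poset\<close>

definition Fn :: 'v where
  "Fn = Sep (fsub (prd om two)) (%p. ALL n b c. pr n b <: p --> pr n c <: p --> b = c)"
lemma mem_Fn: "p <: Fn \<longleftrightarrow> Fin p & sub p (prd om two) & (ALL n b c. pr n b <: p --> pr n c <: p --> b = c)"
  unfolding Fn_def by auto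
lemma emp_Fn [simp]: "emp <: Fn" unfolding mem_Fn by (simp add: sub_def)
lemma Fn_ctb: "lep Fn om"
proof -
  have "lep (prd om two) om"
    by (rule prd_lep[OF Inf_om lep_refl]) (simp add: two_def Fin_ctb Fin_nat)
  moreover have "sub Fn (fsub (prd om two))" by (auto simp: sub_def mem_Fn)
  ultimately show ?thesis using fsub_ctb sub_lep lep_trans by blast
qed

lemma Fn_iff: "p <: Fn \<longleftrightarrow> Fin p & (EX d. sub d om & Func p d two)"
proof
  assume p: "p <: Fn"
  have "Func p (domn p) two" unfolding Func_def
  proof (intro conjI allI impI)
    fix z assume "z <: p"
    then show "EX x y. x <: domn p & y <: two & z = pr x y" using p unfolding mem_Fn sub_def mem_prd mem_domn by blast
  next
    fix x assume "x <: domn p"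
    then show "EX! y. pr x y <: p" using p unfolding mem_Fn mem_domn by blast
  qed
  moreover have "sub (domn p) om" using p unfolding mem_Fn sub_def mem_domn by auto
  ultimately show "Fin p & (EX d. sub d om & Func p d two)" using p unfolding mem_Fn by blast
next
  assume "Fin p & (EX d. sub d om & Func p d two)"
  then obtain d where d: "Fin p" "sub d om" "Func p d two" by blast
  have "sub p (prd om two)" unfolding sub_def mem_prd using Func_memD[OF d(3)] subD[OF d(2)] by blast
  moreover have "pr n b <: p --> pr n c <: p --> b = c" for n b c using Func_pr[OF d(3)] by simp
  ultimately show "p <: Fn" unfolding mem_Fn using d(1) by blast
qed

end

text \<open>The hypotheses of the theorem after evaluation of the formulas, established in
  \<open>starI\<close>: GCH enters as a bound on power sets, and the regularity of \<mu> as
  boundedness of countable subsets.\<close>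

locale star = zfc E for E :: "'v => 'v => bool" (infix \<open><:\<close> 50) +
  fixes \<mu> P l e :: 'v
  assumes gch: "Inf k ==> lep (Pw k) (csuc k)"
    and om_\<mu>: "om <: \<mu>" and ctbbd_\<mu>: "ctbbd \<mu>"
    and mem_P: "p <: P \<longleftrightarrow> Func p \<mu> Fn & lep (Sep \<mu> (%i. app p i ~= emp)) om"
    and mem_l: "z <: l \<longleftrightarrow> (EX p q. z = pr p q & p <: P & q <: P & (ALL i. i <: \<mu> --> sub (app q i) (app p i)) &
       Fin (Sep \<mu> (%i. app p i ~= app q i & app q i ~= emp)))"
    and e_PP: "e <: P" and app_e: "i <: \<mu> ==> app e i = emp"
begin

lemma Inf_\<mu>: "Inf \<mu>" using ctbbd_\<mu> unfolding ctbbd_def by blast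

lemma le_iff: "pr p q <: l \<longleftrightarrow> p <: P & q <: P & (ALL i. i <: \<mu> --> sub (app q i) (app p i)) &
       Fin (Sep \<mu> (%i. app p i ~= app q i & app q i ~= emp))"
  unfolding mem_l by auto

lemma PFn: "p <: P ==> i <: \<mu> ==> app p i <: Fn" unfolding mem_P using Func_app by blast
lemma Pctb: "p <: P ==> lep (Sep \<mu> (%i. app p i ~= emp)) om" unfolding mem_P by blast
lemma P_eqI: "p <: P ==> q <: P ==> (!!i. i <: \<mu> ==> app p i = app q i) ==> p = q"
  unfolding mem_P using Func_eqI by blast

lemma PI: assumes "dF F" "!!i. i <: \<mu> ==> F i <: Fn" "lep (Sep \<mu> (%i. F i ~= emp)) om" shows "lam \<mu> F <: P"
proof -
  note [simp] = dt1[where F=F, OF assms(1)]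
  have "Sep \<mu> (%i. app (lam \<mu> F) i ~= emp) = Sep \<mu> (%i. F i ~= emp)"
    by (rule set_ext) (auto simp: assms(1))
  then show ?thesis unfolding mem_P using Func_lam[OF assms(1)] assms by simp
qed

lemma leI: assumes "p <: P" "q <: P" "!!i. i <: \<mu> ==> sub (app q i) (app p i)"
    "!!i. i <: \<mu> ==> app p i ~= app q i ==> app q i ~= emp ==> i <: d" "Fin d"
  shows "pr p q <: l"
proof -
  have "sub (Sep \<mu> (%i. app p i ~= app q i & app q i ~= emp)) d" using assms(4) by (auto simp: sub_def)
  then show ?thesis unfolding le_iff using assms Fin_sub by blast
qed

lemma forcing: "forcing E P l e"
proof unfold_locales
  show "pr p q <: l ==> p <: P & q <: P" for p q unfolding le_iff by blast
  show "p <: P ==> pr p p <: l" for p by (rule leI[where d=emp]) auto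
  show "pr p r <: l" if pq: "pr p q <: l" "pr q r <: l" for p q r
  proof (rule leI[where d="cup (Sep \<mu> (%i. app p i ~= app q i & app q i ~= emp)) (Sep \<mu> (%i. app q i ~= app r i & app r i ~= emp))"])
    fix i assume i: "i <: \<mu>"
    then have s: "sub (app q i) (app p i)" "sub (app r i) (app q i)" using pq unfolding le_iff by blast+
    then show "sub (app r i) (app p i)" using sub_trans by blast
    assume n: "app p i ~= app r i" "app r i ~= emp"
    \<comment> \<open>A value nonempty in \<open>r\<close> is nonempty in \<open>q\<close> as well,
      so a change of it between \<open>r\<close> and \<open>p\<close> shows up in one of the two
      steps.\<close>
    have "app q i ~= emp" using s(2) n(2) unfolding eq_emp sub_def by blast
    then show "i <: cup (Sep \<mu> (%i. app p i ~= app q i & app q i ~= emp)) (Sep \<mu> (%i. app q i ~= app r i & app r i ~= emp))"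
      using n i by auto
  qed (use pq in \<open>auto simp: le_iff intro!: Fin_cup\<close>)
  show "e <: P" by (rule e_PP)
  show "p <: P ==> pr p e <: l" for p
    by (rule leI[where d=emp]) (auto simp: e_PP app_e sub_def)
qed

end

sublocale star \<subseteq> forcing E P l e by (rule forcing)

context star
begin

definition supp :: "'v => 'v" where "supp p = Sep \<mu> (%i. app p i ~= emp)"
lemma mem_supp [simp]: "i <: supp p \<longleftrightarrow> i <: \<mu> & app p i ~= emp" unfolding supp_def by simp
lemma dt_supp [simp]: "dt a ==> dt (%e. supp (a e))" by (rule dt1[where F=supp], unfold supp_def) simp_all
lemma supp_ctb: "p <: P ==> lep (supp p) om" unfolding supp_def by (rule Pctb)

lemma ctb_lep: assumes "ctbbd k" "om <: k" "lep A k" shows "lep (ctb A) k"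
  using ctb_lep_aux[OF assms(1,3)] bounded_subsets_lep[OF gch InfD(1)] assms unfolding ctbbd_def by blast

definition code :: "'v => 'v" where "code p = Rep (supp p) (%i. pr i (app p i))"
lemma dt_code [simp]: "dt a ==> dt (%e. code (a e))" by (rule dt1[where F=code], unfold code_def) simp_all

lemma code_inj: assumes "p <: P" "q <: P" "code p = code q" shows "p = q"
proof (rule P_eqI[OF assms(1,2)])
  fix i assume i: "i <: \<mu>"
  have c: "pr i b <: code r \<longleftrightarrow> app r i ~= emp & b = app r i" for r b unfolding code_def using i by auto
  show "app p i = app q i" using c[of _ p] c[of _ q] assms(3) by (metis)
qed

text \<open>A condition supported in \<open>Y\<close> is determined by its graph on the support, a
  countable subset of Y \<times> Fn. Since \<open>k\<close> has uncountable cofinality, GCH leaves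
  at most \<open>k\<close> of these.\<close>

lemma restricted_lep:
  assumes "ctbbd k" "om <: k" "lep Y k"
  shows "lep (Sep P (%t. sub (supp t) Y)) k"
proof -
  have k: "Inf k" using assms(1) unfolding ctbbd_def by blast
  have "lep Fn k" using Fn_ctb sub_lep[OF InfD(3)[OF k]] lep_trans by blast
  then have "lep (ctb (prd Y Fn)) k" by (intro ctb_lep assms prd_lep k)
  moreover have "lep (Sep P (%t. sub (supp t) Y)) (ctb (prd Y Fn))"
  proof (rule lepI[of code])
    show "inj_on code (ext (Sep P (%t. sub (supp t) Y)))" unfolding inj_ext using code_inj by simp
    fix t assume t: "t <: Sep P (%t. sub (supp t) Y)"
    then have "sub (code t) (prd Y Fn)" unfolding code_def using PFn by (auto simp: sub_def)
    moreover have "lep (code t) om"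
      unfolding code_def using lep_trans[OF Rep_lep supp_ctb] t by simp
    ultimately show "code t <: ctb (prd Y Fn)" by simp
  qed simp
  ultimately show ?thesis using lep_trans by blast
qed

lemma P_lep: "lep P \<mu>"
proof -
  have "sub P (Sep P (%t. sub (supp t) \<mu>))" by (auto simp: sub_def)
  then show ?thesis using restricted_lep[OF ctbbd_\<mu> om_\<mu> lep_refl] sub_lep lep_trans by blast
qed

text \<open>A replacement for the \<open>\<omega>\<^sub>2\<close>-chain condition: already the conditions supported by a suitable set of size
  \<open>\<omega>\<^sub>1\<close> decide all values.\<close>

lemma hull:
  assumes V: "dP2 V" "!!p. p <: P ==> EX q y. le q p & V q y"
    and con: "!!r p q y z. le r p ==> le r q ==> V p y ==> V q z ==> y = z"
  shows "EX B. lep B w1 & (ALL p y. p <: P --> V p y --> y <: B)"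
proof -
  note [simp] = dp2[where P=V, OF V(1)]
  obtain C where C: "dF C" "ALL y. y <: Pw P & (EX z. z <: y) --> C y <: y" using AC by blast
  note [simp] = dt1[where F=C, OF C(1)]
  define c where "c t = C (Sep P (%q. le q t & (EX y. V q y)))" for t
  have [simp]: "dt t ==> dt (%e. c (t e))" for t by (rule dt1[where F=c], unfold c_def) simp_all
  have c: "le (c t) t & (EX y. V (c t) y)" if "t <: P" for t
  proof -
    let ?S = "Sep P (%q. le q t & (EX y. V q y))"
    have "?S <: Pw P" "EX z. z <: ?S" using V(2)[OF that] le_P by (auto simp: sub_def)
    then have "c t <: ?S" unfolding c_def using C(2) by blast
    then show ?thesis by simp
  qed
  define PX where "PX Y = Sep P (%t. sub (supp t) Y)" for Y
  have [simp]: "dt t ==> dt (%e. PX (t e))" for t by (rule dt1[where F=PX], unfold PX_def) simp_all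
  have PX: "t <: PX Y \<longleftrightarrow> t <: P & sub (supp t) Y" for t Y unfolding PX_def by simp
  \<comment> \<open>\<open>K\<close> adds to \<open>Y\<close> the supports of the chosen deciding
    extensions \<open>c t\<close> of all conditions supported in \<open>Y\<close>. If
    \<open>Y\<close> has size at most \<omega>_1, there are at most \<omega>_1 such conditions, so
    the size does not grow.\<close>
  define K where "K Y = cup Y (Uni (Rep (PX Y) (%t. supp (c t))))" for Y
  have [simp]: "dt t ==> dt (%e. K (t e))" for t by (rule dt1[where F=K], unfold K_def) simp_all
  have K: "i <: K Y \<longleftrightarrow> i <: Y | (EX t. t <: PX Y & i <: supp (c t))" for i Y
    unfolding K_def mem_cup by (subst mem_UniRep) simp_all
  define XX where "XX = wrec (%\<alpha> f. Uni (Rep \<alpha> (%\<beta>. K (app f \<beta>))))"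
  have [simp]: "dt t ==> dt (%e. XX (t e))" for t by (rule dt1[where F=XX], unfold XX_def) simp_all
  have XX: "i <: XX \<alpha> \<longleftrightarrow> (EX \<beta>. \<beta> <: \<alpha> & i <: K (XX \<beta>))" for i \<alpha>
  proof -
    have "XX \<alpha> = Uni (Rep \<alpha> (%\<beta>. K (app (lam \<alpha> XX) \<beta>)))"
      unfolding XX_def by (subst wrec_unfold) simp_all
    then show ?thesis by (simp add: mem_UniRep del: mem_Uni cong: conj_cong)
  qed
  have lw: "lep om w1" by (rule sub_lep[OF InfD(3)[OF Inf_w1]])
  have Klep: "lep (K Y) w1" if "lep Y w1" for Y
    unfolding K_def
  proof (intro cup_lep[OF Inf_w1 that] Uni_lep[OF Inf_w1])
    show "lep (PX Y) w1" unfolding PX_def by (rule restricted_lep[OF ctbbd_w1 w1_props(3) that])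
    fix t assume "t <: PX Y"
    then have "c t <: P" using c PX le_P by blast
    then show "lep (supp (c t)) w1" using supp_ctb lw lep_trans by blast
  qed simp
  have XXlep: "sub \<alpha> w1 --> tran \<alpha> --> lep (XX \<alpha>) w1" for \<alpha>
  proof (induction \<alpha> rule: mem_induct)
    case (step \<alpha>)
    show ?case
    proof (intro impI)
      assume a: "sub \<alpha> w1" "tran \<alpha>"
      show "lep (XX \<alpha>) w1"
      proof (rule Uni_sub_lep[OF Inf_w1 sub_lep[OF a(1)], of "%\<beta>. K (XX \<beta>)"])
        fix \<beta> assume b: "\<beta> <: \<alpha>"
        have "\<beta> <: w1" using a(1) b subD by blast
        then have "tran \<beta>" "sub \<beta> w1" using w1_props(2) Ord_mem[OF w1_props(2)] Ord_trans[OF w1_props(2)]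
          unfolding Ord_def sub_def by blast+
        then show "lep (K (XX \<beta>)) w1" using Klep step[OF b] by blast
      qed (simp, simp add: XX)
    qed
  qed simp
  define X where "X = XX w1"
  have Xlep: "lep X w1" unfolding X_def using XXlep[of w1] w1_props(2) unfolding Ord_def by simp
  \<comment> \<open>A countable support inside the union of the \<omega>_1 stages already lies in a
    single stage, because \<omega>_1 has uncountable cofinality; the next stage contains the support
    of \<open>c t\<close>.\<close>
  have closed: "sub (supp (c t)) X" if t: "t <: P" "sub (supp t) X" for t
  proof -
    define b where "b i = lst (%\<beta>. \<beta> <: w1 & i <: K (XX \<beta>))" for i
    have [simp]: "dt t ==> dt (%e. b (t e))" for t by (rule dt1[where F=b], unfold b_def) simp_all
    have b: "b i <: w1 & i <: K (XX (b i))" if i: "i <: supp t" for i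
    proof -
      obtain \<beta> where "\<beta> <: w1 & i <: K (XX \<beta>)" using subD[OF t(2) i] unfolding X_def XX by blast
      then show ?thesis unfolding b_def using Ord_mem[OF w1_props(2)] by (intro lst(2)[of "%\<beta>. \<beta> <: w1 & i <: K (XX \<beta>)"]) auto
    qed
    have "sub (Rep (supp t) b) w1" using b by (auto simp: sub_def)
    moreover have "lep (Rep (supp t) b) om" using lep_trans[OF Rep_lep supp_ctb[OF t(1)]] by simp
    ultimately obtain \<gamma> where g: "\<gamma> <: w1" "sub (Rep (supp t) b) \<gamma>" using ctbbd_w1 unfolding ctbbd_def by blast
    have "sub (supp t) (XX \<gamma>)"
    proof (rule subI)
      fix i assume i: "i <: supp t"
      then have "b i <: \<gamma>" by (intro subD[OF g(2)] RepI) simp_all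
      then show "i <: XX \<gamma>" unfolding XX using b[OF i] by blast
    qed
    then have "t <: PX (XX \<gamma>)" using t PX by blast
    then have "i <: K (XX \<gamma>)" if "i <: supp (c t)" for i using that K by blast
    then show ?thesis unfolding X_def sub_def XX using g(1) by blast
  qed
  define B where "B = Rep (PX X) (%t. the1 (V (c t)))"
  have "lep B w1"
    unfolding B_def PX_def by (rule lep_trans[OF Rep_lep restricted_lep[OF ctbbd_w1 w1_props(3) Xlep]]) simp
  moreover have "y <: B" if p: "p <: P" "V p y" for p y
  proof -
    \<comment> \<open>The part of \<open>p\<close> on \<open>X\<close>. Its chosen extension
      \<open>c t\<close> decides a value and again has its support inside \<open>X\<close>.\<close>
    define t where "t = lam \<mu> (%i. if i <: X then app p i else emp)"
    have at: "app t i = (if i <: X then app p i else emp)" if "i <: \<mu>" for i using that by (simp add: t_def)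
    have tP: "t <: P" unfolding t_def
    proof (rule PI)
      have "sub (Sep \<mu> (%i. (if i <: X then app p i else emp) ~= emp)) (supp p)" by (auto simp: sub_def)
      then show "lep (Sep \<mu> (%i. (if i <: X then app p i else emp) ~= emp)) om"
        using supp_ctb[OF p(1)] sub_lep lep_trans by blast
    qed (use PFn[OF p(1)] in auto)
    have tX: "sub (supp t) X" by (auto simp: sub_def at split: if_splits)
    note ct = c[OF tP]
    obtain y' where y': "V (c t) y'" using ct by blast
    have cP: "c t <: P" using ct le_P by blast
    have cl: "app (c t) i = emp" if "i <: \<mu>" "~ i <: X" for i
      using closed[OF tP tX] that unfolding sub_def by auto
    \<comment> \<open>\<open>r\<close> follows \<open>c t\<close> on \<open>X\<close> and
      \<open>p\<close> elsewhere. It extends both, because \<open>c t\<close> changes only finitely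
      many nonempty values of \<open>t\<close>; so \<open>p\<close> and \<open>c t\<close> decide
      the same value.\<close>
    define r where "r = lam \<mu> (%i. if i <: X then app (c t) i else app p i)"
    have ar: "app r i = (if i <: X then app (c t) i else app p i)" if "i <: \<mu>" for i using that by (simp add: r_def)
    have rP: "r <: P" unfolding r_def
    proof (rule PI)
      have "sub (Sep \<mu> (%i. (if i <: X then app (c t) i else app p i) ~= emp)) (cup (supp p) (supp (c t)))"
        by (auto simp: sub_def)
      then show "lep (Sep \<mu> (%i. (if i <: X then app (c t) i else app p i) ~= emp)) om"
        using cup_lep[OF Inf_om supp_ctb[OF p(1)] supp_ctb[OF cP]] sub_lep lep_trans by blast
    qed (use PFn[OF p(1)] PFn[OF cP] in auto)
    have 1: "le r (c t)"
      by (rule leI[OF rP cP, where d=emp]) (auto simp: ar cl sub_def split: if_splits)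
    have 2: "le r p"
    proof (rule leI[OF rP p(1), where d="Sep \<mu> (%i. app (c t) i ~= app t i & app t i ~= emp)"])
      fix i assume i: "i <: \<mu>"
      have "sub (app t i) (app (c t) i)" using ct i unfolding le_iff by blast
      then show "sub (app p i) (app r i)" using i by (auto simp: ar at split: if_splits)
      assume "app r i ~= app p i" "app p i ~= emp"
      then show "i <: Sep \<mu> (%i. app (c t) i ~= app t i & app t i ~= emp)"
        using i by (auto simp: ar at split: if_splits)
    qed (use ct in \<open>simp add: le_iff\<close>)
    have yy: "z = y'" if "V (c t) z" for z using con[OF le_refl[OF cP] le_refl[OF cP] that y'] .
    have "y = y'" using con[OF 2 1 p(2) y'] .
    have "the1 (V (c t)) = y'" by (rule the1_eq[of "V (c t)", OF y' yy])
    then have "the1 (V (c t)) = y" using \<open>y = y'\<close> by simp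
    moreover have "t <: PX X" using PX tP tX by blast
    ultimately show ?thesis unfolding B_def by (subst mem_Rep) auto
  qed
  ultimately show ?thesis by blast
qed

subsection \<open>Fusion\<close>

text \<open>The base at stage \<open>\<alpha>\<close> takes at each coordinate the first nonempty value occurring in \<open>p0\<close> or an earlier
  condition; \<open>dset\<close> collects the finitely many coordinates at which condition \<open>\<alpha>\<close> departs from it.\<close>

definition bas :: "'v => ('v => 'v) => 'v => 'v => 'v" where
  "bas p0 H \<alpha> i = (if app p0 i ~= emp then app p0 i
     else if EX \<beta>. \<beta> <: \<alpha> & app (fs (H \<beta>)) i ~= emp then app (fs (H (lst (%\<beta>. \<beta> <: \<alpha> & app (fs (H \<beta>)) i ~= emp)))) i
     else emp)"

lemma bas_cong: "(!!\<beta>. \<beta> <: \<alpha> ==> H \<beta> = H' \<beta>) ==> Ord \<alpha> ==> dF H ==> dF H' ==> bas p0 H \<alpha> i = bas p0 H' \<alpha> i"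
proof -
  assume H: "!!\<beta>. \<beta> <: \<alpha> ==> H \<beta> = H' \<beta>" "Ord \<alpha>" and d: "dF H" "dF H'"
  note [simp] = dt1[where F=H, OF d(1)] dt1[where F=H', OF d(2)]
  have "(%\<beta>. \<beta> <: \<alpha> & app (fs (H \<beta>)) i ~= emp) = (%\<beta>. \<beta> <: \<alpha> & app (fs (H' \<beta>)) i ~= emp)"
    using H(1) by (auto simp: fun_eq_iff)
  moreover have "lst (%\<beta>. \<beta> <: \<alpha> & app (fs (H \<beta>)) i ~= emp) <: \<alpha>" if h: "EX \<beta>. \<beta> <: \<alpha> & app (fs (H \<beta>)) i ~= emp"
  proof -
    obtain \<beta> where b: "\<beta> <: \<alpha> & app (fs (H \<beta>)) i ~= emp" using h by blast
    have "dP (%\<beta>. \<beta> <: \<alpha> & app (fs (H \<beta>)) i ~= emp)" by simp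
    from lst(2)[OF this Ord_mem[OF H(2)] b] b show ?thesis by blast
  qed
  ultimately show ?thesis unfolding bas_def using H(1) by simp
qed

definition dset :: "'v => ('v => 'v) => 'v => 'v" where
  "dset p0 H \<alpha> = Sep \<mu> (%i. app (fs (H \<alpha>)) i ~= emp &
     ((bas p0 H \<alpha> i ~= emp & app (fs (H \<alpha>)) i ~= bas p0 H \<alpha> i) | i = sn (H \<alpha>)))"

context
  fixes p0 H
  assumes p0: "p0 <: P" and dH: "dF H"
begin

lemma dt_bas [simp]: "dt a ==> dt b ==> dt (%e. bas p0 H (a e) (b e))"
  by (rule dt2[where F="bas p0 H"], unfold bas_def) (simp_all add: dt1[where F=H, OF dH])
lemma mem_dset: "i <: dset p0 H \<alpha> \<longleftrightarrow> i <: \<mu> & app (fs (H \<alpha>)) i ~= emp &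
     ((bas p0 H \<alpha> i ~= emp & app (fs (H \<alpha>)) i ~= bas p0 H \<alpha> i) | i = sn (H \<alpha>))"
  unfolding dset_def by (subst mem_Sep) simp_all
lemma dt_dset [simp]: "dt a ==> dt (%e. dset p0 H (a e))"
  by (rule dt1[where F="dset p0 H"], unfold dset_def) (simp_all add: dt1[where F=H, OF dH])

lemma bas_cases: assumes "Ord \<alpha>"
  obtains "app p0 i ~= emp" "bas p0 H \<alpha> i = app p0 i"
  | \<beta> where "app p0 i = emp" "\<beta> <: \<alpha>" "app (fs (H \<beta>)) i ~= emp" "bas p0 H \<alpha> i = app (fs (H \<beta>)) i"
      "!!\<gamma>. \<gamma> <: \<beta> ==> app (fs (H \<gamma>)) i = emp"
  | "app p0 i = emp" "!!\<beta>. \<beta> <: \<alpha> ==> app (fs (H \<beta>)) i = emp" "bas p0 H \<alpha> i = emp"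
proof (cases "app p0 i = emp & (EX \<beta>. \<beta> <: \<alpha> & app (fs (H \<beta>)) i ~= emp)")
  case True
  note [simp] = dt1[where F=H, OF dH]
  let ?Q = "%\<beta>. \<beta> <: \<alpha> & app (fs (H \<beta>)) i ~= emp"
  obtain \<beta> where b: "?Q \<beta>" using True by blast
  have dQ: "dP ?Q" by simp
  have ob: "Ord \<beta>" using b Ord_mem[OF assms] by blast
  have "?Q (lst ?Q)" using dQ ob b by (rule lst(2))
  moreover have "app (fs (H \<gamma>)) i = emp" if "\<gamma> <: lst ?Q" for \<gamma>
    using lst(3)[OF dQ ob b that] Ord_trans[OF assms _ that] calculation by blast
  moreover have "bas p0 H \<alpha> i = app (fs (H (lst ?Q))) i" unfolding bas_def using True by simp
  ultimately show ?thesis using that(2) True by blast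
next
  case False
  show ?thesis
  proof (cases "app p0 i = emp")
    case True
    then have n: "~ (EX \<beta>. \<beta> <: \<alpha> & app (fs (H \<beta>)) i ~= emp)" using False by blast
    then have "bas p0 H \<alpha> i = emp" unfolding bas_def using True by (simp only: if_False simp_thms)
    then show ?thesis using that(3) True n by blast
  next
    case False
    then show ?thesis using that(1) unfolding bas_def by simp
  qed
qed

text \<open>The base takes the first nonempty value, and no later condition can displace the first
  one.\<close>

lemma bas_mono: assumes "Ord \<alpha>" "Ord \<beta>" "sub \<alpha> \<beta>" "bas p0 H \<alpha> i ~= emp" shows "bas p0 H \<beta> i = bas p0 H \<alpha> i"
  using assms(1)
proof (cases rule: bas_cases[where i=i])
  case 1 then show ?thesis unfolding bas_def by simp
next
  case (2 \<gamma>)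
  show ?thesis using assms(2)
  proof (cases rule: bas_cases[where i=i])
    case 1 with 2 show ?thesis by simp
  next
    case (2 \<delta>)
    have "\<gamma> = \<delta>" using Ord_linear[of \<gamma> \<delta>] Ord_mem[OF assms(1) \<open>\<gamma> <: \<alpha>\<close>] Ord_mem[OF assms(2) \<open>\<delta> <: \<beta>\<close>]
      2 \<open>app (fs (H \<gamma>)) i ~= emp\<close> \<open>!!\<gamma>'. \<gamma>' <: \<gamma> ==> app (fs (H \<gamma>')) i = emp\<close> by blast
    then show ?thesis using 2 \<open>bas p0 H \<alpha> i = app (fs (H \<gamma>)) i\<close> by simp
  next
    case 3 with 2 show ?thesis using assms(3) subD by blast
  qed
next
  case 3 then show ?thesis using assms(4) by blast
qed

text \<open>A stage below \<omega>_1 has only countably many predecessors, so the base has countable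
  support. It leaves the nonempty values of \<open>p0\<close> unchanged, hence lies below
  \<open>p0\<close>.\<close>

lemma bas_P:
  assumes "\<alpha> <: w1" "!!\<beta>. \<beta> <: \<alpha> ==> fs (H \<beta>) <: P"
  shows "lam \<mu> (bas p0 H \<alpha>) <: P" "le (lam \<mu> (bas p0 H \<alpha>)) p0"
proof -
  note [simp] = dt1[where F=H, OF dH]
  have o: "Ord \<alpha>" using assms(1) Ord_mem[OF w1_props(2)] by blast
  have "lep (Uni (Rep \<alpha> (%\<beta>. supp (fs (H \<beta>))))) om"
    by (rule Uni_lep[OF Inf_om w1_props(4)[OF assms(1)]]) (use supp_ctb[OF assms(2)] in simp_all)
  then have c: "lep (cup (supp p0) (Uni (Rep \<alpha> (%\<beta>. supp (fs (H \<beta>)))))) om"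
    by (rule cup_lep[OF Inf_om supp_ctb[OF p0]])
  have s: "sub (Sep \<mu> (%i. bas p0 H \<alpha> i ~= emp)) (cup (supp p0) (Uni (Rep \<alpha> (%\<beta>. supp (fs (H \<beta>))))))"
  proof (rule subI)
    fix i assume i: "i <: Sep \<mu> (%i. bas p0 H \<alpha> i ~= emp)"
    then have i': "i <: \<mu>" "bas p0 H \<alpha> i ~= emp" by simp_all
    have "i <: supp p0 | (EX \<beta>. \<beta> <: \<alpha> & i <: supp (fs (H \<beta>)))"
      using o by (cases rule: bas_cases[where i=i]) (use i' in auto)
    then show "i <: cup (supp p0) (Uni (Rep \<alpha> (%\<beta>. supp (fs (H \<beta>)))))" by (subst mem_cup, subst mem_UniRep) simp_all
  qed
  show P: "lam \<mu> (bas p0 H \<alpha>) <: P"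
  proof (rule PI)
    show "lep (Sep \<mu> (%i. bas p0 H \<alpha> i ~= emp)) om" using s c sub_lep lep_trans by blast
    fix i assume i: "i <: \<mu>"
    show "bas p0 H \<alpha> i <: Fn"
      using o by (cases rule: bas_cases[where i=i]) (use PFn[OF p0 i] PFn[OF assms(2) i] in simp_all)
  qed simp
  show "le (lam \<mu> (bas p0 H \<alpha>)) p0"
  proof (rule leI[OF P p0, where d=emp])
    fix i assume i: "i <: \<mu>"
    show "sub (app p0 i) (app (lam \<mu> (bas p0 H \<alpha>)) i)" using i by (auto simp: bas_def sub_def)
    assume "app (lam \<mu> (bas p0 H \<alpha>)) i ~= app p0 i" "app p0 i ~= emp"
    then show "i <: emp" using i by (simp add: bas_def)
  qed simp
qed

context
  assumes H: "!!\<alpha>. \<alpha> <: w1 ==> le (fs (H \<alpha>)) (lam \<mu> (bas p0 H \<alpha>))"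
begin

abbreviation (input) "Bs == bas p0 H w1"
abbreviation (input) "rr \<alpha> == fs (H \<alpha>)"

lemma rP: "\<alpha> <: w1 ==> rr \<alpha> <: P" using H le_P by blast

lemma rr_le: assumes "\<alpha> <: w1" "i <: \<mu>" shows "sub (bas p0 H \<alpha> i) (app (rr \<alpha>) i)"
  using H[OF assms(1)] assms(2) unfolding le_iff by simp

text \<open>If the base is still empty at \<open>i\<close>, then \<alpha> is the first stage to fill
  \<open>i\<close>, so the final base copies the value from it.\<close>

lemma rr_new: assumes "\<alpha> <: w1" "i <: \<mu>" "bas p0 H \<alpha> i = emp" "app (rr \<alpha>) i ~= emp" shows "app (rr \<alpha>) i = Bs i"
proof -
  have oa: "Ord \<alpha>" using assms(1) Ord_mem[OF w1_props(2)] by blast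
  have n: "app p0 i = emp" "\<beta> <: \<alpha> ==> app (rr \<beta>) i = emp" for \<beta>
    using oa assms(3) by (cases rule: bas_cases[where i=i]; simp)+
  show ?thesis using w1_props(2)
  proof (cases rule: bas_cases[where i=i])
    case (2 \<beta>)
    have "\<alpha> = \<beta>" using Ord_linear[OF oa Ord_mem[OF w1_props(2) 2(2)]] n(2) 2(3) 2(5)[of \<alpha>] assms(4) by blast
    then show ?thesis using 2 by simp
  qed (use n assms in auto)
qed

lemma rr_out: assumes "\<alpha> <: w1" "i <: \<mu>" "app (rr \<alpha>) i ~= emp" "~ i <: dset p0 H \<alpha>" shows "app (rr \<alpha>) i = Bs i"
proof (cases "bas p0 H \<alpha> i = emp")
  case True then show ?thesis using rr_new assms by blast
next
  case False
  then have "app (rr \<alpha>) i = bas p0 H \<alpha> i" using assms unfolding mem_dset by blast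
  moreover have "sub \<alpha> w1" using Ord_trans[OF w1_props(2) assms(1)] by (auto simp: sub_def)
  ultimately show ?thesis using bas_mono[OF Ord_mem[OF w1_props(2) assms(1)] w1_props(2) _ False] by simp
qed

lemma rr_in: assumes "\<alpha> <: w1" "i <: dset p0 H \<alpha>" shows "sub (Bs i) (app (rr \<alpha>) i)"
proof (cases "bas p0 H \<alpha> i = emp")
  case True
  then have "app (rr \<alpha>) i = Bs i" using rr_new assms unfolding mem_dset by blast
  then show ?thesis by simp
next
  case False
  have "sub \<alpha> w1" using Ord_trans[OF w1_props(2) assms(1)] by (auto simp: sub_def)
  then have "Bs i = bas p0 H \<alpha> i" using bas_mono[OF Ord_mem[OF w1_props(2) assms(1)] w1_props(2) _ False] by simp
  then show ?thesis using rr_le assms unfolding mem_dset by simp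
qed

lemma Fin_dset: assumes "\<alpha> <: w1" shows "Fin (dset p0 H \<alpha>)"
proof -
  let ?b = "lam \<mu> (bas p0 H \<alpha>)"
  have "Fin (cup (Sep \<mu> (%i. app (rr \<alpha>) i ~= app ?b i & app ?b i ~= emp)) (sg (sn (H \<alpha>))))"
    using H[OF assms] unfolding le_iff by (intro Fin_cup) auto
  then show ?thesis by (rule Fin_sub) (auto simp: sub_def mem_dset)
qed

text \<open>A \<open>\<Delta>\<close>-system argument: for a root \<open>g\<close> with minimal \<open>k\<close>, each element outside \<open>g\<close> lies in only countably many of
  the finite sets \<open>gg \<alpha>\<close>, so infinitely many of them can be chosen disjoint outside \<open>g\<close>.\<close>

lemma lower_bound:
  assumes W: "sub W w1" "~ lep W om"
  shows "EX I q. sub I W & eqp om I & q <: P &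
    (ALL \<alpha>. \<alpha> <: I --> le q (rr \<alpha>) & (ALL i. i <: dset p0 H \<alpha> --> app q i = app (rr \<alpha>) i))"
proof -
  note [simp] = dt1[where F=H, OF dH]
  \<comment> \<open>The departures are recorded together with their values, so that a common root
    prescribes common values.\<close>
  define gg where "gg \<alpha> = Rep (dset p0 H \<alpha>) (%i. pr i (app (rr \<alpha>) i))" for \<alpha>
  have [simp]: "dt t ==> dt (%e. gg (t e))" for t by (rule dt1[where F=gg], unfold gg_def) simp_all
  have gg: "pr i b <: gg \<alpha> \<longleftrightarrow> i <: dset p0 H \<alpha> & b = app (rr \<alpha>) i" for i b \<alpha> unfolding gg_def by auto
  have Fgg: "Fin (gg \<alpha>)" if "\<alpha> <: w1" for \<alpha> unfolding gg_def by (intro Fin_Rep Fin_dset that) simp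
  have Ww: "\<alpha> <: w1" if "\<alpha> <: W" for \<alpha> using W(1) that subD by blast
  define T where "T k g = Sep W (%\<alpha>. sub g (gg \<alpha>) & eqp (diff (gg \<alpha>) g) k)" for k g
  have [simp]: "dt t ==> dt s ==> dt (%e. T (t e) (s e))" for t s by (rule dt2[where F=T], unfold T_def) simp_all
  have T: "\<alpha> <: T k g \<longleftrightarrow> \<alpha> <: W & sub g (gg \<alpha>) & eqp (diff (gg \<alpha>) g) k" for \<alpha> k g unfolding T_def by simp
  let ?Q = "%k. k <: om & (EX g. ~ lep (T k g) om)"
  have dQ: "dP ?Q" by simp
  have "EX k. ?Q k"
  proof -
    have "card (gg \<alpha>) <: om" if "\<alpha> <: W" for \<alpha> using Fgg[OF Ww[OF that]] unfolding Fin_card .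
    from pigeonhole[OF W(2), of "%\<alpha>. card (gg \<alpha>)" om, OF _ this lep_refl]
    obtain k where k: "k <: om" "~ lep (Sep W (%\<alpha>. card (gg \<alpha>) = k)) om" by auto
    have "sub (Sep W (%\<alpha>. card (gg \<alpha>) = k)) (T k emp)"
    proof (rule subI)
      fix \<alpha> assume a: "\<alpha> <: Sep W (%\<alpha>. card (gg \<alpha>) = k)"
      have "diff (gg \<alpha>) emp = gg \<alpha>" by (rule set_ext) simp
      then show "\<alpha> <: T k emp" unfolding T using a eqp_sym[OF card_eqp[of "gg \<alpha>"]] by (auto simp: sub_def)
    qed
    then have "~ lep (T k emp) om" using k(2) sub_lep lep_trans by blast
    then show ?thesis using k(1) by blast
  qed
  then obtain k0 where k0: "?Q k0" by blast
  then have ok0: "Ord k0" using Ord_om_mem by blast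
  define k where "k = lst ?Q"
  have k: "?Q k" unfolding k_def by (rule lst(2)[OF dQ ok0 k0])
  have kmin: "~ ?Q m" if "m <: k" for m using lst(3)[OF dQ ok0 k0] that unfolding k_def by blast
  obtain g where g: "~ lep (T k g) om" using k by blast
  define W' where "W' = T k g"
  have W': "\<alpha> <: W' \<longleftrightarrow> \<alpha> <: W & sub g (gg \<alpha>) & eqp (diff (gg \<alpha>) g) k" for \<alpha> unfolding W'_def T ..
  have W'w: "\<alpha> <: w1" if "\<alpha> <: W'" for \<alpha> using Ww that unfolding W' by blast
  have z_ctb: "lep (Sep W' (%\<alpha>. z <: gg \<alpha>)) om" if z: "~ z <: g" for z
  proof (rule ccontr)
    assume n: "~ ?thesis"
    have "EX \<alpha>. \<alpha> <: Sep W' (%\<alpha>. z <: gg \<alpha>)"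
    proof (rule ccontr)
      assume "~ ?thesis"
      then have "Sep W' (%\<alpha>. z <: gg \<alpha>) = emp" unfolding eq_emp by blast
      then show False using n Fin_ctb[OF Fin_emp] by simp
    qed
    then obtain \<alpha> where "\<alpha> <: W'" "z <: gg \<alpha>" by auto
    then have zd: "z <: diff (gg \<alpha>) g" "eqp (diff (gg \<alpha>) g) k" using z unfolding W' by auto
    obtain m where m: "m <: om" "k = suc m"
    proof -
      have "k ~= emp"
      proof
        assume "k = emp"
        with zd(2) obtain F where "dF F" "bij_betw F (ext (diff (gg \<alpha>) g)) (ext emp)" by (auto elim: eqpE)
        then show False using zd(1) unfolding bij_ext by auto
      qed
      then show ?thesis using om_cases k that by blast
    qed
    have "sub (Sep W' (%\<alpha>. z <: gg \<alpha>)) (T m (cup g (sg z)))"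
    proof (rule subI)
      fix \<beta> assume "\<beta> <: Sep W' (%\<alpha>. z <: gg \<alpha>)"
      then have b: "\<beta> <: W" "sub g (gg \<beta>)" "eqp (diff (gg \<beta>) g) (suc m)" "z <: gg \<beta>" unfolding m(2)[symmetric] using W' by auto
      have "diff (gg \<beta>) (cup g (sg z)) = diff (diff (gg \<beta>) g) (sg z)" by (rule set_ext) auto
      moreover have "eqp (diff (diff (gg \<beta>) g) (sg z)) m" by (rule eqp_del[OF b(3) m(1)]) (use b z in simp)
      ultimately show "\<beta> <: T m (cup g (sg z))" unfolding T using b by (auto simp: sub_def)
    qed
    then have "~ lep (T m (cup g (sg z))) om" using n sub_lep lep_trans by blast
    then show False using kmin[of m] m by auto
  qed
  have i_ctb: "lep (Sep W' (%\<alpha>. i <: dset p0 H \<alpha>)) om" if i: "ALL b. ~ pr i b <: g" for i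
  proof (rule Uni_sub_lep[OF Inf_om Fn_ctb, of "%b. Sep W' (%\<alpha>. pr i b <: gg \<alpha>)"])
    show "lep (Sep W' (%\<alpha>. pr i b <: gg \<alpha>)) om" for b using z_ctb i by blast
    fix \<alpha> assume "\<alpha> <: Sep W' (%\<alpha>. i <: dset p0 H \<alpha>)"
    then have a: "\<alpha> <: W'" "i <: dset p0 H \<alpha>" by simp_all
    then have "app (rr \<alpha>) i <: Fn" using PFn[OF rP[OF W'w]] unfolding mem_dset by blast
    then show "EX b. b <: Fn & \<alpha> <: Sep W' (%\<alpha>. pr i b <: gg \<alpha>)" using a gg by auto
  qed simp
  \<comment> \<open>Outside the root, later departures have to avoid the supports of the conditions
    chosen before. Each condition excludes only countably many indices, so the sequence
    \<open>K\<close> can be continued through all of \<open>om\<close>.\<close>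
  define Bd where "Bd \<alpha> = Sep W' (%\<beta>. EX i. i <: supp (rr \<alpha>) & i <: dset p0 H \<beta> & (ALL b. ~ pr i b <: g))" for \<alpha>
  have [simp]: "dt t ==> dt (%e. Bd (t e))" for t by (rule dt1[where F=Bd], unfold Bd_def) simp_all
  have Bd: "\<beta> <: Bd \<alpha> \<longleftrightarrow> \<beta> <: W' & (EX i. i <: supp (rr \<alpha>) & i <: dset p0 H \<beta> & (ALL b. ~ pr i b <: g))" for \<alpha> \<beta>
    unfolding Bd_def by (subst mem_Sep) simp_all
  have Bd_ctb: "lep (Bd \<alpha>) om" if a: "\<alpha> <: W'" for \<alpha>
  proof (rule Uni_sub_lep[OF Inf_om, of "Sep (supp (rr \<alpha>)) (%i. ALL b. ~ pr i b <: g)" "%i. Sep W' (%\<beta>. i <: dset p0 H \<beta>)"])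
    have "sub (Sep (supp (rr \<alpha>)) (%i. ALL b. ~ pr i b <: g)) (supp (rr \<alpha>))" by (auto simp: sub_def)
    then show "lep (Sep (supp (rr \<alpha>)) (%i. ALL b. ~ pr i b <: g)) om" using supp_ctb[OF rP[OF W'w[OF a]]] sub_lep lep_trans by blast
    show "lep (Sep W' (%\<beta>. x <: dset p0 H \<beta>)) om" if "x <: Sep (supp (rr \<alpha>)) (%i. ALL b. ~ pr i b <: g)" for x
      using i_ctb that by simp
    fix \<beta> assume "\<beta> <: Bd \<alpha>"
    then obtain i where "\<beta> <: W'" "i <: supp (rr \<alpha>)" "i <: dset p0 H \<beta>" "ALL b. ~ pr i b <: g" unfolding Bd by blast
    then show "EX i. i <: Sep (supp (rr \<alpha>)) (%i. ALL b. ~ pr i b <: g) & \<beta> <: Sep W' (%\<beta>. i <: dset p0 H \<beta>)" by auto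
  qed simp
  define K where "K = wrec (%n f. lst (%\<beta>. \<beta> <: W' & (ALL m. m <: n --> \<beta> ~= app f m & ~ \<beta> <: Bd (app f m))))"
  have [simp]: "dt t ==> dt (%e. K (t e))" for t by (rule dt1[where F=K], unfold K_def) simp_all
  let ?R = "%n \<beta>. \<beta> <: W' & (ALL m. m <: n --> \<beta> ~= K m & ~ \<beta> <: Bd (K m))"
  have K: "K n = lst (?R n)" for n
  proof -
    have "K n = lst (%\<beta>. \<beta> <: W' & (ALL m. m <: n --> \<beta> ~= app (lam n K) m & ~ \<beta> <: Bd (app (lam n K) m)))"
      unfolding K_def by (subst wrec_unfold) simp_all
    moreover have "(%\<beta>. \<beta> <: W' & (ALL m. m <: n --> \<beta> ~= app (lam n K) m & ~ \<beta> <: Bd (app (lam n K) m))) = ?R n"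
      by (auto simp: fun_eq_iff)
    ultimately show ?thesis by simp
  qed
  have Kn: "n <: om --> ?R n (K n)" for n
  proof (induction n rule: mem_induct)
    case (step n)
    show ?case
    proof
      assume n: "n <: om"
      have "lep (Uni (Rep n (%m. cup (Bd (K m)) (sg (K m))))) om"
      proof (rule Uni_lep[OF Inf_om Fin_ctb[OF Fin_nat[OF n]]])
        fix m assume m: "m <: n"
        then have "K m <: W'" using step om_memD[OF n] by blast
        then show "lep (cup (Bd (K m)) (sg (K m))) om" by (intro cup_lep[OF Inf_om Bd_ctb Fin_ctb[OF Fin_sg]])
      qed simp
      then have "~ sub W' (Uni (Rep n (%m. cup (Bd (K m)) (sg (K m)))))"
        using g sub_lep lep_trans unfolding W'_def by blast
      then obtain \<beta> where b: "\<beta> <: W'" "~ \<beta> <: Uni (Rep n (%m. cup (Bd (K m)) (sg (K m))))" unfolding sub_def by blast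
      then have "ALL m. m <: n --> ~ \<beta> <: cup (Bd (K m)) (sg (K m))" by (subst (asm) mem_UniRep) simp_all
      then have R: "?R n \<beta>" using b(1) by simp
      have ob: "Ord \<beta>" using W'w[OF b(1)] Ord_mem[OF w1_props(2)] by blast
      have "dP (?R n)" by simp
      from lst(2)[OF this ob R] show "?R n (K n)" unfolding K[of n] .
    qed
  qed simp
  have KW: "K n <: W'" if "n <: om" for n using Kn that by blast
  have Kinj: "m = n" if mn: "m <: om" "n <: om" "K m = K n" for m n
  proof -
    have "~ m <: n" "~ n <: m" using Kn[of n] Kn[of m] mn by auto
    then show ?thesis using Ord_linear[OF Ord_om_mem Ord_om_mem] mn by blast
  qed
  have sep: "EX b. pr i b <: g" if mn: "m <: n" "n <: om" "i <: supp (rr (K m))" "i <: dset p0 H (K n)" for m n i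
    using Kn[of n] mn KW[OF mn(2)] unfolding Bd by blast
  have root: "i <: dset p0 H \<alpha> & app (rr \<alpha>) i = b" if "pr i b <: g" "\<alpha> <: W'" for i b \<alpha>
    using that gg[of i b \<alpha>] unfolding W' sub_def by blast
  have dsup: "i <: supp (rr \<alpha>)" if "i <: dset p0 H \<alpha>" for i \<alpha> using that unfolding mem_dset by simp
  define I where "I = Rep om K"
  have I: "\<alpha> <: I \<longleftrightarrow> (EX n. n <: om & \<alpha> = K n)" for \<alpha> unfolding I_def by simp
  have IW: "\<alpha> <: W'" if "\<alpha> <: I" for \<alpha> using that KW unfolding I by blast
  have Iw: "\<alpha> <: w1" if "\<alpha> <: I" for \<alpha> using IW W'w that by blast
  have agree: "app (rr \<alpha>) i = app (rr \<beta>) i" if ab: "\<alpha> <: I" "\<beta> <: I" "i <: dset p0 H \<alpha>" "i <: dset p0 H \<beta>" for \<alpha> \<beta> i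
  proof -
    obtain m n where mn: "m <: om" "n <: om" "\<alpha> = K m" "\<beta> = K n" using ab(1,2) unfolding I by blast
    from Ord_linear[OF Ord_om_mem[OF mn(1)] Ord_om_mem[OF mn(2)]]
    have "m = n | (EX b. pr i b <: g)" using sep[of m n i] sep[of n m i] mn ab dsup by blast
    then show ?thesis using root[OF _ IW] ab mn by blast
  qed
  \<comment> \<open>Where some member of \<open>I\<close> departs, \<open>q\<close> takes its value,
    which is well defined by \<open>agree\<close>; elsewhere on the union of the supports it takes
    the final base.\<close>
  define q where "q i = (if EX \<alpha>. \<alpha> <: I & i <: dset p0 H \<alpha> then the1 (%v. EX \<alpha>. \<alpha> <: I & i <: dset p0 H \<alpha> & v = app (rr \<alpha>) i)
     else if EX \<alpha>. \<alpha> <: I & app (rr \<alpha>) i ~= emp then Bs i else emp)" for i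
  have dq: "dF q" unfolding q_def by simp
  have q1: "q i = app (rr \<alpha>) i" if "\<alpha> <: I" "i <: dset p0 H \<alpha>" for i \<alpha>
  proof -
    have "the1 (%v. EX \<alpha>. \<alpha> <: I & i <: dset p0 H \<alpha> & v = app (rr \<alpha>) i) = app (rr \<alpha>) i"
      using that agree by (intro the1_eq) blast+
    then show ?thesis unfolding q_def using that by auto
  qed
  have q2: "q i = Bs i" if "\<alpha> <: I" "app (rr \<alpha>) i ~= emp" "~ (EX \<alpha>. \<alpha> <: I & i <: dset p0 H \<alpha>)" for i \<alpha>
    unfolding q_def using that by auto
  have q3: "q i = emp" if "~ (EX \<alpha>. \<alpha> <: I & app (rr \<alpha>) i ~= emp)" for i
    using that unfolding q_def mem_dset by auto
  have q4: "EX \<alpha>. \<alpha> <: I & q i = app (rr \<alpha>) i" if qi: "i <: \<mu>" "q i ~= emp" for i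
  proof -
    obtain \<alpha> where a: "\<alpha> <: I" "app (rr \<alpha>) i ~= emp" using q3[of i] qi(2) by blast
    show ?thesis
    proof (cases "EX \<alpha>. \<alpha> <: I & i <: dset p0 H \<alpha>")
      case True then show ?thesis using q1 by blast
    next
      case False
      then have "app (rr \<alpha>) i = Bs i" using rr_out[OF Iw[OF a(1)] qi(1) a(2)] a by blast
      then show ?thesis using q2[OF a False] a by auto
    qed
  qed
  have qP: "lam \<mu> q <: P"
  proof (rule PI[OF dq])
    fix i assume i: "i <: \<mu>"
    show "q i <: Fn" using q4[OF i] PFn[OF rP[OF Iw] i] by (cases "q i = emp") auto
  next
    show "lep (Sep \<mu> (%i. q i ~= emp)) om"
    proof (rule Uni_sub_lep[OF Inf_om, of I "%\<alpha>. supp (rr \<alpha>)"])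
      show "lep I om" unfolding I_def by (rule Rep_lep) simp
      show "lep (supp (rr \<alpha>)) om" if "\<alpha> <: I" for \<alpha> using supp_ctb[OF rP[OF Iw[OF that]]] .
      fix i assume "i <: Sep \<mu> (%i. q i ~= emp)"
      then have "i <: \<mu>" "q i ~= emp" using dt1[where F=q, OF dq] by simp_all
      then show "EX \<alpha>. \<alpha> <: I & i <: supp (rr \<alpha>)" using q4[of i] by auto
    qed simp
  qed
  have lq: "app (lam \<mu> q) i = q i" if "i <: \<mu>" for i using dq that by simp
  have le: "le (lam \<mu> q) (rr \<alpha>)" if a: "\<alpha> <: I" for \<alpha>
  proof -
    obtain n where n: "n <: om" "\<alpha> = K n" using a unfolding I by blast
    show ?thesis
    \<comment> \<open>On the support of the n-th condition \<open>q\<close> can differ only where an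
      earlier one departs: a later departure meets this support in the root alone, and there the
      n-th condition departs with the same value. The earlier departures form a finite set.\<close>
    proof (rule leI[OF qP rP[OF Iw[OF a]], where d="Uni (Rep n (%m. dset p0 H (K m)))"])
      fix i assume i: "i <: \<mu>"
      show "sub (app (rr \<alpha>) i) (app (lam \<mu> q) i)"
      proof (cases "app (rr \<alpha>) i = emp | i <: dset p0 H \<alpha>")
        case True then show ?thesis using q1[OF a] lq[OF i] by (auto simp: sub_def)
      next
        case False
        then have r: "app (rr \<alpha>) i = Bs i" "app (rr \<alpha>) i ~= emp" using rr_out[OF Iw[OF a] i] by blast+
        show ?thesis
        proof (cases "EX \<beta>. \<beta> <: I & i <: dset p0 H \<beta>")
          case True
          then obtain \<beta> where "\<beta> <: I" "i <: dset p0 H \<beta>" by blast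
          then show ?thesis using q1[of \<beta> i] rr_in[OF Iw, of \<beta> i] r lq[OF i] by simp
        next
          case False then show ?thesis using q2[OF a r(2) False] r lq[OF i] by simp
        qed
      qed
      assume d: "app (lam \<mu> q) i ~= app (rr \<alpha>) i" "app (rr \<alpha>) i ~= emp"
      then have nd: "~ i <: dset p0 H \<alpha>" using q1[OF a] lq[OF i] by auto
      then have r: "app (rr \<alpha>) i = Bs i" using rr_out[OF Iw[OF a] i d(2)] by blast
      then obtain \<beta> where b: "\<beta> <: I" "i <: dset p0 H \<beta>" using q2[OF a d(2)] d lq[OF i] by auto
      then obtain m where m: "m <: om" "\<beta> = K m" unfolding I by blast
      have "m <: n"
      proof (rule ccontr)
        assume "~ m <: n"
        then have "m = n | n <: m" using Ord_linear[OF Ord_om_mem[OF m(1)] Ord_om_mem[OF n(1)]] by blast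
        then have "EX c. pr i c <: g" using sep[of n m i] m n b nd d(2) i by auto
        then show False using root[OF _ IW[OF a]] nd by blast
      qed
      then show "i <: Uni (Rep n (%m. dset p0 H (K m)))" using b m by (subst mem_UniRep) auto
    next
      show "Fin (Uni (Rep n (%m. dset p0 H (K m))))"
      proof (rule Fin_Uni)
        show "Fin (Rep n (%m. dset p0 H (K m)))" by (rule Fin_Rep[OF Fin_nat[OF n(1)]]) simp
        fix x assume "x <: Rep n (%m. dset p0 H (K m))"
        then obtain m where "m <: n" "x = dset p0 H (K m)" by auto
        then show "Fin x" using Fin_dset[OF W'w[OF KW[OF om_memD[OF n(1)]]]] by simp
      qed
    qed
  qed
  have "eqp om I"
  proof (rule eqpI[of K])
    show "bij_betw K (ext om) (ext I)" unfolding bij_ext inj_ext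
    proof (intro conjI allI impI)
      show "x = y" if "x <: om" "y <: om" "K x = K y" for x y using Kinj[OF that] .
      show "K x <: I" if "x <: om" for x unfolding I using that by blast
      show "EX x. x <: om & K x = y" if "y <: I" for y using that unfolding I by blast
    qed
  qed simp
  moreover have "sub I W"
  proof (rule subI)
    fix \<alpha> assume "\<alpha> <: I"
    from IW[OF this] show "\<alpha> <: W" unfolding W' by blast
  qed
  moreover have "app (lam \<mu> q) i = app (rr \<alpha>) i" if "\<alpha> <: I" "i <: dset p0 H \<alpha>" for \<alpha> i
    using q1[OF that] lq that unfolding mem_dset by simp
  ultimately show ?thesis using qP le by blast
qed

end
end

text \<open>Conditions \<open>fs z\<close> with \<open>S z h\<close> are chosen recursively below the base of the previous choices \<open>h\<close>. If the recursion
  stops before \<open>\<omega>\<^sub>1\<close>, the first alternative holds; otherwise the lemma on lower bounds gives the second.\<close>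

lemma fusion:
  assumes S: "dP2 S" and p0: "p0 <: P"
  shows "(EX q h. le q p0 & lep h om & (ALL z. z <: h --> z <: prd P X & (EX h'. S z h')) &
      ~ (EX r x. x <: X & le r q & S (pr r x) h)) |
    (EX H. dF H & (ALL \<alpha>. \<alpha> <: w1 --> H \<alpha> <: prd P X & S (H \<alpha>) (Rep \<alpha> H)) &
      (ALL W. sub W w1 --> ~ lep W om --> (EX I q. sub I W & eqp om I & le q p0 &
         (ALL \<alpha>. \<alpha> <: I --> le q (fs (H \<alpha>)) &
           (sn (H \<alpha>) <: \<mu> --> app (fs (H \<alpha>)) (sn (H \<alpha>)) ~= emp --> app q (sn (H \<alpha>)) = app (fs (H \<alpha>)) (sn (H \<alpha>)))))))"
proof -
  note [simp] = dp2[where P=S, OF S]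
  let ?Z = "prd P X"
  obtain C where C: "dF C" "ALL y. y <: Pw ?Z & (EX z. z <: y) --> C y <: y" using AC by blast
  note [simp] = dt1[where F=C, OF C(1)]
  \<comment> \<open>Inside the recursion the earlier choices are the values of a set function
    \<open>f\<close>; \<open>bas_cong\<close> later allows \<open>app f\<close> to be replaced by
    \<open>H\<close>.\<close>
  define Sx where "Sx \<alpha> f = Sep ?Z (%z. le (fs z) (lam \<mu> (bas p0 (app f) \<alpha>)) & S z (Rep \<alpha> (app f)))" for \<alpha> f
  have dSx: "dt t ==> dt s ==> dt (%e. Sx (t e) (s e))" for t s
    by (rule dt2[where F=Sx], unfold Sx_def bas_def) simp_all
  note [simp] = dSx
  define H where "H = wrec (%\<alpha> f. if EX z. z <: Sx \<alpha> f then C (Sx \<alpha> f) else emp)"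
  have [simp]: "dt t ==> dt (%e. H (t e))" for t by (rule dt1[where F=H], unfold H_def) simp_all
  have dH: "dF H" by simp
  define Sy where "Sy \<alpha> = Sep ?Z (%z. le (fs z) (lam \<mu> (bas p0 H \<alpha>)) & S z (Rep \<alpha> H))" for \<alpha>
  have Sy: "z <: Sy \<alpha> \<longleftrightarrow> z <: ?Z & le (fs z) (lam \<mu> (bas p0 H \<alpha>)) & S z (Rep \<alpha> H)" for z \<alpha>
    unfolding Sy_def by (subst mem_Sep) (simp_all add: dt_bas[OF p0 dH])
  have H: "H \<alpha> = (if EX z. z <: Sy \<alpha> then C (Sy \<alpha>) else emp)" if "Ord \<alpha>" for \<alpha>
  proof -
    have "H \<alpha> = (if EX z. z <: Sx \<alpha> (lam \<alpha> H) then C (Sx \<alpha> (lam \<alpha> H)) else emp)"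
      unfolding H_def by (subst wrec_unfold) simp_all
    moreover have "Sx \<alpha> (lam \<alpha> H) = Sy \<alpha>"
    proof -
      have "Rep \<alpha> (app (lam \<alpha> H)) = Rep \<alpha> H" by (rule set_ext) (auto cong: conj_cong)
      moreover have "bas p0 (app (lam \<alpha> H)) \<alpha> = bas p0 H \<alpha>"
        by (rule HOL.ext, rule bas_cong) (use that in auto)
      ultimately show ?thesis unfolding Sx_def Sy_def by simp
    qed
    ultimately show ?thesis by simp
  qed
  have HZ: "H \<alpha> <: Sy \<alpha>" if "Ord \<alpha>" "H \<alpha> <: ?Z" for \<alpha>
  proof -
    have "EX z. z <: Sy \<alpha>" using that H[OF that(1)] by (auto simp: mem_prd split: if_splits)
    moreover have "Sy \<alpha> <: Pw ?Z" by (auto simp: sub_def Sy)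
    ultimately show ?thesis using H[OF that(1)] C(2) by simp
  qed
  show ?thesis
  proof (cases "EX \<alpha>. \<alpha> <: w1 & ~ H \<alpha> <: ?Z")
    case True
    let ?Q = "%\<alpha>. \<alpha> <: w1 & ~ H \<alpha> <: ?Z"
    have dQ: "dP ?Q" by simp
    obtain \<alpha>0 where a0: "?Q \<alpha>0" using True by blast
    have oa0: "Ord \<alpha>0" using a0 Ord_mem[OF w1_props(2)] by blast
    define \<alpha> where "\<alpha> = lst ?Q"
    have a: "\<alpha> <: w1" "~ H \<alpha> <: ?Z" and oa: "Ord \<alpha>" using lst(1,2)[OF dQ oa0 a0] unfolding \<alpha>_def by blast+
    have am: "H \<beta> <: ?Z" if b: "\<beta> <: \<alpha>" for \<beta>
      using lst(3)[OF dQ oa0 a0, of \<beta>] b Ord_trans[OF w1_props(2) a(1) b] unfolding \<alpha>_def by blast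
    have bP: "fs (H \<beta>) <: P" if "\<beta> <: \<alpha>" for \<beta> using am[OF that] by (auto simp: mem_prd)
    have ns: "~ (EX z. z <: Sy \<alpha>)"
    proof
      assume "EX z. z <: Sy \<alpha>"
      moreover have "Sy \<alpha> <: Pw ?Z" by (auto simp: sub_def Sy)
      ultimately have "H \<alpha> <: Sy \<alpha>" using H[OF oa] C(2) by simp
      then show False using a(2) unfolding Sy by blast
    qed
    let ?q = "lam \<mu> (bas p0 H \<alpha>)"
    have "le ?q p0" by (rule bas_P(2)[OF p0 dH a(1) bP])
    moreover have "lep (Rep \<alpha> H) om" using lep_trans[OF Rep_lep w1_props(4)[OF a(1)]] by simp
    moreover have "z <: ?Z & (EX h'. S z h')" if zr: "z <: Rep \<alpha> H" for z
    proof -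
      obtain \<beta> where b: "\<beta> <: \<alpha>" "z = H \<beta>" using zr by auto
      then show ?thesis using HZ[OF Ord_mem[OF oa b(1)] am[OF b(1)]] unfolding Sy by blast
    qed
    moreover have "~ (EX r x. x <: X & le r ?q & S (pr r x) (Rep \<alpha> H))"
    proof
      assume "EX r x. x <: X & le r ?q & S (pr r x) (Rep \<alpha> H)"
      then obtain r x where "x <: X" "le r ?q" "S (pr r x) (Rep \<alpha> H)" by blast
      then have "pr r x <: Sy \<alpha>" unfolding Sy using le_P by auto
      then show False using ns by blast
    qed
    ultimately show ?thesis by blast
  next
    case False
    then have HZ': "H \<alpha> <: Sy \<alpha>" if "\<alpha> <: w1" for \<alpha> using HZ Ord_mem[OF w1_props(2)] that by blast
    have Hle: "le (fs (H \<alpha>)) (lam \<mu> (bas p0 H \<alpha>))" if "\<alpha> <: w1" for \<alpha> using HZ'[OF that] unfolding Sy by blast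
    have bP: "fs (H \<beta>) <: P" if "\<beta> <: w1" for \<beta> using Hle[OF that] le_P by blast
    have "EX I q. sub I W & eqp om I & le q p0 & (ALL \<alpha>. \<alpha> <: I --> le q (fs (H \<alpha>)) &
           (sn (H \<alpha>) <: \<mu> --> app (fs (H \<alpha>)) (sn (H \<alpha>)) ~= emp --> app q (sn (H \<alpha>)) = app (fs (H \<alpha>)) (sn (H \<alpha>))))"
      if W: "sub W w1" "~ lep W om" for W
    proof -
      obtain I q where I: "sub I W" "eqp om I" "q <: P"
        "ALL \<alpha>. \<alpha> <: I --> le q (fs (H \<alpha>)) & (ALL i. i <: dset p0 H \<alpha> --> app q i = app (fs (H \<alpha>)) i)"
        using lower_bound[OF p0 dH Hle W] by blast
      obtain F where "dF F" "bij_betw F (ext om) (ext I)" using I(2) by (rule eqpE)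
      then obtain \<alpha> where a: "\<alpha> <: I" unfolding bij_ext using emp_om by blast
      then have aw: "\<alpha> <: w1" using I(1) W(1) subD by blast
      have "le (lam \<mu> (bas p0 H \<alpha>)) p0"
        by (rule bas_P(2)[OF p0 dH aw bP]) (rule Ord_trans[OF w1_props(2) aw])
      then have "le q p0" using I(4) a le_trans[OF le_trans[OF _ Hle[OF aw]]] by blast
      \<comment> \<open>The marked coordinate counts as a departure by the last clause of
        \<open>dset\<close> as soon as it is nonempty, even where it agrees with the base; hence the
        lower bound keeps its value.\<close>
      moreover have "app q (sn (H \<alpha>)) = app (fs (H \<alpha>)) (sn (H \<alpha>))"
        if "\<alpha> <: I" "sn (H \<alpha>) <: \<mu>" "app (fs (H \<alpha>)) (sn (H \<alpha>)) ~= emp" for \<alpha>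
        using I(4) that mem_dset[OF p0 dH, of "sn (H \<alpha>)" \<alpha>] by blast
      ultimately show ?thesis using I by blast
    qed
    moreover have "ALL \<alpha>. \<alpha> <: w1 --> H \<alpha> <: ?Z & S (H \<alpha>) (Rep \<alpha> H)" using HZ' unfolding Sy by blast
    ultimately show ?thesis using dH by blast
  qed
qed

end

section \<open>Rational and real numbers inside a model\<close>

context zfc
begin

subsection \<open>Arithmetic of natural numbers\<close>

definition add :: "'v => 'v => 'v" where "add m = wrec (%n f. cup m (Rep n (app f)))"
lemma dt_add [simp]: "dt a ==> dt b ==> dt (%e. add (a e) (b e))"
  by (rule dt2[where F=add], unfold add_def) simp_all

lemma mem_add: "z <: add m n \<longleftrightarrow> z <: m | (EX k. k <: n & z = add m k)"
proof -
  have "add m n = cup m (Rep n (app (lam n (add m))))"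
    unfolding add_def by (subst wrec_unfold) simp_all
  then show ?thesis by (simp cong: conj_cong)
qed
lemma add_emp [simp]: "add m emp = m" by (rule set_ext) (simp add: mem_add)
lemma add_suc [simp]: "add m (suc n) = suc (add m n)" by (rule set_ext) (auto simp: mem_add)
lemma add_om [simp]: "m <: om ==> n <: om ==> add m n <: om" by (rotate_tac, induction rule: om_induct) simp_all

text \<open>For a nonzero natural number, \<open>Uni\<close> is the predecessor
  (\<open>Uni_suc\<close>).\<close>

definition mul :: "'v => 'v => 'v" where
  "mul m = wrec (%n f. if n = emp then emp else add (app f (Uni n)) m)"
lemma dt_mul [simp]: "dt a ==> dt b ==> dt (%e. mul (a e) (b e))"
  by (rule dt2[where F=mul], unfold mul_def) simp_all
lemma mul_unfold: "mul m n = (if n = emp then emp else add (app (lam n (mul m)) (Uni n)) m)"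
  unfolding mul_def by (subst wrec_unfold) simp_all
lemma Uni_suc: "Ord m ==> Uni (suc m) = m"
  by (rule set_ext) (use Ord_trans in auto)
lemma mul_emp [simp]: "mul m emp = emp" by (subst mul_unfold) simp
lemma mul_suc [simp]: "n <: om ==> mul m (suc n) = add (mul m n) m"
  by (subst mul_unfold) (simp add: Uni_suc Ord_om_mem)
lemma mul_om [simp]: "m <: om ==> n <: om ==> mul m n <: om" by (rotate_tac, induction rule: om_induct) simp_all

lemma add_emp_left [simp]: "n <: om ==> add emp n = n" by (induction rule: om_induct) simp_all
lemma add_suc_left [simp]: "n <: om ==> add (suc m) n = suc (add m n)" by (induction rule: om_induct) simp_all
lemma add_commute: "m <: om ==> n <: om ==> add m n = add n m" by (rotate_tac, induction rule: om_induct) simp_all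
lemma add_assoc: "k <: om ==> add (add m n) k = add m (add n k)" by (induction rule: om_induct) simp_all
lemma add_left_commute: "m <: om ==> n <: om ==> k <: om ==> add m (add n k) = add n (add m k)"
  using add_assoc[of k m n] add_assoc[of k n m] add_commute by simp
lemma mul_emp_left [simp]: "n <: om ==> mul emp n = emp" by (induction rule: om_induct) simp_all
lemma mul_suc_left: "n <: om ==> m <: om ==> mul (suc m) n = add (mul m n) n"
proof (induction rule: om_induct)
  case (suc n)
  then show ?case using add_assoc[of m "mul m n" n] add_assoc[of n "mul m n" m] add_commute[of m n] by simp
qed simp_all
lemma mul_commute: "m <: om ==> n <: om ==> mul m n = mul n m"
  by (rotate_tac, induction rule: om_induct) (simp_all add: mul_suc_left)
lemma mul_add: assumes "k <: om" "m <: om" "n <: om" shows "mul (add m n) k = add (mul m k) (mul n k)"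
  using assms(1)
proof (induction rule: om_induct)
  case (suc k)
  then show ?case using assms by (simp add: add_assoc add_left_commute)
qed (use assms in simp_all)
lemma mul_add2: "k <: om ==> m <: om ==> n <: om ==> mul k (add m n) = add (mul k m) (mul k n)"
  using mul_add[of k m n] mul_commute by simp
lemma mul_assoc: assumes "k <: om" "m <: om" "n <: om" shows "mul (mul m n) k = mul m (mul n k)"
proof -
  have "mul (mul n m) k = mul (mul n k) m"
    using assms(2)
  proof (induction rule: om_induct)
    case (suc i)
    then show ?case using assms by (simp add: mul_add)
  qed (use assms in simp_all)
  then show ?thesis using assms mul_commute[of m n] mul_commute[of m "mul n k"] by simp
qed
lemma suc_mono: "n <: om ==> m <: n ==> suc m <: suc n"
  using Ord_suc_sub[OF Ord_om_mem, of n m] Ord_sub[of "suc m" n] Ord_om_mem Ord_mem by auto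
lemma om_linear: "m <: om ==> n <: om ==> m <: n | m = n | n <: m"
  using Ord_linear Ord_om_mem by blast
lemma om_trans: "n <: om ==> m <: n ==> k <: m ==> k <: n" using Ord_trans Ord_om_mem by blast

lemma add_less: "k <: om ==> n <: om ==> m <: n ==> add m k <: add n k"
proof (induction rule: om_induct)
  case (suc k) then show ?case using suc_mono[of "add n k" "add m k"] by simp
qed simp_all
lemma add_less_cancel: assumes "k <: om" "m <: om" "n <: om" "add m k <: add n k" shows "m <: n"
proof (rule ccontr)
  assume "~ m <: n"
  then have "m = n | n <: m" using om_linear assms by blast
  then have "add m k = add n k | add n k <: add m k" using add_less assms by blast
  then show False using assms(4) not_mem_cycle not_mem_self[of "add m k"] by (auto simp: assms)
qed
lemma add_less2: assumes "m <: om" "n <: om" "k <: om" "i <: om" "m <: n" "k <: i | k = i" shows "add m k <: add n i"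
proof (cases "k = i")
  case True then show ?thesis using add_less assms by simp
next
  case False
  then have "add k n <: add i n" using add_less assms by simp
  then have "add n k <: add n i" using add_commute assms by simp
  then show ?thesis using add_less[OF assms(3,2,5)] om_trans[of "add n i" "add n k"] assms by simp
qed
lemma mul_less: assumes "m <: om" "n <: om" "k <: om" "k ~= emp" "m <: n" shows "mul m k <: mul n k"
proof -
  obtain i where i: "i <: om" "k = suc i" using om_cases assms by blast
  have "mul m (suc i) <: mul n (suc i)" using i(1)
  proof (induction rule: om_induct)
    case emp then show ?case using assms mul_suc[OF emp_om] by simp
  next
    case (suc i)
    then show ?case using assms add_less2[of "mul m (suc i)" "mul n (suc i)" m n] mul_suc[of "suc i"] by simp
  qed simp
  then show ?thesis using i by simp
qed
lemma mul_less_cancel: assumes "m <: om" "n <: om" "k <: om" "mul m k <: mul n k" shows "m <: n"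
proof (rule ccontr)
  assume "~ m <: n"
  then have "m = n | n <: m" using om_linear assms by blast
  moreover have "k ~= emp" using assms(4) by auto
  ultimately have "mul m k = mul n k | mul n k <: mul m k" using mul_less assms by blast
  then show False using assms(4) not_mem_cycle not_mem_self[of "mul m k"] by (auto simp: assms)
qed
lemma mul_le: "m <: om ==> n <: om ==> k <: om ==> m <: n | m = n ==> mul m k <: mul n k | mul m k = mul n k"
  using mul_less[of m n k] by (cases "k = emp") auto

subsection \<open>The formulas for sum and product\<close>

lemma eqp_cup:
  assumes "eqp a c" "eqp b d" "!!z. ~ (z <: a & z <: b)" "!!z. ~ (z <: c & z <: d)"
  shows "eqp (cup a b) (cup c d)"
proof -
  obtain F where F: "dF F" "bij_betw F (ext a) (ext c)" using assms(1) by (rule eqpE)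
  obtain G where G: "dF G" "bij_betw G (ext b) (ext d)" using assms(2) by (rule eqpE)
  note [simp] = dt1[where F=F, OF F(1)] dt1[where F=G, OF G(1)]
  let ?H = "%z. if z <: a then F z else G z"
  have Fc: "F x <: c" if "x <: a" for x using F(2) that unfolding bij_ext by blast
  have Gd: "G x <: d" if "x <: b" for x using G(2) that unfolding bij_ext by blast
  have "bij_betw ?H (ext (cup a b)) (ext (cup c d))" unfolding bij_ext inj_ext
  proof (intro conjI allI impI)
    fix x y assume xy: "x <: cup a b" "y <: cup a b" "?H x = ?H y"
    show "x = y"
    proof (cases "x <: a"; cases "y <: a")
      assume "x <: a" "y <: a" then show ?thesis using xy F(2) unfolding bij_ext inj_ext by simp
    next
      assume "x <: a" "~ y <: a" then show ?thesis using xy Fc[of x] Gd[of y] assms(4)[of "F x"] by auto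
    next
      assume "~ x <: a" "y <: a" then show ?thesis using xy Fc[of y] Gd[of x] assms(4)[of "F y"] by auto
    next
      assume "~ x <: a" "~ y <: a" then show ?thesis using xy G(2) unfolding bij_ext inj_ext by simp
    qed
  next
    fix x assume "x <: cup a b" then show "?H x <: cup c d" using Fc Gd by auto
  next
    fix y assume "y <: cup c d"
    then consider "y <: c" | "y <: d" by auto
    then show "EX x. x <: cup a b & ?H x = y"
    proof cases
      case 1
      then obtain x where "x <: a" "F x = y" using F(2) unfolding bij_ext by blast
      then show ?thesis by (intro exI[of _ x]) simp
    next
      case 2
      then obtain x where "x <: b" "G x = y" using G(2) unfolding bij_ext by blast
      then show ?thesis using assms(3)[of x] by (intro exI[of _ x]) auto
    qed
  qed
  then show ?thesis by (rule eqpI[rotated]) simp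
qed

lemma add_split: assumes "m <: om" "n <: om"
  shows "add m n = cup m (Rep n (add m))" "~ (z <: m & z <: Rep n (add m))" "eqp (Rep n (add m)) n"
proof -
  show "add m n = cup m (Rep n (add m))" by (rule set_ext) (simp add: mem_add)
  have "~ add m k <: m" for k
  proof
    assume "add m k <: m"
    then have "add m k <: add m k" by (subst mem_add) blast
    then show False by simp
  qed
  then show "~ (z <: m & z <: Rep n (add m))" by auto
  have "eqp n (Rep n (add m))"
  proof (rule eqpI[of "add m"])
    have "x = y" if "x <: n" "y <: n" "add m x = add m y" for x y
    proof -
      have xy: "x <: om" "y <: om" using om_memD[OF assms(2)] that by blast+
      have "~ x <: y" "~ y <: x" using that(3) mem_add[of "add m x" m y] mem_add[of "add m y" m x] by auto
      then show ?thesis using om_linear xy by blast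
    qed
    then show "bij_betw (add m) (ext n) (ext (Rep n (add m)))" unfolding bij_ext inj_ext by auto
  qed simp
  then show "eqp (Rep n (add m)) n" by (rule eqp_sym)
qed

lemma eqp_om: "m <: om ==> n <: om ==> eqp m n \<longleftrightarrow> m = n" using Card_eqI Card_nat by auto

definition isum :: "'v => 'v => 'v => bool" where
  "isum m n k \<longleftrightarrow> (EX x y. eqp x m & eqp y n & ~ (EX z. z <: x & z <: y) & (ALL z. z <: k \<longleftrightarrow> z <: x | z <: y))"

lemma sum_iff: assumes "m <: om" "n <: om" "k <: om" shows "isum m n k \<longleftrightarrow> k = add m n"
proof
  assume "isum m n k"
  then obtain x y where xy: "eqp x m" "eqp y n" "~ (EX z. z <: x & z <: y)" "ALL z. z <: k \<longleftrightarrow> z <: x | z <: y"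
    unfolding isum_def by blast
  note s = add_split[OF assms(1,2)]
  have "k = cup x y" by (rule set_ext) (use xy(4) in simp)
  moreover have "eqp (cup x y) (cup m (Rep n (add m)))"
    by (rule eqp_cup[OF xy(1) eqp_trans[OF xy(2) eqp_sym[OF s(3)]]]) (use xy(3) s(2) in blast)+
  ultimately have "eqp k (add m n)" using s(1) by simp
  then show "k = add m n" using eqp_om assms by simp
next
  assume "k = add m n"
  then show "isum m n k"
    unfolding isum_def using add_split(2,3)[OF assms(1,2)]
    by (intro exI[of _ m] exI[of _ "Rep n (add m)"]) (auto simp: mem_add)
qed

lemma prd_mul: assumes "m <: om" "n <: om" shows "eqp (prd m n) (mul m n)"
  using assms(2)
proof (induction rule: om_induct)
  case emp
  have "prd m emp = emp" by (rule set_ext) (simp add: mem_prd)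
  then show ?case by simp
next
  case (suc n)
  have "prd m (suc n) = cup (prd m n) (prd m (sg n))" by (rule set_ext) (auto simp: mem_prd)
  moreover have e: "eqp (prd m (sg n)) m"
    by (rule eqpI[of fs]) (auto simp: bij_ext inj_ext mem_prd)
  have mn: "mul m n <: om" using assms(1) suc(1) by simp
  note s = add_split[OF mn assms(1)]
  have "eqp (cup (prd m n) (prd m (sg n))) (cup (mul m n) (Rep m (add (mul m n))))"
  proof (rule eqp_cup[OF suc(2) eqp_trans[OF e eqp_sym[OF s(3)]] _ s(2)])
    show "~ (z <: prd m n & z <: prd m (sg n))" for z by (auto simp: mem_prd)
  qed
  ultimately show ?case using suc(1) s(1) by simp
qed simp

lemma sat_sum [simp]: "a < n ==> b < n ==> k < n ==> sat E e (is_sum a b k n) \<longleftrightarrow> isum (e a) (e b) (e k)"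
  by (simp add: is_sum_def isum_def)
lemma sat_prod [simp]: assumes "a < n" "b < n" "k < n"
  shows "sat E e (is_prod a b k n) \<longleftrightarrow> eqp (prd (e a) (e b)) (e k)"
proof -
  have "(ALL z. z <: c \<longleftrightarrow> (EX x y. x <: e a & y <: e b & z = pr x y)) \<longleftrightarrow> c = prd (e a) (e b)" for c
    using set_ext[of c "prd (e a) (e b)"] by (auto simp: mem_prd)
  then show ?thesis using assms by (simp add: is_prod_def)
qed

subsection \<open>The order of the rationals\<close>

definition RQ :: 'v where "RQ = Sep (prd om (prd om om)) (%q. sn (sn q) ~= emp)"
lemma mem_RQ: "q <: RQ \<longleftrightarrow> (EX a b c. a <: om & b <: om & c <: om & c ~= emp & q = pr a (pr b c))"
  unfolding RQ_def by (auto simp: mem_prd)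

definition rl :: "'v => 'v => bool" where
  "rl q r \<longleftrightarrow> add (mul (fs q) (sn (sn r))) (mul (fs (sn r)) (sn (sn q))) <:
             add (mul (fs r) (sn (sn q))) (mul (fs (sn q)) (sn (sn r)))"
lemma dp_rl [simp]: "dt a ==> dt b ==> dp (%e. rl (a e) (b e))" by (rule dp2[where P=rl], unfold rl_def) simp_all
lemma rl_pr: "rl (pr a (pr b c)) (pr a' (pr b' c')) \<longleftrightarrow> add (mul a c') (mul b' c) <: add (mul a' c) (mul b c')"
  unfolding rl_def by simp

lemma add4: assumes "p <: om" "q <: om" "r <: om" "s <: om"
  shows "add (add r s) (add p q) = add (add p s) (add q r)"
  using assms by (simp add: add_assoc add_commute add_left_commute)
lemma add4': assumes "p <: om" "q <: om" "r <: om" "s <: om"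
  shows "add (add p q) (add r s) = add (add p s) (add q r)"
  using assms by (simp add: add_assoc add_commute add_left_commute)

lemma rl_chain:
  assumes "q <: RQ" "r <: RQ" "s <: RQ" "~ rl r q" "rl r s" shows "rl q s"
proof -
  obtain a b c where q: "a <: om" "b <: om" "c <: om" "c ~= emp" "q = pr a (pr b c)" using assms(1) unfolding mem_RQ by blast
  obtain a' b' c' where r: "a' <: om" "b' <: om" "c' <: om" "c' ~= emp" "r = pr a' (pr b' c')" using assms(2) unfolding mem_RQ by blast
  obtain a'' b'' c'' where s: "a'' <: om" "b'' <: om" "c'' <: om" "c'' ~= emp" "s = pr a'' (pr b'' c'')" using assms(3) unfolding mem_RQ by blast
  note om = q(1-3) r(1-3) s(1-3)
  let ?L = "add (mul a c') (mul b' c)" and ?R = "add (mul a' c) (mul b c')"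
  let ?L' = "add (mul a' c'') (mul b'' c')" and ?R' = "add (mul a'' c') (mul b' c'')"
  have 1: "?L <: ?R | ?L = ?R" using assms(4) om_linear[of ?L ?R] om unfolding q r rl_pr by auto
  have 2: "?L' <: ?R'" using assms(5) unfolding r s rl_pr .
  have "mul ?L c'' <: mul ?R c'' | mul ?L c'' = mul ?R c''" using mul_le[OF _ _ _ 1] om by simp
  moreover have "mul ?L' c <: mul ?R' c" using mul_less[OF _ _ _ q(4) 2] om by simp
  ultimately have "add (mul ?L' c) (mul ?L c'') <: add (mul ?R' c) (mul ?R c'')" using om by (intro add_less2) simp_all
  \<comment> \<open>The two inequalities have been multiplied by c'' and by c and then added. The
    common summand \<open>?X\<close> cancels, and after that the factor c'.\<close>
  moreover let ?X = "add (mul b' (mul c c'')) (mul a' (mul c c''))"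
  have "add (mul ?L' c) (mul ?L c'') = add (mul (add (mul a c'') (mul b'' c)) c') ?X"
  proof -
    have "mul ?L c'' = add (mul a (mul c' c'')) (mul b' (mul c c''))" using om by (simp add: mul_add mul_assoc)
    moreover have "mul ?L' c = add (mul a' (mul c c'')) (mul b'' (mul c c'))"
      using om by (simp add: mul_add mul_assoc mul_commute[of c'' c] mul_commute[of c' c])
    moreover have "mul (add (mul a c'') (mul b'' c)) c' = add (mul a (mul c' c'')) (mul b'' (mul c c'))"
      using om by (simp add: mul_add mul_assoc mul_commute[of c'' c'])
    ultimately show ?thesis by (simp only:) (rule add4, (simp add: om)+)
  qed
  moreover have "add (mul ?R' c) (mul ?R c'') = add (mul (add (mul a'' c) (mul b c'')) c') ?X"
  proof -
    have "mul ?R c'' = add (mul a' (mul c c'')) (mul b (mul c' c''))" using om by (simp add: mul_add mul_assoc)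
    moreover have "mul ?R' c = add (mul a'' (mul c c')) (mul b' (mul c c''))"
      using om by (simp add: mul_add mul_assoc mul_commute[of c'' c] mul_commute[of c' c])
    moreover have "mul (add (mul a'' c) (mul b c'')) c' = add (mul a'' (mul c c')) (mul b (mul c' c''))"
      using om by (simp add: mul_add mul_assoc mul_commute[of c'' c'])
    ultimately show ?thesis by (simp only:) (rule add4', (simp add: om)+)
  qed
  ultimately have "add (mul (add (mul a c'') (mul b'' c)) c') ?X <: add (mul (add (mul a'' c) (mul b c'')) c') ?X" by (simp only:)
  then have "mul (add (mul a c'') (mul b'' c)) c' <: mul (add (mul a'' c) (mul b c'')) c'"
    by (rule add_less_cancel[rotated 3]) (simp_all add: om)
  then have "add (mul a c'') (mul b'' c) <: add (mul a'' c) (mul b c'')" by (rule mul_less_cancel[rotated 3]) (simp_all add: om)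
  then show ?thesis unfolding q s rl_pr .
qed

lemma rl_asym: "q <: RQ ==> r <: RQ ==> rl q r ==> ~ rl r q" unfolding rl_def mem_RQ using not_mem_cycle by auto
lemma rl_trans: "q <: RQ ==> r <: RQ ==> s <: RQ ==> rl q r ==> rl r s ==> rl q s" using rl_chain[of q r s] rl_asym[of q r] by blast
lemma rl_weak: "q <: RQ ==> r <: RQ ==> s <: RQ ==> rl q r ==> rl q s | rl s r" using rl_chain[of s q r] by blast

text \<open>The witness is the mediant, obtained by adding the codes componentwise.\<close>

lemma rl_dense: assumes "q <: RQ" "r <: RQ" "rl q r" shows "EX s. s <: RQ & rl q s & rl s r"
proof -
  obtain a b c where q: "a <: om" "b <: om" "c <: om" "c ~= emp" "q = pr a (pr b c)" using assms(1) unfolding mem_RQ by blast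
  obtain a' b' c' where r: "a' <: om" "b' <: om" "c' <: om" "c' ~= emp" "r = pr a' (pr b' c')" using assms(2) unfolding mem_RQ by blast
  note om = q(1-3) r(1-3)
  let ?s = "pr (add a a') (pr (add b b') (add c c'))"
  have h: "add (mul a c') (mul b' c) <: add (mul a' c) (mul b c')" using assms(3) unfolding q r rl_pr .
  have "add c c' ~= emp"
  proof -
    obtain i where "i <: om" "c' = suc i" using om_cases r(3,4) by blast
    then show ?thesis by simp
  qed
  then have "?s <: RQ" unfolding mem_RQ using om by (intro exI[of _ "add a a'"] exI[of _ "add b b'"] exI[of _ "add c c'"]) simp
  moreover have "rl q ?s"
  proof -
    let ?X = "add (mul a c) (mul b c)"
    have "add (add (mul a c') (mul b' c)) ?X <: add (add (mul a' c) (mul b c')) ?X" using add_less[OF _ _ h] om by simp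
    moreover have "add (add (mul a c') (mul b' c)) ?X = add (mul a (add c c')) (mul (add b b') c)"
      using om by (simp add: mul_add mul_add2 mul_commute add_assoc add_commute add_left_commute)
    moreover have "add (add (mul a' c) (mul b c')) ?X = add (mul (add a a') c) (mul b (add c c'))"
      using om by (simp add: mul_add mul_add2 mul_commute add_assoc add_commute add_left_commute)
    ultimately show ?thesis unfolding q rl_pr by simp
  qed
  moreover have "rl ?s r"
  proof -
    let ?X = "add (mul a' c') (mul b' c')"
    have "add (add (mul a c') (mul b' c)) ?X <: add (add (mul a' c) (mul b c')) ?X" using add_less[OF _ _ h] om by simp
    moreover have "add (add (mul a c') (mul b' c)) ?X = add (mul (add a a') c') (mul b' (add c c'))"
      using om by (simp add: mul_add mul_add2 mul_commute add_assoc add_commute add_left_commute)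
    moreover have "add (add (mul a' c) (mul b c')) ?X = add (mul a' (add c c')) (mul (add b b') c')"
      using om by (simp add: mul_add mul_add2 mul_commute add_assoc add_commute add_left_commute)
    ultimately show ?thesis unfolding r rl_pr by simp
  qed
  ultimately show ?thesis by blast
qed

lemma rl_unbounded: assumes "q <: RQ" shows "EX s. s <: RQ & rl q s" "EX s. s <: RQ & rl s q"
proof -
  obtain a b c where q: "a <: om" "b <: om" "c <: om" "c ~= emp" "q = pr a (pr b c)" using assms(1) unfolding mem_RQ by blast
  have 1: "pr (suc a) (pr b c) <: RQ" "pr a (pr (suc b) c) <: RQ" unfolding mem_RQ using q suc_om by blast+
  have m: "mul a c <: mul (suc a) c" "mul b c <: mul (suc b) c" using q by (auto intro!: mul_less)
  have "rl q (pr (suc a) (pr b c))" unfolding q rl_pr using m q add_less by simp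
  then show "EX s. s <: RQ & rl q s" using 1 by blast
  have "add (mul b c) (mul a c) <: add (mul (suc b) c) (mul a c)" using m q add_less by simp
  then have "rl (pr a (pr (suc b) c)) q" unfolding q rl_pr using q add_commute[of "mul a c"] by simp
  then show "EX s. s <: RQ & rl s q" using 1 by blast
qed

lemma RQ_ne: "EX q. q <: RQ"
  using suc_om[OF emp_om] by (intro exI[of _ "pr emp (pr emp (suc emp))"]) (auto simp: mem_RQ)
lemma RQ_ctb: "lep RQ om"
proof -
  have "sub RQ (prd om (prd om om))" by (auto simp: sub_def mem_RQ)
  then show ?thesis using prd_lep[OF Inf_om lep_refl prd_lep[OF Inf_om lep_refl lep_refl]] sub_lep lep_trans by blast
qed

subsection \<open>Real numbers\<close>

definition real :: "'v => bool" where
  "real x \<longleftrightarrow> sub x RQ & (EX q. q <: x) & (EX q. q <: RQ & ~ q <: x) &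
     (ALL q r. q <: x --> r <: RQ --> rl r q --> r <: x) & (ALL q. q <: x --> (EX r. r <: x & rl q r))"
lemma dp_real [simp]: "dt a ==> dp (%e. real (a e))" by (rule dp1[where P=real], unfold real_def) simp_all
definition rless :: "'v => 'v => bool" where "rless x y \<longleftrightarrow> sub x y & x ~= y"
lemma dp_rless [simp]: "dt a ==> dt b ==> dp (%e. rless (a e) (b e))" by (rule dp2[where P=rless], unfold rless_def) simp_all
definition incl :: "'v => 'v => bool" where
  "incl x A \<longleftrightarrow> real x & (ALL u v. real u & real v & rless u x & rless x v --> (EX a. a <: A & rless u a & rless a v))"
lemma dp_incl [simp]: "dt a ==> dt b ==> dp (%e. incl (a e) (b e))" by (rule dp2[where P=incl], unfold incl_def) simp_all

lemma sat_rat [simp]: "x < n ==> sat E e (is_rat x n) \<longleftrightarrow> e x <: RQ"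
  by (simp add: is_rat_def mem_RQ)
lemma sat_rat_less: assumes "x < n" "y < n" "e x <: RQ" "e y <: RQ" shows "sat E e (rat_less x y n) \<longleftrightarrow> rl (e x) (e y)"
proof -
  obtain a b c where q: "a <: om" "b <: om" "c <: om" "c ~= emp" "e x = pr a (pr b c)" using assms(3) unfolding mem_RQ by blast
  obtain a' b' c' where r: "a' <: om" "b' <: om" "c' <: om" "c' ~= emp" "e y = pr a' (pr b' c')" using assms(4) unfolding mem_RQ by blast
  have p: "eqp (prd m n) k \<longleftrightarrow> k = mul m n" if "m <: om" "n <: om" "k <: om" for m n k
    using prd_mul[OF that(1,2)] eqp_om[of k "mul m n"] eqp_trans eqp_sym that mul_om by blast
  have "sat E e (rat_less x y n) \<longleftrightarrow> (EX k l m n s t. k <: om & l <: om & m <: om & n <: om & s <: om & t <: om &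
     eqp (prd a c') k & eqp (prd b' c) l & isum k l s &
     eqp (prd a' c) m & eqp (prd b c') n & isum m n t & s <: t)"
    unfolding rat_less_def using assms(1,2) q(5) r(5) by simp
  also have "... \<longleftrightarrow> (EX k l m n s t. k <: om & l <: om & m <: om & n <: om & s <: om & t <: om &
     k = mul a c' & l = mul b' c & s = add k l & m = mul a' c & n = mul b c' & t = add m n & s <: t)"
    using q r by (simp add: p sum_iff cong: conj_cong)
  also have "... \<longleftrightarrow> rl (e x) (e y)" unfolding q(5) r(5) rl_pr using q r by auto
  finally show ?thesis .
qed

lemma sat_real [simp]: assumes "x < n" shows "sat E e (is_real x n) \<longleftrightarrow> real (e x)"
proof -
  have "sat E e (is_real x n) \<longleftrightarrow> (ALL q. q <: e x --> q <: RQ) & (EX q. q <: e x) & (EX q. q <: RQ & ~ q <: e x) &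
      (ALL q r. q <: e x & r <: RQ & sat E (e(n := q, Suc n := r)) (rat_less (Suc n) n (Suc (Suc n))) --> r <: e x) &
      (ALL q. q <: e x --> (EX r. r <: e x & sat E (e(n := q, Suc n := r)) (rat_less n (Suc n) (Suc (Suc n)))))"
    using assms by (simp add: is_real_def)
  also have "... \<longleftrightarrow> real (e x)"
  \<comment> \<open>The formula \<open>rat_less\<close> is known to agree with \<open>rl\<close>
    only on codes of rationals, so this has to be secured first.\<close>
  proof (cases "ALL q. q <: e x --> q <: RQ")
    case True
    have 1: "sat E (e(n := q, Suc n := r)) (rat_less (Suc n) n (Suc (Suc n))) \<longleftrightarrow> rl r q" if "q <: e x" "r <: RQ" for q r
      using that True by (subst sat_rat_less) simp_all
    have 2: "sat E (e(n := q, Suc n := r)) (rat_less n (Suc n) (Suc (Suc n))) \<longleftrightarrow> rl q r" if "q <: e x" "r <: e x" for q r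
      using that True by (subst sat_rat_less) simp_all
    have A: "(q <: e x & r <: RQ & sat E (e(n := q, Suc n := r)) (rat_less (Suc n) n (Suc (Suc n))) --> r <: e x) \<longleftrightarrow>
        (q <: e x --> r <: RQ --> rl r q --> r <: e x)" for q r using 1[of q r] by blast
    have B: "(q <: e x --> (EX r. r <: e x & sat E (e(n := q, Suc n := r)) (rat_less n (Suc n) (Suc (Suc n))))) \<longleftrightarrow>
        (q <: e x --> (EX r. r <: e x & rl q r))" for q using 2[of q] by blast
    show ?thesis unfolding real_def sub_def by (simp only: A B)
  next
    case False then show ?thesis unfolding real_def sub_def by blast
  qed
  finally show ?thesis .
qed
lemma sat_real_less [simp]: "x < n ==> y < n ==> sat E e (real_less x y n) \<longleftrightarrow> rless (e x) (e y)"
  by (simp add: real_less_def rless_def)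
lemma sat_in_closure [simp]: "x < n ==> y < n ==> sat E e (in_closure x y n) \<longleftrightarrow> incl (e x) (e y)"
  by (simp add: in_closure_def incl_def)

subsection \<open>A continuous injection of the Cantor space into the reals\<close>

lemma wellordered_diff:
  assumes "Func f om two" "Func g om two" "f ~= g"
  shows "EX n. n <: om & app f n ~= app g n & (ALL k. k <: n --> app f k = app g k)"
proof -
  let ?Q = "%n. n <: om & app f n ~= app g n"
  obtain m where m: "?Q m" using Func_eqI[OF assms(1,2)] assms(3) by blast
  have dQ: "dP ?Q" by simp
  note l = lst[OF dQ Ord_om_mem[OF conjunct1[OF m]] m]
  have "app f k = app g k" if "k <: lst ?Q" for k using l(3)[OF that] l(2) om_memD that by blast
  then show ?thesis using l(2) by blast
qed

text \<open>Each bit of the sequence selects a subinterval of the current interval; the interval chosen at stage \<open>n\<close> also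
  avoids the rational with number \<open>n\<close>, so that the intervals shrink to a point.\<close>

lemma cantor_scheme:
  "EX ct. dF ct & (ALL f. Func f om two --> real (ct f)) &
     (ALL f g. Func f om two --> Func g om two --> ct f = ct g --> f = g) &
     (ALL f u v. Func f om two --> real u --> real v --> rless u (ct f) --> rless (ct f) v -->
        (EX n. n <: om & (ALL g. Func g om two --> (ALL k. k <: n --> app g k = app f k) --> rless u (ct g) & rless (ct g) v)))"
proof -
  obtain \<iota> where \<iota>: "dF \<iota>" "inj_on \<iota> (ext RQ)" "!!x. x <: RQ ==> \<iota> x <: om" using RQ_ctb by (rule lepE) blast
  obtain C where C: "dF C" "ALL y. y <: Pw RQ & (EX z. z <: y) --> C y <: y" using AC by blast
  obtain D where D: "dF D" "ALL y. y <: Pw (prd RQ RQ) & (EX z. z <: y) --> D y <: y" using AC by blast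
  note [simp] = dt1[where F=\<iota>, OF \<iota>(1)] dt1[where F=C, OF C(1)] dt1[where F=D, OF D(1)]
  define pk where "pk a b = C (Sep RQ (%m. rl a m & rl m b))" for a b
  have [simp]: "dt t ==> dt s ==> dt (%e. pk (t e) (s e))" for t s by (rule dt2[where F=pk], unfold pk_def) simp_all
  have pk: "pk a b <: RQ & rl a (pk a b) & rl (pk a b) b" if ab: "a <: RQ" "b <: RQ" "rl a b" for a b
  proof -
    let ?S = "Sep RQ (%m. rl a m & rl m b)"
    have "?S <: Pw RQ" "EX z. z <: ?S" using rl_dense[OF ab] by (auto simp: sub_def)
    then have "C ?S <: ?S" using C(2) by blast
    then show ?thesis unfolding pk_def by simp
  qed
  let ?good = "%n a b z. rl a (fs z) & rl (fs z) (sn z) & rl (sn z) b & (ALL q. q <: RQ --> \<iota> q = n --> ~ (rl (fs z) q & rl q (sn z)))"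
  define nx where "nx n a b = D (Sep (prd RQ RQ) (?good n a b))" for n a b
  have [simp]: "dt t ==> dt s ==> dt u ==> dt (%e. nx (t e) (s e) (u e))" for t s u by (rule dt3[where F=nx], unfold nx_def) simp_all
  have nx: "nx n a b <: prd RQ RQ & ?good n a b (nx n a b)" if ab: "a <: RQ" "b <: RQ" "rl a b" for n a b
  proof -
    let ?S = "Sep (prd RQ RQ) (?good n a b)"
    \<comment> \<open>Of the two disjoint intervals (x, y) and (y, w) inside (a, b), at least one
      misses the code with number \<open>n\<close>, if there is such a code.\<close>
    obtain y where y: "y <: RQ" "rl a y" "rl y b" using rl_dense[OF ab] by blast
    obtain x where x: "x <: RQ" "rl a x" "rl x y" using rl_dense[OF ab(1) y(1,2)] by blast
    obtain w where w: "w <: RQ" "rl y w" "rl w b" using rl_dense[OF y(1) ab(2) y(3)] by blast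
    have xb: "rl y b" "rl a y" using y by blast+
    have "EX z. z <: ?S"
    proof (cases "EX q. q <: RQ & \<iota> q = n & rl x q & rl q y")
      case True
      then obtain q where q: "q <: RQ" "\<iota> q = n" "rl x q" "rl q y" by blast
      have "~ (rl y q' & rl q' w)" if q': "q' <: RQ" "\<iota> q' = n" for q'
      proof -
        have "q' = q" using \<iota>(2) q q' unfolding inj_ext by blast
        then show ?thesis using rl_asym[OF q(1) y(1) q(4)] by blast
      qed
      then have "pr y w <: ?S" using y w by simp
      then show ?thesis by blast
    next
      case False
      then have "pr x y <: ?S" using x y by auto
      then show ?thesis by blast
    qed
    moreover have "?S <: Pw (prd RQ RQ)" by (auto simp: sub_def)
    ultimately have "D ?S <: ?S" using D(2) by blast
    then show ?thesis unfolding nx_def by simp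
  qed
  obtain q0 where q0: "q0 <: RQ" using RQ_ne by blast
  obtain q1 where q1: "q1 <: RQ" "rl q0 q1" using rl_unbounded[OF q0] by blast
  \<comment> \<open>\<open>pk\<close> cuts the current interval in two; the bit \<open>emp\<close>
    leads into the left part and the other bit into the right part.\<close>
  define step where "step n b z = (if b = emp then nx n (fs z) (pk (fs z) (sn z)) else nx n (pk (fs z) (sn z)) (sn z))" for n b z
  have [simp]: "dt t ==> dt s ==> dt u ==> dt (%e. step (t e) (s e) (u e))" for t s u by (rule dt3[where F=step], unfold step_def) simp_all
  define st where "st f = wrec (%n h. if n = emp then pr q0 q1 else step (Uni n) (app f (Uni n)) (app h (Uni n)))" for f
  have [simp]: "dt t ==> dt s ==> dt (%e. st (t e) (s e))" for t s by (rule dt2[where F=st], unfold st_def) simp_all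
  have st_unf: "st f n = (if n = emp then pr q0 q1 else step (Uni n) (app f (Uni n)) (app (lam n (st f)) (Uni n)))" for f n
    unfolding st_def by (subst wrec_unfold) simp_all
  have st0: "st f emp = pr q0 q1" for f by (subst st_unf) simp
  have stS: "st f (suc n) = step n (app f n) (st f n)" if "n <: om" for f n
    using that by (subst st_unf) (simp add: Uni_suc Ord_om_mem)
  define A where "A f n = fs (st f n)" for f n
  define B where "B f n = sn (st f n)" for f n
  have [simp]: "dt t ==> dt s ==> dt (%e. A (t e) (s e))" for t s by (rule dt2[where F=A], unfold A_def) simp_all
  have inv: "st f n <: prd RQ RQ & rl (A f n) (B f n)" if "n <: om" for f n
    using that unfolding A_def B_def
  proof (induction rule: om_induct)
    case emp then show ?case using q0 q1 by (simp add: st0)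
  next
    case (suc n)
    let ?a = "fs (st f n)" and ?b = "sn (st f n)"
    have ab: "?a <: RQ" "?b <: RQ" "rl ?a ?b" using suc(2) by (auto simp: mem_prd)
    note p = pk[OF ab]
    show ?case unfolding stS[OF suc(1)] step_def
      using nx[of ?a "pk ?a ?b" n] nx[of "pk ?a ?b" ?b n] ab p by auto
  qed simp
  have AQ: "A f n <: RQ" "B f n <: RQ" "rl (A f n) (B f n)" if "n <: om" for f n
    using inv[OF that, of f] unfolding A_def B_def by (auto simp: mem_prd)
  let ?m = "%f n. pk (A f n) (B f n)"
  have m: "?m f n <: RQ" "rl (A f n) (?m f n)" "rl (?m f n) (B f n)" if "n <: om" for f n using pk[OF AQ[OF that]] by blast+
  have stp0: "rl (A f n) (A f (suc n)) & rl (B f (suc n)) (?m f n)" if "n <: om" "app f n = emp" for f n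
    using nx[of "A f n" "?m f n" n, OF AQ(1)[OF that(1)] m(1,2)[OF that(1)]] unfolding A_def[of f "suc n"] B_def[of f "suc n"] stS[OF that(1)] step_def
    by (simp add: that A_def B_def)
  have stp1: "rl (?m f n) (A f (suc n)) & rl (B f (suc n)) (B f n)" if "n <: om" "app f n ~= emp" for f n
    using nx[of "?m f n" "B f n" n, OF m(1)[OF that(1)] AQ(2)[OF that(1)] m(3)[OF that(1)]] unfolding A_def[of f "suc n"] B_def[of f "suc n"] stS[OF that(1)] step_def
    by (simp add: that A_def B_def)
  have avoid: "~ (rl (A f (suc n)) q & rl q (B f (suc n)))" if "n <: om" "q <: RQ" "\<iota> q = n" for f n q
    using nx[of "A f n" "?m f n" n, OF AQ(1)[OF that(1)] m(1,2)[OF that(1)]] nx[of "?m f n" "B f n" n, OF m(1)[OF that(1)] AQ(2)[OF that(1)] m(3)[OF that(1)]] that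
    unfolding A_def B_def stS[OF that(1)] step_def by auto
  have up: "rl (A f n) (A f (suc n))" and dn: "rl (B f (suc n)) (B f n)" if n: "n <: om" for f n
  proof -
    have s: "suc n <: om" using n by simp
    show "rl (A f n) (A f (suc n))"
      using stp0[OF n, of f] stp1[OF n, of f] rl_trans[OF AQ(1)[OF n] m(1)[OF n] AQ(1)[OF s] m(2)[OF n]] by blast
    show "rl (B f (suc n)) (B f n)"
      using stp0[OF n, of f] stp1[OF n, of f] rl_trans[OF AQ(2)[OF s] m(1)[OF n] AQ(2)[OF n] _ m(3)[OF n]] by blast
  qed
  have mono: "ALL m. m <: n --> rl (A f m) (A f n) & rl (B f n) (B f m)" if "n <: om" for f n
    using that
  proof (induction rule: om_induct)
    case dp show ?case unfolding B_def by simp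
  next
    case (suc n)
    have s: "suc n <: om" using suc by simp
    show ?case
    proof (intro allI impI)
      fix m assume mn: "m <: suc n"
      show "rl (A f m) (A f (suc n)) & rl (B f (suc n)) (B f m)"
      proof (cases "m = n")
        case True then show ?thesis using up dn suc by blast
      next
        case False
        then have mn': "m <: n" using mn by simp
        have mo: "m <: om" using om_memD[OF suc(1) mn'] .
        show ?thesis
          using suc(2) mn' up[OF suc(1), of f] dn[OF suc(1), of f] rl_trans[OF AQ(1)[OF mo] AQ(1)[OF suc(1)] AQ(1)[OF s]]
            rl_trans[OF AQ(2)[OF s] AQ(2)[OF suc(1)] AQ(2)[OF mo]] by blast
      qed
    qed
  qed simp
  have AB: "rl (A f i) (B f n)" if io: "i <: om" "n <: om" for f i n
  proof -
    consider "i = n" | "i <: n" | "n <: i" using om_linear io by blast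
    then show ?thesis
    proof cases
      case 1 then show ?thesis using AQ io by blast
    next
      case 2 then show ?thesis using mono[OF io(2)] rl_trans[OF AQ(1)[OF io(1)] AQ(1)[OF io(2)] AQ(2)[OF io(2)]] AQ(3)[OF io(2)] by blast
    next
      case 3 then show ?thesis using mono[OF io(1)] rl_trans[OF AQ(1)[OF io(1)] AQ(2)[OF io(1)] AQ(2)[OF io(2)]] AQ(3)[OF io(1)] by blast
    qed
  qed
  have local: "(ALL k. k <: n --> app f k = app g k) --> st f n = st g n" if "n <: om" for f g n
    using that by (induction rule: om_induct) (simp_all add: st0 stS)
  \<comment> \<open>The supremum of the left endpoints, as a Dedekind cut.\<close>
  define ct where "ct f = Sep RQ (%q. EX n. n <: om & rl q (A f n))" for f
  have dct: "dF ct" unfolding ct_def by simp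
  have ct: "q <: ct f \<longleftrightarrow> q <: RQ & (EX n. n <: om & rl q (A f n))" for q f unfolding ct_def by simp
  have Act: "A f n <: ct f" if "n <: om" for f n unfolding ct using AQ(1)[OF that] up[OF that] suc_om[OF that] by blast
  have real: "real (ct f)" for f unfolding real_def
  proof (intro conjI allI impI)
    show "sub (ct f) RQ" unfolding sub_def ct by blast
    show "EX q. q <: ct f" using Act[OF emp_om] by blast
    have "~ B f emp <: ct f"
    proof
      assume "B f emp <: ct f"
      then obtain n where n: "n <: om" "rl (B f emp) (A f n)" unfolding ct by blast
      then show False using AB[OF n(1) emp_om] rl_asym[OF AQ(2)[OF emp_om] AQ(1)[OF n(1)]] by blast
    qed
    then show "EX q. q <: RQ & ~ q <: ct f" using AQ(2)[OF emp_om] by blast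
    fix q assume q: "q <: ct f"
    then obtain n where n: "q <: RQ" "n <: om" "rl q (A f n)" unfolding ct by blast
    show "r <: ct f" if "r <: RQ" "rl r q" for r unfolding ct using that n rl_trans[OF that(1) n(1) AQ(1)[OF n(2)]] by blast
    show "EX r. r <: ct f & rl q r" using Act[OF n(2)] n by blast
  qed
  have inj: "ct f ~= ct g" if fg: "n <: om" "ALL k. k <: n --> app f k = app g k" "app f n = emp" "app g n ~= emp" for f g n
  proof
    assume eq: "ct f = ct g"
    have s: "suc n <: om" using fg by simp
    have stn: "st f n = st g n" using local[OF fg(1)] fg(2) by blast
    then have mm: "?m f n = ?m g n" unfolding A_def B_def by simp
    have "rl (?m f n) (A g (suc n))" unfolding mm using stp1[OF fg(1,4)] by blast
    then have "?m f n <: ct g" unfolding ct using m(1)[OF fg(1)] s by blast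
    then obtain k where k: "k <: om" "rl (?m f n) (A f k)" unfolding eq[symmetric] ct by blast
    have "rl (B f (suc n)) (?m f n)" using stp0[OF fg(1,3)] by blast
    then have "rl (B f (suc n)) (A f k)" using rl_trans[OF AQ(2)[OF s] m(1)[OF fg(1)] AQ(1)[OF k(1)]] k by blast
    then show False using AB[OF k(1) s] rl_asym[OF AQ(1)[OF k(1)] AQ(2)[OF s]] by blast
  qed
  have inj': "f = g" if fg: "Func f om two" "Func g om two" "ct f = ct g" for f g
  proof (rule ccontr)
    assume "f ~= g"
    then obtain n where n: "n <: om" "app f n ~= app g n" "ALL k. k <: n --> app f k = app g k" using wellordered_diff fg by blast
    have "app f n = emp | app g n = emp" using n Func_app[OF fg(1) n(1)] Func_app[OF fg(2) n(1)] by auto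
    then show False using inj[OF n(1), of f g] inj[OF n(1), of g f] n fg(3) by auto
  qed
  have lower: "EX n. n <: om & (ALL g. (ALL k. k <: n --> app g k = app f k) --> rless u (ct g))" if u: "real u" "rless u (ct f)" for f u
  proof -
    obtain q where q: "q <: ct f" "~ q <: u" using u(2) sub_antisym[of u "ct f"] unfolding rless_def sub_def by blast
    then obtain n where n: "q <: RQ" "n <: om" "rl q (A f n)" unfolding ct by blast
    have nu: "~ A f n <: u" using u(1) q n unfolding real_def by blast
    have "rless u (ct g)" if g: "ALL k. k <: n --> app g k = app f k" for g
    proof -
      have Ag: "A g n = A f n" using local[OF n(2), of g f] g unfolding A_def by simp
      have "t <: ct g" if t: "t <: u" for t
      proof -
        obtain t' where t': "t' <: u" "rl t t'" using u(1) t unfolding real_def by blast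
        have tq: "t <: RQ" "t' <: RQ" using u(1) t t' unfolding real_def sub_def by blast+
        have "~ rl (A f n) t'" using u(1) nu t' AQ(1)[OF n(2)] unfolding real_def by blast
        then have "rl t (A f n)" using rl_weak[OF tq AQ(1)[OF n(2)] t'(2)] by blast
        then show ?thesis unfolding ct using Ag n(2) tq by auto
      qed
      moreover have "A f n <: ct g" using Act[OF n(2), of g] Ag by simp
      ultimately show ?thesis unfolding rless_def sub_def using nu by blast
    qed
    then show ?thesis using n(2) by blast
  qed
  have upper: "EX n. n <: om & (ALL g. (ALL k. k <: n --> app g k = app f k) --> rless (ct g) v)" if v: "real v" "rless (ct f) v" for f v
  proof -
    obtain q where q: "q <: v" "~ q <: ct f" using v(2) sub_antisym[of v "ct f"] unfolding rless_def sub_def by blast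
    have qQ: "q <: RQ" using v(1) q unfolding real_def sub_def by blast
    \<comment> \<open>No left endpoint is above \<open>q\<close>. As the interval of stage
      \<open>suc n\<close> avoids \<open>q\<close>, its right endpoint is not above \<open>q\<close>
      either, so every real whose digits agree so far stays below \<open>v\<close>.\<close>
    define n where "n = \<iota> q"
    have n: "n <: om" "suc n <: om" "suc (suc n) <: om" using \<iota>(3)[OF qQ] by (simp_all add: n_def)
    have "~ rl q (A f (suc (suc n)))" using q(2) qQ n(3) unfolding ct by blast
    then have "rl (A f (suc n)) q" using rl_weak[OF AQ(1)[OF n(2)] AQ(1)[OF n(3)] qQ up[OF n(2)]] by blast
    then have nB: "~ rl q (B f (suc n))" using avoid[OF n(1) qQ] n_def by blast
    have "rless (ct g) v" if g: "ALL k. k <: suc n --> app g k = app f k" for g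
    proof -
      have Bg: "B g (suc n) = B f (suc n)" using local[OF n(2), of g f] g unfolding B_def by simp
      have tB: "t <: RQ & rl t (B f (suc n))" if t: "t <: ct g" for t
      proof -
        obtain k where k: "t <: RQ" "k <: om" "rl t (A g k)" using t unfolding ct by blast
        then show ?thesis using AB[OF k(2) n(2), of g] rl_trans[OF k(1) AQ(1)[OF k(2)] AQ(2)[OF n(2)]] Bg by metis
      qed
      have "t <: v" if t: "t <: ct g" for t
      proof -
        have "rl t q" using rl_weak[of t "B f (suc n)" q] tB[OF t] AQ(2)[OF n(2)] qQ nB by blast
        then show ?thesis using v(1) q(1) tB[OF t] unfolding real_def by blast
      qed
      moreover have "~ q <: ct g" using tB nB by blast
      ultimately show ?thesis unfolding rless_def sub_def using q(1) by blast
    qed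
    then show ?thesis using n(2) by blast
  qed
  have "EX n. n <: om & (ALL g. Func g om two --> (ALL k. k <: n --> app g k = app f k) --> rless u (ct g) & rless (ct g) v)"
    if h: "real u" "real v" "rless u (ct f)" "rless (ct f) v" for f u v
  proof -
    obtain i where i: "i <: om" "ALL g. (ALL k. k <: i --> app g k = app f k) --> rless u (ct g)" using lower[OF h(1,3)] by blast
    obtain n where n: "n <: om" "ALL g. (ALL k. k <: n --> app g k = app f k) --> rless (ct g) v" using upper[OF h(2,4)] by blast
    have "cup i n <: om" using cup_Ord[OF Ord_om_mem[OF i(1)] Ord_om_mem[OF n(1)]] i n by auto
    then show ?thesis using i(2) n(2) by (intro exI[of _ "cup i n"]) simp
  qed
  then show ?thesis using dct real inj' by (intro exI[of _ ct]) blast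
qed

end

section \<open>Absoluteness and covering\<close>

context gext
begin

text \<open>By \<open>EN_j\<close> the image of the ground model is closed under elements. Bounded
  quantifiers therefore keep their meaning, which is the source of all absoluteness below.\<close>

lemma all_j: "(ALL y. EN y (j x) --> Q y) \<longleftrightarrow> (ALL v. v <: x --> Q (j v))" unfolding EN_j by blast
lemma ex_j: "(EX y. EN y (j x) & Q y) \<longleftrightarrow> (EX v. v <: x & Q (j v))" unfolding EN_j by blast

lemma j_emp: "j emp = N.emp" unfolding N.eq_emp by (simp add: EN_j)
lemma j_upr: "j (upr a b) = N.upr (j a) (j b)" by (rule N.set_ext) (auto simp: EN_j)
lemma j_pr: "j (pr a b) = N.pr (j a) (j b)" unfolding pr_def N.pr_def j_upr ..
lemma j_suc: "j (suc a) = N.suc (j a)" by (rule N.set_ext) (auto simp: EN_j)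
lemma j_sub: "N.sub (j a) (j b) \<longleftrightarrow> sub a b" unfolding N.sub_def sub_def EN_j by auto
lemma j_tran: "N.tran (j x) \<longleftrightarrow> tran x" proof -
  have "tran x \<longleftrightarrow> (ALL y. y <: x --> (ALL z. z <: y --> z <: x))" unfolding tran_def by blast
  moreover have "N.tran (j x) \<longleftrightarrow> (ALL y. EN y (j x) --> (ALL z. EN z y --> EN z (j x)))" unfolding N.tran_def by blast
  ultimately show ?thesis unfolding all_j EN_j_j by simp
qed
lemma j_Ord: "N.Ord (j x) \<longleftrightarrow> Ord x" unfolding N.Ord_def Ord_def j_tran all_j ..
lemma j_Lim: "N.Lim (j x) \<longleftrightarrow> Lim x"
proof -
  have "j x = N.emp \<longleftrightarrow> x = emp" using j_emp j_eq by metis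
  moreover have "(ALL y. EN y (j x) --> (EX z. EN z (j x) & EN y z)) \<longleftrightarrow> (ALL y. y <: x --> (EX z. z <: x & y <: z))"
    unfolding all_j ex_j EN_j_j ..
  ultimately show ?thesis unfolding N.Lim_def Lim_def j_Ord by simp
qed
lemma j_om: "j om = N.om"
  unfolding N.omega_iff[symmetric] j_Lim EN_j using Lim_om not_Lim_om j_Lim by auto
lemma j_two: "j two = N.two" unfolding two_def N.two_def j_suc j_emp ..
lemma j_Func: assumes "Func f a b" shows "N.Func (j f) (j a) (j b)"
  unfolding N.Func_def
proof (intro conjI allI impI)
  fix z assume "EN z (j f)"
  then obtain v where v: "v <: f" "z = j v" unfolding EN_j by blast
  then obtain x y where "x <: a" "y <: b" "v = pr x y" using Func_memD[OF assms] by blast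
  then show "EX x y. EN x (j a) & EN y (j b) & z = N.pr x y" using v j_pr by (intro exI[of _ "j x"] exI[of _ "j y"]) simp
next
  fix x assume "EN x (j a)"
  then obtain v where v: "v <: a" "x = j v" unfolding EN_j by blast
  show "EX! y. EN (N.pr x y) (j f)"
  proof (rule ex1I[of _ "j (app f v)"])
    show "EN (N.pr x (j (app f v))) (j f)" unfolding v(2) j_pr[symmetric] EN_j_j Func_pr[OF assms] using v by simp
    fix y assume "EN (N.pr x y) (j f)"
    then obtain w where w: "w <: f" "N.pr x y = j w" unfolding EN_j by blast
    then obtain x' y' where "w = pr x' y'" "x' <: a" "y' <: b" using Func_memD[OF assms] by blast
    then have "x = j x'" "y = j y'" using w j_pr by simp_all
    then show "y = j (app f v)" using v w \<open>w = pr x' y'\<close> Func_pr[OF assms] by simp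
  qed
qed

lemma j_app: assumes "Func f a b" "x <: a" shows "N.app (j f) (j x) = j (app f x)"
proof -
  have "EN (N.pr (j x) (j (app f x))) (j f)" unfolding j_pr[symmetric] EN_j_j Func_pr[OF assms(1)] using assms by simp
  then show ?thesis using N.Func_pr[OF j_Func[OF assms(1)]] by simp
qed

lemma j_lep: assumes "lep a b" shows "N.lep (j a) (j b)"
proof -
  obtain f where f: "Func f a b" "ALL x y. x <: a --> y <: a --> app f x = app f y --> x = y" using assms unfolding lep_def by blast
  show ?thesis unfolding N.lep_def
  proof (intro exI[of _ "j f"] conjI j_Func[OF f(1)] allI impI)
    fix x y assume "EN x (j a)" "EN y (j a)" and eq: "N.app (j f) x = N.app (j f) y"
    then obtain v w where "v <: a" "w <: a" "x = j v" "y = j w" unfolding EN_j by blast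
    then show "x = y" using eq f(2) by (simp add: j_app[OF f(1)])
  qed
qed
lemma j_eqp: "eqp a b ==> N.eqp (j a) (j b)"
  by (rule N.lep_antisym) (auto intro: j_lep eqp_lep eqp_sym)

definition GG :: nat where "GG = pi (Rep P (%p. pr (chk p) p))"
lemma EN_GG: "EN a GG \<longleftrightarrow> (EX p:G. a = j p)"
proof -
  have "Name (Rep P (%p. pr (chk p) p))" by (rule NameI) (auto intro!: Name_chk)
  from EN_iff[OF this, of a] show ?thesis unfolding GG_def j_def using G_P by auto
qed

section \<open>Functions between ordinals in the extension\<close>

lemma FM_value: assumes "N.Func f (j c) (j \<gamma>)" "p : G" "FM p (chk (pr \<xi> \<eta>)) (nm f)"
  shows "N.app f (j \<xi>) = j \<eta>"
proof -
  have "EN (j (pr \<xi> \<eta>)) f" using EN_pi[OF Name_chk Name_nm, of "pr \<xi> \<eta>" f] assms unfolding j_def gmem_def by auto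
  then show ?thesis unfolding j_pr using N.Func_pr[OF assms(1)] by simp
qed

lemma value_FM: assumes "N.Func f (j c) (j \<gamma>)" "\<xi> <: c"
  shows "EX \<eta> p. \<eta> <: \<gamma> & p : G & N.app f (j \<xi>) = j \<eta> & FM p (chk (pr \<xi> \<eta>)) (nm f)"
proof -
  have "EN (N.app f (j \<xi>)) (j \<gamma>)" using N.Func_app[OF assms(1)] assms(2) by simp
  then obtain \<eta> where h: "\<eta> <: \<gamma>" "N.app f (j \<xi>) = j \<eta>" unfolding EN_j by blast
  have "EN (j (pr \<xi> \<eta>)) f" unfolding j_pr using N.Func_pr[OF assms(1)] assms(2) h by simp
  then have "gmem (chk (pr \<xi> \<eta>)) (nm f)" using EN_pi[OF Name_chk Name_nm, of "pr \<xi> \<eta>" f] unfolding j_def by simp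
  then show ?thesis using h unfolding gmem_def by blast
qed

lemma total_below: assumes f: "N.Func f (j c) (j \<gamma>)"
  obtains p0 where "p0 : G"
    "!!q \<xi>. le q p0 ==> \<xi> <: c ==> EX r \<eta>. le r q & \<eta> <: \<gamma> & FM r (chk (pr \<xi> \<eta>)) (nm f)"
    "!!q \<xi> \<eta> \<eta>'. le q p0 ==> FM q (chk (pr \<xi> \<eta>)) (nm f) ==> FM q (chk (pr \<xi> \<eta>')) (nm f) ==> \<eta> = \<eta>'"
proof -
  let ?F = "%p \<xi> \<eta>. FM p (chk (pr \<xi> \<eta>)) (nm f)"
  let ?D1 = "%p. (ALL q \<xi>. le q p --> \<xi> <: c --> (EX r \<eta>. le r q & \<eta> <: \<gamma> & ?F r \<xi> \<eta>)) &
     (ALL q \<xi> \<eta> \<eta>'. le q p --> ?F q \<xi> \<eta> --> ?F q \<xi> \<eta>' --> \<eta> = \<eta>')"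
  let ?D2 = "%p. EX \<xi>. \<xi> <: c & (ALL q \<eta>. le q p --> \<eta> <: \<gamma> --> ~ ?F q \<xi> \<eta>)"
  let ?D3 = "%p. EX \<xi> \<eta> \<eta>'. ?F p \<xi> \<eta> & ?F p \<xi> \<eta>' & \<eta> ~= \<eta>'"
  have "EX p:G. ?D1 p | ?D2 p | ?D3 p"
  proof (rule G_generic)
    fix p assume p: "p <: P"
    show "EX q. le q p & (?D1 q | ?D2 q | ?D3 q)"
    proof (cases "EX q. le q p & (?D2 q | ?D3 q)")
      case True then show ?thesis by blast
    next
      case False
      then have n2: "~ ?D2 q" and n3: "~ ?D3 q" if "le q p" for q using that by blast+
      have "?D1 p"
      proof (intro conjI allI impI)
        fix q \<xi> assume "le q p" "\<xi> <: c"
        then show "EX r \<eta>. le r q & \<eta> <: \<gamma> & ?F r \<xi> \<eta>" using n2 by blast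
      next
        fix q \<xi> \<eta> \<eta>' assume "le q p" "?F q \<xi> \<eta>" "?F q \<xi> \<eta>'"
        then show "\<eta> = \<eta>'" using n3 by blast
      qed
      then show ?thesis using le_refl[OF p] by blast
    qed
  qed simp
  then obtain p where p: "p : G" "?D1 p | ?D2 p | ?D3 p" by blast
  have "~ ?D2 p"
  proof
    assume "?D2 p"
    then obtain \<xi> where x: "\<xi> <: c" "ALL q \<eta>. le q p --> \<eta> <: \<gamma> --> ~ ?F q \<xi> \<eta>" by blast
    obtain \<eta> r where r: "\<eta> <: \<gamma>" "r : G" "?F r \<xi> \<eta>" using value_FM[OF f x(1)] by blast
    obtain s where "le s p" "le s r" using G_dir p(1) r(2) by blast
    then show False using x(2) r FM_mono by blast
  qed
  moreover have "~ ?D3 p"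
  proof
    assume "?D3 p"
    then obtain \<xi> \<eta> \<eta>' where "?F p \<xi> \<eta>" "?F p \<xi> \<eta>'" "\<eta> ~= \<eta>'" by blast
    then show False using FM_value[OF f p(1), of \<xi> \<eta>] FM_value[OF f p(1), of \<xi> \<eta>'] by simp
  qed
  ultimately have "?D1 p" using p(2) by blast
  then show ?thesis using that[OF p(1)] by blast
qed

end

locale gstar = star E \<mu> P l e + gext E P l e G
  for E :: "nat => nat => bool" (infix \<open><:\<close> 50) and \<mu> P l e G
begin

text \<open>In the fusion, \<open>S z h\<close> asks that \<open>fs z\<close> decide the value at
  \<open>sn z\<close> and be incompatible with all earlier conditions listed for the same argument.
  It cannot last for \<omega>_1 steps: by pigeonhole uncountably many of them would treat one
  argument, and two of these conditions would have a common lower bound. When it stops, the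
  countable list is predense for every argument.\<close>

lemma decide:
  assumes f: "N.Func f (j c) (j \<gamma>)" and c: "lep c om"
  shows "EX h. lep h om & (ALL z. z <: h --> z <: prd P c & (EX \<eta>. \<eta> <: \<gamma> & FM (fs z) (chk (pr (sn z) \<eta>)) (nm f))) &
     (ALL \<xi>. \<xi> <: c --> (EX z. z <: h & sn z = \<xi> & fs z : G))"
proof -
  let ?F = "%p \<xi> \<eta>. FM p (chk (pr \<xi> \<eta>)) (nm f)"
  obtain p0 where p0: "p0 : G" "!!q \<xi>. le q p0 ==> \<xi> <: c ==> EX r \<eta>. le r q & \<eta> <: \<gamma> & ?F r \<xi> \<eta>"
    by (rule total_below[OF f]) blast
  define S where "S z h \<longleftrightarrow> (EX \<eta>. \<eta> <: \<gamma> & ?F (fs z) (sn z) \<eta>) &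
      (ALL z'. z' <: h --> sn z' = sn z --> ~ (EX r. le r (fs z) & le r (fs z')))" for z h
  have dS: "dP2 S" unfolding S_def by simp
  let ?good = "%q h. lep h om & (ALL z. z <: h --> z <: prd P c & (EX \<eta>. \<eta> <: \<gamma> & ?F (fs z) (sn z) \<eta>)) &
     (ALL r \<xi>. le r q --> \<xi> <: c --> (EX z s. z <: h & sn z = \<xi> & le s r & le s (fs z)))"
  have "EX q:G. le q p0 & (EX h. ?good q h)"
  proof (rule gen_below[OF p0(1)])
    fix p assume p: "le p p0"
    have pP: "p <: P" using p le_P by blast
    from fusion[OF dS pP, of c] show "EX q. le q p & (EX h. ?good q h)"
    proof (elim disjE)
      assume "EX q h. le q p & lep h om & (ALL z. z <: h --> z <: prd P c & (EX h'. S z h')) & ~ (EX r x. x <: c & le r q & S (pr r x) h)"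
      then obtain q h where q: "le q p" "lep h om" "ALL z. z <: h --> z <: prd P c & (EX h'. S z h')"
        "~ (EX r x. x <: c & le r q & S (pr r x) h)" by blast
      have "EX z s. z <: h & sn z = \<xi> & le s r & le s (fs z)" if r: "le r q" "\<xi> <: c" for r \<xi>
      proof -
        have "le r p0" using le_trans[OF r(1) le_trans[OF q(1) p]] .
        then obtain r' \<eta> where r': "le r' r" "\<eta> <: \<gamma>" "?F r' \<xi> \<eta>" using p0(2) r(2) by blast
        have "~ S (pr r' \<xi>) h" using q(4) r(2) le_trans[OF r'(1) r(1)] by blast
        then obtain z s where "z <: h" "sn z = \<xi>" "le s r'" "le s (fs z)" unfolding S_def using r' by auto
        then show ?thesis using le_trans[OF _ r'(1)] by blast
      qed
      then show ?thesis using q unfolding S_def by blast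
    next
      assume "EX H. dF H & (ALL \<alpha>. \<alpha> <: w1 --> H \<alpha> <: prd P c & S (H \<alpha>) (Rep \<alpha> H)) &
        (ALL W. sub W w1 --> ~ lep W om --> (EX I q. sub I W & eqp om I & le q p &
         (ALL \<alpha>. \<alpha> <: I --> le q (fs (H \<alpha>)) &
           (sn (H \<alpha>) <: \<mu> --> app (fs (H \<alpha>)) (sn (H \<alpha>)) ~= emp --> app q (sn (H \<alpha>)) = app (fs (H \<alpha>)) (sn (H \<alpha>))))))"
      then obtain H where H: "dF H" "ALL \<alpha>. \<alpha> <: w1 --> H \<alpha> <: prd P c & S (H \<alpha>) (Rep \<alpha> H)"
        and H': "ALL W. sub W w1 --> ~ lep W om --> (EX I q. sub I W & eqp om I & le q p &
         (ALL \<alpha>. \<alpha> <: I --> le q (fs (H \<alpha>)) &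
           (sn (H \<alpha>) <: \<mu> --> app (fs (H \<alpha>)) (sn (H \<alpha>)) ~= emp --> app q (sn (H \<alpha>)) = app (fs (H \<alpha>)) (sn (H \<alpha>)))))"
        by (elim exE conjE) (rule that)
      note [simp] = dt1[where F=H, OF H(1)]
      have "sn (H \<alpha>) <: c" if "\<alpha> <: w1" for \<alpha> using H(2) that by (auto simp: mem_prd)
      from pigeonhole[OF w1_props(5), of "%\<alpha>. sn (H \<alpha>)" c, OF _ this c]
      obtain \<xi> where x: "\<xi> <: c" "~ lep (Sep w1 (%\<alpha>. sn (H \<alpha>) = \<xi>)) om" by auto
      have "sub (Sep w1 (%\<alpha>. sn (H \<alpha>) = \<xi>)) w1" by (auto simp: sub_def)
      then obtain I q where I: "sub I (Sep w1 (%\<alpha>. sn (H \<alpha>) = \<xi>))" "eqp om I" "ALL \<alpha>. \<alpha> <: I --> le q (fs (H \<alpha>))"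
        using H'[rule_format, OF _ x(2)] by blast
      obtain K where "dF K" and K: "bij_betw K (ext om) (ext I)" using I(2) by (rule eqpE)
      have suc_ne: "emp ~= suc emp" using mem_ne[of emp "suc emp"] by auto
      have KI: "K emp <: I" "K (suc emp) <: I" "K emp ~= K (suc emp)" using K emp_om suc_om[OF emp_om] suc_ne unfolding bij_ext inj_ext by blast+
      have Iw: "\<alpha> <: w1" "sn (H \<alpha>) = \<xi>" if "\<alpha> <: I" for \<alpha> using subD[OF I(1) that] by simp_all
      have no: False if ab: "\<alpha> <: I" "\<beta> <: I" "\<alpha> <: \<beta>" for \<alpha> \<beta>
      proof -
        have "S (H \<beta>) (Rep \<beta> H)" using H(2) Iw(1)[OF ab(2)] by blast
        moreover have "H \<alpha> <: Rep \<beta> H" by (rule RepI) (simp_all add: ab)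
        ultimately have "~ (EX r. le r (fs (H \<beta>)) & le r (fs (H \<alpha>)))" unfolding S_def using Iw(2) ab by auto
        then show False using I(3) ab by blast
      qed
      have "K emp <: K (suc emp) | K (suc emp) <: K emp"
        using Ord_linear[OF Ord_mem[OF w1_props(2) Iw(1)[OF KI(1)]] Ord_mem[OF w1_props(2) Iw(1)[OF KI(2)]]] KI(3) by blast
      then show ?thesis using no KI by blast
    qed
  qed simp
  then obtain q h where q: "q : G" "?good q h" by blast
  have "EX z. z <: h & sn z = \<xi> & fs z : G" if x: "\<xi> <: c" for \<xi>
  proof -
    have "EX r:G. le r q & (EX z. z <: h & sn z = \<xi> & le r (fs z))"
    proof (rule gen_below[OF q(1)])
      fix r assume "le r q"
      then obtain z s where "z <: h" "sn z = \<xi>" "le s r" "le s (fs z)" using q(2) x by blast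
      then show "EX q. le q r & (EX z. z <: h & sn z = \<xi> & le q (fs z))" by blast
    qed simp
    then show ?thesis using G_up by blast
  qed
  then show ?thesis using q(2) by blast
qed

text \<open>Countable domains are settled by \<open>decide\<close>. An uncountable \<open>c\<close>
  has size at least \<omega>_1, so it is enough that each single argument has at most \<omega>_1
  possible values, which \<open>hull\<close> provides.\<close>

lemma covering:
  assumes f: "N.Func f (j c) (j \<gamma>)" and c: "Ord c" "~ Fin c" and g: "Ord \<gamma>"
  shows "EX B. sub B \<gamma> & lep B c & (ALL \<xi>. \<xi> <: c --> (EX \<eta>. \<eta> <: B & N.app f (j \<xi>) = j \<eta>))"
proof (cases "lep c om")
  case True
  let ?F = "%p \<xi> \<eta>. FM p (chk (pr \<xi> \<eta>)) (nm f)"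
  from decide[OF f True] obtain h where h: "lep h om" "ALL z. z <: h --> z <: prd P c & (EX \<eta>. \<eta> <: \<gamma> & ?F (fs z) (sn z) \<eta>)"
    "ALL \<xi>. \<xi> <: c --> (EX z. z <: h & sn z = \<xi> & fs z : G)" by blast
  define v where "v z = lst (%\<eta>. \<eta> <: \<gamma> & ?F (fs z) (sn z) \<eta>)" for z
  have [simp]: "dt t ==> dt (%e. v (t e))" for t by (rule dt1[where F=v], unfold v_def) simp_all
  have v: "v z <: \<gamma> & ?F (fs z) (sn z) (v z)" if z: "z <: h" for z
  proof -
    obtain \<eta> where e: "\<eta> <: \<gamma> & ?F (fs z) (sn z) \<eta>" using h(2) z by blast
    have "dP (%\<eta>. \<eta> <: \<gamma> & ?F (fs z) (sn z) \<eta>)" by simp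
    from lst(2)[OF this Ord_mem[OF g] e] e show ?thesis unfolding v_def by blast
  qed
  have "lep om c" using c(2) unfolding not_Fin .
  then have "lep (Rep h v) c" using lep_trans[OF Rep_lep lep_trans[OF h(1)]] by simp
  moreover have "sub (Rep h v) \<gamma>" using v by (auto simp: sub_def)
  moreover have "EX \<eta>. \<eta> <: Rep h v & N.app f (j \<xi>) = j \<eta>" if x: "\<xi> <: c" for \<xi>
  proof -
    obtain z where z: "z <: h" "sn z = \<xi>" "fs z : G" using h(3) x by blast
    have "N.app f (j \<xi>) = j (v z)" using FM_value[OF f z(3)] v[OF z(1)] z(2) by blast
    then show ?thesis using z(1) by auto
  qed
  ultimately show ?thesis by blast
next
  case False
  let ?F = "%p \<xi> \<eta>. FM p (chk (pr \<xi> \<eta>)) (nm f)"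
  obtain p0 where p0: "p0 : G" "!!q \<xi>. le q p0 ==> \<xi> <: c ==> EX r \<eta>. le r q & \<eta> <: \<gamma> & ?F r \<xi> \<eta>"
    "!!q \<xi> \<eta> \<eta>'. le q p0 ==> ?F q \<xi> \<eta> ==> ?F q \<xi> \<eta>' ==> \<eta> = \<eta>'"
    by (rule total_below[OF f]) blast
  define Bx where "Bx \<xi> = Sep \<gamma> (%\<eta>. EX p. le p p0 & ?F p \<xi> \<eta>)" for \<xi>
  have [simp]: "dt t ==> dt (%e. Bx (t e))" for t by (rule dt1[where F=Bx], unfold Bx_def) simp_all
  have Bx: "\<eta> <: Bx \<xi> \<longleftrightarrow> \<eta> <: \<gamma> & (EX p. le p p0 & ?F p \<xi> \<eta>)" for \<xi> \<eta> unfolding Bx_def by simp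
  have Bw: "lep (Bx \<xi>) w1" if x: "\<xi> <: c" for \<xi>
  proof -
    \<comment> \<open>Conditions incompatible with \<open>p0\<close> receive the dummy value
      \<gamma>, which is not an element of \<gamma>. Thus \<open>V\<close> is densely defined on all
      of \<open>P\<close>, as \<open>hull\<close> requires, and compatible conditions still decide
      alike.\<close>
    define V where "V p y \<longleftrightarrow> (le p p0 & y <: \<gamma> & ?F p \<xi> y) | (~ (EX r. le r p & le r p0) & y = \<gamma>)" for p y
    have "EX B. lep B w1 & (ALL p y. p <: P --> V p y --> y <: B)"
    proof (rule hull)
      show "dP2 V" unfolding V_def by simp
      show "EX q y. le q p & V q y" if p: "p <: P" for p
      proof (cases "EX r. le r p & le r p0")
        case True
        then obtain r where r: "le r p" "le r p0" by blast
        then obtain q \<eta> where "le q r" "\<eta> <: \<gamma>" "?F q \<xi> \<eta>" using p0(2) x by blast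
        then show ?thesis unfolding V_def using le_trans r by blast
      next
        case False then show ?thesis unfolding V_def using le_refl[OF p] by blast
      qed
      show "y = z" if r: "le r p" "le r q" "V p y" "V q z" for r p q y z
      proof (cases "le p p0 & y <: \<gamma> & ?F p \<xi> y")
        case True
        then have rp: "le r p0" "?F r \<xi> y" using le_trans[OF r(1)] FM_mono[OF _ r(1)] by blast+
        then have "?F q \<xi> z" using r(2,4) unfolding V_def by blast
        then show ?thesis using p0(3)[OF rp(1,2)] FM_mono[OF _ r(2)] by blast
      next
        case False
        then have y: "~ (EX r. le r p & le r p0)" "y = \<gamma>" using r(3) unfolding V_def by blast+
        then have "~ le q p0" using r(1) le_trans[OF r(2)] by blast
        then show ?thesis using r(4) y unfolding V_def by blast
      qed
    qed
    then obtain B where B: "lep B w1" "ALL p y. p <: P --> V p y --> y <: B" by blast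
    have "sub (Bx \<xi>) B" unfolding sub_def Bx using B(2) le_P unfolding V_def by blast
    then show ?thesis using B(1) sub_lep lep_trans by blast
  qed
  let ?k = "card c"
  have k: "Inf ?k" using c(2) unfolding Inf_def not_Fin card_lep Card_card_eq[OF Card_om] by simp
  have "lep w1 c"
  proof (rule ccontr)
    assume "~ lep w1 c"
    then have "~ sub w1 ?k" using lep_trans[OF sub_lep eqp_lep[OF card_eqp]] by blast
    then have "?k <: w1" using Ord_not_mem[OF Ord_card w1_props(2)] by blast
    then have "lep ?k om" by (rule w1_props(4))
    then show False using False lep_trans[OF eqp_lep[OF eqp_sym[OF card_eqp]]] by blast
  qed
  then have wk: "lep w1 ?k" using lep_trans eqp_lep[OF eqp_sym[OF card_eqp]] by blast
  have "lep (Uni (Rep c Bx)) ?k"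
    by (rule Uni_lep[OF k eqp_lep[OF eqp_sym[OF card_eqp]]]) (use lep_trans[OF Bw wk] in simp_all)
  then have "lep (Uni (Rep c Bx)) c" using lep_trans eqp_lep[OF card_eqp] by blast
  moreover have "sub (Uni (Rep c Bx)) \<gamma>" by (auto simp: sub_def Bx)
  moreover have "EX \<eta>. \<eta> <: Uni (Rep c Bx) & N.app f (j \<xi>) = j \<eta>" if x: "\<xi> <: c" for \<xi>
  proof -
    obtain \<eta> p where h: "\<eta> <: \<gamma>" "p : G" "N.app f (j \<xi>) = j \<eta>" "?F p \<xi> \<eta>" using value_FM[OF f x] by blast
    obtain r where r: "le r p" "le r p0" using G_dir h(2) p0(1) by blast
    have "\<eta> <: Bx \<xi>" unfolding Bx using h r FM_mono by blast
    then have "\<eta> <: Uni (Rep c Bx)" using x by (subst mem_UniRep) auto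
    then show ?thesis using h by blast
  qed
  ultimately show ?thesis by blast
qed

text \<open>A map of the extension from an infinite \<alpha> below \<beta> onto \<beta> would, by
  \<open>covering\<close>, put \<beta> inside a ground-model set no larger than \<alpha>. Finite
  \<alpha> stay finite.\<close>

lemma Card_j: assumes "Ord \<beta>" shows "N.Card (j \<beta>) \<longleftrightarrow> Card \<beta>"
proof
  assume n: "N.Card (j \<beta>)"
  have "~ eqp \<alpha> \<beta>" if "\<alpha> <: \<beta>" for \<alpha>
    using n that j_eqp[of \<alpha> \<beta>] unfolding N.Card_def by auto
  then show "Card \<beta>" unfolding Card_def using assms by blast
next
  assume b: "Card \<beta>"
  show "N.Card (j \<beta>)"
  proof (cases "sub \<beta> om")
    case True
    then have "N.sub (j \<beta>) N.om" using j_sub[of \<beta> om] unfolding j_om by blast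
    then show ?thesis using N.Card_om_le j_Ord assms by blast
  next
    case False
    then have "om <: \<beta>" using Ord_not_mem[OF Ord_om assms] by blast
    have "~ N.eqp a (j \<beta>)" if a: "EN a (j \<beta>)" for a
    proof
      assume eq: "N.eqp a (j \<beta>)"
      obtain \<alpha> where al: "\<alpha> <: \<beta>" "a = j \<alpha>" using a unfolding EN_j by blast
      have oa: "Ord \<alpha>" using al Ord_mem[OF assms] by blast
      show False
      proof (cases "Fin \<alpha>")
        case True
        then have "\<alpha> <: om" using Fin_card card_mem[OF oa] not_Fin_om Fin_sub[of \<alpha> om] Ord_not_mem[OF oa Ord_om] by blast
        then have "N.Fin a" using N.Fin_nat al j_om EN_j_j by metis
        then have "N.Fin (j \<beta>)" using N.Fin_lep N.eqp_lep[OF N.eqp_sym[OF eq]] by blast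
        moreover have "N.sub N.om (j \<beta>)"
          unfolding j_om[symmetric] j_sub using Ord_sub[OF Ord_om assms] \<open>om <: \<beta>\<close> by blast
        ultimately show False using N.Fin_sub N.not_Fin_om by blast
      next
        case False
        obtain f where f: "N.Func f (j \<alpha>) (j \<beta>)" "ALL y. EN y (j \<beta>) --> (EX x. EN x (j \<alpha>) & N.app f x = y)"
          using eq unfolding al N.eqp_def by blast
        from covering[OF f(1) oa False assms] obtain B where
          B: "lep B \<alpha>" "ALL \<xi>. \<xi> <: \<alpha> --> (EX \<eta>. \<eta> <: B & N.app f (j \<xi>) = j \<eta>)" by blast
        have "sub \<beta> B"
        proof (rule subI)
          fix \<eta> assume "\<eta> <: \<beta>"
          then obtain x where "EN x (j \<alpha>)" "N.app f x = j \<eta>" using f(2)[rule_format, of "j \<eta>"] by auto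
          then obtain \<xi> where "\<xi> <: \<alpha>" "N.app f (j \<xi>) = j \<eta>" unfolding EN_j by blast
          then show "\<eta> <: B" using B(2) by auto
        qed
        then have "lep \<beta> \<alpha>" using sub_lep lep_trans B(1) by blast
        then show False using not_lep_less[OF b al(1)] by blast
      qed
    qed
    then show ?thesis unfolding N.Card_def using j_Ord assms by blast
  qed
qed

lemma cf_j: assumes g: "Lim \<gamma>" and cf: "Ord \<delta>" "EX f. cofm f \<delta> \<gamma>" "ALL c. c <: \<delta> --> ~ (EX f. cofm f c \<gamma>)"
  shows "N.Ord (j \<delta>) & (EX f. N.cofm f (j \<delta>) (j \<gamma>)) & (ALL c. EN c (j \<delta>) --> ~ (EX f. N.cofm f c (j \<gamma>)))"
proof (intro conjI allI impI)
  show "N.Ord (j \<delta>)" using cf j_Ord by blast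
  have og: "Ord \<gamma>" using g unfolding Lim_def by blast
  obtain f where f: "cofm f \<delta> \<gamma>" using cf by blast
  then have ff: "Func f \<delta> \<gamma>" unfolding cofm_def by blast
  have "N.cofm (j f) (j \<delta>) (j \<gamma>)" unfolding N.cofm_def
  proof (intro conjI j_Func[OF ff] allI impI)
    fix a assume "EN a (j \<gamma>)"
    then obtain \<alpha> where a: "\<alpha> <: \<gamma>" "a = j \<alpha>" unfolding EN_j by blast
    then obtain x where "x <: \<delta>" "\<alpha> <: app f x | \<alpha> = app f x" using f unfolding cofm_def by blast
    then show "EX x. EN x (j \<delta>) & (EN a (N.app (j f) x) | a = N.app (j f) x)"
      using a j_app[OF ff] by (intro exI[of _ "j x"]) auto
  qed
  then show "EX f. N.cofm f (j \<delta>) (j \<gamma>)" by blast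
  fix c' assume "EN c' (j \<delta>)"
  then obtain c where c: "c <: \<delta>" "c' = j c" unfolding EN_j by blast
  have oc: "Ord c" using c Ord_mem[OF cf(1)] by blast
  show "~ (EX f. N.cofm f c' (j \<gamma>))"
  proof
    assume "EX f. N.cofm f c' (j \<gamma>)"
    then obtain f where f: "N.Func f (j c) (j \<gamma>)"
      "ALL a. EN a (j \<gamma>) --> (EX x. EN x (j c) & (EN a (N.app f x) | a = N.app f x))" unfolding N.cofm_def c by blast
    show False
    proof (cases "Fin c")
      case True
      then have "c <: om" using not_Fin_om Fin_sub[of c om] Ord_not_mem[OF oc Ord_om] by blast
      then have "N.Fin (j c)" using N.Fin_nat j_om EN_j_j by metis
      then have F: "N.Fin (N.Rep (j c) (N.app f))" by (rule N.Fin_Rep) simp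
      have "N.sub (N.Rep (j c) (N.app f)) (j \<gamma>)" using N.Func_app[OF f(1)] by (auto simp: N.sub_def)
      from N.Fin_bounded[OF F this] obtain b where b: "EN b (j \<gamma>)" "ALL x. EN x (N.Rep (j c) (N.app f)) --> EN x b"
        using j_Lim g by blast
      obtain x where x: "EN x (j c)" "EN b (N.app f x) | b = N.app f x" using f(2) b(1) by blast
      have "EN (N.app f x) b" using b(2) N.RepI[of "N.app f" x "j c"] x(1) by simp
      then show False using x(2) N.not_mem_cycle[of b "N.app f x"] N.not_mem_self[of b] by auto
    next
      case False
      from covering[OF f(1) oc False og] obtain B where
        B: "sub B \<gamma>" "lep B c" "ALL \<xi>. \<xi> <: c --> (EX \<eta>. \<eta> <: B & N.app f (j \<xi>) = j \<eta>)" by blast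
      have Bc: "EX \<eta>. \<eta> <: B & (a <: \<eta> | a = \<eta>)" if a: "a <: \<gamma>" for a
      proof -
        obtain x where "EN x (j c)" "EN (j a) (N.app f x) | j a = N.app f x" using f(2)[rule_format, of "j a"] a by auto
        then obtain \<xi> where "\<xi> <: c" "EN (j a) (N.app f (j \<xi>)) | j a = N.app f (j \<xi>)" unfolding EN_j by blast
        then obtain \<eta> where "\<eta> <: B" "EN (j a) (j \<eta>) | j a = j \<eta>" using B(3)[rule_format, of \<xi>] by auto
        then show ?thesis by auto
      qed
      have "EX a. a <: \<gamma>" using g unfolding Lim_def eq_emp by blast
      then obtain b0 where b0: "b0 <: B" using Bc by blast
      obtain F where F: "dF F" "inj_on F (ext B)" "!!x. x <: B ==> F x <: c" using B(2) by (rule lepE) blast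
      note [simp] = dt1[where F=F, OF F(1)]
      \<comment> \<open>\<open>B\<close> is cofinal and no larger than \<open>c\<close>. Inverting
        its injection into \<open>c\<close>, with default \<open>b0\<close>, turns it into a cofinal
        map defined on all of \<open>c\<close>.\<close>
      define gg where "gg x = (if EX \<eta>. \<eta> <: B & F \<eta> = x then the1 (%\<eta>. \<eta> <: B & F \<eta> = x) else b0)" for x
      have dg: "dF gg" unfolding gg_def by simp
      have gF: "gg (F \<eta>) = \<eta>" if "\<eta> <: B" for \<eta>
      proof -
        have "the1 (%\<eta>'. \<eta>' <: B & F \<eta>' = F \<eta>) = \<eta>" using F(2) that by (intro the1_eq) (auto simp: inj_ext)
        then show ?thesis unfolding gg_def using that by auto
      qed
      have gB: "gg x <: B" for x
      proof (cases "EX \<eta>. \<eta> <: B & F \<eta> = x")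
        case True
        then obtain \<eta> where "\<eta> <: B" "x = F \<eta>" by blast
        then show ?thesis using gF[of \<eta>] by simp
      next
        case False then show ?thesis unfolding gg_def if_not_P[OF False] using b0 by blast
      qed
      have "cofm (lam c gg) c \<gamma>" unfolding cofm_def
      proof (intro conjI allI impI)
        show "Func (lam c gg) c \<gamma>" by (rule Func_lam[OF dg]) (use gB subD[OF B(1)] in blast)
        fix a assume "a <: \<gamma>"
        then obtain \<eta> where h: "\<eta> <: B" "a <: \<eta> | a = \<eta>" using Bc by blast
        then show "EX x. x <: c & (a <: app (lam c gg) x | a = app (lam c gg) x)"
          using F(3) gF dg by (intro exI[of _ "F \<eta>"]) simp
      qed
      then show False using cf(3) c(1) by blast
    qed
  qed
qed

end

section \<open>Cohen reals and the continuum\<close>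

context star
begin

text \<open>One coordinate may always be extended freely: a single change is finite.\<close>

lemma ext_cond:
  assumes p: "p <: P" and i: "i <: \<mu>" and s: "s <: Fn" "sub (app p i) s"
  shows "EX q. le q p & app q i = s & (ALL k. k <: \<mu> --> k ~= i --> app q k = app p k)"
proof -
  let ?F = "%k. if k = i then s else app p k"
  have F: "dF ?F" by simp
  have q: "app (lam \<mu> ?F) k = ?F k" if "k <: \<mu>" for k using that app_lam[OF F] by blast
  have "lep (Sep \<mu> (%k. ?F k ~= emp)) om"
  proof (rule lep_trans[OF sub_lep])
    show "sub (Sep \<mu> (%k. ?F k ~= emp)) (cup (supp p) (sg i))" by (auto simp: sub_def)
    show "lep (cup (supp p) (sg i)) om" by (rule cup_lep) (simp_all add: supp_ctb p Fin_ctb)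
  qed
  then have P: "lam \<mu> ?F <: P" using s PFn[OF p] by (intro PI[OF F]) auto
  have "le (lam \<mu> ?F) p"
    by (rule leI[OF P p, where d="sg i"]) (use q s in \<open>auto split: if_splits\<close>)
  then show ?thesis using q i by (intro exI[of _ "lam \<mu> ?F"]) simp
qed

lemma Fn_ins: assumes "s <: Fn" "n <: om" "!!b. ~ pr n b <: s" "b <: two" shows "cup s (sg (pr n b)) <: Fn"
  using assms Fin_ins[of s] unfolding mem_Fn by (auto simp: sub_def)

lemma Fn_fresh: assumes "s <: Fn" "t <: Fn" shows "EX n. n <: om & (ALL b. ~ pr n b <: s) & (ALL b. ~ pr n b <: t)"
proof (rule ccontr)
  assume n: "~ ?thesis"
  have "EX z. z <: cup s t & n = fs z" if nn: "n <: om" for n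
  proof -
    obtain b where "pr n b <: cup s t" using n nn by auto
    then show ?thesis by (intro exI[of _ "pr n b"]) simp
  qed
  then have "sub om (Rep (cup s t) fs)" by (simp add: sub_def)
  moreover have "Fin (Rep (cup s t) fs)" using assms by (intro Fin_Rep Fin_cup) (auto simp: mem_Fn)
  ultimately show False using Fin_sub not_Fin_om by blast
qed

lemma Fn_total: assumes "n <: om" "s <: Fn" shows "EX t. t <: Fn & sub s t & (ALL m. m <: n --> (EX b. pr m b <: t))"
  using assms(1)
proof (induction rule: om_induct)
  case emp show ?case using assms(2) by (intro exI[of _ s]) simp
next
  case (suc n)
  then obtain t where t: "t <: Fn" "sub s t" "ALL m. m <: n --> (EX b. pr m b <: t)" by blast
  show ?case
  proof (cases "EX b. pr n b <: t")
    case True then show ?thesis using t by (intro exI[of _ t]) auto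
  next
    case False
    have "cup t (sg (pr n emp)) <: Fn" by (rule Fn_ins) (use t suc False in auto)
    then show ?thesis using t by (intro exI[of _ "cup t (sg (pr n emp))"]) (auto simp: sub_def)
  qed
qed simp

lemma P_fun: "p <: P ==> i <: \<mu> ==> pr m b <: app p i ==> m <: om & b <: two"
  using PFn[of p i] unfolding mem_Fn sub_def by auto
lemma P_uniq: "p <: P ==> i <: \<mu> ==> pr m b <: app p i ==> pr m c <: app p i ==> b = c"
  using PFn[of p i] unfolding mem_Fn by blast
lemma le_sub: "le q p ==> i <: \<mu> ==> sub (app p i) (app q i)" unfolding le_iff by blast

end

context gstar
begin

text \<open>A name for the set of all (i, n) such that the i-th Cohen real has digit 1 at n: the
  pair is put in by exactly those conditions that contain this digit.\<close>

definition Cn :: nat where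
  "Cn = Rep (Sep (prd (prd \<mu> om) P) (%z. pr (sn (fs z)) (suc emp) <: app (sn z) (fs (fs z)))) (%z. pr (chk (fs z)) (sn z))"
definition CC :: nat where "CC = pi Cn"

lemma mem_Cn: "pr t v <: Cn \<longleftrightarrow> (EX i n. i <: \<mu> & n <: om & v <: P & pr n (suc emp) <: app v i & t = chk (pr i n))"
proof
  assume "pr t v <: Cn"
  then show "EX i n. i <: \<mu> & n <: om & v <: P & pr n (suc emp) <: app v i & t = chk (pr i n)"
    unfolding Cn_def by (auto simp: mem_prd) blast
next
  assume "EX i n. i <: \<mu> & n <: om & v <: P & pr n (suc emp) <: app v i & t = chk (pr i n)"
  then obtain i n where "i <: \<mu>" "n <: om" "v <: P" "pr n (suc emp) <: app v i" "t = chk (pr i n)" by blast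
  then show "pr t v <: Cn" unfolding Cn_def by (simp, intro exI[of _ "pr (pr i n) v"]) simp
qed

lemma EN_CC: assumes "i <: \<mu>" "n <: om" shows "EN (N.pr (j i) (j n)) CC \<longleftrightarrow> (EX p:G. pr n (suc emp) <: app p i)"
proof -
  have "Name Cn" by (rule NameI) (auto simp: Cn_def mem_prd)
  from EN_iff[OF this, of "j (pr i n)"] have "EN (j (pr i n)) CC \<longleftrightarrow> (EX t v. pr t v <: Cn & v : G & pi t = j (pr i n))"
    unfolding CC_def .
  also have "... \<longleftrightarrow> (EX v. v : G & pr n (suc emp) <: app v i)"
  proof
    assume "EX t v. pr t v <: Cn & v : G & pi t = j (pr i n)"
    then obtain i' n' v where v: "v : G" "pr n' (suc emp) <: app v i'" "j (pr i' n') = j (pr i n)"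
      unfolding mem_Cn j_def by blast
    then show "EX v. v : G & pr n (suc emp) <: app v i" by auto
  next
    assume "EX v. v : G & pr n (suc emp) <: app v i"
    then obtain v where "v : G" "pr n (suc emp) <: app v i" by blast
    then have "pr (chk (pr i n)) v <: Cn & v : G & pi (chk (pr i n)) = j (pr i n)"
      unfolding mem_Cn j_def using assms G_P by blast
    then show "EX t v. pr t v <: Cn & v : G & pi t = j (pr i n)" by blast
  qed
  finally show ?thesis unfolding j_pr by blast
qed

definition cN :: "nat => nat" where "cN x = N.lam N.om (%n. if EN (N.pr x n) CC then N.suc N.emp else N.emp)"
lemma dt_cN [simp]: "N.dt a ==> N.dt (%e. cN (a e))" by (rule N.dt1[where F=cN], unfold cN_def) simp_all

lemma cN_Func: "N.Func (cN x) N.om N.two" unfolding cN_def by (rule N.Func_lam) simp_all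

lemma cN_val: assumes r: "r : G" and i: "i <: \<mu>" and m: "pr m b <: app r i" shows "N.app (cN (j i)) (j m) = j b"
proof -
  have mb: "m <: om" "b <: two" using P_fun[OF G_P[OF r] i m] by blast+
  have jm: "EN (j m) N.om" unfolding j_om[symmetric] using mb by simp
  have v: "N.app (cN (j i)) (j m) = (if EX p:G. pr m (suc emp) <: app p i then j (suc emp) else j emp)"
    unfolding cN_def using jm by (simp add: EN_CC[OF i mb(1)] j_suc j_emp)
  show ?thesis
  proof (cases "b = suc emp")
    case True then show ?thesis unfolding v using r m by auto
  next
    case False
    then have b: "b = emp" using mb by simp
    have "~ pr m (suc emp) <: app p i" if p: "p : G" for p
    proof
      assume q: "pr m (suc emp) <: app p i"
      obtain s where s: "s : G" "le s p" "le s r" using G_dir p r by blast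
      have "pr m (suc emp) <: app s i" "pr m b <: app s i" using subD[OF le_sub[OF s(2) i] q] subD[OF le_sub[OF s(3) i] m] .
      then show False using P_uniq[OF G_P[OF s(1)] i] False by blast
    qed
    then show ?thesis unfolding v b by simp
  qed
qed

text \<open>It is dense to take a digit undecided at both coordinates and to give it different
  values there.\<close>

lemma cN_inj: assumes i: "i <: \<mu>" "k <: \<mu>" "cN (j i) = cN (j k)" shows "i = k"
proof (rule ccontr)
  assume ne: "i ~= k"
  let ?D = "%r. EX n. pr n emp <: app r i & pr n (suc emp) <: app r k"
  have "EX r:G. ?D r"
  proof (rule G_generic)
    fix p assume p: "p <: P"
    obtain n where n: "n <: om" "ALL b. ~ pr n b <: app p i" "ALL b. ~ pr n b <: app p k"
      using Fn_fresh[OF PFn[OF p i(1)] PFn[OF p i(2)]] by blast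
    let ?s = "cup (app p i) (sg (pr n emp))" and ?t = "cup (app p k) (sg (pr n (suc emp)))"
    have s: "?s <: Fn" by (rule Fn_ins) (use n PFn[OF p i(1)] in auto)
    have t: "?t <: Fn" by (rule Fn_ins) (use n PFn[OF p i(2)] in auto)
    obtain q where q: "le q p" "app q i = ?s" "app q k = app p k"
      using ext_cond[OF p i(1) s] ne i(2) by (auto simp: sub_def)
    have qP: "q <: P" using q(1) le_P by blast
    obtain r where r: "le r q" "app r k = ?t" "app r i = app q i"
      using ext_cond[OF qP i(2) t] ne i(1) q(3) by (auto simp: sub_def)
    show "EX q. le q p & ?D q" using le_trans[OF r(1) q(1)] r q by (intro exI[of _ r]) auto
  qed simp
  then obtain r n where r: "r : G" "pr n emp <: app r i" "pr n (suc emp) <: app r k" by blast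
  then have "j emp = j (suc emp)" using cN_val[OF r(1) i(1) r(2)] cN_val[OF r(1) i(2) r(3)] i(3) by simp
  then show False by simp
qed

lemma continuum_ge: "N.lep (j \<mu>) (N.funsp N.om N.two)"
  by (rule N.lepI[of cN]) (auto simp: N.inj_ext EN_j cN_Func dest: cN_inj)

text \<open>A real is determined by the generic filter and a countable set of pairs \<open>(n, r)\<close> of the ground model such that
  \<open>r\<close> forces its \<open>n\<close>th digit to be 1.\<close>

lemma continuum_le: "N.lep (N.funsp N.om N.two) (j \<mu>)"
proof -
  define F where "F k = N.lam N.om (%n. if EX r. EN r GG & EN (N.pr n r) k then N.suc N.emp else N.emp)" for k
  have dF: "N.dF F" unfolding F_def by simp
  have "N.lep (N.funsp N.om N.two) (j (ctb (prd om P)))"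
  proof (rule N.surj_lep[OF dF])
    fix f assume "EN f (N.funsp N.om N.two)"
    then have f': "N.Func f N.om N.two" by simp
    then have f: "N.Func f (j om) (j two)" unfolding j_om j_two .
    obtain h where h: "lep h om" "ALL z. z <: h --> z <: prd P om & (EX \<eta>. \<eta> <: two & FM (fs z) (chk (pr (sn z) \<eta>)) (nm f))"
      "ALL n. n <: om --> (EX z. z <: h & sn z = n & fs z : G)" using decide[OF f lep_refl] by blast
    define k where "k = Sep (prd om P) (%z. pr (sn z) (fs z) <: h & FM (sn z) (chk (pr (fs z) (suc emp))) (nm f))"
    have k: "pr n r <: k \<longleftrightarrow> n <: om & r <: P & pr r n <: h & FM r (chk (pr n (suc emp))) (nm f)" for n r
      unfolding k_def by simp
    have "lep k h" by (rule lepI[of "%z. pr (sn z) (fs z)"]) (auto simp: inj_ext k_def mem_prd)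
    then have "k <: ctb (prd om P)" using lep_trans[OF _ h(1)] by (auto simp: k_def sub_def)
    moreover have "F (j k) = f"
    proof (rule N.Func_eqI[OF _ f'])
      show "N.Func (F (j k)) N.om N.two" unfolding F_def by (rule N.Func_lam) simp_all
      fix x assume x: "EN x N.om"
      then obtain n where n: "n <: om" "x = j n" unfolding j_om[symmetric] EN_j by blast
      have v: "N.app (F (j k)) x = (if EX r. EN r GG & EN (N.pr x r) (j k) then N.suc N.emp else N.emp)"
        unfolding F_def using x by simp
      have ex: "(EX r. EN r GG & EN (N.pr x r) (j k)) \<longleftrightarrow> (EX r:G. pr n r <: k)"
      proof -
        have "(EX r. EN r GG & EN (N.pr x r) (j k)) \<longleftrightarrow> (EX r:G. EN (j (pr n r)) (j k))" unfolding EN_GG n(2) j_pr by blast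
        then show ?thesis by simp
      qed
      obtain z where z: "z <: h" "sn z = n" "fs z : G" using h(3) n(1) by blast
      then obtain r where r: "z = pr r n" "r : G" using h(2) by (auto simp: mem_prd)
      obtain \<eta> where e: "\<eta> <: two" "FM r (chk (pr n \<eta>)) (nm f)" using h(2)[rule_format, OF z(1)] unfolding r(1) fs_pr sn_pr by blast
      have fv: "N.app f x = j \<eta>" unfolding n(2) by (rule FM_value[OF f r(2) e(2)])
      show "N.app (F (j k)) x = N.app f x"
      proof (cases "\<eta> = suc emp")
        case True
        have "pr n r <: k" unfolding k using n(1) z(1) e(2) G_P[OF r(2)] unfolding r(1) True by simp
        then show ?thesis unfolding v ex fv True j_suc j_emp using r by auto
      next
        case False
        then have "\<eta> = emp" using e by simp
        moreover have "~ pr n r <: k" if "r : G" for r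
        proof
          assume "pr n r <: k"
          then have "N.app f x = j (suc emp)" unfolding n(2) k using FM_value[OF f that] by blast
          then show False using fv False by simp
        qed
        ultimately show ?thesis unfolding v ex fv using j_emp by auto
      qed
    qed
    ultimately show "EX x. EN x (j (ctb (prd om P))) & F x = f" by (intro exI[of _ "j k"]) simp
  qed
  moreover have "lep (prd om P) \<mu>" by (rule prd_lep[OF Inf_\<mu> sub_lep P_lep]) (rule InfD[OF Inf_\<mu>])
  ultimately show ?thesis using N.lep_trans j_lep ctb_lep[OF ctbbd_\<mu> om_\<mu>] by blast
qed

lemma Card_j\<mu>: "N.Card (j \<mu>)" using Card_j InfD[OF Inf_\<mu>] by blast
lemma continuum: "N.eqp (N.funsp N.om N.two) (j \<mu>)" by (rule N.lep_antisym[OF continuum_le continuum_ge])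

end

section \<open>The principle in the extension\<close>

context zfc
begin

text \<open>Since \<kappa> may be a limit cardinal, the bounds m and m' are merged into one infinite
  ordinal below \<kappa>, whose cardinal absorbs the union.\<close>

lemma below_Card:
  assumes k: "Card \<kappa>" "om <: \<kappa>" and m: "m <: \<kappa>" "m' <: \<kappa>" "lep A m" "lep B m'" shows "~ lep \<kappa> (cup A B)"
proof
  assume n: "lep \<kappa> (cup A B)"
  have o: "Ord m" "Ord m'" using m Ord_mem[OF Card_Ord[OF k(1)]] by blast+
  define d where "d = cup (cup m m') om"
  have "d <: \<kappa>" unfolding d_def using cup_Ord[OF o] cup_Ord[OF Ord_cup[OF o] Ord_om] m k(2) by auto
  moreover have "lep om d" by (rule sub_lep) (auto simp: sub_def d_def)
  then have "Inf (card d)" unfolding Inf_def using card_lep[of om d] Card_card_eq[OF Card_om] by simp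
  then have "lep (cup A B) (card d)"
  proof (rule cup_lep)
    have *: "lep x (card d)" if "sub y d" "lep x y" for x y
      using that lep_trans sub_lep eqp_lep[OF eqp_sym[OF card_eqp]] by blast
    show "lep A (card d)" by (rule *[OF _ m(3)]) (auto simp: sub_def d_def)
    show "lep B (card d)" by (rule *[OF _ m(4)]) (auto simp: sub_def d_def)
  qed
  then have "lep \<kappa> d" using n lep_trans eqp_lep[OF card_eqp] by blast
  ultimately show False using not_lep_less[OF k(1)] by blast
qed

lemma suc_Card: assumes "Card \<kappa>" "om <: \<kappa>" "\<beta> <: \<kappa>" shows "suc \<beta> <: \<kappa>"
proof (rule ccontr)
  assume n: "~ suc \<beta> <: \<kappa>"
  have o: "Ord \<kappa>" "Ord \<beta>" using assms Card_Ord Ord_mem by blast+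
  have "sub \<kappa> (suc \<beta>)" using n Ord_not_mem[OF Ord_suc[OF o(2)] o(1)] by blast
  moreover have "~ lep \<kappa> (cup \<beta> (sg \<beta>))"
    by (rule below_Card[OF assms(1,2,3,2)]) (simp_all add: Fin_ctb)
  ultimately show False using sub_lep unfolding suc_def by blast
qed

lemma diff_lep: assumes "Card \<kappa>" "om <: \<kappa>" "lep a om" shows "lep \<kappa> (diff \<kappa> a)"
proof (rule ccontr)
  assume n: "~ ?thesis"
  have "card (diff \<kappa> a) <: \<kappa>"
  proof (rule ccontr)
    assume "~ card (diff \<kappa> a) <: \<kappa>"
    then have "sub \<kappa> (card (diff \<kappa> a))" using Ord_not_mem[OF Ord_card Card_Ord[OF assms(1)]] by blast
    then show False using n lep_trans[OF sub_lep eqp_lep[OF card_eqp]] by blast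
  qed
  from below_Card[OF assms(1,2) this assms(2) eqp_lep[OF eqp_sym[OF card_eqp]] assms(3)]
  have "~ lep \<kappa> (cup (diff \<kappa> a) a)" .
  then show False using sub_lep[of \<kappa> "cup (diff \<kappa> a) a"] by (auto simp: sub_def)
qed

text \<open>If \<kappa> has a countable cofinal subset \<open>C\<close>, the pigeonhole principle
  gives uncountably many \<open>x\<close> with \<open>F x\<close> below one element of
  \<open>C\<close>. Otherwise countable sets of values are bounded anyway, and \<open>W\<close>
  itself serves.\<close>

lemma bounded_refine:
  assumes k: "Card \<kappa>" "om <: \<kappa>" and W: "~ lep W om" and F: "dF F" "!!x. x <: W ==> F x <: \<kappa>"
  shows "EX V. sub V W & ~ lep V om & (ALL I. sub I V --> lep I om --> (EX \<beta>. \<beta> <: \<kappa> & (ALL x. x <: I --> F x <: \<beta>)))"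
proof (cases "EX C. sub C \<kappa> & lep C om & (ALL \<beta>. \<beta> <: \<kappa> --> (EX c. c <: C & \<beta> <: c))")
  case True
  note [simp] = dt1[where F=F, OF F(1)]
  obtain C where C: "sub C \<kappa>" "lep C om" "ALL \<beta>. \<beta> <: \<kappa> --> (EX c. c <: C & \<beta> <: c)" using True by blast
  define g where "g x = lst (%c. c <: C & F x <: c)" for x
  have g: "g x <: C & F x <: g x" if x: "x <: W" for x
  proof -
    obtain c where c: "c <: C & F x <: c" using C(3) F(2)[OF x] by blast
    have "dP (%c. c <: C & F x <: c)" by simp
    from lst(2)[OF this _ c] c show ?thesis unfolding g_def using subD[OF C(1)] Ord_mem[OF Card_Ord[OF k(1)]] by blast
  qed
  have dg: "dF g" unfolding g_def by simp
  note [simp] = dt1[where F=g, OF dg]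
  have "EX c. c <: C & ~ lep (Sep W (%x. g x = c)) om" by (rule pigeonhole[OF W dg _ C(2)]) (use g in blast)
  then obtain c where c: "c <: C" "~ lep (Sep W (%x. g x = c)) om" by blast
  have "F x <: c" if "x <: Sep W (%x. g x = c)" for x using that g by auto
  moreover have "sub (Sep W (%x. g x = c)) W" by (auto simp: sub_def)
  ultimately show ?thesis using c subD[OF C(1)] subD by blast
next
  case False
  note [simp] = dt1[where F=F, OF F(1)]
  have "EX \<beta>. \<beta> <: \<kappa> & (ALL x. x <: I --> F x <: \<beta>)" if I: "sub I W" "lep I om" for I
  proof -
    have "sub (Rep I F) \<kappa>" using F(2) subD[OF I(1)] by (auto simp: sub_def)
    moreover have "lep (Rep I F) om" using lep_trans[OF Rep_lep I(2)] by simp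
    ultimately obtain \<beta> where b: "\<beta> <: \<kappa>" "~ (EX c. c <: Rep I F & \<beta> <: c)" using False by blast
    have "F x <: suc \<beta>" if x: "x <: I" for x
    proof -
      have "F x <: Rep I F" using x by (intro RepI) simp_all
      then have "~ \<beta> <: F x" using b(2) by blast
      then show ?thesis using Ord_linear[OF Ord_mem Ord_mem, OF Card_Ord[OF k(1)] F(2) Card_Ord[OF k(1)] b(1), of x] subD[OF I(1) x] by auto
    qed
    then show ?thesis using suc_Card[OF k b(1)] by blast
  qed
  then show ?thesis using W by (intro exI[of _ W]) simp
qed

end

context gstar
begin

text \<open>The fusion lists conditions that put new indices into \<open>Y\<close>. Stopping at a
  countable list would mean that the listed indices cover \<open>Y\<close>. So it runs through
  \<omega>_1; thinning out to a single value \<open>s\<close>, as \<open>Fn\<close> is countable,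
  and to bounded sets of indices leaves enough conditions for a lower bound.\<close>

lemma uncountable_traced:
  assumes k: "Card \<kappa>" "om <: \<kappa>" "sub \<kappa> \<mu>" and Y: "N.sub Y (j \<kappa>)" "~ N.lep Y N.om"
  shows "EX a s q. eqp a om & (EX \<beta>. \<beta> <: \<kappa> & sub a \<beta>) & s <: Fn & s ~= emp & q : G &
    (ALL i. i <: a --> app q i = s & EN (j i) Y)"
proof -
  let ?Y = "nm Y"
  have jY: "EN (j i) Y \<longleftrightarrow> (EX p:G. FM p (chk i) ?Y)" for i
    using EN_pi[OF Name_chk Name_nm, of i Y] unfolding j_def gmem_def by simp
  \<comment> \<open>Nonemptiness at \<open>sn z\<close> makes the lower bound keep the value there;
    the last clause makes the indices distinct.\<close>
  define S where "S z h \<longleftrightarrow> FM (fs z) (chk (sn z)) ?Y & app (fs z) (sn z) ~= emp & (ALL z'. z' <: h --> sn z' ~= sn z)" for z h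
  have dS: "dP2 S" unfolding S_def by simp
  note [simp] = dp2[where P=S, OF dS]
  let ?A = "%q. EX h. lep h om & (ALL r x. x <: \<kappa> --> le r q --> ~ S (pr r x) h)"
  let ?B = "%q. EX a s. eqp a om & (EX \<beta>. \<beta> <: \<kappa> & sub a \<beta>) & s <: Fn & s ~= emp &
    (ALL i. i <: a --> app q i = s & FM q (chk i) ?Y)"
  have "EX q:G. ?A q | ?B q"
  proof (rule G_generic)
    fix p assume p: "p <: P"
    from fusion[OF dS p, of \<kappa>] show "EX q. le q p & (?A q | ?B q)"
    proof (elim disjE)
      assume "EX q h. le q p & lep h om & (ALL z. z <: h --> z <: prd P \<kappa> & (EX h'. S z h')) & ~ (EX r x. x <: \<kappa> & le r q & S (pr r x) h)"
      then obtain q h where q: "le q p" "lep h om" "~ (EX r x. x <: \<kappa> & le r q & S (pr r x) h)" by (elim exE conjE) (rule that)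
      then have "?A q" by blast
      then show ?thesis using q(1) by blast
    next
      assume "EX H. dF H & (ALL \<alpha>. \<alpha> <: w1 --> H \<alpha> <: prd P \<kappa> & S (H \<alpha>) (Rep \<alpha> H)) &
        (ALL W. sub W w1 --> ~ lep W om --> (EX I q. sub I W & eqp om I & le q p &
         (ALL \<alpha>. \<alpha> <: I --> le q (fs (H \<alpha>)) &
           (sn (H \<alpha>) <: \<mu> --> app (fs (H \<alpha>)) (sn (H \<alpha>)) ~= emp --> app q (sn (H \<alpha>)) = app (fs (H \<alpha>)) (sn (H \<alpha>))))))"
      then obtain H where H: "dF H" "ALL \<alpha>. \<alpha> <: w1 --> H \<alpha> <: prd P \<kappa> & S (H \<alpha>) (Rep \<alpha> H)"
        and H': "ALL W. sub W w1 --> ~ lep W om --> (EX I q. sub I W & eqp om I & le q p &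
         (ALL \<alpha>. \<alpha> <: I --> le q (fs (H \<alpha>)) &
           (sn (H \<alpha>) <: \<mu> --> app (fs (H \<alpha>)) (sn (H \<alpha>)) ~= emp --> app q (sn (H \<alpha>)) = app (fs (H \<alpha>)) (sn (H \<alpha>)))))"
        by (elim exE conjE) (rule that)
      note [simp] = dt1[where F=H, OF H(1)]
      let ?f = "%\<alpha>. sn (H \<alpha>)" and ?v = "%\<alpha>. app (fs (H \<alpha>)) (sn (H \<alpha>))"
      have HP: "fs (H \<alpha>) <: P" "?f \<alpha> <: \<kappa>" "?f \<alpha> <: \<mu>" if "\<alpha> <: w1" for \<alpha>
      proof -
        have "H \<alpha> <: prd P \<kappa>" using H(2) that by blast
        then show "fs (H \<alpha>) <: P" "?f \<alpha> <: \<kappa>" "?f \<alpha> <: \<mu>" using subD[OF k(3)] by (auto simp: mem_prd)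
      qed
      have HS: "FM (fs (H \<alpha>)) (chk (?f \<alpha>)) ?Y" "?v \<alpha> ~= emp" "!!\<beta>. \<beta> <: \<alpha> ==> ?f \<beta> ~= ?f \<alpha>" if a: "\<alpha> <: w1" for \<alpha>
      proof -
        have s: "S (H \<alpha>) (Rep \<alpha> H)" using H(2) a by blast
        then show "FM (fs (H \<alpha>)) (chk (?f \<alpha>)) ?Y" "?v \<alpha> ~= emp" unfolding S_def by blast+
        show "?f \<beta> ~= ?f \<alpha>" if "\<beta> <: \<alpha>" for \<beta> using s RepI[OF H(1) that] unfolding S_def by blast
      qed
      have "EX s. s <: Fn & ~ lep (Sep w1 (%\<alpha>. ?v \<alpha> = s)) om"
        by (rule pigeonhole[OF w1_props(5) _ _ Fn_ctb]) (use PFn HP in simp_all)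
      then obtain s where s: "s <: Fn" "~ lep (Sep w1 (%\<alpha>. ?v \<alpha> = s)) om" by blast
      have "EX V. sub V (Sep w1 (%\<alpha>. ?v \<alpha> = s)) & ~ lep V om &
        (ALL I. sub I V --> lep I om --> (EX \<beta>. \<beta> <: \<kappa> & (ALL x. x <: I --> ?f x <: \<beta>)))"
        by (rule bounded_refine[OF k(1,2) s(2)]) (use HP in auto)
      then obtain V where V: "sub V (Sep w1 (%\<alpha>. ?v \<alpha> = s))" "~ lep V om"
        "ALL I. sub I V --> lep I om --> (EX \<beta>. \<beta> <: \<kappa> & (ALL x. x <: I --> ?f x <: \<beta>))" by blast
      have Vw: "\<alpha> <: w1" "?v \<alpha> = s" if "\<alpha> <: V" for \<alpha> using subD[OF V(1) that] by simp_all
      have "sub V w1" using Vw by (auto simp: sub_def)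
      from H'[rule_format, OF this V(2)] obtain I q where I: "sub I V" "eqp om I" "le q p"
        "!!\<alpha>. \<alpha> <: I ==> le q (fs (H \<alpha>))" "!!\<alpha>. \<alpha> <: I ==> ?f \<alpha> <: \<mu> ==> ?v \<alpha> ~= emp ==> app q (?f \<alpha>) = ?v \<alpha>" by blast
      have Iw: "\<alpha> <: w1" "?v \<alpha> = s" if "\<alpha> <: I" for \<alpha> using Vw subD[OF I(1) that] by blast+
      have inj: "\<alpha> = \<beta>" if ab: "\<alpha> <: I" "\<beta> <: I" "?f \<alpha> = ?f \<beta>" for \<alpha> \<beta>
        using Ord_linear[OF Ord_mem[OF w1_props(2) Iw(1)[OF ab(1)]] Ord_mem[OF w1_props(2) Iw(1)[OF ab(2)]]]
          HS(3)[OF Iw(1)[OF ab(1)], of \<beta>] HS(3)[OF Iw(1)[OF ab(2)], of \<alpha>] ab(3) by auto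
      have "eqp I (Rep I ?f)" by (rule eqpI[of ?f]) (auto simp: bij_ext inj_ext dest: inj)
      then have "eqp (Rep I ?f) om" using eqp_sym eqp_trans I(2) by blast
      moreover have "EX \<beta>. \<beta> <: \<kappa> & sub (Rep I ?f) \<beta>"
      proof -
        have "EX \<beta>. \<beta> <: \<kappa> & (ALL x. x <: I --> ?f x <: \<beta>)" using V(3) I(1) eqp_lep[OF eqp_sym[OF I(2)]] by blast
        then show ?thesis by (auto simp: sub_def)
      qed
      moreover have "s ~= emp"
      proof -
        obtain K where "dF K" and "bij_betw K (ext om) (ext I)" using I(2) by (rule eqpE)
        then have "K emp <: I" unfolding bij_ext by simp
        then show ?thesis using HS(2) Iw by blast
      qed
      moreover have "app q i = s & FM q (chk i) ?Y" if "i <: Rep I ?f" for i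
      proof -
        have "EX \<alpha>. \<alpha> <: I & i = ?f \<alpha>" using that by simp
        then obtain \<alpha> where a: "\<alpha> <: I" "i = ?f \<alpha>" by blast
        note w = Iw(1)[OF a(1)]
        show ?thesis using I(5)[OF a(1) HP(3)[OF w] HS(2)[OF w]] FM_mono[OF HS(1)[OF w] I(4)[OF a(1)]] Iw(2)[OF a(1)]
          unfolding a(2) by simp
      qed
      ultimately have "?B q" using s(1) by blast
      then show ?thesis using I(3) by blast
    qed
  qed simp
  then obtain q where q: "q : G" "?A q | ?B q" by blast
  have "~ ?A q"
  proof
    assume "?A q"
    then obtain h where h: "lep h om" "ALL r x. x <: \<kappa> --> le r q --> ~ S (pr r x) h" by blast
    have "N.sub Y (j (Rep h sn))"
    proof (rule N.subI)
      fix y assume y: "EN y Y"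
      then have "EN y (j \<kappa>)" using N.subD[OF Y(1)] by blast
      then obtain i where i: "i <: \<kappa>" "y = j i" unfolding EN_j by blast
      have im: "i <: \<mu>" using subD[OF k(3) i(1)] .
      obtain p where p: "p : G" "FM p (chk i) ?Y" using y jY unfolding i by blast
      obtain r where r: "r : G" "le r p" "le r q" using G_dir p(1) q(1) by blast
      \<comment> \<open>\<open>S\<close> demands a nonempty value at \<open>i\<close>; if there is
        none yet, an arbitrary digit is added.\<close>
      have "EX r'. le r' r & app r' i ~= emp"
      proof (cases "app r i = emp")
        case True
        have "cup emp (sg (pr emp emp)) <: Fn" by (rule Fn_ins) simp_all
        then obtain r' where "le r' r" "app r' i = sg (pr emp emp)" using ext_cond[OF G_P[OF r(1)] im] True by (auto simp: sub_def)
        moreover have "sg (pr emp emp) ~= emp" by (rule mem_ne) simp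
        ultimately show ?thesis by auto
      qed (use le_refl[OF G_P[OF r(1)]] in blast)
      then obtain r' where r': "le r' r" "app r' i ~= emp" by blast
      have "~ S (pr r' i) h" using h(2) i(1) le_trans[OF r'(1) r(3)] by blast
      then obtain z where "z <: h" "sn z = i"
        unfolding S_def using FM_mono[OF p(2) le_trans[OF r'(1) r(2)]] r'(2) by auto
      then have "i <: Rep h sn" by auto
      then show "EN y (j (Rep h sn))" unfolding i by simp
    qed
    moreover have "lep (Rep h sn) om" using lep_trans[OF Rep_lep h(1)] by simp
    ultimately show False using Y(2) N.lep_trans[OF N.sub_lep] j_lep[of "Rep h sn" om] unfolding j_om by blast
  qed
  then obtain a s where "eqp a om" "EX \<beta>. \<beta> <: \<kappa> & sub a \<beta>" "s <: Fn" "s ~= emp"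
    "ALL i. i <: a --> app q i = s & FM q (chk i) ?Y" using q(2) by blast
  then show ?thesis using q(1) jY by blast
qed

lemma infinite_avoid: assumes "eqp a om" "Fin d" shows "EX i. i <: a & ~ i <: d"
proof (rule ccontr)
  assume "~ ?thesis"
  then have "sub a d" by (auto simp: sub_def)
  then have "Fin om" using Fin_lep[OF Fin_sub[OF assms(2)] eqp_lep[OF eqp_sym[OF assms(1)]]] by blast
  then show False using not_Fin_om by blast
qed

text \<open>Only finitely many coordinates of \<open>a\<close> can change below a condition that is constantly \<open>s \<noteq> \<emptyset>\<close> on \<open>a\<close>, so one
  of the others is free to copy any coordinate extending \<open>s\<close>.\<close>

lemma agreeing_coordinate:
  assumes a: "eqp a om" "sub a \<mu>" and s: "s ~= emp" and q: "q : G" "!!i. i <: a ==> app q i = s"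
    and i: "i <: \<mu>" and r0: "r0 : G" "sub s (app r0 i)" and n: "n <: om"
  shows "EX r:G. EX k. k <: a & (ALL m. m <: n --> (EX b. pr m b <: app r i & pr m b <: app r k))"
proof -
  obtain q0 where q0: "q0 : G" "le q0 q" "le q0 r0" using G_dir q(1) r0(1) by blast
  let ?D = "%r. EX k. k <: a & (ALL m. m <: n --> (EX b. pr m b <: app r i & pr m b <: app r k))"
  have "EX r:G. le r q0 & ?D r"
  proof (rule gen_below[OF q0(1)])
    fix p assume p: "le p q0"
    have pP: "p <: P" using p le_P by blast
    have pq: "le p q" using le_trans[OF p q0(2)] .
    then have "Fin (Sep \<mu> (%i. app p i ~= app q i & app q i ~= emp))" unfolding le_iff by blast
    from infinite_avoid[OF a(1) Fin_ins[OF this, of i]] obtain k where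
      k: "k <: a" "k ~= i" "~ k <: Sep \<mu> (%i. app p i ~= app q i & app q i ~= emp)" by auto
    have km: "k <: \<mu>" using subD[OF a(2) k(1)] .
    have pk: "app p k = s" using k(3) km q(2)[OF k(1)] s by auto
    have si: "sub s (app p i)" using sub_trans[OF r0(2) le_sub[OF le_trans[OF p q0(3)] i]] .
    obtain t where t: "t <: Fn" "sub (app p i) t" "ALL m. m <: n --> (EX b. pr m b <: t)" using Fn_total[OF n PFn[OF pP i]] by blast
    obtain p1 where p1: "le p1 p" "app p1 i = t" "app p1 k = app p k" using ext_cond[OF pP i t(1,2)] k(2) km by auto
    have p1P: "p1 <: P" using p1(1) le_P by blast
    have "sub (app p1 k) t" unfolding p1(3) pk using sub_trans[OF si t(2)] .
    then obtain p2 where p2: "le p2 p1" "app p2 k = t" "app p2 i = app p1 i" using ext_cond[OF p1P km t(1)] k(2) i by auto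
    have "?D p2" using k(1) t(3) by (intro exI[of _ k]) (simp add: p2(2,3) p1(2))
    then show "EX q. le q p & ?D q" using le_trans[OF p2(1) p1(1)] by blast
  qed simp
  then show ?thesis by blast
qed

context
  fixes \<kappa> ct
  assumes \<kappa>: "Card \<kappa>" "om <: \<kappa>" "sub \<kappa> \<mu>"
    and ct: "N.dF ct" "ALL f. N.Func f N.om N.two --> N.real (ct f)"
      "ALL f g. N.Func f N.om N.two --> N.Func g N.om N.two --> ct f = ct g --> f = g"
      "ALL f u v. N.Func f N.om N.two --> N.real u --> N.real v --> N.rless u (ct f) --> N.rless (ct f) v -->
        (EX n. EN n N.om & (ALL g. N.Func g N.om N.two --> (ALL k. EN k n --> N.app g k = N.app f k) --> N.rless u (ct g) & N.rless (ct g) v))"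
begin

section \<open>The set T of Cohen reals, closures in it, and the family\<close>

definition X :: "nat => nat" where "X i = ct (cN i)"
lemma dt_X [simp]: "N.dt a ==> N.dt (%e. X (a e))"
  by (rule N.dt1[where F=X], unfold X_def) (simp add: N.dt1[where F=ct, OF ct(1)])
definition TT :: nat where "TT = N.Rep (j \<kappa>) X"
lemma mem_TT: "EN x TT \<longleftrightarrow> (EX i. i <: \<kappa> & x = X (j i))" unfolding TT_def by (simp add: EN_j) blast

lemma X_real: "N.real (X i)" unfolding X_def using ct(2) cN_Func by blast
lemma X_inj: assumes "EN a (j \<kappa>)" "EN b (j \<kappa>)" "X a = X b" shows "a = b"
proof -
  obtain i k where i: "i <: \<kappa>" "k <: \<kappa>" "a = j i" "b = j k" using assms unfolding EN_j by blast
  have "cN a = cN b" using assms(3) ct(3) cN_Func unfolding X_def by blast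
  then show ?thesis using cN_inj[of i k] subD[OF \<kappa>(3)] i by blast
qed

lemma eqp_X: assumes "N.sub a (j \<kappa>)" shows "N.eqp (N.Rep a X) a"
  by (rule N.eqp_sym[OF N.eqpI[of X]]) (use X_inj N.subD[OF assms] in \<open>auto simp: N.bij_ext N.inj_ext\<close>)

definition Cl :: "nat => nat" where "Cl A = N.Sep TT (%x. N.incl x A)"
lemma dt_Cl [simp]: "N.dt a ==> N.dt (%e. Cl (a e))" by (rule N.dt1[where F=Cl], unfold Cl_def) simp_all
lemma mem_Cl: "EN x (Cl A) \<longleftrightarrow> EN x TT & N.incl x A" unfolding Cl_def by simp

lemma eqp_TT: "N.eqp TT (j \<kappa>)" unfolding TT_def by (rule eqp_X) simp
lemma Cl_lep: "N.lep (Cl A) (j \<kappa>)"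
proof -
  have "N.sub (Cl A) TT" unfolding N.sub_def mem_Cl by blast
  then show ?thesis using N.lep_trans[OF N.sub_lep N.eqp_lep[OF eqp_TT]] by blast
qed

text \<open>A neighbourhood of \<open>X (j i)\<close> contains the images of all sequences that
  agree with the i-th one up to some n; \<open>agreeing_coordinate\<close> finds such a sequence
  with index in \<open>a\<close>.\<close>

lemma closure_coordinate:
  assumes a: "eqp a om" "sub a \<kappa>" and s: "s ~= emp" and q: "q : G" "!!i. i <: a ==> app q i = s"
    and i: "i <: \<kappa>" and r0: "r0 : G" "sub s (app r0 i)"
  shows "N.incl (X (j i)) (N.Rep (j a) X)"
  unfolding N.incl_def
proof (intro conjI X_real allI impI)
  fix u v assume uv: "N.real u & N.real v & N.rless u (X (j i)) & N.rless (X (j i)) v"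
  have im: "i <: \<mu>" using subD[OF \<kappa>(3) i] .
  obtain n' where n': "EN n' N.om" "ALL g. N.Func g N.om N.two --> (ALL k. EN k n' --> N.app g k = N.app (cN (j i)) k) -->
      N.rless u (ct g) & N.rless (ct g) v" using ct(4) cN_Func uv unfolding X_def by blast
  obtain n where n: "n <: om" "n' = j n" using n'(1) unfolding j_om[symmetric] EN_j by blast
  obtain r k where r: "r : G" "k <: a" "ALL m. m <: n --> (EX b. pr m b <: app r i & pr m b <: app r k)"
    using agreeing_coordinate[OF a(1) sub_trans[OF a(2) \<kappa>(3)] s q im r0 n(1)] by blast
  have km: "k <: \<mu>" using subD[OF \<kappa>(3) subD[OF a(2) r(2)]] .
  have "N.app (cN (j k)) m' = N.app (cN (j i)) m'" if m': "EN m' n'" for m'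
  proof -
    obtain m where m: "m <: n" "m' = j m" using m' unfolding n EN_j by blast
    then obtain b where "pr m b <: app r i" "pr m b <: app r k" using r(3) by blast
    then show ?thesis using cN_val[OF r(1) im] cN_val[OF r(1) km] m(2) by simp
  qed
  then have "N.rless u (X (j k)) & N.rless (X (j k)) v" using n'(2) cN_Func unfolding X_def by blast
  moreover have "EN (X (j k)) (N.Rep (j a) X)" using r(2) by (intro N.RepI) simp_all
  ultimately show "EX y. EN y (N.Rep (j a) X) & N.rless u y & N.rless y v" by blast
qed

text \<open>An injection of \<kappa> \<times> \<omega>_1 into \<kappa> provides \<kappa> disjoint
  blocks of \<omega>_1 indices. Supports are countable, so by genericity every block contains an
  index at which a condition of \<open>G\<close> has the value \<open>s\<close>, and the real with
  this index lies in the closure.\<close>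

lemma closure_card:
  assumes a: "eqp a om" "sub a \<kappa>" and s: "s <: Fn" "s ~= emp" and q: "q : G" "!!i. i <: a ==> app q i = s"
  shows "N.eqp (Cl (N.Rep (j a) X)) (j \<kappa>)"
proof (rule N.lep_antisym[OF Cl_lep])
  let ?A = "N.Rep (j a) X"
  define Z where "Z = N.Sep (j \<kappa>) (%i. N.incl (X i) ?A)"
  have Z: "EN z Z \<longleftrightarrow> EN z (j \<kappa>) & N.incl (X z) ?A" for z unfolding Z_def by simp
  have ok: "Ord \<kappa>" by (rule Card_Ord[OF \<kappa>(1)])
  have ik: "Inf \<kappa>" unfolding Inf_def using \<kappa> Ord_sub[OF Ord_om ok] by blast
  have "sub w1 \<kappa>" unfolding w1_def by (rule csuc_le[OF \<kappa>(1,2)])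
  then have "lep (prd \<kappa> w1) \<kappa>" using prd_lep[OF ik lep_refl sub_lep] by blast
  then obtain f where f: "Func f (prd \<kappa> w1) \<kappa>" "ALL x y. x <: prd \<kappa> w1 --> y <: prd \<kappa> w1 --> app f x = app f y --> x = y"
    unfolding lep_def by blast
  \<comment> \<open>\<open>F\<close> recovers the number of the block from an index. As every block
    is hit, \<open>F\<close> maps \<open>Z\<close> onto all of \<kappa>.\<close>
  define F where "F z = N.fs (N.the1 (%y. EN y (j (prd \<kappa> w1)) & N.app (j f) y = z))" for z
  have dF: "N.dF F" unfolding F_def by simp
  have Ff: "F (j (app f (pr \<xi> \<alpha>))) = j \<xi>" if x: "\<xi> <: \<kappa>" "\<alpha> <: w1" for \<xi> \<alpha>
  proof -
    have x': "pr \<xi> \<alpha> <: prd \<kappa> w1" using x by simp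
    have "N.the1 (%y. EN y (j (prd \<kappa> w1)) & N.app (j f) y = j (app f (pr \<xi> \<alpha>))) = j (pr \<xi> \<alpha>)"
    proof (rule N.the1_eq)
      show "EN (j (pr \<xi> \<alpha>)) (j (prd \<kappa> w1)) & N.app (j f) (j (pr \<xi> \<alpha>)) = j (app f (pr \<xi> \<alpha>))"
        using x' j_app[OF f(1) x'] by simp
      fix y assume y: "EN y (j (prd \<kappa> w1)) & N.app (j f) y = j (app f (pr \<xi> \<alpha>))"
      then obtain v where v: "v <: prd \<kappa> w1" "y = j v" unfolding EN_j by blast
      then have "app f v = app f (pr \<xi> \<alpha>)" using y j_app[OF f(1) v(1)] by simp
      then show "y = j (pr \<xi> \<alpha>)" using f(2) v x' by blast
    qed
    then show ?thesis unfolding F_def by (simp add: j_pr)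
  qed
  have "N.lep (j \<kappa>) Z"
  proof (rule N.surj_lep[OF dF])
    fix y assume "EN y (j \<kappa>)"
    then obtain \<xi> where x: "\<xi> <: \<kappa>" "y = j \<xi>" unfolding EN_j by blast
    have fk: "app f (pr \<xi> \<alpha>) <: \<kappa>" "app f (pr \<xi> \<alpha>) <: \<mu>" if "\<alpha> <: w1" for \<alpha>
      using Func_app[OF f(1), of "pr \<xi> \<alpha>"] x(1) that subD[OF \<kappa>(3)] by auto
    have "EX r:G. EX \<alpha>. \<alpha> <: w1 & app r (app f (pr \<xi> \<alpha>)) = s"
    proof (rule G_generic)
      fix p assume p: "p <: P"
      have "EX \<alpha>. \<alpha> <: w1 & ~ app f (pr \<xi> \<alpha>) <: supp p"
      proof (rule ccontr)
        assume n: "~ ?thesis"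
        have "lep w1 (supp p)"
        proof (rule lepI[of "%\<alpha>. app f (pr \<xi> \<alpha>)"])
          show "inj_on (%\<alpha>. app f (pr \<xi> \<alpha>)) (ext w1)" unfolding inj_ext
          proof (intro allI impI)
            fix \<alpha> \<beta> assume "\<alpha> <: w1" "\<beta> <: w1" "app f (pr \<xi> \<alpha>) = app f (pr \<xi> \<beta>)"
            then have "pr \<xi> \<alpha> = pr \<xi> \<beta>" using f(2) x(1) pr_mem_prd by blast
            then show "\<alpha> = \<beta>" by simp
          qed
        qed (use n in auto)
        then show False using lep_trans[OF _ supp_ctb[OF p]] w1_props(5) by blast
      qed
      then obtain \<alpha> where al: "\<alpha> <: w1" "app p (app f (pr \<xi> \<alpha>)) = emp" using fk(2) by auto
      then obtain r where "le r p" "app r (app f (pr \<xi> \<alpha>)) = s" using ext_cond[OF p fk(2)[OF al(1)] s(1)] by (auto simp: sub_def)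
      then show "EX q. le q p & (EX \<alpha>. \<alpha> <: w1 & app q (app f (pr \<xi> \<alpha>)) = s)" using al(1) by blast
    qed simp
    then obtain r \<alpha> where r: "r : G" "\<alpha> <: w1" "app r (app f (pr \<xi> \<alpha>)) = s" by blast
    have "N.incl (X (j (app f (pr \<xi> \<alpha>)))) ?A"
      by (rule closure_coordinate[OF a s(2) q fk(1)[OF r(2)] r(1)]) (simp_all add: r(3))
    then have "EN (j (app f (pr \<xi> \<alpha>))) Z" unfolding Z using fk(1)[OF r(2)] by simp
    then show "EX z. EN z Z & F z = y" using Ff[OF x(1) r(2)] x(2) by blast
  qed
  moreover have "N.lep Z (Cl ?A)"
  proof (rule N.lepI[of X])
    show "inj_on X (N.ext Z)" unfolding N.inj_ext Z using X_inj by blast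
    show "EN (X z) (Cl ?A)" if "EN z Z" for z
      unfolding mem_Cl using that N.RepI[of X z "j \<kappa>"] unfolding Z TT_def by simp
  qed simp
  ultimately show "N.lep (j \<kappa>) (Cl ?A)" using N.lep_trans by blast
qed

definition BB :: nat where "BB = Sep (Uni (Rep \<kappa> Pw)) (%a. eqp a om)"
lemma mem_BB: "a <: BB \<longleftrightarrow> eqp a om & (EX \<beta>. \<beta> <: \<kappa> & sub a \<beta>)"
  unfolding BB_def using mem_UniRep[of Pw a \<kappa>] by auto
lemma BB_sub: assumes "a <: BB" shows "sub a \<kappa>"
proof -
  obtain \<beta> where "\<beta> <: \<kappa>" "sub a \<beta>" using assms mem_BB by blast
  then show ?thesis using Ord_trans[OF Card_Ord[OF \<kappa>(1)]] unfolding sub_def by blast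
qed

definition FF :: nat where "FF = N.Sep (N.Rep (j BB) (%a. N.Rep a X)) (%A. N.eqp (Cl A) (j \<kappa>))"
lemma mem_FF: "EN A FF \<longleftrightarrow> (EX a. a <: BB & A = N.Rep (j a) X) & N.eqp (Cl A) (j \<kappa>)"
  unfolding FF_def by (simp add: EN_j) blast

lemma FF_dense: assumes "N.sub Y (j \<kappa>)" "~ N.lep Y N.om"
  shows "EX a. a <: BB & N.sub (j a) Y & EN (N.Rep (j a) X) FF"
proof -
  obtain a s q where "eqp a om & (EX \<beta>. \<beta> <: \<kappa> & sub a \<beta>) & s <: Fn & s ~= emp & q : G & (ALL i. i <: a --> app q i = s & EN (j i) Y)"
    using uncountable_traced[OF \<kappa> assms] by (elim exE) (rule that)
  then have a: "eqp a om" "EX \<beta>. \<beta> <: \<kappa> & sub a \<beta>" "s <: Fn" "s ~= emp" "q : G" "ALL i. i <: a --> app q i = s & EN (j i) Y" by blast+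
  have b: "a <: BB" using a mem_BB by blast
  have "N.eqp (Cl (N.Rep (j a) X)) (j \<kappa>)"
    by (rule closure_card[OF a(1) BB_sub[OF b] a(3,4,5)]) (use a(6) in blast)
  then have "EN (N.Rep (j a) X) FF" unfolding mem_FF using b by blast
  moreover have "N.sub (j a) Y" unfolding N.sub_def EN_j using a(6) by blast
  ultimately show ?thesis using b by blast
qed

lemma FF_T: assumes "EN A FF" shows "N.sub A TT" "N.eqp A N.om"
proof -
  obtain a where a: "a <: BB" "A = N.Rep (j a) X" using assms mem_FF by blast
  have s: "N.sub (j a) (j \<kappa>)" unfolding j_sub by (rule BB_sub[OF a(1)])
  show "N.sub A TT" unfolding a TT_def using N.subD[OF s] by (auto simp: N.sub_def)
  have "N.eqp (j a) N.om" using a(1) mem_BB j_eqp[of a om] unfolding j_om by blast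
  then show "N.eqp A N.om" unfolding a using N.eqp_trans[OF eqp_X[OF s]] by blast
qed

lemma Card_j\<kappa>: "N.Card (j \<kappa>)" using Card_j Card_Ord \<kappa>(1) by blast

lemma not_ctb_j\<kappa>: "~ N.lep (j \<kappa>) N.om"
  using N.not_lep_less[OF Card_j\<kappa>, of N.om] \<kappa>(2) unfolding j_om[symmetric] by simp

text \<open>The upper bound counts bounded subsets of \<kappa>. For the lower bound, one point
  outside a fixed \<open>a\<close> can be added in \<kappa> ways, and the closure only
  grows.\<close>

lemma FF_card: "N.eqp FF (j \<kappa>)"
proof (rule N.lep_antisym)
  have ok: "Ord \<kappa>" by (rule Card_Ord[OF \<kappa>(1)])
  have "N.sub FF (N.Rep (j BB) (%a. N.Rep a X))" by (auto simp: N.sub_def FF_def)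
  then have 1: "N.lep FF (j BB)" using N.lep_trans[OF N.sub_lep N.Rep_lep] by simp
  have "sub BB (Uni (Rep \<kappa> Pw))" by (auto simp: sub_def BB_def)
  then have "lep BB \<kappa>" using lep_trans[OF sub_lep bounded_subsets_lep[OF gch \<kappa>(1,2)]] by blast
  then show "N.lep FF (j \<kappa>)" using 1 N.lep_trans j_lep by blast
  obtain a where a: "a <: BB" "EN (N.Rep (j a) X) FF" using FF_dense[OF N.sub_refl not_ctb_j\<kappa>] by blast
  have ao: "eqp a om" using a mem_BB by blast
  let ?B = "%i. N.Rep (N.cup (j a) (N.sg i)) X"
  have X': "EN (X i) (N.Rep b X) \<longleftrightarrow> EN i b" if "EN i (j \<kappa>)" "N.sub b (j \<kappa>)" for i b
    using X_inj[OF that(1)] N.subD[OF that(2)] by auto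
  have as: "N.sub (j a) (j \<kappa>)" unfolding j_sub by (rule BB_sub[OF a(1)])
  have "N.lep (j (diff \<kappa> a)) FF"
  proof (rule N.lepI[of ?B])
    have d: "EN i (j (diff \<kappa> a)) ==> EN i (j \<kappa>) & ~ EN i (j a)" for i unfolding EN_j by auto
    have bs: "N.sub (N.cup (j a) (N.sg i)) (j \<kappa>)" if "EN i (j \<kappa>)" for i using that N.subD[OF as] by (auto simp: N.sub_def)
    show "inj_on ?B (N.ext (j (diff \<kappa> a)))" unfolding N.inj_ext
    proof (intro allI impI)
      fix x y assume x: "EN x (j (diff \<kappa> a))" and y: "EN y (j (diff \<kappa> a))" and eq: "?B x = ?B y"
      have "EN (X x) (?B x)" using X'[OF _ bs, of x x] d[OF x] by simp
      then have "EN x (N.cup (j a) (N.sg y))" unfolding eq using X'[OF _ bs, of x y] d[OF x] d[OF y] by simp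
      then show "x = y" using d[OF x] by simp
    qed
    fix x assume x: "EN x (j (diff \<kappa> a))"
    then obtain i where i: "i <: \<kappa>" "~ i <: a" "x = j i" unfolding EN_j by auto
    let ?a = "cup a (sg i)"
    have ja: "N.cup (j a) (N.sg x) = j ?a" unfolding i by (rule N.set_ext) (auto simp: EN_j)
    have "?a <: BB"
    proof -
      have "eqp ?a om"
      proof (rule lep_antisym)
        show "lep ?a om" by (rule cup_lep[OF Inf_om eqp_lep[OF ao]]) (simp add: Fin_ctb)
        have "lep om a" using eqp_lep[OF eqp_sym[OF ao]] .
        then show "lep om ?a" using lep_trans[OF _ sub_lep] by (auto simp: sub_def)
      qed
      moreover obtain \<beta> where b: "\<beta> <: \<kappa>" "sub a \<beta>" using a(1) mem_BB by blast
      have "cup \<beta> (suc i) <: \<kappa>" using cup_Ord[OF Ord_mem[OF ok b(1)] Ord_suc[OF Ord_mem[OF ok i(1)]]] b(1) suc_Card[OF \<kappa>(1,2) i(1)] by auto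
      moreover have "sub ?a (cup \<beta> (suc i))" using subD[OF b(2)] by (auto simp: sub_def)
      ultimately show ?thesis unfolding mem_BB by blast
    qed
    moreover have "N.eqp (Cl (N.Rep (j ?a) X)) (j \<kappa>)"
    proof (rule N.lep_antisym[OF Cl_lep])
      have ss: "N.sub (N.Rep (j a) X) (N.Rep (j ?a) X)" unfolding ja[symmetric] by (auto simp: N.sub_def)
      have "N.sub (Cl (N.Rep (j a) X)) (Cl (N.Rep (j ?a) X))"
        unfolding N.sub_def mem_Cl N.incl_def using N.subD[OF ss] by blast
      moreover have "N.eqp (Cl (N.Rep (j a) X)) (j \<kappa>)" using a(2) mem_FF by blast
      ultimately show "N.lep (j \<kappa>) (Cl (N.Rep (j ?a) X))" using N.lep_trans[OF N.eqp_lep[OF N.eqp_sym] N.sub_lep] by blast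
    qed
    ultimately show "EN (?B x) FF" unfolding ja mem_FF by blast
  qed simp
  then show "N.lep (j \<kappa>) FF" using N.lep_trans j_lep[OF diff_lep[OF \<kappa>(1,2) eqp_lep[OF ao]]] by blast
qed

lemma Phi_j: assumes "k < n" "env k = j \<kappa>" shows "sat EN env (Phi k n)"
proof -
  have "EX A. EN A FF & N.sub A Z" if Z: "N.sub Z TT" "N.eqp Z N.w1" for Z
  proof -
    \<comment> \<open>The given set of reals is pulled back to the uncountable set of its indices,
      to which \<open>FF_dense\<close> applies.\<close>
    define Y where "Y = N.Sep (j \<kappa>) (%i. EN (X i) Z)"
    have Y: "EN i Y \<longleftrightarrow> EN i (j \<kappa>) & EN (X i) Z" for i unfolding Y_def by simp
    have "N.lep Z Y"
    proof (rule N.surj_lep[of X])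
      fix y assume y: "EN y Z"
      then have "EN y TT" using N.subD[OF Z(1)] by blast
      then obtain i where "i <: \<kappa>" "y = X (j i)" unfolding mem_TT by blast
      then show "EX x. EN x Y & X x = y" unfolding Y using y by (intro exI[of _ "j i"]) simp
    qed simp
    then have "~ N.lep Y N.om" using N.w1_props(5) N.lep_trans N.eqp_lep[OF N.eqp_sym[OF Z(2)]] by blast
    moreover have "N.sub Y (j \<kappa>)" unfolding N.sub_def Y by blast
    ultimately obtain a where a: "N.sub (j a) Y" "EN (N.Rep (j a) X) FF" using FF_dense by blast
    have "N.sub (N.Rep (j a) X) Z" using N.subD[OF a(1)] unfolding Y by (auto simp: N.sub_def)
    then show ?thesis using a(2) by blast
  qed
  moreover have "EX C. (ALL x. EN x C \<longleftrightarrow> N.incl x A & EN x TT) & N.eqp C (j \<kappa>)" if "EN A FF" for A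
    using that mem_FF mem_Cl by (intro exI[of _ "Cl A"]) blast
  moreover have "ALL x. EN x TT --> N.real x" unfolding mem_TT using X_real by blast
  ultimately have "EX T F. (ALL x. EN x T --> N.real x) & N.eqp T (j \<kappa>) & N.eqp F (j \<kappa>) &
    (ALL A. EN A F --> N.sub A T & N.eqp A N.om) &
    (ALL A. EN A F --> (EX C. (ALL x. EN x C \<longleftrightarrow> N.incl x A & EN x T) & N.eqp C (j \<kappa>))) &
    (ALL Z. N.sub Z T & N.eqp Z N.w1 --> (EX A. EN A F & N.sub A Z))"
    using eqp_TT FF_card FF_T by - (rule exI[of _ TT], rule exI[of _ FF], blast)
  then show ?thesis using assms Card_j\<kappa> N.w1_props(1) unfolding Phi_def by simp
qed

end

lemma Phi_holds: assumes "n = 0" shows "sat EN env (Phi_up_to_continuum n)"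
proof -
  obtain ct where ct: "N.dF ct" "ALL f. N.Func f N.om N.two --> N.real (ct f)"
      "ALL f g. N.Func f N.om N.two --> N.Func g N.om N.two --> ct f = ct g --> f = g"
      "ALL f u v. N.Func f N.om N.two --> N.real u --> N.real v --> N.rless u (ct f) --> N.rless (ct f) v -->
        (EX n. EN n N.om & (ALL g. N.Func g N.om N.two --> (ALL k. EN k n --> N.app g k = N.app f k) --> N.rless u (ct g) & N.rless (ct g) v))"
    using N.cantor_scheme by (elim exE conjE) (rule that)
  have "sat EN (env(0 := k)) (Phi 0 (Suc 0))" if k: "N.Card k" "N.sub N.w1 k" "N.Card c" "N.eqp (N.funsp N.om N.two) c" "N.sub k c" for k c
  proof -
    \<comment> \<open>The continuum of the extension is known, so a cardinal up to it comes from a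
      ground-model ordinal, which by \<open>Card_j\<close> is a cardinal there.\<close>
    have "c = j \<mu>" using N.Card_eqI[OF k(3) Card_j\<mu> N.eqp_trans[OF N.eqp_sym[OF k(4)] continuum]] .
    then have "EN k (j \<mu>) | k = j \<mu>"
      using k(5) N.Ord_sub[OF N.Card_Ord[OF k(1)] N.Card_Ord[OF k(3)]] by blast
    then obtain \<kappa> where \<kappa>: "k = j \<kappa>" "\<kappa> <: \<mu> | \<kappa> = \<mu>" unfolding EN_j by blast
    have om: "Ord \<mu>" using InfD[OF Inf_\<mu>] by blast
    have ok: "Ord \<kappa>" using \<kappa>(2) Ord_mem[OF om] om by blast
    have "Card \<kappa>" using k(1) Card_j[OF ok] unfolding \<kappa> by blast
    moreover have "EN N.om k" using N.subD[OF k(2) N.w1_props(3)] .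
    then have "om <: \<kappa>" unfolding \<kappa> j_om[symmetric] by simp
    moreover have "sub \<kappa> \<mu>" using \<kappa>(2) Ord_sub[OF ok om] by blast
    ultimately show ?thesis using ct \<kappa>(1) by (intro Phi_j[of \<kappa> ct]) simp_all
  qed
  then show ?thesis unfolding Phi_up_to_continuum_def assms by auto
qed

end

section \<open>Reduction to countable models\<close>

context zfc
begin

lemma starI:
  assumes gch: "sat E ((!) []) (fm0 GCH)" and reg: "sat E ((!) [\<mu>]) (fm1 is_uncountable_regular)"
    and pow: "sat E ((!) [\<mu>, P, l, e]) (fm4 is_star_power_Fn)"
  shows "star E \<mu> P l e"
proof -
  have r: "Inf \<mu>" "ALL c. c <: \<mu> --> ~ (EX f. cofm f c \<mu>)" "om <: \<mu>" using reg by (simp_all add: fm1_def)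
  have "EX Q r u. (ALL p. p <: Q \<longleftrightarrow> Fin p & (EX d. sub d om & Func p d two)) &
      (ALL z. z <: r \<longleftrightarrow> (EX p q. p <: Q & q <: Q & sub q p & z = pr p q)) & u = emp &
      (ALL p. p <: P \<longleftrightarrow> Func p \<mu> Q & (EX s. (ALL i. i <: s \<longleftrightarrow> i <: \<mu> & (EX a. pr i a <: p & a ~= u)) & lep s om)) &
      (ALL z. z <: l \<longleftrightarrow> (EX p q. p <: P & q <: P & z = pr p q &
            (ALL i. i <: \<mu> --> (EX a b. pr i a <: p & pr i b <: q & pr a b <: r)) &
            (EX s. Fin s & (ALL i. i <: s \<longleftrightarrow> i <: \<mu> &
                  (EX a b. pr i a <: p & pr i b <: q & (pr a b <: r & a ~= b) & pr b u <: r & b ~= u))))) &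
      e <: P & (ALL i. i <: \<mu> --> pr i u <: e)"
    using pow by (simp add: fm4_def is_star_power_Fn_def is_Fn_omega_2_def is_star_power_def is_supp_def strictly_below_def)
  then obtain Q r u where Q: "ALL p. p <: Q \<longleftrightarrow> Fin p & (EX d. sub d om & Func p d two)"
    and rr: "ALL z. z <: r \<longleftrightarrow> (EX p q. p <: Q & q <: Q & sub q p & z = pr p q)" and u: "u = emp"
    and P: "ALL p. p <: P \<longleftrightarrow> Func p \<mu> Q & (EX s. (ALL i. i <: s \<longleftrightarrow> i <: \<mu> & (EX a. pr i a <: p & a ~= u)) & lep s om)"
    and l: "ALL z. z <: l \<longleftrightarrow> (EX p q. p <: P & q <: P & z = pr p q &
            (ALL i. i <: \<mu> --> (EX a b. pr i a <: p & pr i b <: q & pr a b <: r)) &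
            (EX s. Fin s & (ALL i. i <: s \<longleftrightarrow> i <: \<mu> &
                  (EX a b. pr i a <: p & pr i b <: q & (pr a b <: r & a ~= b) & pr b u <: r & b ~= u))))"
    and e: "e <: P" "ALL i. i <: \<mu> --> pr i u <: e"
    by (elim exE conjE) (rule that)
  have QF: "Q = Fn" by (rule set_ext) (simp add: Q Fn_iff)
  have r_iff: "pr p q <: r \<longleftrightarrow> p <: Fn & q <: Fn & sub q p" for p q
    using rr[rule_format, of "pr p q"] unfolding QF by auto
  have mP: "p <: P \<longleftrightarrow> Func p \<mu> Fn & lep (Sep \<mu> (%i. app p i ~= emp)) om" for p
  proof (cases "Func p \<mu> Fn")
    case True
    have "(EX a. pr i a <: p & a ~= emp) \<longleftrightarrow> i <: \<mu> & app p i ~= emp" for i unfolding Func_pr[OF True] by blast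
    then have "(ALL i. i <: s \<longleftrightarrow> i <: \<mu> & (EX a. pr i a <: p & a ~= u)) \<longleftrightarrow> s = Sep \<mu> (%i. app p i ~= emp)" for s
      unfolding u using set_ext[of s "Sep \<mu> (%i. app p i ~= emp)"] by auto
    then show ?thesis using P[rule_format, of p] unfolding QF by simp
  qed (use P QF in blast)
  \<comment> \<open>For functions the existential quantifiers only evaluate \<open>p\<close> and
    \<open>q\<close> at \<open>i\<close>; once \<open>p\<close> extends \<open>q\<close> everywhere,
    strictness in the poset is mere inequality.\<close>
  have ml: "(ALL i. i <: \<mu> --> (EX a b. pr i a <: p & pr i b <: q & pr a b <: r)) &
            (EX s. Fin s & (ALL i. i <: s \<longleftrightarrow> i <: \<mu> &
                  (EX a b. pr i a <: p & pr i b <: q & (pr a b <: r & a ~= b) & pr b u <: r & b ~= u))) \<longleftrightarrow>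
      (ALL i. i <: \<mu> --> sub (app q i) (app p i)) & Fin (Sep \<mu> (%i. app p i ~= app q i & app q i ~= emp))" (is "?L1 & ?L2 \<longleftrightarrow> ?R1 & ?R2")
    if pq: "p <: P" "q <: P" for p q
  proof -
    have F: "Func p \<mu> Fn" "Func q \<mu> Fn" using pq mP by blast+
    have FF: "app p i <: Fn" "app q i <: Fn" if "i <: \<mu>" for i using Func_app F that by blast+
    have ab: "(EX a b. pr i a <: p & pr i b <: q & R a b) \<longleftrightarrow> R (app p i) (app q i)" if "i <: \<mu>" for i R
      unfolding Func_pr[OF F(1)] Func_pr[OF F(2)] using that by blast
    have "?L1 \<longleftrightarrow> ?R1" using ab[of _ "%a b. pr a b <: r"] FF unfolding r_iff by blast
    moreover have "?L2 \<longleftrightarrow> ?R2" if R: ?R1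
    proof -
      have "(i <: \<mu> & (EX a b. pr i a <: p & pr i b <: q & (pr a b <: r & a ~= b) & pr b u <: r & b ~= u)) \<longleftrightarrow>
        i <: Sep \<mu> (%i. app p i ~= app q i & app q i ~= emp)" for i
      proof (cases "i <: \<mu>")
        case True
        have "sub emp (app q i)" by (simp add: sub_def)
        then show ?thesis using ab[OF True, of "%a b. (pr a b <: r & a ~= b) & pr b u <: r & b ~= u"] FF[OF True] R True
          unfolding r_iff u by simp
      qed simp
      note * = this
      have "(ALL i. i <: s \<longleftrightarrow> i <: \<mu> & (EX a b. pr i a <: p & pr i b <: q & (pr a b <: r & a ~= b) & pr b u <: r & b ~= u)) \<longleftrightarrow>
        s = Sep \<mu> (%i. app p i ~= app q i & app q i ~= emp)" for s
        unfolding * using set_ext[of s "Sep \<mu> (%i. app p i ~= app q i & app q i ~= emp)"] by blast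
      then show ?thesis by (simp only:) blast
    qed
    ultimately show ?thesis by blast
  qed
  show ?thesis
  proof unfold_locales
    show "Inf k ==> lep (Pw k) (csuc k)" for k using sat_GCH gch unfolding fm0_def by blast
    show "om <: \<mu>" using r by blast
    show "ctbbd \<mu>" using regular_ctbbd r by blast
    show "p <: P \<longleftrightarrow> Func p \<mu> Fn & lep (Sep \<mu> (%i. app p i ~= emp)) om" for p by (rule mP)
    show "z <: l \<longleftrightarrow> (EX p q. z = pr p q & p <: P & q <: P & (ALL i. i <: \<mu> --> sub (app q i) (app p i)) &
       Fin (Sep \<mu> (%i. app p i ~= app q i & app q i ~= emp)))" for z
      unfolding l[rule_format, of z]
    proof (intro iff_exI)
      fix p q
      show "(p <: P & q <: P & z = pr p q &
            (ALL i. i <: \<mu> --> (EX a b. pr i a <: p & pr i b <: q & pr a b <: r)) &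
            (EX s. Fin s & (ALL i. i <: s \<longleftrightarrow> i <: \<mu> &
                  (EX a b. pr i a <: p & pr i b <: q & (pr a b <: r & a ~= b) & pr b u <: r & b ~= u)))) \<longleftrightarrow>
        (z = pr p q & p <: P & q <: P & (ALL i. i <: \<mu> --> sub (app q i) (app p i)) &
          Fin (Sep \<mu> (%i. app p i ~= app q i & app q i ~= emp)))"
        by (cases "p <: P & q <: P") (use ml[of p q] in \<open>simp only: simp_thms, blast\<close>)+
    qed
    show "e <: P" by (rule e(1))
    have "Func e \<mu> Fn" using e(1) mP by blast
    note F = Func_pr[OF this]
    show "app e i = emp" if "i <: \<mu>" for i using e(2)[rule_format, OF that] unfolding F u by simp
  qed
qed

lemma infinite_UNIV: "infinite (UNIV :: 'v set)"
proof -
  have "(suc ^^ m) emp = (suc ^^ n) emp ==> m = n" for m n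
  proof (induction m arbitrary: n)
    case 0 then show ?case by (cases n) auto
  next
    case (Suc m) then show ?case by (cases n) auto
  qed
  then have "inj (%n. (suc ^^ n) emp)" by (rule injI)
  then have "infinite (range (%n. (suc ^^ n) emp))" by (rule range_inj_infinite)
  then show ?thesis by (rule infinite_super[OF subset_UNIV])
qed

end

text \<open>A condition that does not force \<phi> has, by \<open>forces_dense\<close>, an extension
  below which nothing forces \<phi>; a generic filter through it contains no condition forcing
  \<phi>. So statements are forced as soon as they hold in all generic extensions.\<close>

lemma not_forced:
  fixes E :: "nat => nat => bool"
  assumes "forcing E P l e" "E p P" "!!i. forcing.Name E P (env i)" "~ forces E P l p env \<phi>"
  shows "EX G. gext E P l e G & p : G & ~ (EX r:G. forces E P l r env \<phi>)"
proof -
  interpret forcing E P l e by fact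
  obtain q where q: "le q p" "ALL r. le r q --> ~ forces E P l r env \<phi>"
    using forces_dense[OF assms(2), of env \<phi>] assms(3,4) by blast
  have "E q P" using q(1) le_P by blast
  then obtain G where G: "gext E P l e G" "q : G" using generic_exists[OF assms(1)] by blast
  interpret gext E P l e G by fact
  have "~ forces E P l r env \<phi>" if r: "r : G" for r
  proof
    assume f: "forces E P l r env \<phi>"
    obtain s where s: "le s r" "le s q" using G_dir r G(2) by blast
    then show False using forces_mono[OF f assms(3) s(1)] q(2) by blast
  qed
  then show ?thesis using G G_up[OF G(2) q(1)] by blast
qed

lemma theorem3_nat:
  fixes E :: "nat => nat => bool"
  assumes "star E \<mu> P l e"
  shows "preserves_cardinals E P l e & preserves_cofinalities E P l e &
    forces E P l e ((!) [check E e \<mu>]) (fm1 is_continuum) & forces E P l e ((!) []) (fm0 Phi_up_to_continuum)"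
proof -
  interpret star E \<mu> P l e by fact
  note f = forcing
  have N: "!!i. Name (if i = (0::nat) then chk a else chk b)" for a b by simp
  \<comment> \<open>The truth lemma wants a name at every variable, whereas a list leaves the later
    ones unspecified; this environment agrees with the lists at the variables that are read.\<close>
  let ?e = "%a b i. if i = (0::nat) then chk a else chk b"
  have cong: "forces E P l p e1 \<phi> \<longleftrightarrow> forces E P l p (?e a b) \<phi>" if "bd k \<phi>" "!!i. i < k ==> e1 i = ?e a b i" for k e1 a b \<phi> p
    by (rule forces_cong) (use that in \<open>auto simp: bd_def\<close>)
  have forcedI: "forces E P l p (?e a b) \<phi>"
    if p: "E p P" and G: "!!G. gext E P l e G ==> EX r:G. forces E P l r (?e a b) \<phi>" for p a b \<phi>
    using not_forced[OF f p, of "?e a b" \<phi>] G N by blast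
  have card: "forces E P l p (?e \<beta> \<beta>) (is_Card 0 1) \<longleftrightarrow> Card \<beta>" if p: "E p P" and b: "Ord \<beta>" for p \<beta>
  proof -
    have *: "(EX r:G. forces E P l r (?e \<beta> \<beta>) (is_Card 0 1)) \<longleftrightarrow> Card \<beta>" if G: "gext E P l e G" for G
    proof -
      interpret gext E P l e G by fact
      interpret gstar E \<mu> P l e G ..
      show ?thesis using truth[of "?e \<beta> \<beta>" "is_Card 0 1"] Card_j[OF b] by (simp add: j_def)
    qed
    obtain G where "gext E P l e G" "p : G" using generic_exists[OF f p] by blast
    then show ?thesis using * forcedI[OF p] by blast
  qed
  have "preserves_cardinals E P l e"
    unfolding preserves_cardinals_def check_chk
  proof (intro allI impI)
    fix \<beta> p assume b: "sat E ((!) [\<beta>]) (fm1 is_Ord)" and p: "E p P"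
    have "forces E P l p ((!) [chk \<beta>]) (fm1 is_Card) \<longleftrightarrow> forces E P l p (?e \<beta> \<beta>) (is_Card 0 1)"
      unfolding fm1_def by (rule cong[of 1]) simp_all
    then show "forces E P l p ((!) [chk \<beta>]) (fm1 is_Card) \<longleftrightarrow> sat E ((!) [\<beta>]) (fm1 is_Card)"
      using card[OF p, of \<beta>] b by (simp add: fm1_def)
  qed
  moreover have "preserves_cofinalities E P l e"
    unfolding preserves_cofinalities_def check_chk
  proof (intro allI impI)
    fix \<gamma> \<delta> assume g: "sat E ((!) [\<gamma>]) (fm1 is_Limit) & sat E ((!) [\<gamma>, \<delta>]) (fm2 is_cf)"
    then have "Lim \<gamma>" "Ord \<delta>" "EX f. cofm f \<delta> \<gamma>" "ALL c. E c \<delta> --> ~ (EX f. cofm f c \<gamma>)" by (simp_all add: fm1_def fm2_def)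
    note g' = this
    have "forces E P l e (?e \<gamma> \<delta>) (is_cf 0 1 2)"
    proof (rule forcedI[OF e_P])
      fix G assume G: "gext E P l e G"
      interpret gext E P l e G by fact
      interpret gstar E \<mu> P l e G ..
      show "EX r:G. forces E P l r (?e \<gamma> \<delta>) (is_cf 0 1 2)"
        using truth[of "?e \<gamma> \<delta>" "is_cf 0 1 2"] cf_j[OF g'] by (simp add: j_def)
    qed
    moreover have "forces E P l e ((!) [chk \<gamma>, chk \<delta>]) (fm2 is_cf) \<longleftrightarrow> forces E P l e (?e \<gamma> \<delta>) (is_cf 0 1 2)"
      unfolding fm2_def by (rule cong[of 2]) (auto simp: less_Suc_eq numeral_2_eq_2)
    ultimately show "forces E P l e ((!) [chk \<gamma>, chk \<delta>]) (fm2 is_cf)" by blast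
  qed
  moreover have "forces E P l e ((!) [check E e \<mu>]) (fm1 is_continuum)"
  proof -
    have "forces E P l e (?e \<mu> \<mu>) (is_continuum 0 1)"
    proof (rule forcedI[OF e_P])
      fix G assume G: "gext E P l e G"
      interpret gext E P l e G by fact
      interpret gstar E \<mu> P l e G ..
      show "EX r:G. forces E P l r (?e \<mu> \<mu>) (is_continuum 0 1)"
        using truth[of "?e \<mu> \<mu>" "is_continuum 0 1"] continuum Card_j\<mu> by (simp add: j_def)
    qed
    moreover have "forces E P l e ((!) [check E e \<mu>]) (fm1 is_continuum) \<longleftrightarrow> forces E P l e (?e \<mu> \<mu>) (is_continuum 0 1)"
      unfolding fm1_def check_chk by (rule cong[of 1]) simp_all
    ultimately show ?thesis by blast
  qed
  moreover have "forces E P l e ((!) []) (fm0 Phi_up_to_continuum)"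
  proof -
    have "forces E P l e (?e \<mu> \<mu>) (Phi_up_to_continuum 0)"
    proof (rule forcedI[OF e_P])
      fix G assume G: "gext E P l e G"
      interpret gext E P l e G by fact
      interpret gstar E \<mu> P l e G ..
      show "EX r:G. forces E P l r (?e \<mu> \<mu>) (Phi_up_to_continuum 0)"
        using truth[of "?e \<mu> \<mu>" "Phi_up_to_continuum 0"] Phi_holds[OF refl] by simp
    qed
    moreover have "forces E P l e ((!) []) (fm0 Phi_up_to_continuum) \<longleftrightarrow> forces E P l e (?e \<mu> \<mu>) (Phi_up_to_continuum 0)"
      unfolding fm0_def by (rule cong[of 0]) (simp_all add: bd_Phi_up_to_continuum)
    ultimately show ?thesis by blast
  qed
  ultimately show ?thesis by blast
qed

text \<open>The single axioms are sentences and transfer directly. An instance of a schema is first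
  written as one formula, whose additional set variables are fresh for \<phi>.\<close>

lemma ZFC_model_elementary:
  assumes Z: "ZFC_model E" and el: "!!env \<phi>. sat E' env \<phi> = sat E (%n. h (env n)) \<phi>"
  shows "ZFC_model E'"
proof -
  have tr: "sat E' env \<phi>" if "!!env. sat E env \<phi>" for env \<phi> unfolding el by (rule that)
  note ax = Z[unfolded ZFC_model_def]
  have "sat E' (%_. a) ((\<^bold>\<forall>x. \<^bold>\<forall>y. (\<^bold>\<forall>z. z \<^bold>\<in> x \<^bold>\<longleftrightarrow> z \<^bold>\<in> y) \<^bold>\<longrightarrow> x \<^bold>= y) 0)" for a
    by (rule tr) (use ax in simp)
  then have 1: "ALL x y. (ALL z. E' z x \<longleftrightarrow> E' z y) --> x = y" by simp
  have "sat E' (%_. a) ((\<^bold>\<forall>x. (\<^bold>\<exists>y. y \<^bold>\<in> x) \<^bold>\<longrightarrow> (\<^bold>\<exists>y. y \<^bold>\<in> x \<^bold>\<and> \<^bold>\<not> (\<^bold>\<exists>z. z \<^bold>\<in> x \<^bold>\<and> z \<^bold>\<in> y))) 0)" for a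
    by (rule tr) (use ax in simp)
  then have 2: "ALL x. (EX y. E' y x) --> (EX y. E' y x & ~ (EX z. E' z x & E' z y))" by simp
  have "sat E' (%_. a) ((\<^bold>\<forall>x. \<^bold>\<forall>y. \<^bold>\<exists>z. x \<^bold>\<in> z \<^bold>\<and> y \<^bold>\<in> z) 0)" for a
    by (rule tr) (use ax in simp)
  then have 3: "ALL x y. EX z. E' x z & E' y z" by simp
  have "sat E' (%_. a) ((\<^bold>\<forall>a. \<^bold>\<exists>u. \<^bold>\<forall>y. \<^bold>\<forall>x. x \<^bold>\<in> y \<^bold>\<and> y \<^bold>\<in> a \<^bold>\<longrightarrow> x \<^bold>\<in> u) 0)" for a
    by (rule tr) (use ax in simp)
  then have 4: "ALL a. EX u. ALL y x. E' x y & E' y a --> E' x u" by simp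
  have "sat E' (%_. a) ((\<^bold>\<forall>a. \<^bold>\<exists>b. \<^bold>\<forall>x. (\<^bold>\<forall>z. z \<^bold>\<in> x \<^bold>\<longrightarrow> z \<^bold>\<in> a) \<^bold>\<longrightarrow> x \<^bold>\<in> b) 0)" for a
    by (rule tr) (use ax in simp)
  then have 5: "ALL a. EX b. ALL x. (ALL z. E' z x --> E' z a) --> E' x b" by simp
  have "sat E' (%_. a) ((\<^bold>\<exists>a. (\<^bold>\<exists>e. e \<^bold>\<in> a \<^bold>\<and> (\<^bold>\<forall>z. \<^bold>\<not> z \<^bold>\<in> e)) \<^bold>\<and>
      (\<^bold>\<forall>y. y \<^bold>\<in> a \<^bold>\<longrightarrow> (\<^bold>\<exists>s. s \<^bold>\<in> a \<^bold>\<and> (\<^bold>\<forall>z. z \<^bold>\<in> s \<^bold>\<longleftrightarrow> z \<^bold>\<in> y \<^bold>\<or> z \<^bold>= y)))) 0)" for a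
    by (rule tr) (use ax in simp)
  then have 6: "EX a. (EX e. E' e a & (ALL z. ~ E' z e)) & (ALL y. E' y a --> (EX s. E' s a & (ALL z. E' z s \<longleftrightarrow> E' z y | z = y)))" by simp
  \<comment> \<open>The language lacks unique existence; the equivalence is stated twice because the
    two models live on different types.\<close>
  have ex1: "(EX! z. Q z) \<longleftrightarrow> (EX z. ALL y. Q y \<longleftrightarrow> y = z)" for Q :: "'a => bool" unfolding Ex1_def by (rule iff_exI) auto
  have ex1': "(EX! z. Q z) \<longleftrightarrow> (EX z. ALL y. Q y \<longleftrightarrow> y = z)" for Q :: "'b => bool" unfolding Ex1_def by (rule iff_exI) auto
  have "sat E' (%_. a) ((\<^bold>\<forall>a. (\<^bold>\<forall>x. x \<^bold>\<in> a \<^bold>\<longrightarrow> (\<^bold>\<exists>z. z \<^bold>\<in> x)) \<^bold>\<and>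
      (\<^bold>\<forall>x. \<^bold>\<forall>y. \<^bold>\<forall>z. x \<^bold>\<in> a \<^bold>\<and> y \<^bold>\<in> a \<^bold>\<and> z \<^bold>\<in> x \<^bold>\<and> z \<^bold>\<in> y \<^bold>\<longrightarrow> x \<^bold>= y) \<^bold>\<longrightarrow>
      (\<^bold>\<exists>c. \<^bold>\<forall>x. x \<^bold>\<in> a \<^bold>\<longrightarrow> (\<^bold>\<exists>z. \<^bold>\<forall>y. (y \<^bold>\<in> x \<^bold>\<and> y \<^bold>\<in> c) \<^bold>\<longleftrightarrow> y \<^bold>= z))) 0)" for a
    by (rule tr) (use ax in \<open>simp add: ex1 ex1'\<close>)
  then have 7: "ALL a. (ALL x. E' x a --> (EX z. E' z x)) & (ALL x y z. E' x a & E' y a & E' z x & E' z y --> x = y) -->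
          (EX c. ALL x. E' x a --> (EX! z. E' z x & E' z c))" by (simp add: ex1 ex1')
  have 8: "EX b. ALL x. E' x b \<longleftrightarrow> E' x a & sat E' (env(0 := x)) \<phi>" for \<phi> env a
  proof -
    define m where "m = Suc (fresh (fv \<phi>))"
    have m: "k ~= m" "k ~= Suc m" if "k : fv \<phi>" for k using fresh[OF finite_fv that] by (auto simp: m_def)
    have m0: "m ~= 0" by (simp add: m_def)
    let ?S = "Neg (Forall (Suc m) (Neg (Forall 0 (((0 \<^bold>\<in> Suc m) \<^bold>\<longleftrightarrow> (0 \<^bold>\<in> m) \<^bold>\<and> (%_. \<phi>)) 0))))"
    have c: "sat F (env(Suc m := b, 0 := x)) \<phi> = sat F (env(0 := x)) \<phi>" "sat F (env(m := a, Suc m := b, 0 := x)) \<phi> = sat F (env(0 := x)) \<phi>"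
      for F env a b and x :: 'c by (rule sat_cong, simp add: m)+
    have c': "sat F (env(m := a, 0 := x)) \<phi> = sat F (env(0 := x)) \<phi>" for F env a and x :: 'c by (rule sat_cong) (simp add: m)
    have "sat E' (env(m := a)) ?S" by (rule tr) (use ax m0 in \<open>simp add: c\<close>)
    then show ?thesis using m0 by (simp add: c c')
  qed
  have 9: "EX b. ALL x. E' x a --> (EX y. E' y b & sat E' (env(0 := x, 1 := y)) \<phi>)"
    if u: "ALL x. E' x a --> (EX! y. sat E' (env(0 := x, 1 := y)) \<phi>)" for \<phi> env a
  proof -
    define m where "m = Suc (Suc (fresh (fv \<phi>)))"
    have m: "k ~= m" "k ~= Suc m" "k ~= Suc (Suc m)" if "k : fv \<phi>" for k using fresh[OF finite_fv that] by (auto simp: m_def)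
    have m0: "m ~= 0" "m ~= 1" "m ~= Suc 0" by (simp_all add: m_def)
    let ?S = "((%_. Forall 0 (((0 \<^bold>\<in> m) \<^bold>\<longrightarrow> \<^bold>\<not> (%_. Forall (Suc (Suc m)) (Neg (Forall 1 (((%_. \<phi>) \<^bold>\<longleftrightarrow> (1 \<^bold>= Suc (Suc m))) 0))))) 0)) \<^bold>\<longrightarrow>
      \<^bold>\<not> (%_. Forall (Suc m) (Neg (Forall 0 (((0 \<^bold>\<in> m) \<^bold>\<longrightarrow> \<^bold>\<not> (%_. Forall 1 (Neg (((1 \<^bold>\<in> Suc m) \<^bold>\<and> (%_. \<phi>)) 0)))) 0))))) 0"
    have c: "sat F (e(m := a, 0 := x, Suc (Suc m) := z, 1 := y)) \<phi> = sat F (e(0 := x, 1 := y)) \<phi>"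
      "sat F (e(m := a, Suc m := b, 0 := x, 1 := y)) \<phi> = sat F (e(0 := x, 1 := y)) \<phi>"
      for F e a b x z and y :: 'c by (rule sat_cong, simp add: m)+
    have S: "sat F (e(m := a)) ?S \<longleftrightarrow> ((ALL x. F x a --> (EX z. ALL y. sat F (e(0 := x, 1 := y)) \<phi> \<longleftrightarrow> y = z)) -->
      (EX b. ALL x. F x a --> (EX y. F y b & sat F (e(0 := x, 1 := y)) \<phi>)))" for F e and a :: 'c
      using m0 by (simp add: c[unfolded One_nat_def])
    have "sat E (%n. h ((env(m := a)) n)) ?S"
    proof -
      have eq: "(%n. h ((env(m := a)) n)) = (%n. h (env n))(m := h a)" by auto
      have "ALL \<phi> env a. (ALL x. E x a --> (EX! y. sat E (env(0 := x, 1 := y)) \<phi>)) -->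
          (EX b. ALL x. E x a --> (EX y. E y b & sat E (env(0 := x, 1 := y)) \<phi>))" using ax by (elim conjE)
      then have "(ALL x. E x (h a) --> (EX! y. sat E ((%n. h (env n))(0 := x, 1 := y)) \<phi>)) -->
          (EX b. ALL x. E x (h a) --> (EX y. E y b & sat E ((%n. h (env n))(0 := x, 1 := y)) \<phi>))" by (elim allE)
      then show ?thesis unfolding eq S ex1 ex1' .
    qed
    then have "sat E' (env(m := a)) ?S" unfolding el .
    from this[unfolded S] show ?thesis by (rule mp) (use u in \<open>unfold ex1 ex1'\<close>)
  qed
  show ?thesis unfolding ZFC_model_def
  proof (intro conjI 1 2 3 4 5 6 7)
    show "ALL \<phi> env a. EX b. ALL x. E' x b \<longleftrightarrow> E' x a & sat E' (env(0 := x)) \<phi>" by (intro allI 8)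
    show "ALL \<phi> env a. (ALL x. E' x a --> (EX! y. sat E' (env(0 := x, 1 := y)) \<phi>)) -->
          (EX b. ALL x. E' x a --> (EX y. E' y b & sat E' (env(0 := x, 1 := y)) \<phi>))" by (rule allI, rule allI, rule allI, rule impI, rule 9)
  qed
qed

lemma bd_Finite [simp]: "x < n ==> bd n (is_Finite x n)" by (simp add: is_Finite_def)
lemma bd_Countable [simp]: "x < n ==> bd n (is_Countable x n)" by (simp add: is_Countable_def)
lemma bd_InfCard [simp]: "x < n ==> bd n (is_InfCard x n)" by (simp add: is_InfCard_def)
lemma bd_GCH: "bd n (GCH n)" by (simp add: GCH_def)
lemma bd_uncountable_regular: "x < n ==> bd n (is_uncountable_regular x n)"
  by (simp add: is_uncountable_regular_def is_regular_def)
lemma bd_star_power_Fn: "a < n ==> b < n ==> c < n ==> d < n ==> bd n (is_star_power_Fn a b c d n)"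
  by (simp add: is_star_power_Fn_def is_Fn_omega_2_def is_star_power_def is_supp_def strictly_below_def)
lemma bd_check: "a < n ==> b < n ==> c < n ==> bd n (is_check a b c n)" by (simp add: is_check_def)

text \<open>\<open>xs\<close> lists further objects that the countable submodel is to contain, so
  that each clause of the theorem can be transferred for the particular ordinals and conditions it
  mentions.\<close>

lemma theorem3_aux:
  fixes E :: "'v => 'v => bool" and \<mu> P l e :: 'v and xs :: "'v list"
  assumes Z: "ZFC_model E"
    and gch: "sat E ((!) []) (fm0 GCH)"
    and reg: "sat E ((!) [\<mu>]) (fm1 is_uncountable_regular)"
    and pow: "sat E ((!) [\<mu>, P, l, e]) (fm4 is_star_power_Fn)"
  obtains E' :: "nat => nat => bool" and h \<mu>' P' l' e' ys where "map h ys = xs" "h \<mu>' = \<mu>"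
    "preserves_cardinals E' P' l' e'" "preserves_cofinalities E' P' l' e'"
    "forces E' P' l' e' ((!) [check E' e' \<mu>']) (fm1 is_continuum)" "forces E' P' l' e' ((!) []) (fm0 Phi_up_to_continuum)"
    "h e' = e" "!!x. h (check E' e' x) = check E e (h x)"
    "!!x. E' x P' \<longleftrightarrow> E (h x) P"
    "!!env \<phi>. sat E' env \<phi> = sat E (%n. h (env n)) \<phi>"
    "!!p env \<phi>. forces E' P' l' p env \<phi> = forces E P l (h p) (%n. h (env n)) \<phi>"
proof -
  interpret zfc E by unfold_locales (rule Z)
  interpret star E \<mu> P l e by (rule starI[OF gch reg pow])
  let ?zs = "[\<mu>, P, l, e] @ xs"
  obtain h :: "nat => 'v" where h: "inj h" "range ((!) ?zs) \<subseteq> range h"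
    "!!env \<phi>. sat (%i j. E (h i) (h j)) env \<phi> = sat E (%n. h (env n)) \<phi>"
    by (rule elementary_submodel[OF infinite_UNIV, of "(!) ?zs" E]) blast
  define E' where "E' i j \<longleftrightarrow> E (h i) (h j)" for i j
  have el: "sat E' env \<phi> = sat E (%n. h (env n)) \<phi>" for env \<phi> using h(3) unfolding E'_def .
  have pre: "EX y. h y = z" if "z : set ?zs" for z
  proof -
    obtain i where "z = ?zs ! i" using \<open>z : set ?zs\<close> unfolding in_set_conv_nth by blast
    then have "z : range h" using h(2) by blast
    then show ?thesis by blast
  qed
  have "EX y. h y = \<mu>" "EX y. h y = P" "EX y. h y = l" "EX y. h y = e" by (rule pre, simp)+
  then obtain \<mu>' P' l' e' where m: "h \<mu>' = \<mu>" "h P' = P" "h l' = l" "h e' = e" by blast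
  have "h (inv h z) = z" if z: "z : set xs" for z
  proof -
    have "EX y. h y = z" by (rule pre) (simp add: z)
    then show ?thesis by (intro f_inv_into_f) blast
  qed
  then have ys: "map h (map (inv h) xs) = xs" by (simp add: map_idI)
  have Z': "ZFC_model E'" by (rule ZFC_model_elementary[OF Z el])
  interpret M: zfc E' by unfold_locales (rule Z')
  have tr: "sat E' ((!) as) \<phi> = sat E ((!) (map h as)) \<phi>" if "bd (length as) \<phi>" for as \<phi>
    unfolding el by (rule sat_bd[OF that]) simp
  have S: "star E' \<mu>' P' l' e'"
  proof (rule M.starI)
    show "sat E' ((!) []) (fm0 GCH)" using assms(2) by (subst tr) (simp_all add: fm0_def bd_GCH)
    show "sat E' ((!) [\<mu>']) (fm1 is_uncountable_regular)" using reg m by (subst tr) (simp_all add: fm1_def bd_uncountable_regular)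
    show "sat E' ((!) [\<mu>', P', l', e']) (fm4 is_star_power_Fn)" using pow m by (subst tr) (simp_all add: fm4_def bd_star_power_Fn numeral_eq_Suc)
  qed
  then interpret M: star E' \<mu>' P' l' e' .
  have fo: "forces E' P' l' p env \<phi> = forces E P l (h p) (%n. h (env n)) \<phi>" for p env \<phi>
  proof -
    let ?e = "%n. if n = 0 then P' else if n = 1 then l' else if n = 2 then p else env (n - 3)"
    have "forces E' P' l' p env \<phi> = sat E' ?e (ftr \<phi>)" unfolding sat_ftr by simp
    also have "... = sat E (%n. h (?e n)) (ftr \<phi>)" by (rule el)
    also have "... = forces E P l (h p) (%n. h (env n)) \<phi>" unfolding sat_ftr by (simp add: m)
    finally show ?thesis .
  qed
  have ck: "h (check E' e' x) = check E e (h x)" for x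
  proof -
    have "sat E' ((!) [e', x, check E' e' x]) (fm3 is_check)" unfolding M.check_chk M.sat_check ..
    then have "sat E ((!) [e, h x, h (check E' e' x)]) (fm3 is_check)"
      by (subst (asm) tr) (simp_all add: fm3_def m bd_check numeral_eq_Suc)
    then show ?thesis unfolding sat_check check_chk .
  qed
  have EP: "E' x P' \<longleftrightarrow> E (h x) P" for x unfolding E'_def m ..
  from theorem3_nat[OF S] show ?thesis using that[OF ys m(1) _ _ _ _ m(4) ck EP el fo] by blast
qed

theorem theorem3:
  fixes E :: "'v \<Rightarrow> 'v \<Rightarrow> bool" and \<mu> P l e :: 'v
  assumes "ZFC_model E"
    and "sat E ((!) []) (fm0 GCH)"
    and "sat E ((!) [\<mu>]) (fm1 is_uncountable_regular)"
    and "sat E ((!) [\<mu>, P, l, e]) (fm4 is_star_power_Fn)"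
  shows "preserves_cardinals E P l e \<and>
    preserves_cofinalities E P l e \<and>
    forces E P l e ((!) [check E e \<mu>]) (fm1 is_continuum) \<and>
    forces E P l e ((!) []) (fm0 Phi_up_to_continuum)"
proof -
  have fc: "forces E P l p (%n. h (((!) as) n)) \<phi> = forces E P l p ((!) (map h as)) \<phi>"
    if "bd (length as) \<phi>" for p as \<phi> and h :: "nat => 'v"
    by (rule forces_cong) (use that in \<open>auto simp: bd_def\<close>)
  have sc: "sat E (%n. h (((!) as) n)) \<phi> = sat E ((!) (map h as)) \<phi>"
    if "bd (length as) \<phi>" for as \<phi> and h :: "nat => 'v" by (rule sat_bd[OF that]) simp
  have "preserves_cardinals E P l e"
    unfolding preserves_cardinals_def
  proof (intro allI impI)
    fix \<beta> p assume b: "sat E ((!) [\<beta>]) (fm1 is_Ord)" and p: "E p P"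
    obtain E' :: "nat => nat => bool" and h P' l' e' ys where r: "map h ys = [\<beta>, p]" "preserves_cardinals E' P' l' e'"
      "!!x. h (check E' e' x) = check E e (h x)" "!!x. E' x P' \<longleftrightarrow> E (h x) P"
      "!!env \<phi>. sat E' env \<phi> = sat E (%n. h (env n)) \<phi>"
      "!!p env \<phi>. forces E' P' l' p env \<phi> = forces E P l (h p) (%n. h (env n)) \<phi>"
      by (rule theorem3_aux[OF assms, of "[\<beta>, p]"]) (rule that)
    then obtain \<beta>' p' where h: "h \<beta>' = \<beta>" "h p' = p" by (auto simp: map_eq_Cons_conv)
    have s: "sat E' ((!) [\<beta>']) (fm1 \<phi>) = sat E ((!) [\<beta>]) (fm1 \<phi>)" if "bd 1 (fm1 \<phi>)" for \<phi>
      unfolding r(5) using sc[of "[\<beta>']" "fm1 \<phi>" h] that h by simp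
    have "forces E' P' l' p' ((!) [check E' e' \<beta>']) (fm1 is_Card) \<longleftrightarrow> sat E' ((!) [\<beta>']) (fm1 is_Card)"
      using r(2) b p s[of is_Ord] r(4)[of p'] h unfolding preserves_cardinals_def by (simp add: fm1_def)
    then show "forces E P l p ((!) [check E e \<beta>]) (fm1 is_Card) \<longleftrightarrow> sat E ((!) [\<beta>]) (fm1 is_Card)"
      unfolding r(6) using fc[of "[check E' e' \<beta>']" "fm1 is_Card" _ h] s[of is_Card] r(3)[of \<beta>'] h by (simp add: fm1_def)
  qed
  moreover have "preserves_cofinalities E P l e"
    unfolding preserves_cofinalities_def
  proof (intro allI impI)
    fix \<gamma> \<delta> assume g: "sat E ((!) [\<gamma>]) (fm1 is_Limit) & sat E ((!) [\<gamma>, \<delta>]) (fm2 is_cf)"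
    obtain E' :: "nat => nat => bool" and h P' l' e' ys where r: "map h ys = [\<gamma>, \<delta>]" "preserves_cofinalities E' P' l' e'"
      "h e' = e" "!!x. h (check E' e' x) = check E e (h x)"
      "!!env \<phi>. sat E' env \<phi> = sat E (%n. h (env n)) \<phi>"
      "!!p env \<phi>. forces E' P' l' p env \<phi> = forces E P l (h p) (%n. h (env n)) \<phi>"
      by (rule theorem3_aux[OF assms, of "[\<gamma>, \<delta>]"]) (rule that)
    then obtain \<gamma>' \<delta>' where h: "h \<gamma>' = \<gamma>" "h \<delta>' = \<delta>" by (auto simp: map_eq_Cons_conv)
    have "sat E' ((!) [\<gamma>']) (fm1 is_Limit)" unfolding r(5) using sc[of "[\<gamma>']" "fm1 is_Limit" h] g h by (simp add: fm1_def)
    moreover have "sat E' ((!) [\<gamma>', \<delta>']) (fm2 is_cf)" unfolding r(5) using sc[of "[\<gamma>', \<delta>']" "fm2 is_cf" h] g h by (simp add: fm2_def numeral_2_eq_2)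
    ultimately have "forces E' P' l' e' ((!) [check E' e' \<gamma>', check E' e' \<delta>']) (fm2 is_cf)"
      using r(2) unfolding preserves_cofinalities_def by blast
    then show "forces E P l e ((!) [check E e \<gamma>, check E e \<delta>]) (fm2 is_cf)"
      unfolding r(6) using fc[of "[check E' e' \<gamma>', check E' e' \<delta>']" "fm2 is_cf" _ h] r(3,4) h by (simp add: fm2_def numeral_2_eq_2)
  qed
  moreover have "forces E P l e ((!) [check E e \<mu>]) (fm1 is_continuum) & forces E P l e ((!) []) (fm0 Phi_up_to_continuum)"
  proof -
    obtain E' :: "nat => nat => bool" and h \<mu>' P' l' e' where r: "h \<mu>' = \<mu>" "forces E' P' l' e' ((!) [check E' e' \<mu>']) (fm1 is_continuum)"
      "forces E' P' l' e' ((!) []) (fm0 Phi_up_to_continuum)"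
      "h e' = e" "!!x. h (check E' e' x) = check E e (h x)"
      "!!p env \<phi>. forces E' P' l' p env \<phi> = forces E P l (h p) (%n. h (env n)) \<phi>"
      by (rule theorem3_aux[OF assms, of "[]"]) (rule that)
    show ?thesis using r(2,3) unfolding r(6)
      using fc[of "[check E' e' \<mu>']" "fm1 is_continuum" _ h] fc[of "[]" "fm0 Phi_up_to_continuum" _ h] r(1,4,5)
      by (simp add: fm1_def fm0_def bd_Phi_up_to_continuum)
  qed
  ultimately show ?thesis by blast
qed

end
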